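(* There exists a function $h:(0,\infty)\to(0,\infty)$ with $h(s)/s\to0$ as $s\to\infty$ such that the following holds. Let $a>b>0$ be fixed with $$(a-b)^2\ge 8\,\mathsf{P}_*^2\,(a+b)+h(a+b),$$ and let $\theta_n=\frac{b}{4}+\varepsilon_n$ where $\varepsilon_n\sqrt{n}\to\infty$. Then the test which, given a graph $G$ on $n$ vertices ($n$ even), accepts the hypothesis $H_1$ if $\mathrm{mcut}(G)\le n\theta_n$ and accepts $H_0$ otherwise, succeeds with high probability as $n\to\infty$; that is, $$\mathbb{P}_{G\sim G_I(n,(a+b)/(2n))}\big[\mathrm{mcut}(G)>n\theta_n\big]\to1\quad\text{and}\quad \mathbb{P}_{G\sim G_I(n,a/n,b/n)}\big[\mathrm{mcut}(G)\le n\theta_n\big]\to1 .$$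
   Context: All limits are along even $n$. $\mathrm{mcut}(G)$ is the minimum, over partitions of the vertex set into two parts of equal cardinality, of the number of edges between the two parts. $G_I(n,p)$ is the random graph on $[n]$ in which each edge is present independently with probability $p$. $G_I(n,a/n,b/n)$ is the planted partition model: given a uniformly random balanced partition $[n]=V_1\cup V_2$, edges $(i,j)$ are present independently, with probability $a/n$ when $i,j$ lie in the same part and with probability $b/n$ when they lie in different parts. The null hypothesis $H_0$ is $G\sim G_I(n,(a+b)/(2n))$ and the alternative $H_1$ is $G\sim G_I(n,a/n,b/n)$. The constant $\mathsf{P}_*$. For $\beta>0$ let $\mathcal{D}_\beta$ be the set of non-decreasing, right-continuous functions $x:[0,1]\to[0,\beta]$. For $x\in\mathcal{D}_\beta$ let $f(q,y)=f(q,y;x)$, $(q,y)\in[0,1]\times\mathbb{R}$, be the unique weak solution of $$\frac{\partial f}{\partial q}+\frac12\frac{\partial^2 f}{\partial y^2}+\frac12 x(q)\Big(\frac{\partial f}{\partial y}\Big)^2=0,\qquad f(1,y;x)=\frac1\beta\log(2\cosh(\beta y)),$$ among continuous functions $f$ with $\partial f/\partial y\in L^2([0,1]\times\mathbb{R})$. Put $\mathsf{P}_\beta[x]=f(0,0;x)-\frac12\int_0^1 q\,x(q)\,dq$, $\mathsf{P}_{*,\beta}=\inf\{\mathsf{P}_\beta[x]:x\in\mathcal{D}_\beta\}$, and $\mathsf{P}_*=\lim_{\beta\to\infty}\mathsf{P}_{*,\beta}$ (the limit is known to exist). By the known Parisi formula, $\mathsf{P}_*=\lim_{n\to\infty}n^{-1}\mathbb{E}[\max_{\sigma\in\{-1,+1\}^n}H^{SK}(\sigma)]$,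 where $H^{SK}(\sigma)=-\frac{1}{\sqrt{2n}}\sum_{i,j=1}^nJ_{ij}\sigma_i\sigma_j$ with $J_{ij}$ ($1\le i,j\le n$) i.i.d. standard Gaussian.
   Formalization: In the first limit ε_n → 0 is also assumed (the limit fails for ε_n = n); the second needs only ε_n√n → ∞. In the definition of P_*, ∂f/∂y is required to be bounded instead of square-integrable on [0,1]×R, since no weak solution has the latter property. *)

theory Defs
  imports "HOL-Probability.Probability"
begin

section \<open>Weak solutions of the Parisi equation\<close>

abbreviation strip :: "(real \<times> real) set"
  where "strip \<equiv> {0..1} \<times> UNIV"

definition d_q :: "(real \<times> real \<Rightarrow> real) \<Rightarrow> real \<times> real \<Rightarrow> real"
  where "d_q \<phi> = (\<lambda>(q, y). deriv (\<lambda>s. \<phi> (s, y)) q)"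

definition d_y :: "(real \<times> real \<Rightarrow> real) \<Rightarrow> real \<times> real \<Rightarrow> real"
  where "d_y \<phi> = (\<lambda>(q, y). deriv (\<lambda>t. \<phi> (q, t)) y)"

text \<open>The largest class of everywhere differentiable functions on the plane that is closed
  under both partial derivatives, that is, the infinitely differentiable functions.\<close>

coinductive smooth :: "(real \<times> real \<Rightarrow> real) \<Rightarrow> bool" where
  "\<phi> differentiable_on UNIV \<Longrightarrow> smooth (d_q \<phi>) \<Longrightarrow> smooth (d_y \<phi>) \<Longrightarrow> smooth \<phi>"

definition test_function :: "(real \<times> real \<Rightarrow> real) \<Rightarrow> bool" where
  "test_function \<phi> \<longleftrightarrow> smooth \<phi> \<and>
     (\<exists>K. compact K \<and> K \<subseteq> {0<..<1} \<times> UNIV \<and> (\<forall>z. z \<notin> K \<longrightarrow> \<phi> z = 0))"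

text \<open>The functions below are only constrained on the strip; since test functions are supported
  in its interior, the values elsewhere do not enter the integrals.\<close>

definition weak_d_y :: "(real \<times> real \<Rightarrow> real) \<Rightarrow> (real \<times> real \<Rightarrow> real) \<Rightarrow> bool" where
  "weak_d_y f g \<longleftrightarrow>
     (\<forall>\<phi>. test_function \<phi> \<longrightarrow> (LINT z|lborel. f z * d_y \<phi> z) = - (LINT z|lborel. g z * \<phi> z))"

text \<open>The solution class: continuous on the strip with essentially bounded weak \<open>y\<close>-derivative.
  Global square integrability of the \<open>y\<close>-derivative over the strip would exclude every solution,
  as the derivative of the terminal value is \<open>tanh (\<beta> * y)\<close>, which has limits \<open>-1\<close> and \<open>1\<close> at
  infinity; mere local square integrability would allow several solutions (if \<open>x\<close> vanishes on an
  initial interval the equation is the heat equation there). Since \<open>f\<close> is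
  continuous up to \<open>q = 1\<close>, the terminal condition is imposed pointwise.\<close>

definition parisi_weak_solution ::
    "real \<Rightarrow> (real \<Rightarrow> real) \<Rightarrow> (real \<times> real \<Rightarrow> real) \<Rightarrow> bool" where
  "parisi_weak_solution \<beta> x f \<longleftrightarrow>
     continuous_on strip f \<and>
     (\<forall>y. f (1, y) = 1 / \<beta> * ln (2 * cosh (\<beta> * y))) \<and>
     (\<exists>g. g \<in> borel_measurable lborel \<and>
        (\<exists>C. AE z in lborel. z \<in> strip \<longrightarrow> \<bar>g z\<bar> \<le> C) \<and>
        weak_d_y f g \<and>
        (\<forall>\<phi>. test_function \<phi> \<longrightarrow>
           (LINT z|lborel. - f z * d_q \<phi> z + 1/2 * f z * d_y (d_y \<phi>) z
                            + 1/2 * x (fst z) * (g z)\<^sup>2 * \<phi> z) = 0))"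

section \<open>The Parisi constant\<close>

definition parisi_domain :: "real \<Rightarrow> (real \<Rightarrow> real) set" where
  "parisi_domain \<beta> = {x. x ` {0..1} \<subseteq> {0..\<beta>} \<and> mono_on {0..1} x \<and>
                        (\<forall>q\<in>{0..<1}. continuous (at_right q) x)}"

text \<open>The weak solution is unique on the strip, so the choice does not affect \<open>f (0, 0)\<close>.\<close>

definition parisi_solution :: "real \<Rightarrow> (real \<Rightarrow> real) \<Rightarrow> real \<times> real \<Rightarrow> real"
  where "parisi_solution \<beta> x = (SOME f. parisi_weak_solution \<beta> x f)"

definition parisi_functional :: "real \<Rightarrow> (real \<Rightarrow> real) \<Rightarrow> real" where
  "parisi_functional \<beta> x =
     parisi_solution \<beta> x (0, 0) - 1/2 * integral {0..1} (\<lambda>q. q * x q)"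

definition P_star_beta :: "real \<Rightarrow> real"
  where "P_star_beta \<beta> = (INF x\<in>parisi_domain \<beta>. parisi_functional \<beta> x)"

definition P_star :: real
  where "P_star = Lim at_top P_star_beta"

section \<open>Random graphs and minimum bisection\<close>

text \<open>A graph on \<open>{1..n}\<close> is represented by its set of edges, a set of two-element subsets.\<close>

definition pairs :: "nat \<Rightarrow> nat set set"
  where "pairs n = {e. e \<subseteq> {1..n} \<and> card e = 2}"

text \<open>A balanced partition is represented by one of its two parts.\<close>

definition halves :: "nat \<Rightarrow> nat set set"
  where "halves n = {S. S \<subseteq> {1..n} \<and> 2 * card S = n}"

definition mcut :: "nat \<Rightarrow> nat set set \<Rightarrow> nat" where
  "mcut n G = (MIN S\<in>halves n. card {e\<in>G. \<exists>i\<in>S. \<exists>j\<in>{1..n} - S. e = {i, j}})"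

definition edge_indep_graph :: "nat \<Rightarrow> (nat set \<Rightarrow> real) \<Rightarrow> nat set set pmf" where
  "edge_indep_graph n p =
     map_pmf (\<lambda>\<omega>. {e\<in>pairs n. \<omega> e})
       (Pi_pmf (pairs n) False (\<lambda>e. bernoulli_pmf (p e)))"

definition erdos_renyi :: "nat \<Rightarrow> real \<Rightarrow> nat set set pmf"
  where "erdos_renyi n p = edge_indep_graph n (\<lambda>_. p)"

definition planted_partition :: "nat \<Rightarrow> real \<Rightarrow> real \<Rightarrow> nat set set pmf" where
  "planted_partition n p q =
     bind_pmf (pmf_of_set (halves n))
       (\<lambda>V\<^sub>1. edge_indep_graph n (\<lambda>e. if e \<subseteq> V\<^sub>1 \<or> e \<inter> V\<^sub>1 = {} then p else q))"

definition even_at_top :: "nat filter"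
  where "even_at_top = inf at_top (principal {n. even n})"

end

(* Null model.  The maximum over balanced S of the number of uncut minus cut edges is bounded by a free energy at
   inverse temperature beta, and the Parisi upper bound for the expected free energy is proved directly on the sparse
   graph: edges are removed one by one while independent random-walk increments are added at every level of a
   hierarchy of log-mean-exp operators, and the second-order cost of an edge is paid for by the gain of the walk steps
   (Guerra's interpolation, with walk steps of size O(1/sqrt N) in place of Gaussians).  After the interpolation the
   sites decouple, and each site contributes one copy of the random-walk scheme for the Parisi equation.  That scheme
   converges along dyadic refinements to a weak solution; the weak solution is unique by a weighted energy estimate
   for the mollified difference of two solutions, so it is the one chosen in parisi_functional.  The constant
   P_star_beta decreases in beta and is nonnegative, hence has the limit P_star.  The edge count concentrates by
   Chebyshev, and the function h records, by a diagonal choice, how small the error is at each average degree.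

   Planted model.  The minimum bisection is at most the planted cut, whose size has mean n b / 4 and variance O(n). *)

theory Submission
  imports Defs
begin

text \<open>The constant 8: put ga = (a + b)/2. If uncut minus cut edges stay below n * sqrt ga * P
  for every bisection, then with about n*ga/2 edges the minimum bisection exceeds n * (ga/4 - sqrt
  ga * P/2). This is above n*b/4 once a - b > 4 * sqrt ga * P, that is (a - b)^2 > 8 * P^2 * (a +
  b). Only an upper bound on a maximum is needed, so \<open>P_star\<close> enters as an infimum of
  Parisi functionals. What is bounded is the mean of exp (m * free energy), with m > 0 the outermost
  value of the order parameter; Markov's inequality then gives probabilities exponentially small in
  n. Two terms are foreign to Guerra's Gaussian setting. Edge indicators are not centred, and their
  first-order effect would be of order n * sqrt ga; for balanced spins it has a favourable sign.
  Third-order terms survive as c / sqrt ga with c independent of n; they force a large degree and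
  are the reason for \<open>h\<close>. Limits are taken in the order: walk length N for fixed n,
  then n for fixed ga. Walks on finite lists keep all operators finite sums, so that Taylor
  expansion replaces Gaussian integration by parts.\<close>

notation LIMSEQ (infixr "---->" 60)

abbreviation lborel_integral :: "('a :: euclidean_space => real) => real" (binder "LI " 10)
 where "lborel_integral f == integral\<^sup>L lborel f"

section \<open>The random walk scheme for the Parisi equation\<close>

text \<open>For m > 0 this is (1/m) times the log of the mean of exp (m*X), with X uniform on r and
  -r. The value 0 at m = 0 is the limit, so intervals on which the order parameter vanishes are
  covered.\<close>

definition lcosh :: "real => real => real"
 where "lcosh m r = (if m = 0 then 0 else ln (cosh (m*r))/m)"

text \<open>One step of the walk, in a form that also makes sense for \<open>m = 0\<close>.\<close>

definition pstep :: "real => real => (real => real) => real => real"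
 where "pstep m h u y = (u (y + h) + u (y - h))/2 + lcosh m ((u (y + h) - u (y - h))/2)"

text \<open>Identifies \<open>pstep\<close> with a log-mean-exp, the form needed when a walk step on
  spin energies is reduced to a single site.\<close>

lemma exp_pstep:
 assumes "m > 0"
 shows "exp (m*pstep m h u y) = (exp (m*u (y + h)) + exp (m*u (y - h)))/2"
proof -
 let ?a = "m*u (y + h)" and ?b = "m*u (y - h)"
 have "m*pstep m h u y = (?a + ?b)/2 + ln (cosh ((?a - ?b)/2))"
  using assms by (simp add: pstep_def lcosh_def field_simps)
 hence "exp (m*pstep m h u y) = exp ((?a + ?b)/2)*cosh ((?a - ?b)/2)" by (simp add: exp_add)
 also have "... = (exp ((?a + ?b)/2 + (?a - ?b)/2) + exp ((?a + ?b)/2 + - ((?a - ?b)/2)))/2"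
  unfolding exp_add cosh_field_def by (simp add: algebra_simps)
 also have "... = (exp ?a + exp ?b)/2"
 proof -
  have "(?a + ?b)/2 + (?a - ?b)/2 = ?a" "(?a + ?b)/2 + - ((?a - ?b)/2) = ?b" by (simp_all add: field_simps)
  thus ?thesis by simp
 qed
 finally show ?thesis .
qed

lemma lcosh_0 [simp]: "lcosh m 0 = 0" by (simp add: lcosh_def)

lemma has_derivative_lcosh: "(lcosh m has_real_derivative tanh (m*r)) (at r within A)"
proof (cases "m = 0")
 case True
 thus ?thesis unfolding lcosh_def by simp
next
 case False
 hence "((%r. ln (cosh (m*r))/m) has_real_derivative tanh (m*r)) (at r within A)"
  by (auto intro!: derivative_eq_intros simp: tanh_def field_simps)
 thus ?thesis using False by (simp add: lcosh_def[abs_def])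
qed

lemma abs_tanh_le_1: "abs(tanh x) <= 1" for x :: real
 using tanh_real_lt_1[of x] tanh_real_gt_neg1[of x] by (simp add: abs_le_iff)

lemma tanh_sq_le_1: "(tanh x)^2 <= 1" for x :: real
 using abs_tanh_le_1[of x] by (simp add: abs_square_le_1)

lemma lcosh_minus: "lcosh m (- r) = lcosh m r" by (simp add: lcosh_def)

lemma lcosh_lipschitz: "abs(lcosh m r - lcosh m r') <= abs(r - r')"
proof -
 have "norm (lcosh m r - lcosh m r') <= 1*norm (r - r')"
  using abs_tanh_le_1 by (intro field_differentiable_bound[OF convex_UNIV has_derivative_lcosh]) auto
 thus ?thesis by simp
qed

lemma tanh_increment:
 fixes x y :: real
 assumes "x <= y"
 shows "tanh x <= tanh y" "tanh y <= tanh x + (y - x)"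
proof -
 show "tanh x <= tanh y" using assms by simp
 have "abs(tanh y - tanh x) <= 1*abs(y - x)" unfolding real_norm_def[symmetric]
  by (rule field_differentiable_bound[where f' = "%x. 1 - tanh x^2" and S = UNIV])
    (auto intro!: derivative_eq_intros simp: abs_le_iff tanh_sq_le_1)
 thus "tanh y <= tanh x + (y - x)" using assms by auto
qed

text \<open>All terms vanish at 0 and are even in r, so it suffices to compare r-derivatives on r >=
  0: the difference of \<open>tanh (m'*r)\<close> and \<open>tanh (m*r)\<close> lies between 0 and
  (m' - m)*r.\<close>

lemma lcosh_param:
 assumes "m <= m'"
 shows "lcosh m r <= lcosh m' r" "lcosh m' r <= lcosh m r + (m' - m)*r^2/2"
proof -
 have *: "lcosh m r <= lcosh m' r & lcosh m' r <= lcosh m r + (m' - m)*r^2/2" if r: "r >= 0" for r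
 proof
  have "(%r. lcosh m' r - lcosh m r) 0 <= (%r. lcosh m' r - lcosh m r) r"
  proof (rule DERIV_nonneg_imp_nondecreasing[OF r])
   fix s :: real assume s: "0 <= s" "s <= r"
   have "DERIV (%r. lcosh m' r - lcosh m r) s :> tanh (m' * s) - tanh (m * s)"
    by (intro DERIV_diff has_derivative_lcosh)
   moreover have "0 <= tanh (m' * s) - tanh (m * s)"
    using tanh_increment(1)[of "m * s" "m' * s"] s assms by (simp add: mult_right_mono)
   ultimately show "EX y. (DERIV (%r. lcosh m' r - lcosh m r) s :> y) & 0 <= y" by blast
  qed
  thus "lcosh m r <= lcosh m' r" by simp
  have "(%r. lcosh m r + (m' - m)*r^2/2 - lcosh m' r) 0 <= (%r. lcosh m r + (m' - m)*r^2/2 - lcosh m' r) r"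
  proof (rule DERIV_nonneg_imp_nondecreasing[OF r])
   fix s :: real assume s: "0 <= s" "s <= r"
   have "((%r. lcosh m r + (m' - m)*r^2/2 - lcosh m' r) has_real_derivative
     tanh (m * s) + (m' - m) * s - tanh (m' * s)) (at s)"
    by (auto intro!: derivative_eq_intros has_derivative_lcosh)
   moreover have "0 <= tanh (m * s) + (m' - m) * s - tanh (m' * s)"
    using tanh_increment(2)[of "m * s" "m' * s"] s assms by (simp add: mult_right_mono left_diff_distrib)
   ultimately show "EX y. (DERIV (%r. lcosh m r + (m' - m)*r^2/2 - lcosh m' r) s :> y) & 0 <= y"
    by blast
  qed
  thus "lcosh m' r <= lcosh m r + (m' - m)*r^2/2" by simp
 qed
 show "lcosh m r <= lcosh m' r" "lcosh m' r <= lcosh m r + (m' - m)*r^2/2"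
  using *[of r] *[of "- r"] by (cases "r >= 0"; simp add: lcosh_minus)+
qed

lemma cosh_ge_quadratic: "cosh x >= 1 + x^2/2" for x :: real
proof -
 let ?f = "%n. if even n then x^n /\<^sub>R fact n else 0"
 have "sum ?f {..<3} <= suminf ?f"
  using cosh_converges[of x] by (intro sum_le_suminf) (auto simp: sums_iff zero_le_even_power)
 thus ?thesis using cosh_converges[of x] by (simp add: sums_iff eval_nat_numeral lessThan_Suc)
qed

text \<open>For t = x^2/2 <= 1 this follows from cosh x >= 1 + t and ln (1 + t) >= t - t^2; for
  larger t the polynomial is not positive.\<close>

lemma ln_cosh_ge: "ln (cosh x) >= x^2/2 - x^4/4" for x :: real
proof -
 have "x^2/2 - x^4/4 = x^2/2 - (x^2/2)^2" by (simp add: power_divide)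
 also have "... <= ln (1 + x^2/2)"
 proof (cases "x^2/2 <= 1")
  case True
  thus ?thesis by (intro ln_one_plus_pos_lower_bound) auto
 next
  case False
  hence "1*(x^2/2) <= (x^2/2)*(x^2/2)" by (intro mult_right_mono) auto
  hence "x^2/2 - (x^2/2)^2 <= 0" by (simp only: power2_eq_square mult_1 diff_le_0_iff_le)
  also have "0 <= ln (1 + x^2/2)" by simp
  finally show ?thesis .
 qed
 also have "... <= ln (cosh x)" using cosh_ge_quadratic[of x] by (intro ln_mono) (auto intro: add_pos_nonneg)
 finally show ?thesis .
qed

lemma lcosh_bounds:
 assumes "m >= 0"
 shows "lcosh m r <= m*r^2/2" "lcosh m r >= m*r^2/2 - m^3*r^4/4"
proof -
 show "lcosh m r <= m*r^2/2" using lcosh_param(2)[OF assms, of r] by (simp add: lcosh_def)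
 show "lcosh m r >= m*r^2/2 - m^3*r^4/4"
 proof (cases "m = 0")
  case False
  hence m: "m > 0" using assms by simp
  have "m*(m*r^2/2 - m^3*r^4/4) <= ln (cosh (m*r))"
   using ln_cosh_ge[of "m*r"] by (simp add: power_mult_distrib algebra_simps eval_nat_numeral)
  thus ?thesis using m by (simp add: lcosh_def le_divide_eq mult.commute)
 qed (simp add: lcosh_def)
qed

text \<open>A step is monotone in the two values it sees and commutes with adding constants:
  \<open>lcosh\<close> is 1-Lipschitz, so a change of the half difference never outweighs that of
  the half sum. The one-sided form yields both monotonicity and sup-norm contraction.\<close>

lemma pstep_diff_le:
 assumes "u (y + h) - v (y + h) <= e" "u (y - h) - v (y - h) <= e"
 shows "pstep m h u y - pstep m h v y <= e"
proof -
 have "lcosh m ((u (y + h) - u (y - h))/2) - lcosh m ((v (y + h) - v (y - h))/2)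
   <= abs((u (y + h) - u (y - h))/2 - (v (y + h) - v (y - h))/2)"
  using lcosh_lipschitz[of m "(u (y + h) - u (y - h))/2" "(v (y + h) - v (y - h))/2"] by linarith
 thus ?thesis using assms unfolding pstep_def by (simp add: field_simps)
qed

lemma pstep_mono: "(!!y. u y <= v y) ==> pstep m h u y <= pstep m h v y"
 using pstep_diff_le[of u y h v 0 m] by simp

lemma pstep_contraction: "(!!y. abs(u y - v y) <= e) ==> abs(pstep m h u y - pstep m h v y) <= e"
 using pstep_diff_le[of u y h v e m] pstep_diff_le[of v y h u e m] by (auto simp: abs_le_iff)

text \<open>For a 1-Lipschitz u the half difference is at most h. With h^2 = 1/N the costs of all
  steps therefore add up to half the L1 distance of two order parameters.\<close>

lemma pstep_param:
 assumes "m <= m'" and lip: "!!y y'. abs(u y - u y') <= abs(y - y')"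
 shows "pstep m h u y <= pstep m' h u y" "pstep m' h u y <= pstep m h u y + (m' - m)*h^2/2"
proof -
 let ?r = "(u (y + h) - u (y - h))/2"
 show "pstep m h u y <= pstep m' h u y" using lcosh_param(1)[OF assms(1)] by (simp add: pstep_def)
 have "abs(?r) <= abs h" using lip[of "y + h" "y - h"] by simp
 hence "?r^2 <= h^2" by (rule abs_le_square_iff[THEN iffD1])
 hence "(m' - m)*?r^2/2 <= (m' - m)*h^2/2" using assms(1) by (intro divide_right_mono mult_left_mono) auto
 thus "pstep m' h u y <= pstep m h u y + (m' - m)*h^2/2"
  using lcosh_param(2)[OF assms(1), of ?r] unfolding pstep_def by linarith
qed

subsection \<open>Derivative bounds\<close>

text \<open>\<open>u'' + m u'\<^sup>2 \<le> be\<close> is preserved by the steps because the order parameter is monotone; this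
  keeps the bound on the second derivative uniform in the number of steps.\<close>

definition good :: "real => real => real => (real => real) => (real => real) => (real => real) => (real => real) => bool" where
 "good be c m u u1 u2 u3 \<longleftrightarrow> (ALL y. (DERIV u y :> u1 y)) & (ALL y. (DERIV u1 y :> u2 y)) &
   (ALL y. (DERIV u2 y :> u3 y)) &
   (ALL y. abs(u1 y) <= 1) & (ALL y. 0 <= u2 y) & (ALL y. u2 y + m*(u1 y)^2 <= be) & (ALL y. abs(u3 y) <= c)"

lemma goodD:
 assumes "good be c m u u1 u2 u3" "m >= 0"
 shows "DERIV u y :> u1 y" "DERIV u1 y :> u2 y"
  "DERIV u2 y :> u3 y" "abs(u1 y) <= 1" "0 <= u2 y" "u2 y <= be"
  "u2 y + m*(u1 y)^2 <= be" "abs(u3 y) <= c"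
proof -
 have "u2 y + m*(u1 y)^2 <= be" using assms(1) unfolding good_def by blast
 moreover have "0 <= m*(u1 y)^2" using assms(2) by simp
 ultimately show "u2 y <= be" by linarith
qed (use assms in \<open>auto simp: good_def\<close>)

lemma good_mono:
 assumes "good be c m u u1 u2 u3" "m' <= m" "c <= c'"
 shows "good be c' m' u u1 u2 u3"
proof -
 have "u2 y + m'*(u1 y)^2 <= u2 y + m*(u1 y)^2" for y
  using assms(2) by (intro add_left_mono mult_right_mono) auto
 thus ?thesis using assms(1,3) unfolding good_def by (meson order.trans)
qed

lemma deriv_bound:
 fixes f :: "real => real"
 assumes "!!y. (DERIV f y :> f' y)" "!!y. abs(f' y) <= B"
 shows "abs(f x - f y) <= B*abs(x - y)"
 using field_differentiable_bound[OF convex_UNIV assms(1), of B x y] assms(2) by auto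

lemma abs_average_le: "abs(a - c) <= B ==> abs(b - c) <= B ==> abs((a + b)/2 - c) <= B" for a b c B :: real
 by (auto simp: abs_le_iff field_simps)

lemma has_derivative_pstep:
 fixes h m :: real
 assumes u: "!!y. (DERIV u y :> u1 y)" and "!!y. (DERIV u1 y :> u2 y)"
  and "!!y. (DERIV u2 y :> u3 y)"
 defines "R \<equiv> %f y. (f (y + h) - f (y - h))/2" and "S \<equiv> %f y. (f (y + h) + f (y - h))/2"
 defines "ta \<equiv> %y. tanh (m * R u y)"
 shows "DERIV (pstep m h u) y :> S u1 y + ta y * R u1 y"
  and "DERIV (%y. S u1 y + ta y * R u1 y) y :> S u2 y + ta y * R u2 y + m*(1 - (ta y)^2)*(R u1 y)^2"
  and "((%y. S u2 y + ta y * R u2 y + m*(1 - (ta y)^2)*(R u1 y)^2) has_real_derivative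
   S u3 y + ta y * R u3 y + 3 * m*(1 - (ta y)^2) * R u1 y * R u2 y - 2 * m^2*ta y*(1 - (ta y)^2)*(R u1 y)^3) (at y)"
proof -
 have sh: "DERIV (%y. f (y + c)) y :> f' (y + c)" if "!!y. (DERIV f y :> f' y)" for f f' c y
  using that[of "y + c"] by (simp add: DERIV_shift)
 have dS: "DERIV (S f) y :> S f' y" if "!!y. (DERIV f y :> f' y)" for f f' y
  unfolding S_def using sh[OF that, of h y] sh[OF that, of "- h" y] by (auto intro!: derivative_eq_intros)
 have dR: "DERIV (R f) y :> R f' y" if "!!y. (DERIV f y :> f' y)" for f f' y
  unfolding R_def using sh[OF that, of h y] sh[OF that, of "- h" y] by (auto intro!: derivative_eq_intros)
 have dta: "DERIV ta y :> m*(1 - (ta y)^2) * R u1 y" for y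
  unfolding ta_def by (auto intro!: derivative_eq_intros dR[OF u])
 have p: "pstep m h u = (%y. S u y + lcosh m (R u y))" by (auto simp: pstep_def S_def R_def)
 show "DERIV (pstep m h u) y :> S u1 y + ta y * R u1 y"
  unfolding p by (auto intro!: derivative_eq_intros dS[OF u] dR[OF u] DERIV_chain2[OF has_derivative_lcosh] simp: ta_def)
 show "DERIV (%y. S u1 y + ta y * R u1 y) y :> S u2 y + ta y * R u2 y + m*(1 - (ta y)^2)*(R u1 y)^2"
  by (auto intro!: derivative_eq_intros dS dR dta assms(2) simp: power2_eq_square algebra_simps)
 show "((%y. S u2 y + ta y * R u2 y + m*(1 - (ta y)^2)*(R u1 y)^2) has_real_derivative
   S u3 y + ta y * R u3 y + 3 * m*(1 - (ta y)^2) * R u1 y * R u2 y - 2 * m^2*ta y*(1 - (ta y)^2)*(R u1 y)^3) (at y)"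
  by (auto intro!: derivative_eq_intros dS dR dta assms(2,3))
    (simp add: power2_eq_square power3_eq_cube algebra_simps)
qed

text \<open>Terms of the form S f + ta * R f are averages with weights (1 + ta)/2 and (1 - ta)/2, so
  bounds pass through them unchanged. The constant of the third derivative grows by a factor 1 +
  O(h^2) plus O(h^3), which is harmless over 1/h^2 steps.\<close>

lemma good_pstep:
 assumes g: "good be c m u u1 u2 u3" and m: "0 <= m" "m <= be" and h: "h >= 0"
 shows "EX v1 v2 v3. good be (c*(1 + 3*be^2*h^2) + 2*be^5*h^3) m (pstep m h u) v1 v2 v3 &
   (ALL y. abs(v1 y - u1 y) <= 2*be*h) & (ALL y. abs(v2 y - u2 y) <= 2 * c*h + be^3*h^2)"
proof -
 note G = goodD[OF g m(1)]
 define R where "R = (%f y. (f (y + h) - f (y - h))/2 :: real)"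
 define S where "S = (%f y. (f (y + h) + f (y - h))/2 :: real)"
 define ta where "ta y = tanh (m * R u y)" for y
 have b0: "be >= 0" using m by simp
 have c0: "c >= 0" using G(8)[of 0] by linarith
 note d = has_derivative_pstep[OF G(1-3), where h = h and m = m]
 have ta1: "abs(ta y) <= 1" "0 <= 1 - (ta y)^2" "1 - (ta y)^2 <= 1" for y
  using abs_tanh_le_1[of "m * R u y"] tanh_sq_le_1[of "m * R u y"] by (auto simp: ta_def)
 have comb: "S f y + ta y * R f y = (1 + ta y)/2*f (y + h) + (1 - ta y)/2*f (y - h)" for f y
  by (simp add: S_def R_def field_simps)
 have comb_le: "S f y + ta y * R f y <= B" if "!!y. f y <= B" for f y B
 proof -
  have "(1 + ta y)/2*f (y + h) + (1 - ta y)/2*f (y - h) <= (1 + ta y)/2*B + (1 - ta y)/2*B"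
   using ta1(1)[of y] that by (intro add_mono mult_left_mono) auto
  thus ?thesis unfolding comb by (simp add: field_simps)
 qed
 have comb_ge: "S f y + ta y * R f y >= B" if "!!y. f y >= B" for f y B
 proof -
  have "(1 + ta y)/2*f (y + h) + (1 - ta y)/2*f (y - h) >= (1 + ta y)/2*B + (1 - ta y)/2*B"
   using ta1(1)[of y] that by (intro add_mono mult_left_mono) auto
  thus ?thesis unfolding comb by (simp add: field_simps)
 qed
 have comb_abs: "abs(S f y + ta y * R f y) <= B" if "!!y. abs(f y) <= B" for f y B
 proof -
  have a: "f y <= B" for y using that[of y] by linarith
  have b: "- B <= f y" for y using that[of y] by linarith
  show ?thesis using comb_le[of f B y, OF a] comb_ge[of "- B" f y, OF b] by linarith
 qed
 have R1: "abs(R u1 y) <= be*h" for y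
  using deriv_bound[OF G(2), of be "y + h" "y - h"] G(5,6) h by (auto simp: R_def)
 have R2: "abs(R u2 y) <= c*h" for y
  using deriv_bound[OF G(3), of c "y + h" "y - h"] G(8) h by (auto simp: R_def)
 have S1: "abs(S u1 y - u1 y) <= be*h" for y
 proof -
  have "abs(u1 (y + h) - u1 y) <= be*h" "abs(u1 (y - h) - u1 y) <= be*h"
   using deriv_bound[OF G(2), of be "y + h" y] deriv_bound[OF G(2), of be "y - h" y] G(5,6) h by auto
  thus ?thesis unfolding S_def by (rule abs_average_le)
 qed
 have S2: "abs(S u2 y - u2 y) <= c*h" for y
 proof -
  have "abs(u2 (y + h) - u2 y) <= c*h" "abs(u2 (y - h) - u2 y) <= c*h"
   using deriv_bound[OF G(3), of c "y + h" y] deriv_bound[OF G(3), of c "y - h" y] G(8) h by auto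
  thus ?thesis unfolding S_def by (rule abs_average_le)
 qed
 define v1 where "v1 y = S u1 y + ta y * R u1 y" for y
 define v2 where "v2 y = S u2 y + ta y * R u2 y + m*(1 - (ta y)^2)*(R u1 y)^2" for y
 define v3 where "v3 y = S u3 y + ta y * R u3 y + 3 * m*(1 - (ta y)^2) * R u1 y * R u2 y - 2 * m^2*ta y*(1 - (ta y)^2)*(R u1 y)^3" for y
 \<comment> \<open>The extra term of v2 completes the square of v1: the quantity u2 + m*u1^2 is
   merely averaged with the tilted weights, so its bound be is kept without loss.\<close>
 have "v2 y + m*(v1 y)^2 = S (%y. u2 y + m*(u1 y)^2) y + ta y * R (%y. u2 y + m*(u1 y)^2) y" for y
  unfolding v1_def v2_def S_def R_def by (simp add: field_simps power2_eq_square)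
 also have "... y <= be" for y using G(7) by (intro comb_le)
 finally have X: "v2 y + m*(v1 y)^2 <= be" for y .
 have t0: "0 <= m*(1 - (ta y)^2)*(R u1 y)^2" for y using m ta1 by (intro mult_nonneg_nonneg) auto
 have v20: "0 <= v2 y" for y unfolding v2_def using comb_ge[of 0 u2 y] G(5) t0[of y] by auto
 have v3b: "abs(v3 y) <= c*(1 + 3*be^2*h^2) + 2*be^5*h^3" for y
 proof -
  have "abs(3 * m*(1 - (ta y)^2) * R u1 y * R u2 y) <= 3*be*1*(be*h)*(c*h)"
   unfolding abs_mult using m ta1[of y] R1[of y] R2[of y] b0 h c0
   by (intro mult_mono mult_nonneg_nonneg) auto
  moreover have "abs(2 * m^2*ta y*(1 - (ta y)^2)*(R u1 y)^3) <= 2*be^2*1*1*(be*h)^3"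
   unfolding abs_mult power_abs using m ta1[of y] R1[of y] b0 h
   by (intro mult_mono mult_nonneg_nonneg power_mono) auto
  moreover have "abs(S u3 y + ta y * R u3 y) <= c" using G(8) by (rule comb_abs)
  moreover have "3*be*1*(be*h)*(c*h) = c*(3*be^2*h^2)" "2*be^2*1*1*(be*h)^3 = 2*be^5*h^3"
   by (simp_all add: power2_eq_square power_mult_distrib eval_nat_numeral)
  ultimately show ?thesis unfolding v3_def by (simp only: distrib_left)
 qed
 have "good be (c*(1 + 3*be^2*h^2) + 2*be^5*h^3) m (pstep m h u) v1 v2 v3" unfolding good_def
 proof (intro conjI allI X v20 v3b)
  show "abs(v1 y) <= 1" for y unfolding v1_def using G(4) by (rule comb_abs)
 qed (use d in \<open>simp_all only: v1_def[abs_def] v2_def[abs_def] v3_def[abs_def] ta_def R_def S_def\<close>)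
 moreover have "abs(v1 y - u1 y) <= 2*be*h" for y
 proof -
  have "abs(ta y * R u1 y) <= 1*(be*h)" unfolding abs_mult using ta1[of y] R1[of y] by (intro mult_mono) auto
  thus ?thesis using S1[of y] unfolding v1_def by linarith
 qed
 moreover have "abs(v2 y - u2 y) <= 2 * c*h + be^3*h^2" for y
 proof -
  have "abs(ta y * R u2 y) <= 1*(c*h)" unfolding abs_mult using ta1[of y] R2[of y] by (intro mult_mono) auto
  moreover have "abs(m*(1 - (ta y)^2)*(R u1 y)^2) <= be*1*(be*h)^2"
   unfolding abs_mult power_abs using m ta1[of y] R1[of y] b0 h
   by (intro mult_mono mult_nonneg_nonneg power_mono) auto
  moreover have "be*1*(be*h)^2 = be^3*h^2" by (simp add: power2_eq_square power3_eq_cube)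
  ultimately show ?thesis using S2[of y] unfolding v2_def by linarith
 qed
 ultimately show ?thesis by blast
qed

text \<open>One step is an Euler step of length h^2 for du/dt = (u'' + m*u'^2)/2, with t running
  downwards from q = 1. The m of the step may differ from the m' in the bound on u, because steps
  with neighbouring grid values will be exchanged.\<close>

lemma pstep_expansion:
 assumes g: "good be c m' u u1 u2 u3" and m: "0 <= m" "m <= be" "0 <= m'" and h: "0 <= h" "h <= 1"
 shows "abs(pstep m h u y - u y - h^2/2*(u2 y + m*(u1 y)^2)) <= (c + be^2 + be^3)*h^3"
proof -
 note G = goodD[OF g m(3)]
 have c0: "c >= 0" using G(8)[of 0] by linarith
 have b0: "be >= 0" using m by simp
 have tay: "abs(u (y + k) - u y - k*u1 y - k^2/2*u2 y) <= c*abs k^3" for k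
 proof -
  obtain t where "u (y + k) = (SUM i<3. (if i = 0 then u y else if i = 1 then u1 y else u2 y)/fact i * k^i) + u3 t/fact 3 * k^3"
  proof -
   define diff :: "nat => real => real" where
    "diff i = (if i = 0 then (%k. u (y + k)) else if i = 1 then (%k. u1 (y + k)) else if i = 2 then (%k. u2 (y + k)) else (%k. u3 (y + k)))" for i
   have "EX t. abs t <= abs k & diff 0 k = (SUM i<3. diff i 0/fact i * k^i) + diff 3 t/fact 3 * k^3"
   proof (rule Maclaurin_bi_le)
    show "diff 0 = diff 0" ..
    show "ALL i t. i < 3 & abs t <= abs k --> (DERIV (diff i) t :> diff (Suc i) t)"
    proof (intro allI impI)
     fix i :: nat and t :: real assume "i < 3 & abs t <= abs k"
     then consider "i = 0" | "i = 1" | "i = 2" by linarith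
     thus "DERIV (diff i) t :> diff (Suc i) t"
      by cases (use G(1-3)[of "y + t"] in \<open>simp_all add: diff_def DERIV_shift add.commute[of y]\<close>)
    qed
   qed
   thus ?thesis using that by (auto simp: diff_def eval_nat_numeral lessThan_Suc)
  qed
  hence "u (y + k) - u y - k*u1 y - k^2/2*u2 y = u3 t/6 * k^3"
   by (simp add: eval_nat_numeral lessThan_Suc algebra_simps)
  also have "abs(...) <= c*abs k^3"
   unfolding abs_mult power_abs using G(8)[of t] by (intro mult_right_mono) auto
  finally show ?thesis .
 qed
 let ?S = "(u (y + h) + u (y - h))/2" and ?R = "(u (y + h) - u (y - h))/2"
 have S: "abs(?S - u y - h^2/2*u2 y) <= c*h^3"
  using tay[of h] tay[of "- h"] h by (simp add: abs_le_iff field_simps)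
 have lip: "abs(u a - u b) <= 1*abs(a - b)" for a b by (rule deriv_bound[OF G(1,4)])
 have Rh: "abs(?R) <= h" using lip[of "y + h" "y - h"] h by simp
 have R: "abs(?R - h*u1 y) <= be*h^2"
 proof -
  have "abs(u (y + k) - u y - k*u1 y) <= be*abs k*abs k" for k
  proof -
   have "norm ((%k. u (y + k) - k*u1 y) k - (%k. u (y + k) - k*u1 y) 0) <= be*abs k*norm (k - 0)"
   proof (rule field_differentiable_bound[where S = "{- abs k..abs k}" and f' = "%t. u1 (y + t) - u1 y"])
    fix t assume t: "t : {- abs k..abs k}"
    have "DERIV (%k. u (y + k)) t :> u1 (y + t)"
     using G(1)[of "y + t"] by (simp add: DERIV_shift add.commute[of y])
    thus "((%k. u (y + k) - k*u1 y) has_real_derivative u1 (y + t) - u1 y) (at t within {- abs k..abs k})"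
     by (auto intro!: derivative_eq_intros intro: DERIV_subset)
    have "abs(u1 (y + t) - u1 y) <= be*abs(y + t - y)"
     using G(5,6) by (intro deriv_bound[OF G(2)]) auto
    also have "... <= be*abs k" using t b0 by (intro mult_left_mono) auto
    finally show "norm (u1 (y + t) - u1 y) <= be*abs k" by simp
   qed auto
   thus ?thesis by simp
  qed
  from this[of h] this[of "- h"] show ?thesis using h by (simp add: abs_le_iff field_simps power2_eq_square)
 qed
 have R2: "abs(?R^2 - (h*u1 y)^2) <= 2*be*h^3"
 proof -
  have "abs(h*u1 y) <= h" using G(4)[of y] h by (simp add: abs_mult mult_left_le)
  hence "abs(?R + h*u1 y)*abs(?R - h*u1 y) <= (2*h)*(be*h^2)"
   using Rh R h by (intro mult_mono) linarith+
  moreover have "?R^2 - (h*u1 y)^2 = (?R + h*u1 y)*(?R - h*u1 y)"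
   by (simp add: power2_eq_square algebra_simps)
  moreover have "(2*h)*(be*h^2) = 2*be*h^3" by (simp add: power2_eq_square power3_eq_cube)
  ultimately show ?thesis by (simp only: abs_mult)
 qed
 have R4: "?R^4 <= h^3"
 proof -
  have "?R^4 = abs(?R)^4" by (rule power_even_abs[symmetric]) simp
  also have "abs(?R)^4 <= h^4" using Rh by (intro power_mono) auto
  also have "... <= h^3" using h by (intro power_decreasing) auto
  finally show ?thesis .
 qed
 have "abs(lcosh m ?R - m*?R^2/2) <= m^3*?R^4/4"
  using lcosh_bounds[OF m(1), of ?R] m(1) by (simp add: abs_le_iff)
 also have "... <= be^3*h^3"
 proof -
  have "m^3*?R^4 <= be^3*h^3" using m R4 b0 by (intro mult_mono power_mono) auto
  moreover have "0 <= be^3*h^3" using b0 h by simp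
  ultimately show ?thesis by linarith
 qed
 finally have L: "abs(lcosh m ?R - m*?R^2/2) <= be^3*h^3" .
 have "abs(m*?R^2/2 - m*(h*u1 y)^2/2) = m/2*abs(?R^2 - (h*u1 y)^2)"
 proof -
  have eq: "m*a/2 - m*b/2 = m/2*(a - b)" for a b by (simp add: algebra_simps)
  show ?thesis unfolding eq abs_mult using m(1) by simp
 qed
 also have "... <= be/2*(2*be*h^3)" using m R2 b0 by (intro mult_mono) auto
 finally have M: "abs(m*?R^2/2 - m*(h*u1 y)^2/2) <= be^2*h^3" by (simp add: power2_eq_square)
 have "h^2/2*(u2 y + m*(u1 y)^2) = h^2/2*u2 y + m*(h*u1 y)^2/2"
  by (simp add: algebra_simps power_mult_distrib)
 moreover have "(c + be^2 + be^3)*h^3 = c*h^3 + be^2*h^3 + be^3*h^3" by (simp add: algebra_simps)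
 ultimately show ?thesis using S L M unfolding pstep_def by linarith
qed

section \<open>The terminal value and the iterated scheme\<close>

definition pterm :: "real => real => real"
 where "pterm be y = ln (2*cosh (be*y))/be"

text \<open>Here u' = tanh (be*y), so u'' + be*u'^2 equals be identically: the invariant starts with
  equality at m = be.\<close>

lemma good_pterm:
 assumes be: "be > 0" and m: "m <= be"
 shows "EX u1 u2 u3. good be (2*be^2) m (pterm be) u1 u2 u3"
proof (intro exI)
 let ?t = "%y. tanh (be*y)"
 have t: "(?t y)^2 <= 1" "abs(?t y) <= 1" for y using tanh_sq_le_1 abs_tanh_le_1 by auto
 have dt: "DERIV ?t y :> be*(1 - (?t y)^2)" for y by (auto intro!: derivative_eq_intros)
 show "good be (2*be^2) m (pterm be) ?t (%y. be*(1 - (?t y)^2)) (%y. - 2*be^2*?t y*(1 - (?t y)^2))"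
  unfolding good_def
 proof (intro conjI allI)
  show "DERIV (pterm be) y :> ?t y" for y unfolding pterm_def[abs_def] using be
   by (auto intro!: derivative_eq_intros simp: tanh_def field_simps)
  show "DERIV (%y. be*(1 - (?t y)^2)) y :> - 2*be^2*?t y*(1 - (?t y)^2)" for y
   by (auto intro!: derivative_eq_intros dt simp: power2_eq_square algebra_simps)
  show "be*(1 - (?t y)^2) + m*(?t y)^2 <= be" for y
   using mult_right_mono[OF m, of "(?t y)^2"] by (simp add: algebra_simps)
  have "abs(?t y)*abs(1 - (?t y)^2) <= 1*1" for y using t[of y] by (intro mult_mono) auto
  hence b: "2*be^2*(abs(?t y)*abs(1 - (?t y)^2)) <= 2*be^2*1" for y by (intro mult_left_mono) auto
  show "abs(- 2*be^2*?t y*(1 - (?t y)^2)) <= 2*be^2" for y using b[of y] by (simp add: abs_mult mult_ac)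
 qed (use t be dt in auto)
qed

text \<open>In the form abs y + ln (1 + exp (-2*be*abs y))/be both the logarithm and the factor 1/be
  decrease in be.\<close>

lemma pterm_antimono:
 assumes "0 < be" "be <= be'"
 shows "pterm be' y <= pterm be y"
proof -
 have eq: "pterm b y = abs y + ln (1 + exp (- 2*b*abs y))/b" if "b > 0" for b
 proof -
  have "2*cosh (b*y) = exp (b*abs y)*(1 + exp (- 2*b*abs y))"
  proof -
   have "cosh (b*y) = cosh (b*abs y)" using cosh_real_abs[of "b*y"] that by (simp add: abs_mult)
   moreover have "exp (b*abs y)*exp (- 2*b*abs y) = exp (- (b*abs y))" by (simp add: exp_add[symmetric])
   ultimately show ?thesis by (simp add: cosh_field_def distrib_left)
  qed
  moreover have "1 + exp (- 2*b*abs y) > 0" by (simp add: add_pos_pos)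
  ultimately have "ln (2*cosh (b*y)) = b*abs y + ln (1 + exp (- 2*b*abs y))" by (simp add: ln_mult)
  thus ?thesis using that by (simp add: pterm_def field_simps)
 qed
 have "ln (1 + exp (- 2*be'*abs y))/be' <= ln (1 + exp (- 2*be'*abs y))/be"
  using assms by (intro divide_left_mono) auto
 also have "... <= ln (1 + exp (- 2*be*abs y))/be"
  using assms by (intro divide_right_mono ln_mono) (auto intro: add_pos_pos mult_right_mono)
 finally show ?thesis using assms by (simp add: eq)
qed

text \<open>Time runs backwards: step 0 starts at the terminal time q = 1, and \<open>mm i\<close>
  is the order parameter used in step i.\<close>

primrec sch :: "real => real => (nat => real) => nat => real => real" where
 "sch be h mm 0 = pterm be"
| "sch be h mm (Suc i) = pstep (mm i) h (sch be h mm i)"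

lemma pstep_lipschitz:
 assumes "!!y y'. abs(u y - u y') <= abs(y - y')"
 shows "abs(pstep m h u y - pstep m h u y') <= abs(y - y')"
proof -
 have "pstep m h u y - pstep m h u y' <= abs(y - y')" for y y'
 proof -
  have "y + h + (y' - y) = y' + h" "y - h + (y' - y) = y' - h" by auto
  hence "pstep m h u y' = pstep m h (%z. u (z + (y' - y))) y" by (simp only: pstep_def)
  moreover have "pstep m h u y - pstep m h (%z. u (z + (y' - y))) y <= abs(y - y')"
   using assms[of "y + h" "y' + h"] assms[of "y - h" "y' - h"] by (intro pstep_diff_le) (auto simp: algebra_simps)
  ultimately show ?thesis by simp
 qed
 from this[of y y'] this[of y' y] show ?thesis by (auto simp: abs_le_iff)
qed

lemma sch_lipschitz: "be > 0 ==> abs(sch be h mm i y - sch be h mm i y') <= abs(y - y')"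
proof (induction i arbitrary: y y')
 case 0
 obtain u1 u2 u3 where g: "good be (2*be^2) 0 (pterm be) u1 u2 u3" using good_pterm[OF 0, of 0] 0 by auto
 show ?case using deriv_bound[OF goodD(1)[OF g] goodD(4)[OF g], of y y'] by simp
next
 case (Suc i)
 thus ?case by (auto intro: pstep_lipschitz)
qed

lemma sch_param:
 assumes "be > 0" "!!i. i < n ==> mm i <= mm' i"
 shows "sch be h mm n y <= sch be h mm' n y"
  and "sch be h mm' n y <= sch be h mm n y + (SUM i<n. mm' i - mm i)*h^2/2"
proof -
 have "sch be h mm n y <= sch be h mm' n y & sch be h mm' n y <= sch be h mm n y + (SUM i<n. mm' i - mm i)*h^2/2"
  using assms(2)
 proof (induction n arbitrary: y)
  case (Suc n)
  let ?e = "(SUM i<n. mm' i - mm i)*h^2/2"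
  have IH: "sch be h mm n y <= sch be h mm' n y" "sch be h mm' n y <= sch be h mm n y + ?e" for y
   using Suc by auto
  note p = pstep_param[OF _ sch_lipschitz[OF assms(1)], of "mm n" "mm' n"]
  have "sch be h mm (Suc n) y <= pstep (mm n) h (sch be h mm' n) y"
   using IH by (auto intro: pstep_mono)
  also have "... <= sch be h mm' (Suc n) y" using p(1) Suc.prems by simp
  finally have 1: "sch be h mm (Suc n) y <= sch be h mm' (Suc n) y" .
  have "sch be h mm' (Suc n) y <= pstep (mm n) h (sch be h mm' n) y + (mm' n - mm n)*h^2/2"
   using p(2) Suc.prems by simp
  also have "pstep (mm n) h (sch be h mm' n) y - sch be h mm (Suc n) y <= ?e"
   unfolding sch.simps using IH(2)[of "y + h"] IH(2)[of "y - h"] by (intro pstep_diff_le) linarith+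
  hence "pstep (mm n) h (sch be h mm' n) y + (mm' n - mm n)*h^2/2 <= sch be h mm (Suc n) y + ?e + (mm' n - mm n)*h^2/2" by simp
  also have "... = sch be h mm (Suc n) y + (SUM i<Suc n. mm' i - mm i)*h^2/2"
   by (simp add: algebra_simps add_divide_distrib diff_divide_distrib)
  finally show ?case using 1 by simp
 qed simp
 thus "sch be h mm n y <= sch be h mm' n y"
  and "sch be h mm' n y <= sch be h mm n y + (SUM i<n. mm' i - mm i)*h^2/2" by auto
qed

lemma sch_antimono: "0 < be ==> be <= be' ==> sch be' h mm n y <= sch be h mm n y"
 by (induction n arbitrary: y) (auto intro: pterm_antimono pstep_mono)

text \<open>Turns the existential witnesses of \<open>good_pstep\<close> and
  \<open>good_pterm\<close> into iterated \<open>deriv\<close>, so that all later bounds refer to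
  the same functions.\<close>

lemma good_deriv:
 assumes "good be c m u u1 u2 u3"
 shows "u1 = deriv u" "u2 = deriv (deriv u)" "u3 = deriv (deriv (deriv u))"
proof -
 have "u1 = deriv u" "u2 = deriv u1" "u3 = deriv u2"
  using assms by (auto simp: good_def fun_eq_iff intro!: DERIV_imp_deriv[symmetric])
 thus "u1 = deriv u" "u2 = deriv (deriv u)" "u3 = deriv (deriv (deriv u))" by simp_all
qed

abbreviation Good :: "real => real => real => (real => real) => bool"
 where "Good be c m u \<equiv> good be c m u (deriv u) (deriv (deriv u)) (deriv (deriv (deriv u)))"

lemma Good_pstep:
 assumes g: "Good be c m u" and m: "0 <= m" "m <= be" and h: "h >= 0"
 shows "Good be (c*(1 + 3*be^2*h^2) + 2*be^5*h^3) m (pstep m h u)"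
  and "abs(deriv (pstep m h u) y - deriv u y) <= 2*be*h"
  and "abs(deriv (deriv (pstep m h u)) y - deriv (deriv u) y) <= 2 * c*h + be^3*h^2"
 using good_pstep[OF g m h] good_deriv[of be _ m "pstep m h u"] by metis+

section \<open>Refinement of the scheme for a fixed order parameter\<close>

locale order_parameter =
 fixes be :: real and x :: "real => real"
 assumes be: "be > 0"
  and x_range: "0 <= q ==> q <= 1 ==> 0 <= x q & x q <= be"
  and x_mono: "0 <= p ==> p <= q ==> q <= 1 ==> x p <= x q"
begin

text \<open>Step i runs over the cell from (N - i - 1)/N to (N - i)/N and takes x at its right end,
  the side from which right continuity will give convergence.\<close>

definition grid :: "nat => nat => real"
 where "grid N i = x ((real N - real i)/real N)"

text \<open>The value of the scheme with \<open>N\<close> time steps at time \<open>(N - i) / N\<close>.\<close>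

definition U :: "nat => nat => real => real"
 where "U N = sch be (1/sqrt N) (grid N)"

lemma U_0: "U N 0 = pterm be" and U_Suc: "U N (Suc i) = pstep (grid N i) (1/sqrt N) (U N i)"
 by (auto simp: U_def)

lemma grid_bounds: "i <= N ==> N > 0 ==> 0 <= grid N i & grid N i <= be"
 unfolding grid_def by (intro x_range) auto

lemma grid_antimono: "i <= k ==> k <= N ==> N > 0 ==> grid N k <= grid N i"
 unfolding grid_def by (intro x_mono) (auto intro: divide_right_mono)

text \<open>Discrete Gronwall over at most N steps with h^2 = 1/N: the growth factor is (1 +
  3*be^2/N)^N <= exp (3*be^2), the terminal value starts with 2*be^2, and the N sources 2*be^5*h^3
  sum to at most 2*be^5.\<close>

definition Cb :: real
 where "Cb = exp (3*be^2)*(2*be^2 + 2*be^5)"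

lemma Good_U:
 assumes N: "N > 0" and i: "i <= N"
 shows "Good be Cb (grid N i) (U N i)"
proof -
 have be0: "be >= 0" using be by simp
 define a where "a = 3*be^2/N"
 have a: "a >= 0" by (simp add: a_def)
 have "Good be ((1 + a)^i*(2*be^2 + i/N*(2*be^5))) (grid N i) (U N i)" using i
 proof (induction i)
  case 0
  obtain u1 u2 u3 where g: "good be (2*be^2) (grid N 0) (pterm be) u1 u2 u3"
   using good_pterm[OF be] grid_bounds[of 0 N] N by blast
  show ?case using g good_deriv[OF g] by (simp add: U_0)
 next
  case (Suc i)
  let ?c = "(1 + a)^i*(2*be^2 + i/N*(2*be^5))"
  let ?h = "1/sqrt N"
  have h: "0 <= ?h" "?h <= 1" "?h^2 = 1/N" using N by (auto simp: power_divide)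
  have IH: "Good be ?c (grid N i) (U N i)" using Suc by simp
  have "Good be (?c*(1 + 3*be^2*?h^2) + 2*be^5*?h^3) (grid N i) (U N (Suc i))"
   unfolding U_Suc using grid_bounds[of i N] Suc.prems N by (intro Good_pstep(1)[OF IH]) auto
  moreover have "grid N (Suc i) <= grid N i" using Suc.prems N by (intro grid_antimono) auto
  moreover have "?c*(1 + 3*be^2*?h^2) + 2*be^5*?h^3 <= (1 + a)^Suc i*(2*be^2 + Suc i/N*(2*be^5))"
  proof -
   have "?h^3 <= ?h^2" using h by (intro power_decreasing) auto
   hence "2*be^5*?h^3 <= 2*be^5*(1/N)" using be h(3) by (intro mult_left_mono) auto
   also have "... <= (1 + a)^Suc i*(2*be^5*(1/N))"
    using be a mult_right_mono[of 1 "(1 + a)^Suc i" "2*be^5*(1/N)"] one_le_power[of "1 + a" "Suc i"] by simp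
   finally have "?c*(1 + a) + 2*be^5*?h^3 <= ?c*(1 + a) + (1 + a)^Suc i*(2*be^5*(1/N))" by simp
   also have "... = (1 + a)^Suc i*(2*be^2 + Suc i/N*(2*be^5))"
    by (simp add: algebra_simps add_divide_distrib)
   finally show ?thesis unfolding h(3) by (simp add: a_def)
  qed
  ultimately show ?case by (rule good_mono)
 qed
 moreover have "(1 + a)^i*(2*be^2 + i/N*(2*be^5)) <= Cb" unfolding Cb_def
 proof (intro mult_mono)
  have "(1 + a)^i <= exp a^i" using a by (intro power_mono) (auto simp: exp_ge_add_one_self)
  also have "... = exp (i*a)" by (simp add: exp_of_nat_mult)
  also have "... <= exp (3*be^2)" using i N by (simp add: a_def field_simps mult_right_mono)
  finally show "(1 + a)^i <= exp (3*be^2)" .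
  have "i/N*(2*be^5) <= 1*(2*be^5)" using i N be by (intro mult_right_mono) auto
  thus "2*be^2 + i/N*(2*be^5) <= 2*be^2 + 2*be^5" by simp
 qed (use be in auto)
 ultimately show ?thesis using good_mono by blast
qed

lemmas U_props = goodD[OF Good_U conjunct1[OF grid_bounds]]

lemma Cb_nonneg: "Cb >= 0" using be by (auto simp: Cb_def)

definition C1 :: real
 where "C1 = Cb + be^2 + be^3"

lemma C1_nonneg: "C1 >= 0" using Cb_nonneg be by (auto simp: C1_def)

lemma U_Suc_expansion:
 assumes N: "N > 0" and i: "i <= N"
 shows "abs(U N (Suc i) y - U N i y - 1/(2*real N)*(deriv (deriv (U N i)) y + grid N i*(deriv (U N i) y)^2)) <= C1*(1/sqrt N)^3"
proof -
 have h: "0 <= 1/sqrt N" "1/sqrt N <= 1" "(1/sqrt N)^2/2 = 1/(2*real N)" using N by (auto simp: power_divide)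
 have gb: "0 <= grid N i" "grid N i <= be" using grid_bounds[OF i N] by auto
 show ?thesis
  using pstep_expansion[OF Good_U[OF N i] gb gb(1) h(1,2), of y] unfolding h(3) U_Suc C1_def .
qed

lemma U_Suc_diff:
 assumes N: "N > 0" and i: "i <= N"
 shows "abs(U N (Suc i) y - U N i y) <= (be + C1)/N"
proof -
 let ?X = "deriv (deriv (U N i)) y + grid N i*(deriv (U N i) y)^2"
 have X: "0 <= ?X" "?X <= be" using U_props[OF N i i N] grid_bounds[OF i N] by auto
 have "(1/sqrt N)^3 <= (1/sqrt N)^2" using N by (intro power_decreasing) auto
 hence "C1*(1/sqrt N)^3 <= C1*(1/N)" using C1_nonneg N by (intro mult_left_mono) (auto simp: power_divide)
 moreover have "1/(2*real N)*?X <= 1/(2*real N)*be" "0 <= 1/(2*real N)*?X"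
  using divide_right_mono[OF X(2), of "2*real N"] X(1) by simp_all
 moreover have "1/(2*real N)*be <= 1/N*be" using be N by (intro mult_right_mono) (auto simp: field_simps)
 moreover have "(be + C1)/N = 1/N*be + C1*(1/N)" by (simp add: add_divide_distrib)
 ultimately show ?thesis using U_Suc_expansion[OF N i, of y] by linarith
qed

text \<open>Per step, three expansions cost 3*C1 and the change of the generator between the two
  short steps costs the next three terms, all times N^(-3/2). The final be is the total variation of
  the order parameter, whose cost carries a factor 1/N only once.\<close>

definition C2 :: real
 where "C2 = 3*C1 + 2*Cb + be^3 + 4*be^2 + be"

text \<open>One step of length h is compared with two of length k, where k^2 = h^2/2. All are Euler
  steps up to O(h^3), the generator changes by O(h) after the first short step, and replacing the
  midpoint value of x by the right one costs at most grid N i - grid N (Suc i) over N, which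
  telescopes in i.\<close>

lemma U_double_step:
 assumes N: "N > 0" and i: "i < N"
 shows "abs(pstep (grid N i) (1/sqrt N) (U (2*N) (2*i)) y - U (2*N) (2*i + 2) y)
  <= (3*C1 + 2*Cb + be^3 + 4*be^2)*(1/sqrt N)^3 + (grid N i - grid N (Suc i))*(1/N)"
proof -
 define h where "h = 1/sqrt N"
 define k where "k = 1/sqrt (2*N)"
 have N2: "2*N > 0" using N by simp
 have h: "0 <= h" "h <= 1" "h^2 = 1/N" using N by (auto simp: h_def power_divide)
 have k: "0 <= k" "k <= h" "k^2 = h^2/2" "k <= 1" using N by (auto simp: k_def h_def power_divide frac_le)
 define m where "m = grid N i"
 have grid_double: "grid (2*N) (2 * k) = grid N k" for k
 proof -
  have "(real (2*N) - real (2 * k))/real (2*N) = (2*(real N - real k))/(2*real N)"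
   by (simp add: algebra_simps)
  also have "... = (real N - real k)/real N" by (rule mult_divide_mult_cancel_left) simp
  finally show ?thesis unfolding grid_def by simp
 qed
 have m1: "grid (2*N) (2*i) = m" by (simp add: m_def grid_double)
 define m2 where "m2 = grid (2*N) (Suc (2*i))"
 have m2: "m2 <= m" "grid N (Suc i) <= m2"
 proof -
  show "m2 <= m" unfolding m2_def m1[symmetric] using i N by (intro grid_antimono) auto
  have "grid N (Suc i) = grid (2*N) (2*Suc i)" by (rule grid_double[symmetric])
  thus "grid N (Suc i) <= m2" unfolding m2_def using i N by (simp only:) (intro grid_antimono; auto)
 qed
 have m0: "0 <= m" "m <= be" unfolding m_def using grid_bounds[of i N] i N by auto
 have m20: "0 <= m2" "m2 <= be" unfolding m2_def using grid_bounds[of "Suc (2*i)" "2*N"] i N by auto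
 define u where "u = U (2*N) (2*i)"
 define v where "v = U (2*N) (Suc (2*i))"
 have v: "v = pstep m k u" unfolding v_def u_def U_Suc m1 k_def by simp
 have w: "U (2*N) (2*i + 2) = pstep m2 k v" unfolding v_def m2_def k_def by (simp add: U_Suc)
 have gu: "Good be Cb m u" unfolding u_def m1[symmetric] using i N by (intro Good_U) auto
 have gv: "Good be Cb m2 v" unfolding v_def m2_def using i N by (intro Good_U) auto
 let ?X = "%u y. deriv (deriv u) y + m*(deriv u y)^2"
 have 1: "abs(pstep m h u y - u y - h^2/2*?X u y) <= C1*h^3"
  unfolding C1_def by (rule pstep_expansion[OF gu m0 m0(1) h(1,2)])
 have k3: "C1 * k^3 <= C1*h^3" using k C1_nonneg by (intro mult_left_mono power_mono) auto
 have 2: "abs(v y - u y - k^2/2*?X u y) <= C1*h^3"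
  using pstep_expansion[OF gu m0 m0(1) k(1,4), of y] k3 unfolding v C1_def by linarith
 have 3: "abs(pstep m k v y - v y - k^2/2*?X v y) <= C1*h^3"
  using pstep_expansion[OF gv m0 m20(1) k(1,4), of y] k3 unfolding C1_def by linarith
 have "abs(?X v y - ?X u y) <= (2*Cb + be^3 + 4*be^2)*h"
 proof -
  have d1: "abs(deriv v y - deriv u y) <= 2*be*h"
   using Good_pstep(2)[OF gu m0 k(1), of y] mult_left_mono[OF k(2), of "2*be"] be unfolding v by linarith
  have d2: "abs(deriv (deriv v) y - deriv (deriv u) y) <= 2*Cb*h + be^3*h"
  proof -
   have "2*Cb * k <= 2*Cb*h" using k Cb_nonneg by (intro mult_left_mono) auto
   moreover have "k^2 <= h" using k mult_mono[of k h k 1] by (simp add: power2_eq_square)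
   hence "be^3 * k^2 <= be^3*h" using be by (intro mult_left_mono) auto
   ultimately show ?thesis using Good_pstep(3)[OF gu m0 k(1), of y] unfolding v by linarith
  qed
  have "abs((deriv v y)^2 - (deriv u y)^2) = abs(deriv v y + deriv u y)*abs(deriv v y - deriv u y)"
   by (simp add: abs_mult[symmetric] power2_eq_square algebra_simps)
  also have "... <= 2*(2*be*h)"
  proof (intro mult_mono d1)
   show "abs(deriv v y + deriv u y) <= 2" using goodD(4)[OF gu m0(1), of y] goodD(4)[OF gv m20(1), of y] by linarith
  qed auto
  finally have d3: "abs((deriv v y)^2 - (deriv u y)^2) <= 4*be*h" by simp
  have "abs(m*(deriv v y)^2 - m*(deriv u y)^2) = m*abs((deriv v y)^2 - (deriv u y)^2)"
   using m0 by (simp add: abs_mult right_diff_distrib[symmetric])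
  also have "... <= be*(4*be*h)" using m0 d3 be by (intro mult_mono) auto
  finally have "abs(m*(deriv v y)^2 - m*(deriv u y)^2) <= 4*be^2*h" by (simp add: power2_eq_square)
  moreover have "(2*Cb + be^3 + 4*be^2)*h = 2*Cb*h + be^3*h + 4*be^2*h" by (simp add: algebra_simps)
  ultimately show ?thesis using d2 by linarith
 qed
 hence "k^2/2*abs(?X v y - ?X u y) <= h^2*((2*Cb + be^3 + 4*be^2)*h)"
  unfolding k(3) by (intro mult_mono) auto
 moreover have "abs(k^2/2*?X v y - k^2/2*?X u y) = k^2/2*abs(?X v y - ?X u y)"
  unfolding right_diff_distrib[symmetric] abs_mult by simp
 moreover have "h^2*((2*Cb + be^3 + 4*be^2)*h) = (2*Cb + be^3 + 4*be^2)*h^3"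
  by (simp add: power2_eq_square power3_eq_cube)
 ultimately have 4: "abs(k^2/2*?X v y - k^2/2*?X u y) <= (2*Cb + be^3 + 4*be^2)*h^3" by linarith
 have lipv: "abs(v a - v b) <= abs(a - b)" for a b unfolding v_def U_def by (rule sch_lipschitz[OF be])
 have 5: "abs(pstep m k v y - pstep m2 k v y) <= (m - m2) * k^2/2"
  using pstep_param[OF m2(1) lipv, of k y] by linarith
 have "(m - m2) * k^2/2 <= (grid N i - grid N (Suc i))*(1/N)"
 proof -
  have "(m - m2) * k^2 <= (grid N i - grid N (Suc i))*(1/N)"
  proof (rule mult_mono)
   show "k^2 <= 1/N" using power_mono[OF k(2,1), of 2] h(3) by simp
  qed (use m2 in \<open>auto simp: m_def\<close>)
  moreover have "0 <= (m - m2) * k^2" using m2 by simp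
  ultimately show ?thesis by linarith
 qed
 moreover have "h^2/2*?X u y = k^2/2*?X u y + k^2/2*?X u y" unfolding k(3) by simp
 moreover have "(3*C1 + 2*Cb + be^3 + 4*be^2)*h^3 = 3*(C1*h^3) + (2*Cb + be^3 + 4*be^2)*h^3"
  by (simp add: algebra_simps)
 ultimately show ?thesis using 1 2 3 4 5 unfolding w m_def[symmetric] h_def[symmetric] u_def[symmetric] by linarith
qed

text \<open>N local errors of order N^(-3/2) sum to order 1/sqrt N; none is amplified, since
  \<open>pstep\<close> is a contraction.\<close>

lemma U_double:
 assumes N: "N > 0" and i: "i <= N"
 shows "abs(U N i y - U (2*N) (2*i) y) <= C2/sqrt N"
proof -
 let ?B = "3*C1 + 2*Cb + be^3 + 4*be^2"
 have B: "?B >= 0" using C1_nonneg Cb_nonneg be by simp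
 have "abs(U N i y - U (2*N) (2*i) y) <= i*(?B*(1/sqrt N)^3) + (grid N 0 - grid N i)*(1/N)" using i
 proof (induction i arbitrary: y)
  case (Suc i)
  let ?e = "i*(?B*(1/sqrt N)^3) + (grid N 0 - grid N i)*(1/N)"
  have "abs(U N (Suc i) y - pstep (grid N i) (1/sqrt N) (U (2*N) (2*i)) y) <= ?e"
   unfolding U_Suc using Suc by (intro pstep_contraction) auto
  moreover have "abs(pstep (grid N i) (1/sqrt N) (U (2*N) (2*i)) y - U (2*N) (2*i + 2) y)
    <= ?B*(1/sqrt N)^3 + (grid N i - grid N (Suc i))*(1/N)"
   using Suc.prems N by (intro U_double_step) auto
  moreover have "Suc i*(?B*(1/sqrt N)^3) + (grid N 0 - grid N (Suc i))*(1/N)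
    = ?e + (?B*(1/sqrt N)^3 + (grid N i - grid N (Suc i))*(1/N))"
   by (simp add: algebra_simps diff_divide_distrib)
  moreover have eq: "2*Suc i = 2*i + 2" by simp
  ultimately show ?case unfolding eq by linarith
 qed (simp add: U_0)
 also have "... <= ?B*(1/sqrt N) + be*(1/sqrt N)"
 proof (intro add_mono)
  have "i*(?B*(1/sqrt N)^3) <= N*(?B*(1/sqrt N)^3)" using i B by (intro mult_right_mono) auto
  also have "... = ?B*(1/sqrt N)*(N*(1/sqrt N)^2)" by (simp add: power2_eq_square power3_eq_cube)
  also have "N*(1/sqrt N)^2 = 1" using N by (simp add: power_divide)
  finally show "i*(?B*(1/sqrt N)^3) <= ?B*(1/sqrt N)" by simp
  have "1/N <= 1/sqrt N" using N by (intro frac_le) (auto simp: real_sqrt_le_iff real_le_lsqrt self_le_power)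
  thus "(grid N 0 - grid N i)*(1/N) <= be*(1/sqrt N)"
   using grid_bounds[of 0 N] grid_bounds[OF i N] grid_antimono[of 0 i N] i N be by (intro mult_mono) auto
 qed
 finally show ?thesis by (simp add: C2_def add_divide_distrib distrib_right)
qed

end

section \<open>The limit of the scheme\<close>

text \<open>A quadratic remainder bound survives pointwise limits, which is how differentiability
  passes to the limit of the scheme. It also gives the derivative of \<open>flat\<close> at
  0.\<close>

lemma derivative_from_quadratic:
 fixes f :: "real => real"
 assumes "!!h. abs(f (y + h) - f y - h*p) <= C*h^2"
 shows "DERIV f y :> p" unfolding DERIV_def
proof (rule Lim_transform2[where f = "%_. p", OF tendsto_const])
 show "((%h. p - (f (y + h) - f y)/h) \<longlongrightarrow> 0) (at 0)"
 proof (rule Lim_null_comparison)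
  show "\<forall>\<^sub>F h in at 0. norm (p - (f (y + h) - f y)/h) <= abs C*abs h"
  proof (rule eventually_mono[OF eventually_neq_at_within[of 0 0]])
   fix h :: real assume h: "h ~= 0"
   have "abs(p - (f (y + h) - f y)/h)*abs h = abs(f (y + h) - f y - h*p)"
    using h by (simp add: abs_mult[symmetric] field_simps abs_minus_commute)
   also have "... <= abs C*h^2" using assms[of h] by (rule order.trans) (intro mult_right_mono; simp)
   also have "... = abs C*abs h*abs h" by (simp add: power2_eq_square abs_mult_self_eq mult.assoc)
   finally show "norm (p - (f (y + h) - f y)/h) <= abs C*abs h" using h by simp
  qed
  show "((%h. abs C*abs h) \<longlongrightarrow> 0) (at 0)" by (intro tendsto_eq_intros) auto
 qed
qed

lemma taylor1_bound:
 fixes f :: "real => real"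
 assumes f: "!!y. (DERIV f y :> f1 y)" "!!y. (DERIV f1 y :> f2 y)"
  and B: "!!y. abs(f2 y) <= B"
 shows "abs(f (y + h) - f y - h*f1 y) <= B*h^2"
proof -
 have B0: "B >= 0" using B[of 0] by linarith
 have "norm ((%k. f (y + k) - k*f1 y) h - (%k. f (y + k) - k*f1 y) 0) <= B*abs h*norm (h - 0)"
 proof (rule field_differentiable_bound[where S = "{- abs h..abs h}" and f' = "%t. f1 (y + t) - f1 y"])
  fix t assume t: "t : {- abs h..abs h}"
  have "DERIV (%k. f (y + k)) t :> f1 (y + t)"
   using f(1)[of "y + t"] by (simp add: DERIV_shift add.commute[of y])
  thus "((%k. f (y + k) - k*f1 y) has_real_derivative f1 (y + t) - f1 y) (at t within {- abs h..abs h})"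
   by (auto intro!: derivative_eq_intros intro: DERIV_subset)
  have "abs(f1 (y + t) - f1 y) <= B*abs(y + t - y)" by (rule deriv_bound[OF f(2) B])
  also have "... <= B*abs h" using t B0 by (intro mult_left_mono) auto
  finally show "norm (f1 (y + t) - f1 y) <= B*abs h" by simp
 qed auto
 thus ?thesis by (simp add: power2_eq_square abs_mult_self_eq mult.assoc)
qed

text \<open>Landau's interpolation: a step of length e in Taylor's formula balances the bound e^2 on
  f against the bound on f2. It makes the derivatives Cauchy without a recursion of their
  own.\<close>

lemma derivative_interpolation:
 fixes f :: "real => real"
 assumes f: "!!y. (DERIV f y :> f1 y)" "!!y. (DERIV f1 y :> f2 y)"
  and B: "!!y. abs(f2 y) <= B" and e: "!!y. abs(f y) <= e^2" "e > 0"
 shows "abs(f1 y) <= (2 + B)*e"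
proof -
 have "abs(e*f1 y) <= abs(f (y + e)) + abs(f y) + abs(f (y + e) - f y - e*f1 y)" by linarith
 also have "... <= e^2 + e^2 + B*e^2" using e(1)[of "y + e"] e(1)[of y] taylor1_bound[OF f B, of y e] by linarith
 finally have "abs(f1 y)*e <= ((2 + B)*e)*e"
  using e(2) by (simp add: abs_mult power2_eq_square algebra_simps)
 thus ?thesis using e(2) by (rule mult_right_le_imp_le)
qed

lemma uniformly_Cauchy_derivative:
 fixes F :: "nat => 'a \<times> real => real"
 assumes c: "uniformly_Cauchy_on (A \<times> UNIV) F"
  and d1: "!!j q y. q : A ==> (DERIV (%y. F j (q, y)) y :> F1 j (q, y))"
  and d2: "!!j q y. q : A ==> (DERIV (%y. F1 j (q, y)) y :> F2 j (q, y))"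
  and B: "!!j q y. q : A ==> abs(F2 j (q, y)) <= B"
 shows "uniformly_Cauchy_on (A \<times> UNIV) F1"
proof (cases "A = {}")
 case False
 then obtain q0 where "q0 : A" by blast
 hence B0: "B >= 0" using B[of q0 0 undefined] by linarith
 show ?thesis unfolding uniformly_Cauchy_on_def
proof (intro allI impI)
 fix e :: real assume e: "e > 0"
 \<comment> \<open>Second derivatives of differences are bounded by 2*B, so interpolation will yield
   (2 + 2*B)*e'.\<close>
 define e' where "e' = e/(3 + 2*B)"
 have e': "e' > 0" "(2 + 2*B)*e' < e" using e B0 by (auto simp: e'_def field_simps)
 then obtain M where M: "!!z m n. z : A \<times> UNIV ==> m >= M ==> n >= M ==> dist (F m z) (F n z) < e'^2"
  using c unfolding uniformly_Cauchy_on_def by (metis zero_less_power)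
 show "EX M. ALL z:A \<times> UNIV. ALL m>=M. ALL n>=M. dist (F1 m z) (F1 n z) < e"
 proof (intro exI[of _ M] ballI allI impI)
  fix z :: "'a \<times> real" and m n assume z: "z : A \<times> UNIV" and mn: "m >= M" "n >= M"
  obtain q y where [simp]: "z = (q, y)" and q: "q : A" using z by auto
  have "abs(F1 m (q, y) - F1 n (q, y)) <= (2 + 2*B)*e'"
  proof (rule derivative_interpolation[where ?f1.0 = "%y. F1 m (q, y) - F1 n (q, y)" and y = y])
   show "DERIV (%y. F m (q, y) - F n (q, y)) y :> F1 m (q, y) - F1 n (q, y)" for y
    by (intro DERIV_diff d1 q)
   show "DERIV (%y. F1 m (q, y) - F1 n (q, y)) y :> F2 m (q, y) - F2 n (q, y)" for y
    by (intro DERIV_diff d2 q)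
   show "abs(F2 m (q, y) - F2 n (q, y)) <= 2*B" for y using B[OF q, of m y] B[OF q, of n y] by linarith
   show "abs(F m (q, y) - F n (q, y)) <= e'^2" for y
    using M[of "(q, y)" m n] mn q by (auto simp: dist_real_def intro: less_imp_le)
  qed (rule e')
  thus "dist (F1 m z) (F1 n z) < e" using e'(2) by (simp add: dist_real_def)
 qed
qed
qed (simp add: uniformly_Cauchy_on_def)

context order_parameter
begin

text \<open>The index of the right end point of the cell of \<open>q\<close>; for \<open>q = 1\<close> truncated subtraction
  gives the terminal index \<open>0\<close>.\<close>

definition idx :: "nat => real => nat"
 where "idx N q = N - 1 - nat \<lfloor>q*N\<rfloor>"

lemma idx_le: "idx N q <= N" by (simp add: idx_def)

text \<open>A coarse cell splits into two fine ones, with the extra index for q in the left half.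
  The point q = 1 is apart: its floor is N, and truncated subtraction gives index 0 on both
  grids.\<close>

lemma idx_double:
 assumes "0 <= q" "q <= 1" "N > 0"
 shows "idx (2*N) q = 2*idx N q | idx (2*N) q = Suc (2*idx N q)"
proof -
 define k where "k = nat \<lfloor>q*N\<rfloor>"
 have k: "real k <= q*N" "q*N < real k + 1"
 proof -
  have "real k = of_int \<lfloor>q*N\<rfloor>" unfolding k_def using assms by simp
  thus "real k <= q*N" "q*N < real k + 1" by linarith+
 qed
 have k2: "nat \<lfloor>q*(2*N)\<rfloor> = 2 * k | nat \<lfloor>q*(2*N)\<rfloor> = 2 * k + 1"
 proof -
  have "\<lfloor>q*(2*N)\<rfloor> = int (2 * k) | \<lfloor>q*(2*N)\<rfloor> = int (2 * k + 1)"
   using k by (cases "q*(2*N) < 2 * k + 1") (auto simp: floor_eq_iff)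
  thus ?thesis by (auto simp del: of_nat_add of_nat_mult)
 qed
 have "q*N <= 1*real N" using assms by (intro mult_right_mono) auto
 hence kN: "k <= N" using k(1) by linarith
 have "q = 1" if "k = N" using that k(1) assms by (simp add: mult_le_cancel_right)
 hence *: "k = N ==> nat \<lfloor>q*(2*N)\<rfloor> = 2*N"
 proof -
  assume "k = N"
  with `k = N ==> q = 1` have "\<lfloor>q*(2*N)\<rfloor> = int (2*N)" by (simp add: floor_eq_iff)
  thus ?thesis by (simp del: of_nat_mult)
 qed
 show ?thesis using k2 kN * unfolding idx_def k_def[symmetric] by (cases "k = N") auto
qed

definition FF :: "nat => real \<times> real => real" where "FF j = (%(q, y). U (2^j) (idx (2^j) q) y)"
definition FF1 :: "nat => real \<times> real => real" where "FF1 j = (%(q, y). deriv (U (2^j) (idx (2^j) q)) y)"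
definition FF2 :: "nat => real \<times> real => real" where "FF2 j = (%(q, y). deriv (deriv (U (2^j) (idx (2^j) q))) y)"
definition FF3 :: "nat => real \<times> real => real" where "FF3 j = (%(q, y). deriv (deriv (deriv (U (2^j) (idx (2^j) q)))) y)"

lemmas FF_defs = FF_def FF1_def FF2_def FF3_def

lemma FF_props:
 shows "DERIV (%y. FF j (q, y)) y :> FF1 j (q, y)"
  "DERIV (%y. FF1 j (q, y)) y :> FF2 j (q, y)"
  "DERIV (%y. FF2 j (q, y)) y :> FF3 j (q, y)"
  "abs(FF1 j (q, y)) <= 1" "0 <= FF2 j (q, y)" "FF2 j (q, y) <= be" "abs(FF3 j (q, y)) <= Cb"
 unfolding FF_defs prod.case by (rule U_props[OF _ idx_le idx_le]; simp)+

definition C4 :: real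
 where "C4 = C2 + be + C1"

lemma sqrt_pow2: "sqrt (2^j) = sqrt 2^j" by (simp add: real_sqrt_power)

text \<open>Refinement costs C2/sqrt N. If q lies in the left half of its cell the fine grid makes
  one step more, at a cost of O(1/N).\<close>

lemma FF_Suc:
 assumes "0 <= q" "q <= 1"
 shows "abs(FF j (q, y) - FF (Suc j) (q, y)) <= C4*(1/sqrt 2)^j"
proof -
 let ?N = "2^j :: nat" and ?i = "idx (2^j) q" and ?i' = "idx (2^Suc j) q"
 have N: "?N > 0" by simp
 have 1: "abs(U ?N ?i y - U (2*?N) (2*?i) y) <= C2/sqrt ?N" by (rule U_double[OF N idx_le])
 have "abs(U (2*?N) (2*?i) y - U (2*?N) ?i' y) <= (be + C1)/(2*?N)"
 proof -
  have "?i' = 2*?i | ?i' = Suc (2*?i)" using idx_double[OF assms N] by simp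
  moreover have "abs(U (2*?N) (Suc (2*?i)) y - U (2*?N) (2*?i) y) <= (be + C1)/real (2*?N)"
   using idx_le[of ?N q] by (intro U_Suc_diff) auto
  ultimately show ?thesis using C1_nonneg be by (auto simp: abs_minus_commute)
 qed
 also have "... <= (be + C1)/sqrt ?N"
 proof (rule divide_left_mono)
  have "sqrt (real ?N) <= real ?N" by (intro real_le_lsqrt) (auto simp: self_le_power)
  thus "sqrt (real ?N) <= real (2*?N)" using of_nat_0_le_iff[of ?N] by linarith
 qed (use C1_nonneg be in auto)
 finally have 2: "abs(U (2*?N) (2*?i) y - U (2*?N) ?i' y) <= (be + C1)/sqrt ?N" .
 have "C4*(1/sqrt 2)^j = C2/sqrt ?N + (be + C1)/sqrt ?N"
  by (simp add: C4_def sqrt_pow2 power_divide add_divide_distrib)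
 thus ?thesis using 1 2 unfolding FF_def by simp
qed

lemma FF_Cauchy: "uniformly_Cauchy_on ({0..1} \<times> UNIV) FF"
proof -
 let ?th = "1/sqrt 2 :: real"
 have th: "0 < ?th" "?th < 1" by auto
 have C4: "C4 >= 0" using C1_nonneg be Cb_nonneg by (auto simp: C4_def C2_def)
 have tail: "abs(FF j (q, y) - FF (j + k) (q, y)) <= C4*?th^j/(1 - ?th)" if "0 <= q" "q <= 1" for j k q y
 proof -
  have "abs(FF j (q, y) - FF (j + k) (q, y)) <= (SUM l<k. C4*?th^(j + l))"
  proof (induction k)
   case (Suc k)
   thus ?case using FF_Suc[OF that, of "j + k" y] by simp
  qed simp
  also have "... = C4*?th^j*(SUM l<k. ?th^l)" by (simp add: power_add sum_distrib_left mult_ac)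
  also have "... <= C4*?th^j*(1/(1 - ?th))"
  proof (rule mult_left_mono)
   have "(SUM l<k. ?th^l) <= suminf (%l. ?th^l)"
    using th by (intro sum_le_suminf summable_geometric) auto
   thus "(SUM l<k. ?th^l) <= 1/(1 - ?th)" using th by (simp add: suminf_geometric)
  qed (use C4 th in auto)
  finally show ?thesis by simp
 qed
 show ?thesis unfolding uniformly_Cauchy_on_def
 proof (intro allI impI)
  fix e :: real assume e: "e > 0"
  have l: "(%j. 2*(C4*?th^j/(1 - ?th))) ----> 2*(C4*0/(1 - ?th))"
   using th by (intro tendsto_intros LIMSEQ_realpow_zero) auto
  have "2*(C4*0/(1 - ?th)) < e" using e by simp
  from order_tendstoD(2)[OF l this] have "\<forall>\<^sub>F j in sequentially. 2*(C4*?th^j/(1 - ?th)) < e" .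
  then obtain M where M: "2*(C4*?th^M/(1 - ?th)) < e" unfolding eventually_sequentially by blast
  show "EX M. ALL z:{0..1} \<times> UNIV. ALL m>=M. ALL n>=M. dist (FF m z) (FF n z) < e"
  proof (intro exI[of _ M] ballI allI impI)
   fix z :: "real \<times> real" and m n assume z: "z : {0..1} \<times> UNIV" and mn: "M <= m" "M <= n"
   obtain q y where [simp]: "z = (q, y)" and q: "0 <= q" "q <= 1" using z by auto
   show "dist (FF m z) (FF n z) < e"
    using tail[OF q, of M y "m - M"] tail[OF q, of M y "n - M"] mn M by (simp add: dist_real_def)
  qed
 qed
qed

lemma FF1_Cauchy: "uniformly_Cauchy_on ({0..1} \<times> UNIV) FF1"
 using FF_props by (intro uniformly_Cauchy_derivative[OF FF_Cauchy, where ?F2.0 = FF2 and B = be]) (auto simp: abs_of_nonneg)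

lemma FF2_Cauchy: "uniformly_Cauchy_on ({0..1} \<times> UNIV) FF2"
 using FF_props by (intro uniformly_Cauchy_derivative[OF FF1_Cauchy, where ?F2.0 = FF3 and B = Cb]) auto

definition ff :: "real \<times> real => real" where "ff z = lim (%j. FF j z)"
definition pp :: "real \<times> real => real" where "pp z = lim (%j. FF1 j z)"
definition rr :: "real \<times> real => real" where "rr z = lim (%j. FF2 j z)"

lemma uniform_limits:
 shows "uniform_limit ({0..1} \<times> UNIV) FF ff sequentially"
  "uniform_limit ({0..1} \<times> UNIV) FF1 pp sequentially"
  "uniform_limit ({0..1} \<times> UNIV) FF2 rr sequentially"
proof -
 have *: "uniform_limit A F (%z. lim (%j. F j z)) sequentially" if "uniformly_Cauchy_on A F"
  for A and F :: "nat => real \<times> real => real"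
  using Cauchy_uniformly_convergent[OF that] by (simp add: uniformly_convergent_uniform_limit_iff)
 show "uniform_limit ({0..1} \<times> UNIV) FF ff sequentially"
  "uniform_limit ({0..1} \<times> UNIV) FF1 pp sequentially"
  "uniform_limit ({0..1} \<times> UNIV) FF2 rr sequentially"
  using *[OF FF_Cauchy] *[OF FF1_Cauchy] *[OF FF2_Cauchy] by (simp_all add: ff_def[abs_def] pp_def[abs_def] rr_def[abs_def])
qed

lemma pointwise_limits:
 assumes "0 <= q" "q <= 1"
 shows "(%j. FF j (q, y)) ----> ff (q, y)" "(%j. FF1 j (q, y)) ----> pp (q, y)" "(%j. FF2 j (q, y)) ----> rr (q, y)"
 using assms tendsto_uniform_limitI[OF uniform_limits(1), of "(q, y)"]
  tendsto_uniform_limitI[OF uniform_limits(2), of "(q, y)"] tendsto_uniform_limitI[OF uniform_limits(3), of "(q, y)"] by auto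

lemma ff_bounds:
 assumes q: "0 <= q" "q <= 1"
 shows "abs(pp (q, y)) <= 1" "0 <= rr (q, y)" "rr (q, y) <= be" "abs(rr (q, y) - rr (q, y')) <= Cb*abs(y - y')"
proof -
 note l = pointwise_limits[OF q]
 show "abs(pp (q, y)) <= 1" by (rule LIMSEQ_le_const2[OF tendsto_rabs[OF l(2)]]) (auto intro: FF_props)
 show "0 <= rr (q, y)" by (rule LIMSEQ_le_const[OF l(3)]) (auto intro: FF_props)
 show "rr (q, y) <= be" by (rule LIMSEQ_le_const2[OF l(3)]) (auto intro: FF_props)
 show "abs(rr (q, y) - rr (q, y')) <= Cb*abs(y - y')"
 proof -
  have "abs(FF2 j (q, y) - FF2 j (q, y')) <= Cb*abs(y - y')" for j
   by (rule deriv_bound[of "%y. FF2 j (q, y)" "%y. FF3 j (q, y)"]) (rule FF_props)+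
  thus ?thesis by (intro LIMSEQ_le_const2[OF tendsto_rabs[OF tendsto_diff[OF l(3) l(3)]]]) auto
 qed
qed

lemma ff_derivatives:
 assumes q: "0 <= q" "q <= 1"
 shows "DERIV (%y. ff (q, y)) y :> pp (q, y)"
  and "DERIV (%y. pp (q, y)) y :> rr (q, y)"
proof -
 note l = pointwise_limits[OF q]
 show "DERIV (%y. ff (q, y)) y :> pp (q, y)"
 proof (rule derivative_from_quadratic)
  fix h
  have "abs(FF j (q, y + h) - FF j (q, y) - h*FF1 j (q, y)) <= be*h^2" for j
   using FF_props by (intro taylor1_bound[of "%y. FF j (q, y)" "%y. FF1 j (q, y)" "%y. FF2 j (q, y)"]) (auto simp: abs_of_nonneg)
  thus "abs(ff (q, y + h) - ff (q, y) - h*pp (q, y)) <= be*h^2"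
   by (intro LIMSEQ_le_const2[where X = "%j. abs(FF j (q, y + h) - FF j (q, y) - h*FF1 j (q, y))"] tendsto_intros l) auto
 qed
 show "DERIV (%y. pp (q, y)) y :> rr (q, y)"
 proof (rule derivative_from_quadratic)
  fix h
  have "abs(FF1 j (q, y + h) - FF1 j (q, y) - h*FF2 j (q, y)) <= Cb*h^2" for j
   using FF_props by (intro taylor1_bound[of "%y. FF1 j (q, y)" "%y. FF2 j (q, y)" "%y. FF3 j (q, y)"]) auto
  thus "abs(pp (q, y + h) - pp (q, y) - h*rr (q, y)) <= Cb*h^2"
   by (intro LIMSEQ_le_const2[where X = "%j. abs(FF1 j (q, y + h) - FF1 j (q, y) - h*FF2 j (q, y))"] tendsto_intros l) auto
 qed
qed

lemma ff_terminal: "ff (1, y) = pterm be y"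
proof -
 have "idx N 1 = 0" for N by (simp add: idx_def)
 hence "(%j. FF j (1, y)) = (%j. pterm be y)" by (simp add: FF_def U_0)
 thus ?thesis using pointwise_limits(1)[of 1 y] LIMSEQ_unique[OF _ tendsto_const] by force
qed

text \<open>At q = 0 the index is N - 1, not N, so \<open>FF j (0, y)\<close> is one step short of
  the full scheme; that step is O(1/N).\<close>

lemma U_tendsto_ff: "(%j. U (2^j) (2^j) y) ----> ff (0, y)"
proof -
 have "(%j. U (2^j) (2^j) y - FF j (0, y)) ----> 0"
 proof (rule Lim_null_comparison)
  show "\<forall>\<^sub>F j in sequentially. norm (U (2^j) (2^j) y - FF j (0, y)) <= (be + C1)*(1/2)^j"
  proof (rule always_eventually, intro allI)
   fix j :: nat
   let ?N = "2^j :: nat"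
   have "Suc (?N - 1) = ?N" "?N - 1 <= ?N" "?N > 0" by auto
   hence "abs(U ?N ?N y - U ?N (?N - 1) y) <= (be + C1)/real ?N"
    using U_Suc_diff[of ?N "?N - 1" y] by simp
   thus "norm (U (2^j) (2^j) y - FF j (0, y)) <= (be + C1)*(1/2)^j"
    by (simp add: FF_def idx_def power_divide)
  qed
  have "(%j. (be + C1)*(1/2)^j) ----> (be + C1)*0" by (intro tendsto_intros LIMSEQ_realpow_zero) auto
  thus "(%j. (be + C1)*(1/2)^j) ----> 0" by simp
 qed
 from tendsto_add[OF this pointwise_limits(1)[of 0 y]] show ?thesis by simp
qed

end

section \<open>Test functions\<close>

lemma smoothD:
 assumes "smooth ph"
 shows "ph differentiable (at z)" "smooth (d_q ph)" "smooth (d_y ph)" "continuous_on UNIV ph"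
proof -
 have d: "ph differentiable_on UNIV" using assms by (cases rule: smooth.cases)
 thus "ph differentiable (at z)" unfolding differentiable_on_def by blast
 show "continuous_on UNIV ph" using d by (rule differentiable_imp_continuous_on)
 show "smooth (d_q ph)" "smooth (d_y ph)" using assms by (cases rule: smooth.cases; simp)+
qed

lemma partial_derivatives:
 assumes "ph differentiable (at (q, y))"
 shows "DERIV (%s. ph (s, y)) q :> d_q ph (q, y)"
  and "DERIV (%t. ph (q, t)) y :> d_y ph (q, y)"
proof -
 have "(%s. ph (s, y)) differentiable (at q)"
  using assms by (intro differentiable_compose[of ph "%s. (s, y)"]) auto
 thus "DERIV (%s. ph (s, y)) q :> d_q ph (q, y)"
  by (simp add: d_q_def DERIV_deriv_iff_real_differentiable)
 have "(%t. ph (q, t)) differentiable (at y)"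
  using assms by (intro differentiable_compose[of ph "%t. (q, t)"]) auto
 thus "DERIV (%t. ph (q, t)) y :> d_y ph (q, y)"
  by (simp add: d_y_def DERIV_deriv_iff_real_differentiable)
qed

lemma test_function_smooth: "test_function ph ==> smooth ph" by (simp add: test_function_def)

lemma test_function_d:
 assumes "test_function ph"
 shows "test_function (d_q ph)" "test_function (d_y ph)"
proof -
 obtain K where K: "compact K" "K <= {0<..<1} \<times> UNIV" "!!z. z ~: K ==> ph z = 0"
  using assms by (auto simp: test_function_def)
 have op: "open (- K)" using K(1) by (simp add: compact_imp_closed open_Compl)
 have "d_q ph z = 0 & d_y ph z = 0" if z: "z ~: K" for z
 proof -
  obtain q y where [simp]: "z = (q, y)" by (cases z)
  have "DERIV (%s. ph (s, y)) q :> 0"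
  proof (rule has_field_derivative_transform_within_open[of "%_. 0"])
   show "open ((%s. (s, y)) -` (- K))" by (rule open_vimage[OF op]) (intro continuous_intros)
  qed (use z K(3) in auto)
  moreover have "DERIV (%t. ph (q, t)) y :> 0"
  proof (rule has_field_derivative_transform_within_open[of "%_. 0"])
   show "open ((%t. (q, t)) -` (- K))" by (rule open_vimage[OF op]) (intro continuous_intros)
  qed (use z K(3) in auto)
  ultimately show ?thesis by (simp add: d_q_def d_y_def DERIV_imp_deriv)
 qed
 thus "test_function (d_q ph)" "test_function (d_y ph)"
  using K smoothD[OF test_function_smooth[OF assms]] unfolding test_function_def by blast+
qed

lemma test_function_box:
 assumes "test_function ph"
 obtains a b R B where "0 < a" "a < b" "b < 1" "R > 0" "!!q y. ph (q, y) ~= 0 ==> a < q & q < b & abs y < R"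
  "!!z. abs(ph z) <= B"
proof -
 obtain K where K: "compact K" "K <= {0<..<1} \<times> UNIV" "!!z. z ~: K ==> ph z = 0"
  using assms by (auto simp: test_function_def)
 have cont: "continuous_on UNIV ph" by (rule smoothD(4)[OF test_function_smooth[OF assms]])
 have "compact (ph ` K)" using K(1) cont by (intro compact_continuous_image continuous_on_subset[OF cont]) auto
 then obtain B where B: "!!z. z : K ==> abs(ph z) <= B"
  by (metis bounded_iff compact_imp_bounded image_eqI real_norm_def)
 have B': "abs(ph z) <= abs B" for z using B[of z] K(3)[of z] by (cases "z : K") auto
 show ?thesis
 proof (cases "K = {}")
  case True
  thus ?thesis using that[of "1/3" "2/3" 1 "abs B"] K(3) B' by auto
 next
  case False
  have cf: "compact (fst ` K)" "compact (snd ` K)" using K(1) by (auto intro!: compact_continuous_image continuous_intros)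
  obtain q0 where q0: "q0 : fst ` K" "!!q. q : fst ` K ==> q0 <= q"
   using compact_attains_inf[OF cf(1)] False by auto
  obtain q1 where q1: "q1 : fst ` K" "!!q. q : fst ` K ==> q <= q1"
   using compact_attains_sup[OF cf(1)] False by auto
  have q01: "0 < q0" "q1 < 1" "q0 <= q1" using q0 q1 K(2) by auto
  obtain R where R: "!!y. y : snd ` K ==> abs y <= R"
   using compact_imp_bounded[OF cf(2)] by (auto simp: bounded_iff)
  show ?thesis
  proof (rule that[of "q0/2" "(1 + q1)/2" "abs R + 1" "abs B"])
   fix q y assume "ph (q, y) ~= 0"
   hence "(q, y) : K" using K(3) by blast
   hence "q : fst ` K" "y : snd ` K" by force+
   thus "q0/2 < q & q < (1 + q1)/2 & abs y < abs R + 1"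
    using q0(2)[of q] q1(2)[of q] R[of y] q01 by auto
  qed (use q01 B' in auto)
 qed
qed

lemma test_function_measurable: "test_function ph ==> ph : borel_measurable borel"
 by (intro borel_measurable_continuous_onI smoothD(4) test_function_smooth)

lemma test_function_times_integrable:
 assumes ph: "test_function ph" and f: "f : borel_measurable borel"
  and B: "!!R. R > 0 ==> EX C. AE z in lborel. z : {0..1} \<times> {-R..R} --> abs(f z) <= C"
 shows "integrable lborel (%z. f z*ph z :: real)"
proof -
 obtain a b R Bd where b: "0 < a" "a < b" "b < 1" "R > 0" "!!q y. ph (q, y) ~= 0 ==> a < q & q < b & abs y < R"
  "!!z. abs(ph z) <= Bd" using test_function_box[OF ph] by blast
 obtain C where C: "AE z in lborel. z : {0..1} \<times> {-R..R} --> abs(f z) <= C" using B[OF b(4)] by blast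
 have eq: "{0..1::real} \<times> {-R..R} = cbox (0, -R) (1, R)" by (auto simp: cbox_Pair_iff cbox_interval)
 have em: "emeasure lborel ({0..1::real} \<times> {-R..R}) < \<infinity>"
  unfolding eq by (rule emeasure_lborel_cbox_finite)
 have Bd: "Bd >= 0" using b(6)[of undefined] by linarith
 show ?thesis
 proof (rule integrableI_bounded_set[where A = "{0..1} \<times> {-R..R}" and B = "C*Bd"])
  show "AE z in lborel. z : {0..1} \<times> {-R..R} --> norm (f z*ph z) <= C*Bd" using C
  proof eventually_elim
   case (elim z)
   show ?case
   proof
    assume "z : {0..1} \<times> {-R..R}"
    hence "abs(f z) <= C" using elim by blast
    thus "norm (f z*ph z) <= C*Bd" using b(6)[of z] by (auto simp: abs_mult intro!: mult_mono)
   qed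
  qed
  show "AE z in lborel. z ~: {0..1} \<times> {-R..R} --> f z*ph z = 0"
  proof (rule AE_I2)
   fix z :: "real \<times> real"
   obtain q y where [simp]: "z = (q, y)" by (cases z)
   show "z ~: {0..1} \<times> {-R..R} --> f z*ph z = 0"
    using b(5)[of q y] b(1-3) by (auto simp: abs_less_iff)
  qed
 qed (use f test_function_measurable[OF ph] em in \<open>auto simp: eq\<close>)
qed

section \<open>Fubini and integration by parts for compactly supported functions\<close>

lemma lborel_plane: "(lborel :: (real \<times> real) measure) = lborel \<Otimes>\<^sub>M lborel"
 by (rule lborel_prod[symmetric])

lemma integral_plane:
 fixes f :: "real \<times> real => real"
 assumes "integrable lborel f"
 shows "(LI z. f z) = (LI q. LI y. f (q, y))"
  and "(LI z. f z) = (LI y. LI q. f (q, y))"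
proof -
 have i: "integrable (lborel \<Otimes>\<^sub>M lborel) f" using assms by (simp add: lborel_prod)
 show "(LI z. f z) = (LI q. LI y. f (q, y))"
  using lborel_pair.integral_fst'[OF i] by (simp add: lborel_prod)
 thus "(LI z. f z) = (LI y. LI q. f (q, y))"
  using lborel_pair.Fubini_integral[of "%q y. f (q, y)"] i by simp
qed

lemma integral_derivative_compact_support:
 fixes h :: "real => real"
 assumes h: "!!y. (DERIV h y :> h' y)" and c: "continuous_on UNIV h'"
  and z: "!!y. abs y >= R ==> h y = 0"
 shows "(LI y. h' y) = 0"
proof -
 define R' where "R' = abs R + 1"
 have z': "h' y = 0" if "abs y > R'" for y
 proof -
  have "open {y. abs y > R'}" by (intro open_Collect_less continuous_intros)
  hence "DERIV h y :> 0"
   by (rule has_field_derivative_transform_within_open[OF DERIV_const[where k = 0]])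
     (use that z in \<open>auto simp: R'_def\<close>)
  thus ?thesis using DERIV_unique[OF h] by simp
 qed
 have "(%y. h' y) = (%y. h' y*indicator {-R'..R'} y)"
 proof
  fix y show "h' y = h' y*indicator {-R'..R'} y"
   using z'[of y] by (cases "abs y <= R'") (auto simp: indicator_def abs_le_iff)
 qed
 hence "(LI y. h' y) = (LI y. h' y*indicator {-R'..R'} y)" by metis
 also have "... = h R' - h (- R')"
  using c by (intro integral_FTC_Icc_real h) (auto simp: R'_def continuous_on_eq_continuous_at)
 also have "... = 0" using z[of R'] z[of "- R'"] by (auto simp: R'_def)
 finally show ?thesis .
qed

lemma integral_by_parts_compact_support:
 fixes u ph :: "real => real"
 assumes u: "!!y. (DERIV u y :> u' y)" "continuous_on UNIV u'"
  and ph: "!!y. (DERIV ph y :> ph' y)" "continuous_on UNIV ph'"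
  and z: "!!y. abs y >= R ==> ph y = 0" "!!y. abs y >= R ==> ph' y = 0"
 shows "(LI y. u y*ph' y) = - (LI y. u' y*ph y)"
proof -
 have cu: "continuous_on UNIV u" and cph: "continuous_on UNIV ph"
  using u(1) ph(1) by (auto intro!: continuous_at_imp_continuous_on DERIV_isCont)
 have int: "integrable lborel (%y. f y)" if "continuous_on UNIV f" "!!y. abs y >= R ==> f y = 0" for f :: "real => real"
 proof -
  have "integrable lborel (%y. indicator {-R..R} y *\<^sub>R f y)"
   using that(1) by (intro borel_integrable_compact) (auto intro: continuous_on_subset)
  moreover have "(%y. indicator {-R..R} y *\<^sub>R f y) = f"
  proof
   fix y show "indicator {-R..R} y *\<^sub>R f y = f y"
    using that(2)[of y] by (cases "abs y <= R") (auto simp: indicator_def abs_le_iff)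
  qed
  ultimately show ?thesis by simp
 qed
 have "(LI y. u' y*ph y + u y*ph' y) = 0"
 proof (rule integral_derivative_compact_support)
  show "DERIV (%y. u y*ph y) y :> u' y*ph y + u y*ph' y" for y
   by (auto intro!: derivative_eq_intros u ph)
 qed (use u(2) ph(2) cu cph z in \<open>auto intro!: continuous_intros\<close>)
 moreover have "integrable lborel (%y. u' y*ph y)" "integrable lborel (%y. u y*ph' y)"
  using u(2) ph(2) cu cph z by (auto intro!: int continuous_intros)
 ultimately show ?thesis by simp
qed

section \<open>Existence of weak solutions\<close>

locale right_continuous_order = order_parameter +
 assumes right_cont: "0 <= q ==> q < 1 ==> continuous (at_right q) x"
begin

definition gen :: "nat => nat => real => real"
 where "gen N i y = deriv (deriv (U N i)) y + grid N i*(deriv (U N i) y)^2"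

lemma gen_bounds:
 assumes N: "N > 0" and i: "i <= N"
 shows "0 <= gen N i y & gen N i y <= be"
 unfolding gen_def using U_props(5,7)[OF N i i N, of y] grid_bounds[OF i N] by auto

lemma idx_cell:
 assumes "N > 0" "i < N" "(real N - real (Suc i))/N <= s" "s < (real N - real i)/N"
 shows "idx N s = i"
proof -
 have 1: "real N - real (Suc i) <= s*N" "s*N < real N - real i"
  using assms by (simp_all add: divide_le_eq less_divide_eq)
 have "\<lfloor>s*N\<rfloor> = int (N - 1 - i)" using 1 assms(2) by (intro floor_unique) (auto simp: of_nat_diff)
 thus ?thesis using assms(2) unfolding idx_def by simp
qed

text \<open>Writes the accumulated generator as the integral of a step function in time, on which
  dominated convergence can act. Cells are closed on the left, hence the interval without 1.\<close>

lemma gen_integral: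
 assumes N: "N > 0" and i: "i <= N"
 shows "has_bochner_integral lborel (%s. indicator {(real N - real i)/N..<1} s*gen N (idx N s) y) ((SUM l<i. gen N l y)/N)"
 using i
proof (induction i)
 case 0
 have "(%s. indicator {(real N - real 0)/N..<1} s*gen N (idx N s) y) = (%s. 0)" using N by auto
 thus ?case using has_bochner_integral_zero by simp
next
 case (Suc i)
 let ?a' = "(real N - real (Suc i))/N" and ?a = "(real N - real i)/N"
 have a: "?a' <= ?a" "?a <= 1" using N Suc.prems by (auto simp: divide_right_mono)
 have h1: "has_bochner_integral lborel (%s. gen N i y*indicator {?a'..<?a} s) (gen N i y*(?a - ?a'))"
  using a by (intro has_bochner_integral_mult_right has_bochner_integral_real_indicator[THEN has_bochner_integral_cong[THEN iffD1, rotated -1]]) auto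
 have da: "?a - ?a' = 1/N" by (simp add: diff_divide_distrib[symmetric])
 have eq: "(%s. indicator {?a'..<1} s*gen N (idx N s) y)
   = (%s. gen N i y*indicator {?a'..<?a} s + indicator {?a..<1} s*gen N (idx N s) y)"
 proof
  fix s
  show "indicator {?a'..<1} s*gen N (idx N s) y = gen N i y*indicator {?a'..<?a} s + indicator {?a..<1} s*gen N (idx N s) y"
  proof (cases "s < ?a")
   case True
   hence "s < 1" using a(2) by linarith
   thus ?thesis using True idx_cell[OF N, of i s] Suc.prems by (auto simp: indicator_def)
  next
   case False
   thus ?thesis using a(1) by (auto simp: indicator_def)
  qed
 qed
 have h2: "has_bochner_integral lborel (%s. indicator {?a..<1} s*gen N (idx N s) y) ((SUM l<i. gen N l y)/N)"
  using Suc by simp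
 have val: "gen N i y*(?a - ?a') + (SUM l<i. gen N l y)/N = (SUM l<Suc i. gen N l y)/N"
  unfolding da by (simp add: add_divide_distrib)
 show ?case unfolding eq val[symmetric] by (rule has_bochner_integral_add[OF h1 h2])
qed

lemma U_telescope:
 assumes N: "N > 0" and i: "i <= N"
 shows "abs(U N i y - pterm be y - (SUM l<i. gen N l y)/N/2) <= i*(C1*(1/sqrt N)^3)" using i
proof (induction i)
 case (Suc i)
 have "abs(U N (Suc i) y - U N i y - gen N i y/N/2) <= C1*(1/sqrt N)^3"
  using U_Suc_expansion[OF N, of i y] Suc.prems by (simp add: gen_def mult.commute)
 moreover have "abs(U N i y - pterm be y - (SUM l<i. gen N l y)/N/2) <= i*(C1*(1/sqrt N)^3)"
  using Suc by simp
 moreover have "(SUM l<Suc i. gen N l y)/N/2 = (SUM l<i. gen N l y)/N/2 + gen N i y/N/2"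
  by (simp add: add_divide_distrib)
 moreover have "Suc i*(C1*(1/sqrt N)^3) = i*(C1*(1/sqrt N)^3) + C1*(1/sqrt N)^3"
  by (simp add: distrib_right)
 moreover have "abs(A - P - (S + g)) <= f + e" if "abs(A - B - g) <= e" "abs(B - P - S) <= f" for A B P S g e f :: real
  using that by linarith
 ultimately show ?case by (simp only:)
qed (simp add: U_0)

definition xx :: "real => real"
 where "xx q = (if q : {0..1} then x q else 0)"

lemma xx_measurable [measurable]: "xx : borel_measurable borel"
proof -
 have "mono_on {0..1} x" by (auto intro!: mono_onI x_mono)
 from borel_measurable_mono_on_fnc[OF this]
 have "(%q. indicator {0..1} q *\<^sub>R x q) : borel_measurable borel"
  by (subst (asm) borel_measurable_restrict_space_iff) auto
 moreover have "xx = (%q. indicator {0..1} q *\<^sub>R x q)" by (auto simp: xx_def indicator_def fun_eq_iff)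
 ultimately show ?thesis by simp
qed

lemma U_continuous:
 assumes "N > 0" "i <= N"
 shows "continuous_on UNIV (U N i)" "continuous_on UNIV (deriv (U N i))" "continuous_on UNIV (deriv (deriv (U N i)))"
 using U_props(1-3)[OF assms assms(2,1)]
 by (auto intro!: continuous_at_imp_continuous_on DERIV_isCont)

lemma FF_measurable [measurable]:
 "FF j : borel_measurable borel" "FF1 j : borel_measurable borel" "FF2 j : borel_measurable borel"
proof -
 have *: "(%z::real \<times> real. f (idx (2^j) (fst z)) (snd z)) : borel_measurable borel"
  if "!!i. i <= 2^j ==> continuous_on UNIV (f i)" for f :: "nat => real => real"
 proof -
  have "(%z::real \<times> real. (if idx (2^j) (fst z) <= 2^j then f (idx (2^j) (fst z)) (snd z) else 0)) : borel_measurable borel"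
  proof (rule measurable_compose_countable[where f = "%i z. if i <= 2^j then f i (snd z) else 0"])
   fix i :: nat
   show "(%z::real \<times> real. if i <= 2^j then f i (snd z) else 0) : borel_measurable borel"
   proof (cases "i <= 2^j")
    case True
    hence "continuous_on UNIV (%z::real \<times> real. f i (snd z))"
     by (intro continuous_on_compose2[OF that] continuous_intros) auto
    thus ?thesis using True by (auto intro: borel_measurable_continuous_onI)
   qed simp
  next
   have "(%q::real. idx (2^j) q) : borel \<rightarrow>\<^sub>M count_space UNIV" unfolding idx_def by measurable
   thus "(%z::real \<times> real. idx (2^j) (fst z)) : borel \<rightarrow>\<^sub>M count_space UNIV"
    by (rule measurable_compose[rotated]) (intro borel_measurable_continuous_onI continuous_intros)
  qed
  thus ?thesis by (simp add: idx_le)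
 qed
 show "FF j : borel_measurable borel" "FF1 j : borel_measurable borel" "FF2 j : borel_measurable borel"
  unfolding FF_defs case_prod_beta by (intro * U_continuous; simp)+
qed

lemma ff_measurable [measurable]:
 "ff : borel_measurable borel" "pp : borel_measurable borel" "rr : borel_measurable borel"
 unfolding ff_def[abs_def] pp_def[abs_def] rr_def[abs_def] by measurable

definition GG :: "real => real => real"
 where "GG y s = rr (s, y) + xx s*(pp (s, y))^2"

lemma GG_measurable [measurable]: "GG y : borel_measurable borel"
proof -
 have "(%s. (s, y)) : borel \<rightarrow>\<^sub>M (borel :: (real \<times> real) measure)"
  by (intro borel_measurable_continuous_onI continuous_intros)
 thus ?thesis unfolding GG_def[abs_def] by measurable
qed

lemma xx_bounds: "0 <= xx q" "xx q <= be" using x_range[of q] be by (auto simp: xx_def)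

lemma GG_bounds: "0 <= s ==> s <= 1 ==> 0 <= GG y s & GG y s <= 2*be"
proof -
 assume s: "0 <= s" "s <= 1"
 have "(pp (s, y))^2 <= 1" using ff_bounds(1)[OF s, of y] by (simp add: abs_square_le_1)
 hence "xx s*(pp (s, y))^2 <= be*1" using xx_bounds[of s] be by (intro mult_mono) auto
 thus ?thesis using ff_bounds(2,3)[OF s, of y] xx_bounds[of s] by (auto simp: GG_def)
qed

lemma idx_right_end:
 assumes q: "0 <= q" "q < 1" and N: "N > 0"
 shows "q < (real N - real (idx N q))/N" "(real N - real (idx N q))/N <= q + 1/N" "(real N - real (idx N q))/N <= 1"
proof -
 define k where "k = nat \<lfloor>q*N\<rfloor>"
 have "real k = of_int \<lfloor>q*N\<rfloor>" unfolding k_def using q by simp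
 hence k: "real k <= q*N" "q*N < real k + 1" by linarith+
 have "q*N < 1*real N" using q N by (intro mult_strict_right_mono) auto
 hence "k < N" using k by linarith
 hence e: "real N - real (idx N q) = real k + 1" unfolding idx_def k_def[symmetric] by (simp add: of_nat_diff)
 show "q < (real N - real (idx N q))/N" unfolding e using k N by (simp add: less_divide_eq)
 show "(real N - real (idx N q))/N <= q + 1/N" unfolding e using k N by (simp add: divide_le_eq field_simps)
 show "(real N - real (idx N q))/N <= 1" using N by simp
qed

lemma tendsto_right_end:
 assumes q: "0 <= q" "q < 1"
 shows "(%j. (real (2^j) - real (idx (2^j) q))/real (2^j)) ----> q"
proof (rule tendsto_sandwich[of "%_. q"])
 have "(%j. q + 1/2^j) ----> q + 0" by (intro tendsto_intros LIMSEQ_divide_realpow_zero) auto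
 thus "(%j. q + 1/real (2^j)) ----> q" by simp
 show "\<forall>\<^sub>F j in sequentially. q <= (real (2^j) - real (idx (2^j) q))/real (2^j)"
  by (intro always_eventually allI, rule less_imp_le[OF idx_right_end(1)[OF q]]) simp
 show "\<forall>\<^sub>F j in sequentially. (real (2^j) - real (idx (2^j) q))/real (2^j) <= q + 1/real (2^j)"
  by (intro always_eventually allI, rule idx_right_end(2)[OF q]) simp
qed simp

text \<open>The right ends of the cells of s converge to s strictly from the right; this is where
  right continuity of x enters.\<close>

lemma gen_tendsto:
 assumes s: "0 <= s" "s < 1"
 shows "(%j. gen (2^j) (idx (2^j) s) y) ----> GG y s"
proof -
 have "filterlim (%j. (real (2^j) - real (idx (2^j) s))/real (2^j)) (at_right s) sequentially"
  proof (intro filterlim_at_withinI)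
  show "\<forall>\<^sub>F j in sequentially. (real (2^j) - real (idx (2^j) s))/real (2^j) : {s<..} - {s}"
  proof (intro always_eventually allI)
   fix j :: nat
   have "s < (real (2^j) - real (idx (2^j) s))/real (2^j)" by (rule idx_right_end(1)[OF s]) simp
   thus "(real (2^j) - real (idx (2^j) s))/real (2^j) : {s<..} - {s}" by simp
  qed
 qed (rule tendsto_right_end[OF s])
 hence "(%j. x ((real (2^j) - real (idx (2^j) s))/real (2^j))) ----> x s"
  using right_cont[OF s] unfolding continuous_within by (rule filterlim_compose[rotated])
 hence "(%j. grid (2^j) (idx (2^j) s)) ----> xx s" using s by (simp add: grid_def xx_def)
 hence "(%j. FF2 j (s, y) + grid (2^j) (idx (2^j) s)*(FF1 j (s, y))^2) ----> GG y s"
  unfolding GG_def using s by (intro tendsto_intros pointwise_limits) auto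
 thus ?thesis by (simp add: FF1_def FF2_def gen_def)
qed

text \<open>The Euler steps telescope: at most N errors of order N^(-3/2) vanish in the limit, and
  the generators converge boundedly to \<open>GG\<close>. The case q = 1 is separate because the
  right end of the cell lies beyond q only for q < 1.\<close>

lemma ff_integral_equation:
 assumes q: "0 <= q" "q <= 1"
 shows "ff (q, y) = pterm be y + (LI s. indicator {q..1} s*GG y s)/2"
proof (cases "q = 1")
 case True
 have "AE s in lborel. indicator {1..1} s*GG y s = 0"
  using AE_lborel_singleton[of "1::real"] by eventually_elim auto
 hence "(LI s. indicator {1..1} s*GG y s) = 0" by (subst integral_cong_AE[where g = "%_. 0"]) auto
 thus ?thesis using True ff_terminal by simp
next
 case False
 hence q1: "q < 1" using q by simp
 let ?N = "%j. 2^j :: nat"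
 let ?a = "%j. (real (?N j) - real (idx (?N j) q))/real (?N j)"
 let ?s = "%j s. indicator {?a j..<1} s*gen (?N j) (idx (?N j) s) y"
 have I: "has_bochner_integral lborel (?s j) ((SUM l<idx (?N j) q. gen (?N j) l y)/?N j)" for j
  by (rule gen_integral[OF _ idx_le]) simp
 have 1: "(%j. LI s. ?s j s) ----> (LI s. indicator {q..1} s*GG y s)"
 proof (rule integral_dominated_convergence[where w = "%s. 2*be*indicator {0..1} s"])
  show "(%s. indicator {q..1} s*GG y s) : borel_measurable lborel" by measurable
  show "?s j : borel_measurable lborel" for j using I[of j] by (auto simp: has_bochner_integral_iff)
  show "integrable lborel (%s. 2*be*indicator {0..1::real} s)" by simp
  show "AE s in lborel. norm (?s j s) <= 2*be*indicator {0..1} s" for j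
  proof (rule AE_I2)
   fix s :: real
   have "q < ?a j" using idx_right_end(1)[OF q(1) q1, of "?N j"] by simp
   thus "norm (?s j s) <= 2*be*indicator {0..1} s"
    using gen_bounds[of "?N j" "idx (?N j) s" y] idx_le[of "?N j" s] q be by (auto simp: indicator_def)
  qed
  show "AE s in lborel. (%j. ?s j s) ----> indicator {q..1} s*GG y s"
   using AE_lborel_singleton[of q] AE_lborel_singleton[of "1::real"]
  proof eventually_elim
   case (elim s)
   show ?case
   proof (cases "q < s & s < 1")
    case True
    have "\<forall>\<^sub>F j in sequentially. ?a j < s"
     using order_tendstoD(2)[OF tendsto_right_end[OF q(1) q1]] True by blast
    hence "\<forall>\<^sub>F j in sequentially. gen (?N j) (idx (?N j) s) y = ?s j s"
     by eventually_elim (use True in \<open>auto simp: indicator_def\<close>)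
    moreover have "(%j. gen (?N j) (idx (?N j) s) y) ----> GG y s"
     using True q by (intro gen_tendsto) auto
    ultimately have "(%j. ?s j s) ----> GG y s" by (rule Lim_transform_eventually[rotated])
    thus ?thesis using True by (simp add: indicator_def)
   next
    case False
    have "?s j s = 0" for j
    proof -
     have "q < ?a j" using idx_right_end(1)[OF q(1) q1, of "?N j"] by simp
     thus ?thesis using False elim by (auto simp: indicator_def)
    qed
    moreover have "indicator {q..1} s*GG y s = 0" using False elim by (auto simp: indicator_def)
    ultimately show ?thesis by (simp only: tendsto_const)
   qed
  qed
 qed
 have "(%j. FF j (q, y) - pterm be y - (LI s. ?s j s)/2) ----> 0"
 proof (rule Lim_null_comparison)
  show "\<forall>\<^sub>F j in sequentially. norm (FF j (q, y) - pterm be y - (LI s. ?s j s)/2) <= C1*(1/sqrt 2)^j"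
  proof (rule always_eventually, intro allI)
   fix j :: nat
   have "abs(FF j (q, y) - pterm be y - (LI s. ?s j s)/2) <= idx (?N j) q*(C1*(1/sqrt (?N j))^3)"
    using U_telescope[of "?N j" "idx (?N j) q" y] idx_le[of "?N j" q] has_bochner_integral_integral_eq[OF I[of j]]
    by (simp add: FF_def)
   also have "... <= ?N j*(C1*(1/sqrt (?N j))^3)"
    using idx_le[of "?N j" q] C1_nonneg by (intro mult_right_mono) (auto simp flip: of_nat_power)
   also have "... = C1*(?N j*(1/sqrt (?N j))^2)*(1/sqrt (?N j))"
    by (simp add: power2_eq_square power3_eq_cube)
   also have "?N j*(1/sqrt (?N j))^2 = 1" by (simp add: power_divide)
   finally show "norm (FF j (q, y) - pterm be y - (LI s. ?s j s)/2) <= C1*(1/sqrt 2)^j"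
    by (simp add: sqrt_pow2 power_divide)
  qed
  have "(%j. C1*(1/sqrt 2)^j) ----> C1*0" by (intro tendsto_intros LIMSEQ_realpow_zero) auto
  thus "(%j. C1*(1/sqrt 2)^j) ----> 0" by simp
 qed
 moreover have "(%j. FF j (q, y) - pterm be y - (LI s. ?s j s)/2)
   ----> ff (q, y) - pterm be y - (LI s. indicator {q..1} s*GG y s)/2"
  by (intro tendsto_intros 1 pointwise_limits q) auto
 ultimately have "ff (q, y) - pterm be y - (LI s. indicator {q..1} s*GG y s)/2 = 0"
  using LIMSEQ_unique by blast
 thus ?thesis by simp
qed

lemma ff_lipschitz_time:
 assumes "0 <= q" "q <= q'" "q' <= 1"
 shows "abs(ff (q, y) - ff (q', y)) <= be*(q' - q)"
proof -
 let ?f = "%q s. indicator {q..1} s*GG y s"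
 have int: "integrable lborel (?f q)" if "0 <= q" for q
 proof (rule integrableI_bounded_set[where A = "{0..1}" and B = "2*be"])
  show "AE s in lborel. s : {0..1} --> norm (?f q s) <= 2*be"
   using GG_bounds[of _ y] be by (intro AE_I2) (auto simp: indicator_def)
  show "AE s in lborel. s ~: {0..1} --> ?f q s = 0"
   using that by (intro AE_I2) (auto simp: indicator_def)
 qed auto
 have "ff (q, y) - ff (q', y) = (LI s. ?f q s - ?f q' s)/2"
  using assms by (subst (1 2) ff_integral_equation) (auto simp: int diff_divide_distrib)
 moreover have "norm (LI s. ?f q s - ?f q' s) <= (LI s. 2*be*indicator {q..q'} s)"
 proof (rule order.trans[OF integral_norm_bound integral_mono])
  show "norm (?f q s - ?f q' s) <= 2*be*indicator {q..q'} s" for s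
   using GG_bounds[of s y] assms by (auto simp: indicator_def)
 qed (use assms in \<open>auto intro!: integrable_abs Bochner_Integration.integrable_diff int\<close>)
 moreover have "(LI s. 2*be*indicator {q..q'} s) = 2*be*(q' - q)" using assms by simp
 moreover have "abs(I/2) <= be*(q' - q)" if "norm I <= 2*be*(q' - q)" for I :: real
  using that by (simp add: abs_le_iff)
 ultimately show ?thesis by (simp only:)
qed

lemma ff_lipschitz_space:
 assumes "0 <= q" "q <= 1"
 shows "abs(ff (q, y) - ff (q, y')) <= abs(y - y')"
 using deriv_bound[of "%y. ff (q, y)", OF ff_derivatives(1)[OF assms] ff_bounds(1)[OF assms]] by simp

lemma ff_lipschitz:
 assumes "0 <= q" "q <= 1" "0 <= q'" "q' <= 1"
 shows "abs(ff (q, y) - ff (q', y')) <= be*abs(q - q') + abs(y - y')"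
proof -
 have "abs(ff (q, y) - ff (q', y)) <= be*abs(q - q')"
  using ff_lipschitz_time[of q q' y] ff_lipschitz_time[of q' q y] assms by (cases "q <= q'") (auto simp: abs_minus_commute)
 thus ?thesis using ff_lipschitz_space[of q' y y'] assms by linarith
qed

lemma ff_continuous_on: "continuous_on strip ff"
proof (rule lipschitz_on_continuous_on[of "be + 1"])
 show "(be + 1)-lipschitz_on strip ff"
 proof (rule lipschitz_onI)
  fix z z' :: "real \<times> real" assume z: "z : strip" "z' : strip"
  have "abs(ff z - ff z') <= be*abs(fst z - fst z') + abs(snd z - snd z')"
   using ff_lipschitz[of "fst z" "fst z'" "snd z" "snd z'"] z by auto
  also have "... <= be*dist z z' + dist z z'"
   using dist_fst_le[of z z'] dist_snd_le[of z z'] be by (intro add_mono mult_left_mono) (auto simp: dist_real_def)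
  finally show "dist (ff z) (ff z') <= (be + 1)*dist z z'" by (simp add: dist_real_def algebra_simps)
 qed (use be in auto)
qed

text \<open>In time, \<open>ff\<close> is known only through an integral of a bounded measurable
  function; exchanging the two time integrations replaces the product rule.\<close>

lemma time_integration_by_parts:
 assumes ph: "!!s. (DERIV ph s :> ph' s)" "continuous_on UNIV ph'"
  and z: "!!s. s <= 0 | s >= 1 ==> ph s = 0" "!!s. s <= 0 | s >= 1 ==> ph' s = 0"
 shows "(LI s. ff (s, y)*ph' s) = (LI s. GG y s*ph s)/2"
proof -
 let ?G = "%t. indicator {0..1} t*GG y t"
 let ?f = "%s t. (indicator {0..1} s*ph' s)*(indicator {0..} (t - s)*?G t)"
 have [measurable]: "ph' : borel_measurable borel" using ph(2) by (rule borel_measurable_continuous_onI)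
 obtain B where B: "!!s. s : {0..1} ==> abs(ph' s) <= B"
  using compact_continuous_image[OF continuous_on_subset[OF ph(2)], of "{0..1}"] compact_imp_bounded
  by (fastforce simp: bounded_iff)
 have B0: "B >= 0" using B[of 0] by auto
 have int: "integrable (lborel \<Otimes>\<^sub>M lborel) (%(s, t). ?f s t)"
 proof (rule integrableI_bounded_set[where A = "{0..1} \<times> {0..1}" and B = "B*(2*be)"])
  show "emeasure (lborel \<Otimes>\<^sub>M lborel) ({0..1::real} \<times> {0..1::real}) < \<infinity>"
   by (simp add: lborel.emeasure_pair_measure_Times)
  show "AE z in lborel \<Otimes>\<^sub>M lborel. z : {0..1} \<times> {0..1} --> norm (case z of (s, t) => ?f s t) <= B*(2*be)"
  proof (intro AE_I2 impI)
   fix z :: "real \<times> real" assume "z : {0..1} \<times> {0..1}"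
   then obtain s t where [simp]: "z = (s, t)" and st: "s : {0..1}" "t : {0..1}" by auto
   have "abs(indicator {0..1} s*ph' s)*abs(indicator {0..} (t - s)*?G t) <= B*(2*be)"
    using B[OF st(1)] GG_bounds[of t y] st be B0 by (intro mult_mono) (auto simp: indicator_def)
   thus "norm (case z of (s, t) => ?f s t) <= B*(2*be)" by (simp add: abs_mult)
  qed
  show "AE z in lborel \<Otimes>\<^sub>M lborel. z ~: {0..1} \<times> {0..1} --> (case z of (s, t) => ?f s t) = 0"
   by (intro AE_I2) (auto simp: indicator_def)
  show "{0..1::real} \<times> {0..1::real} : sets (lborel \<Otimes>\<^sub>M lborel)" by (intro pair_measureI) auto
 qed measurable
 have c: "(LI s. pterm be y*ph' s) = 0"
  using integral_derivative_compact_support[OF ph, of 1] z by (auto simp: abs_le_iff abs_if split: if_splits)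
 have l: "ff (s, y)*ph' s = pterm be y*ph' s + (LI t. ?f s t)/2" for s
 proof (cases "0 <= s & s <= 1")
  case True
  have "(LI t. ?f s t) = (LI t. ph' s*(indicator {s..1} t*GG y t))"
   using True by (intro Bochner_Integration.integral_cong) (auto simp: indicator_def)
  also have "... = ph' s*(LI t. indicator {s..1} t*GG y t)" by simp
  finally show ?thesis using True by (subst ff_integral_equation) (auto simp: algebra_simps)
 next
  case False
  hence "ph' s = 0" using z(2)[of s] by auto
  thus ?thesis by simp
 qed
 have "integrable lborel (%s. pterm be y*ph' s)"
 proof (rule integrable_mult_right)
  have "integrable lborel (%s. indicator {0..1} s *\<^sub>R ph' s)"
   using ph(2) by (intro borel_integrable_compact) (auto intro: continuous_on_subset)
  moreover have "(%s. indicator {0..1} s *\<^sub>R ph' s) = ph'"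
  proof
   fix s show "indicator {0..1} s *\<^sub>R ph' s = ph' s" using z(2)[of s] by (cases "s <= 0 | s >= 1") (auto simp: indicator_def)
  qed
  ultimately show "integrable lborel ph'" by simp
 qed
 moreover have "integrable lborel (%s. LI t. ?f s t)"
  using lborel_pair.integrable_fst'[OF int] by simp
 ultimately have "(LI s. ff (s, y)*ph' s) = (LI s. LI t. ?f s t)/2" unfolding l using c by simp
 also have "(LI s. LI t. ?f s t) = (LI t. LI s. ?f s t)"
  using lborel_pair.Fubini_integral[OF int] by simp
 also have "... = (LI t. GG y t*ph t)"
 proof (intro Bochner_Integration.integral_cong refl)
  fix t :: real
  show "(LI s. ?f s t) = GG y t*ph t"
  proof (cases "0 <= t & t <= 1")
   case True
   have "(LI s. ?f s t) = (LI s. GG y t*(ph' s*indicator {0..t} s))"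
    using True by (intro Bochner_Integration.integral_cong) (auto simp: indicator_def)
   also have "... = GG y t*(LI s. ph' s*indicator {0..t} s)" by simp
   also have "(LI s. ph' s*indicator {0..t} s) = ph t - ph 0"
    using True ph by (intro integral_FTC_Icc_real) (auto simp: continuous_on_eq_continuous_at)
   finally show ?thesis using z(1)[of 0] by simp
  next
   case False
   hence "ph t = 0" "(%s. ?f s t) = (%s. 0)" using z(1)[of t] by auto
   thus ?thesis by simp
  qed
 qed
 finally show ?thesis .
qed

text \<open>The weak derivative is \<open>pp\<close> cut to the strip. Two integrations by parts on
  each time slice turn the second y-derivative of the test function into \<open>rr\<close>, and the
  integral equation in time supplies the rest.\<close>

theorem parisi_weak_solution_ff: "parisi_weak_solution be x ff"
proof -
 define g where "g z = (if z : strip then pp z else 0)" for z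
 define r where "r z = (if z : strip then rr z else 0)" for z
 have strip_set [measurable]: "strip : sets borel" by (intro borel_closed closed_Times) auto
 have [measurable]: "g : borel_measurable borel" "r : borel_measurable borel"
  unfolding g_def[abs_def] r_def[abs_def] by measurable
 have xf [measurable]: "(%z::real \<times> real. xx (fst z)) : borel_measurable borel"
 proof -
  have "(%z::real \<times> real. fst z) : borel_measurable borel" by (intro borel_measurable_continuous_onI continuous_intros)
  from measurable_compose[OF this xx_measurable] show ?thesis .
 qed
 have g1: "abs(g z) <= 1" for z using ff_bounds(1)[of "fst z" "snd z"] by (cases z) (auto simp: g_def)
 have r1: "abs(r z) <= be" for z using ff_bounds(2,3)[of "fst z" "snd z"] be by (cases z) (auto simp: r_def)
 have ffB: "EX C. AE z in lborel. z : {0..1} \<times> {-R..R} --> abs(ff z) <= C" for R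
 proof (intro exI[of _ "abs(ff (0, 0)) + be + R"] AE_I2 impI)
  fix z :: "real \<times> real" assume "z : {0..1} \<times> {-R..R}"
  then obtain q y where [simp]: "z = (q, y)" and q: "0 <= q" "q <= 1" "abs y <= R" by auto
  have "be*q <= be" using q be by simp
  thus "abs(ff z) <= abs(ff (0, 0)) + be + R" using ff_lipschitz[of q 0 y 0] q by auto
 qed
 have iff: "integrable lborel (%z. ff z*ph z)" if "test_function ph" for ph
  by (rule test_function_times_integrable[OF that _ ffB]) measurable
 have ib: "integrable lborel (%z. h z*ph z)" if "test_function ph" "h : borel_measurable borel" "!!z. abs(h z) <= B" for ph h B
  using that by (intro test_function_times_integrable[OF that(1,2)] exI[of _ B] AE_I2) auto
 have partial: "continuous_on UNIV (%y. ph (q, y))" "continuous_on UNIV (%q. ph (q, y))" if "test_function ph" for ph q y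
  using smoothD(4)[OF test_function_smooth[OF that]]
  by (auto intro!: continuous_on_compose2[of UNIV ph] continuous_intros)
 have sD: "DERIV (%s. ph (s, y)) q :> d_q ph (q, y)"
  "DERIV (%t. ph (q, t)) y :> d_y ph (q, y)" if "test_function ph" for ph q y
  by (rule partial_derivatives[OF smoothD(1)[OF test_function_smooth[OF that]]])+
 have zero_out: "ph (q, y) = 0" if tf: "test_function ph" "q <= 0 | q >= 1" for ph q y
 proof -
  obtain a b R B where ab: "0 < a" "a < b" "b < 1" "R > 0" "!!q y. ph (q, y) ~= 0 ==> a < q & q < b & abs y < R" "!!z. abs(ph z) <= B"
   using test_function_box[OF tf(1)] by blast
  show ?thesis using ab(5)[of q y] ab(1-3) tf(2) by force
 qed
 have zero_far: "EX R. ALL q y. abs y >= R --> ph (q, y) = 0" if tf: "test_function ph" for ph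
 proof -
  obtain a b R B where "0 < a" "a < b" "b < 1" "R > 0" "!!q y. ph (q, y) ~= 0 ==> a < q & q < b & abs y < R" "!!z. abs(ph z) <= B"
   using test_function_box[OF tf] by blast
  thus ?thesis by (meson not_le)
 qed
 have slice: "(LI y. u (q, y)*d_y ph (q, y)) = - (LI y. u' (q, y)*ph (q, y))"
  if ph: "test_function ph" and u: "!!y. (DERIV (%y. u (q, y)) y :> u' (q, y))" "continuous_on UNIV (%y. u' (q, y))" for ph u u' q
 proof -
  obtain R R' where "!!q y. abs y >= R ==> ph (q, y) = 0" "!!q y. abs y >= R' ==> d_y ph (q, y) = 0"
   using zero_far[OF ph] zero_far[OF test_function_d(2)[OF ph]] by metis
  thus ?thesis using sD[OF ph] partial[OF test_function_d(2)[OF ph]] u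
   by (intro integral_by_parts_compact_support[where R = "max R R'"]) auto
 qed
 have cont_pp: "continuous_on UNIV (%y. pp (q, y))" if "0 <= q" "q <= 1" for q
  using ff_derivatives(2)[OF that] by (auto intro!: continuous_at_imp_continuous_on DERIV_isCont)
 have cont_rr: "continuous_on UNIV (%y. rr (q, y))" if "0 <= q" "q <= 1" for q
  using ff_bounds(4)[OF that]
  by (intro lipschitz_on_continuous_on[of Cb] lipschitz_onI) (auto simp: dist_real_def Cb_nonneg)
 have wd1: "(LI z. ff z*d_y ph z) = - (LI z. g z*ph z)" if ph: "test_function ph" for ph
 proof -
  have "(LI y. ff (q, y)*d_y ph (q, y)) = - (LI y. g (q, y)*ph (q, y))" for q
  proof (cases "0 <= q & q <= 1")
   case True
   thus ?thesis using slice[OF ph, of ff q pp] ff_derivatives(1) cont_pp by (simp add: g_def)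
  next
   case False
   hence "q <= 0 | q >= 1" by auto
   hence "ph (q, y) = 0" "d_y ph (q, y) = 0" for y
    using zero_out[OF ph] zero_out[OF test_function_d(2)[OF ph]] by blast+
   thus ?thesis by simp
  qed
  thus ?thesis
   using integral_plane(1)[OF iff[OF test_function_d(2)[OF ph]]] integral_plane(1)[OF ib[OF ph _ g1]] by simp
 qed
 have wd2: "(LI z. g z*d_y ph z) = - (LI z. r z*ph z)" if ph: "test_function ph" for ph
 proof -
  have "(LI y. g (q, y)*d_y ph (q, y)) = - (LI y. r (q, y)*ph (q, y))" for q
  proof (cases "0 <= q & q <= 1")
   case True
   thus ?thesis using slice[OF ph, of pp q rr] ff_derivatives(2) cont_rr by (simp add: g_def r_def)
  next
   case False
   hence "q <= 0 | q >= 1" by auto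
   hence "ph (q, y) = 0" "d_y ph (q, y) = 0" for y
    using zero_out[OF ph] zero_out[OF test_function_d(2)[OF ph]] by blast+
   thus ?thesis by simp
  qed
  thus ?thesis
   using integral_plane(1)[OF ib[OF test_function_d(2)[OF ph] _ g1]] integral_plane(1)[OF ib[OF ph _ r1]] by simp
 qed
 have xg: "abs(xx (fst z)*(g z)^2) <= be*1" for z
  unfolding abs_mult using xx_bounds[of "fst z"] g1[of z] be by (intro mult_mono) (auto simp: abs_square_le_1)
 have xg_int: "integrable lborel (%z. xx (fst z)*(g z)^2*ph z)" if "test_function ph" for ph
  by (rule ib[OF that _ xg]) measurable
 have main: "(LI z. - ff z*d_q ph z + 1/2*ff z*d_y (d_y ph) z + 1/2*x (fst z)*(g z)^2*ph z) = 0"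
  if ph: "test_function ph" for ph
 proof -
  note dq = test_function_d(1)[OF ph] and dy = test_function_d(2)[OF ph]
  note dyy = test_function_d(2)[OF dy]
  have "(LI z. ff z*d_q ph z) = (LI y. LI q. ff (q, y)*d_q ph (q, y))"
   by (rule integral_plane(2)[OF iff[OF dq]])
  also have "... = (LI y. (LI q. (r (q, y) + xx q*(g (q, y))^2)*ph (q, y))/2)"
  proof (intro Bochner_Integration.integral_cong refl)
   fix y :: real
   have "(LI q. ff (q, y)*d_q ph (q, y)) = (LI q. GG y q*ph (q, y))/2"
    using sD(1)[OF ph] partial(2)[OF dq] zero_out[OF ph] zero_out[OF dq] by (intro time_integration_by_parts) auto
   also have "(LI q. GG y q*ph (q, y)) = (LI q. (r (q, y) + xx q*(g (q, y))^2)*ph (q, y))"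
   proof (intro Bochner_Integration.integral_cong refl)
    fix q :: real
    show "GG y q*ph (q, y) = (r (q, y) + xx q*(g (q, y))^2)*ph (q, y)"
     using zero_out[OF ph, of q y] by (cases "0 <= q & q <= 1") (auto simp: GG_def r_def g_def)
   qed
   finally show "(LI q. ff (q, y)*d_q ph (q, y)) = (LI q. (r (q, y) + xx q*(g (q, y))^2)*ph (q, y))/2" .
  qed
  also have "... = (LI y. LI q. (r (q, y) + xx q*(g (q, y))^2)*ph (q, y))/2" by simp
  also have "(LI y. LI q. (r (q, y) + xx q*(g (q, y))^2)*ph (q, y)) = (LI z. (r z + xx (fst z)*(g z)^2)*ph z)"
  proof -
   have "integrable lborel (%z. (r z + xx (fst z)*(g z)^2)*ph z)"
    using ib[OF ph _ r1] xg_int[OF ph] by (simp add: distrib_right)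
   from integral_plane(2)[OF this] show ?thesis by simp
  qed
  also have "... = (LI z. r z*ph z) + (LI z. xx (fst z)*(g z)^2*ph z)"
   using ib[OF ph _ r1] xg_int[OF ph] by (simp add: distrib_right)
  finally have A: "(LI z. ff z*d_q ph z) = ((LI z. r z*ph z) + (LI z. xx (fst z)*(g z)^2*ph z))/2" .
  have B: "(LI z. ff z*d_y (d_y ph) z) = (LI z. r z*ph z)" using wd1[OF dy] wd2[OF ph] by simp
  have "(%z. - ff z*d_q ph z + 1/2*ff z*d_y (d_y ph) z + 1/2*x (fst z)*(g z)^2*ph z)
    = (%z. - (ff z*d_q ph z) + 1/2*(ff z*d_y (d_y ph) z) + 1/2*(xx (fst z)*(g z)^2*ph z))"
  proof
   fix z :: "real \<times> real"
   obtain q y where [simp]: "z = (q, y)" by (cases z)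
   have "x (fst z)*ph z = xx (fst z)*ph z" using zero_out[OF ph, of q y] by (cases "0 <= q & q <= 1") (auto simp: xx_def)
   hence "x (fst z)*(g z)^2*ph z = xx (fst z)*(g z)^2*ph z" by (metis mult.assoc mult.commute)
   thus "- ff z*d_q ph z + 1/2*ff z*d_y (d_y ph) z + 1/2*x (fst z)*(g z)^2*ph z
    = - (ff z*d_q ph z) + 1/2*(ff z*d_y (d_y ph) z) + 1/2*(xx (fst z)*(g z)^2*ph z)" by simp
  qed
  hence "(LI z. - ff z*d_q ph z + 1/2*ff z*d_y (d_y ph) z + 1/2*x (fst z)*(g z)^2*ph z)
    = (LI z. - (ff z*d_q ph z) + 1/2*(ff z*d_y (d_y ph) z) + 1/2*(xx (fst z)*(g z)^2*ph z))" by simp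
  also have "... = - (LI z. ff z*d_q ph z) + 1/2*(LI z. ff z*d_y (d_y ph) z) + 1/2*(LI z. xx (fst z)*(g z)^2*ph z)"
   using iff[OF dq] iff[OF dyy] xg_int[OF ph] by simp
  also have "... = 0" unfolding A B by (simp add: add_divide_distrib)
  finally show ?thesis .
 qed
 show ?thesis unfolding parisi_weak_solution_def weak_d_y_def
 proof (intro conjI exI[of _ g])
  show "continuous_on strip ff" by (rule ff_continuous_on)
  show "ALL y. ff (1, y) = 1/be*ln (2*cosh (be*y))" by (simp add: ff_terminal pterm_def)
  show "g : borel_measurable lborel" by simp
  show "EX C. AE z in lborel. z : strip --> abs(g z) <= C" using g1 by (intro exI[of _ 1]) auto
 qed (use wd1 main in auto)
qed

end

section \<open>Smooth functions of one variable\<close>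

coinductive smooth1 :: "(real => real) => bool" where
 "(!!t. (DERIV f t :> f' t)) ==> smooth1 f' ==> smooth1 f"

lemma smooth1_coinduct:
 assumes "X h" "!!h. X h ==> EX h'. (ALL t. (DERIV h t :> h' t)) & X h'"
 shows "smooth1 h" using assms(1)
proof (coinduction arbitrary: h rule: smooth1.coinduct)
 case (smooth1 h)
 thus ?case using assms(2)[of h] by blast
qed

lemma smooth1_derivative:
 assumes "smooth1 f"
 obtains f' where "!!t. (DERIV f t :> f' t)" "smooth1 f'"
 using assms by (cases rule: smooth1.cases) blast

lemma smooth1_deriv_unique:
 assumes "smooth1 f" "!!t. (DERIV f t :> f' t)"
 shows "smooth1 f'"
proof -
 obtain f'' where f'': "!!t. (DERIV f t :> f'' t)" "smooth1 f''"
  using smooth1_derivative[OF assms(1)] by blast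
 have "f' = f''" using DERIV_unique[OF assms(2) f''(1)] by blast
 thus ?thesis using f''(2) by simp
qed

lemma smooth1_continuous: "smooth1 f ==> continuous_on S f"
 by (erule smooth1_derivative) (auto intro!: continuous_at_imp_continuous_on DERIV_isCont)

lemma smooth1_affine:
 assumes "smooth1 f"
 shows "smooth1 (%t. c*f (a*t + b))"
proof -
 define X where "X g \<longleftrightarrow> (EX f c. smooth1 f & g = (%t. c*f (a*t + b)))" for g
 have "X (%t. c*f (a*t + b))" using assms unfolding X_def by blast
 thus ?thesis
 proof (rule smooth1_coinduct[where X = X])
  fix g assume "X g"
  then obtain f c where f: "smooth1 f" "g = (%t. c*f (a*t + b))" unfolding X_def by blast
  obtain f' where f': "!!t. (DERIV f t :> f' t)" "smooth1 f'"
   using smooth1_derivative[OF f(1)] by blast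
  have "DERIV g t :> (c*a)*f' (a*t + b)" for t
   unfolding f(2) by (rule derivative_eq_intros DERIV_chain2[OF f'(1)] refl | simp)+
  moreover have "X (%t. (c*a)*f' (a*t + b))" using f'(2) unfolding X_def by blast
  ultimately show "EX h'. (ALL t. (DERIV g t :> h' t)) & X h'"
   by (intro exI[of _ "%t. (c*a)*f' (a*t + b)"]) blast
 qed
qed

lemma smooth1_add:
 assumes "smooth1 f" "smooth1 g"
 shows "smooth1 (%t. f t + g t)"
proof -
 define X where "X h \<longleftrightarrow> (EX f g. smooth1 f & smooth1 g & h = (%t. f t + g t))" for h
 have "X (%t. f t + g t)" using assms unfolding X_def by blast
 thus ?thesis
 proof (rule smooth1_coinduct[where X = X])
  fix h assume "X h"
  then obtain f g where f: "smooth1 f" "smooth1 g" "h = (%t. f t + g t)" unfolding X_def by blast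
  obtain f' where f': "!!t. (DERIV f t :> f' t)" "smooth1 f'"
   using smooth1_derivative[OF f(1)] by blast
  obtain g' where g': "!!t. (DERIV g t :> g' t)" "smooth1 g'"
   using smooth1_derivative[OF f(2)] by blast
  have "DERIV h t :> f' t + g' t" for t unfolding f(3) by (intro DERIV_add f' g')
  moreover have "X (%t. f' t + g' t)" using f' g' unfolding X_def by blast
  ultimately show "EX h'. (ALL t. (DERIV h t :> h' t)) & X h'"
   by (intro exI[of _ "%t. f' t + g' t"]) blast
 qed
qed

text \<open>Coinduction needs a set closed under differentiation. Single products are not such a
  set, as the Leibniz rule yields sums of products; the generated algebra is.\<close>

inductive_set smooth1_algebra :: "(real => real) set" where
 atom: "smooth1 f ==> f : smooth1_algebra"
| add: "f : smooth1_algebra ==> g : smooth1_algebra ==> (%t. f t + g t) : smooth1_algebra"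
| mult: "f : smooth1_algebra ==> g : smooth1_algebra ==> (%t. f t*g t) : smooth1_algebra"

lemma smooth1_algebra_derivative:
 "f : smooth1_algebra ==> EX f':smooth1_algebra. ALL t. (DERIV f t :> f' t)"
proof (induction rule: smooth1_algebra.induct)
 case (atom f)
 thus ?case by (metis smooth1_derivative smooth1_algebra.atom)
next
 case (add f g)
 then obtain f' g' where "f' : smooth1_algebra" "g' : smooth1_algebra"
  "ALL t. (DERIV f t :> f' t)" "ALL t. (DERIV g t :> g' t)" by blast
 thus ?case by (intro bexI[of _ "%t. f' t + g' t"]) (auto intro!: DERIV_add smooth1_algebra.add)
next
 case (mult f g)
 then obtain f' g' where d: "f' : smooth1_algebra" "g' : smooth1_algebra"
  "ALL t. (DERIV f t :> f' t)" "ALL t. (DERIV g t :> g' t)" by blast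
 have "DERIV (%t. f t*g t) t :> (f' t*g t + g' t*f t)" for t using d(3,4) by (intro DERIV_mult) auto
 thus ?case using d(1,2) mult.hyps
  by (intro bexI[of _ "%t. f' t*g t + g' t*f t"]) (auto intro!: smooth1_algebra.intros(2,3))
qed

lemma smooth1_mult:
 assumes "smooth1 f" "smooth1 g"
 shows "smooth1 (%t. f t*g t)"
proof (rule smooth1_coinduct)
 show "(%t. f t*g t) : smooth1_algebra" using assms by (intro smooth1_algebra.intros)
 show "EX h'. (ALL t. (DERIV h t :> h' t)) & h' : smooth1_algebra" if "h : smooth1_algebra" for h
  using smooth1_algebra_derivative[OF that] by blast
qed

lemma d_product:
 assumes "!!t. (DERIV A t :> A' t)" "!!t. (DERIV B t :> B' t)"
 shows "d_q (%(s, z). A s*B z) = (%(s, z). A' s*B z)"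
  and "d_y (%(s, z). A s*B z) = (%(s, z). A s*B' z)"
proof -
 have "DERIV (%s. A s*B z) s :> A' s*B z" for s z by (rule DERIV_cmult_right[OF assms(1)])
 thus "d_q (%(s, z). A s*B z) = (%(s, z). A' s*B z)"
  by (auto simp: d_q_def fun_eq_iff intro!: DERIV_imp_deriv)
 have "DERIV (%z. A s*B z) z :> A s*B' z" for s z by (rule DERIV_cmult[OF assms(2)])
 thus "d_y (%(s, z). A s*B z) = (%(s, z). A s*B' z)"
  by (auto simp: d_y_def fun_eq_iff intro!: DERIV_imp_deriv)
qed

lemma smooth_product:
 assumes "smooth1 A" "smooth1 B"
 shows "smooth (%(s, z). A s*B z)"
proof -
 define X where "X ph \<longleftrightarrow> (EX A B. smooth1 A & smooth1 B & ph = (%(s, z). A s*B z))" for ph :: "real \<times> real => real"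
 have "smooth ph" if "X ph" for ph using that
 proof (coinduction arbitrary: ph rule: smooth.coinduct)
  case (smooth ph)
  then obtain A B where f: "smooth1 A" "smooth1 B" "ph = (%(s, z). A s*B z)" unfolding X_def by blast
  obtain A' where A': "!!t. (DERIV A t :> A' t)" "smooth1 A'"
   using smooth1_derivative[OF f(1)] by blast
  obtain B' where B': "!!t. (DERIV B t :> B' t)" "smooth1 B'"
   using smooth1_derivative[OF f(2)] by blast
  have "(%p. A (fst p)*B (snd p)) differentiable (at p)" for p :: "real \<times> real"
  proof (intro differentiable_mult)
   show "(%p. A (fst p)) differentiable (at p)" by (rule differentiable_compose[of A])
      (use A'(1) in \<open>auto intro!: bounded_linear_imp_differentiable bounded_linear_fst
       simp: real_differentiable_def\<close>)
   show "(%p. B (snd p)) differentiable (at p)" by (rule differentiable_compose[of B])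
      (use B'(1) in \<open>auto intro!: bounded_linear_imp_differentiable bounded_linear_snd
       simp: real_differentiable_def\<close>)
  qed
  hence "ph differentiable_on UNIV"
   unfolding f(3) differentiable_on_def by (simp add: case_prod_unfold)
  moreover have "X (d_q ph)" "X (d_y ph)"
   unfolding f(3) d_product[OF A'(1) B'(1)] X_def using A' B' f by blast+
  ultimately show ?case by blast
 qed
 thus ?thesis using assms unfolding X_def by blast
qed

lemma test_function_product:
 assumes "smooth1 A" "smooth1 B" "0 < a" "b < 1" "!!s. s < a | s > b ==> A s = 0"
  "!!z. abs z > R ==> B z = 0"
 shows "test_function (%(s, z). A s*B z)" unfolding test_function_def
proof (intro conjI exI allI impI)
 show "smooth (%(s, z). A s*B z)" by (rule smooth_product assms)+
 show "compact ({a..b} \<times> {-R..R})" by (intro compact_Times) auto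
 show "{a..b} \<times> {-R..R} <= {0<..<1} \<times> UNIV" using assms(3,4) by auto
next
 fix z :: "real \<times> real"
 assume "z ~: {a..b} \<times> {-R..R}"
 thus "(case z of (s, z) => A s*B z) = 0"
  using assms(5)[of "fst z"] assms(6)[of "snd z"] by (cases z) (force simp: abs_le_iff not_le)
qed

section \<open>A smooth bump\<close>

text \<open>The powers in the denominator close the family exp (-1/t)/t^k under differentiation up
  to linear combinations; \<open>flat 0\<close> is the classical smooth function that is not
  analytic at 0.\<close>

definition flat :: "nat => real => real"
 where "flat k t = (if t > 0 then exp (- 1/t)/t^k else 0)"

lemma power_div_fact_le_exp:
 assumes "0 <= (x :: real)"
 shows "x^n/fact n <= exp x"
proof -
 obtain t where t: "exp x = (SUM m<Suc n. x^m/fact m) + (exp t/fact (Suc n))*x^Suc n"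
  using Maclaurin_exp_le[of x "Suc n"] by blast
 have "x^n/fact n <= (SUM m<Suc n. x^m/fact m)" using assms by (auto intro!: sum_nonneg)
 moreover have "0 <= (exp t/fact (Suc n))*x^Suc n" using assms by simp
 ultimately show ?thesis using t by linarith
qed

text \<open>The exponential dominates the term of order k + 2 of its series at 1/t. The quadratic
  bound is what makes the derivative at 0 exist and vanish.\<close>

lemma flat_bounds: "0 <= flat k t" "flat k t <= fact (k + 2)*t^2"
proof -
 show "0 <= flat k t" by (simp add: flat_def)
 show "flat k t <= fact (k + 2)*t^2"
 proof (cases "t > 0")
  case True
  have "(1/t)^(k + 2)/fact (k + 2) <= exp (1/t)" using True by (intro power_div_fact_le_exp) simp
  hence "inverse (exp (1/t)) <= inverse ((1/t)^(k + 2)/fact (k + 2))"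
   using True by (intro le_imp_inverse_le) auto
  also have "... = fact (k + 2)*t^(k + 2)" by (simp add: power_one_over divide_simps)
  finally have "exp (- 1/t) <= fact (k + 2)*t^2*t^k"
   by (simp add: exp_minus power_add mult_ac power2_eq_square)
  thus ?thesis using True by (simp add: flat_def pos_divide_le_eq del: fact_Suc)
 qed (simp add: flat_def)
qed

lemma flat_derivative: "DERIV (flat k) t :> flat (k + 2) t - real k*flat (k + 1) t"
proof -
 consider "t > 0" | "t < 0" | "t = 0" by linarith
 thus ?thesis
 proof cases
  case 1
  have "((%t. exp (- 1/t)/t^k) has_real_derivative
    (exp (- 1/t)*(1/t^2)*t^k - exp (- 1/t)*(real k*t^(k - Suc 0)))/(t^k*t^k)) (at t)"
   using 1 by (intro DERIV_divide DERIV_pow) (auto intro!: derivative_eq_intros simp: power2_eq_square)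
  moreover have "(exp (- 1/t)*(1/t^2)*t^k - exp (- 1/t)*(real k*t^(k - Suc 0)))/(t^k*t^k)
    = flat (k + 2) t - real k*flat (k + 1) t"
   using 1 by (cases k) (simp_all add: flat_def field_simps power2_eq_square)
  ultimately have "((%t. exp (- 1/t)/t^k) has_real_derivative
    flat (k + 2) t - real k*flat (k + 1) t) (at t)" by simp
  thus ?thesis
   by (rule has_field_derivative_transform_within_open[where S = "{0<..}"]) (use 1 in \<open>auto simp: flat_def\<close>)
 next
  case 2
  have "DERIV (%t. 0) t :> flat (k + 2) t - real k*flat (k + 1) t" using 2 by (auto simp: flat_def)
  thus ?thesis
   by (rule has_field_derivative_transform_within_open[where S = "{..<0}"]) (use 2 in \<open>auto simp: flat_def\<close>)
 next
  case 3
  have "DERIV (flat k) 0 :> 0" using flat_bounds[of k]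
   by (intro derivative_from_quadratic[where C = "fact (k + 2)"]) (auto simp: flat_def)
  thus ?thesis using 3 by (simp add: flat_def)
 qed
qed

text \<open>The coinduction runs over the linear span of all \<open>flat k\<close>, whose elements
  are coded by lists of coefficients and indices.\<close>

lemma smooth1_flat: "smooth1 (flat k)"
proof -
 define X where "X f \<longleftrightarrow> (EX F :: (real \<times> nat) list. f = (%t. SUM (c, k)<-F. c*flat k t))" for f
 have "flat k = (%t. SUM (c, k)<-[(1, k)]. c*flat k t)" by auto
 hence "X (flat k)" unfolding X_def by blast
 thus ?thesis
 proof (rule smooth1_coinduct[where X = X])
  fix f assume "X f"
  then obtain F where F: "f = (%t. SUM (c, k)<-F. c*flat k t)" unfolding X_def by blast
  define G where "G = concat (map (%(c, k). [(c, k + 2), (- c*real k, k + 1)]) F)"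
  have "DERIV (%t. SUM (c, k)<-F. c*flat k t) t :> (SUM (c, k)<-G. c*flat k t)" for t
   unfolding G_def
  proof (induction F)
   case (Cons p F)
   obtain c k where p: "p = (c, k)" by (cases p)
   have "((%t. c*flat k t + (SUM (c, k)<-F. c*flat k t)) has_real_derivative
     c*(flat (k + 2) t - real k*flat (k + 1) t)
     + (SUM (c, k)<-concat (map (%(c, k). [(c, k + 2), (- c*real k, k + 1)]) F). c*flat k t)) (at t)"
    by (intro DERIV_add DERIV_cmult flat_derivative Cons)
   thus ?case by (simp add: p algebra_simps)
  qed simp
  moreover have "X (%t. SUM (c, k)<-G. c*flat k t)" unfolding X_def by blast
  ultimately show "EX h'. (ALL t. (DERIV f t :> h' t)) & X h'"
   unfolding F by (intro exI[of _ "%t. SUM (c, k)<-G. c*flat k t"]) blast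
 qed
qed

definition bump0 :: "real => real"
 where "bump0 t = flat 0 (1 + t)*flat 0 (1 - t)"

definition bump :: "real => real"
 where "bump t = bump0 t/(LI t. bump0 t)"

lemma smooth1_bump0: "smooth1 bump0"
proof -
 have "smooth1 (%t. (1*flat 0 (1*t + 1))*(1*flat 0 ((-1)*t + 1)))"
  by (intro smooth1_mult smooth1_affine smooth1_flat)
 thus ?thesis by (simp add: bump0_def[abs_def] add.commute)
qed

lemma bump0: "0 <= bump0 t" "abs t >= 1 ==> bump0 t = 0" "bump0 (- t) = bump0 t"
 by (auto simp: bump0_def flat_def abs_if split: if_splits)

lemma integrable_compact_support:
 fixes f :: "real => real"
 assumes "continuous_on UNIV f" "!!y. abs y > R ==> f y = 0"
 shows "integrable lborel f"
proof -
 have "integrable lborel (%y. indicator {-R..R} y *\<^sub>R f y)"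
  using assms(1) by (intro borel_integrable_compact) (auto intro: continuous_on_subset)
 moreover have "(%y. indicator {-R..R} y *\<^sub>R f y) = f"
 proof
  fix y show "indicator {-R..R} y *\<^sub>R f y = f y"
   using assms(2)[of y] by (cases "abs y <= R") (auto simp: indicator_def abs_le_iff)
 qed
 ultimately show ?thesis by simp
qed

lemma bump0_mass: "integrable lborel bump0" "0 < (LI t. bump0 t)"
proof -
 show i: "integrable lborel bump0"
  by (rule integrable_compact_support[where R = 1]) (use bump0 smooth1_bump0 in \<open>auto intro: smooth1_continuous\<close>)
 have "(LI t. bump0 t) ~= 0"
 proof
  assume "(LI t. bump0 t) = 0"
  hence "AE t in lborel. bump0 t = 0" using integral_nonneg_eq_0_iff_AE[OF i] bump0(1) by simp
  hence "AE t in lborel. t ~: {-1<..<1::real}"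
   by eventually_elim (auto simp: bump0_def flat_def split: if_splits)
  hence "{-1<..<1::real} : null_sets lborel" by (simp add: AE_iff_null_sets)
  thus False by (simp add: null_sets_def)
 qed
 moreover have "0 <= (LI t. bump0 t)" by (simp add: bump0(1))
 ultimately show "0 < (LI t. bump0 t)" by linarith
qed

lemma bump: "0 <= bump t" "abs t >= 1 ==> bump t = 0" "bump (- t) = bump t"
  "integrable lborel bump" "(LI t. bump t) = 1" "smooth1 bump"
proof -
 have "smooth1 (%t. (1/(LI t. bump0 t))*bump0 (1*t + 0))" by (intro smooth1_affine smooth1_bump0)
 thus "smooth1 bump" by (simp add: bump_def[abs_def])
 show "integrable lborel bump" using bump0_mass(1) by (simp add: bump_def[abs_def])
qed (use bump0 bump0_mass in \<open>auto simp: bump_def\<close>)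

lemma bump_measurable [measurable]: "bump : borel_measurable borel"
 using bump(4) by (simp add: borel_measurable_integrable)

section \<open>Mollifiers\<close>

definition moll :: "real => real => real"
 where "moll e t = bump (t/e)/e"

lemma smooth1_moll: "smooth1 (moll e)"
 using smooth1_affine[OF bump(6), of "1/e" "1/e" 0] by (simp add: moll_def[abs_def])

lemma moll:
 assumes "e > 0"
 shows "0 <= moll e t" "abs t >= e ==> moll e t = 0" "moll e (- t) = moll e t"
  "integrable lborel (moll e)" "(LI t. moll e t) = 1"
proof -
 show "0 <= moll e t" using assms bump(1) by (simp add: moll_def)
 show "abs t >= e ==> moll e t = 0" using assms by (simp add: moll_def bump(2))
 show "moll e (- t) = moll e t" using bump(3)[of "t/e"] by (simp add: moll_def)
 show "integrable lborel (moll e)"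
 proof (rule integrable_compact_support[where R = e])
  show "moll e y = 0" if "abs y > e" for y using assms that by (simp add: moll_def bump(2))
 qed (rule smooth1_continuous[OF smooth1_moll])
 have "(LI t. bump t) = abs(1/e) *\<^sub>R (LI t. bump (0 + 1/e*t))"
  by (rule lborel_integral_real_affine) (use assms in auto)
 thus "(LI t. moll e t) = 1" using assms bump(5) by (simp add: moll_def)
qed

lemma moll_measurable [measurable]: "moll e : borel_measurable borel"
 unfolding moll_def[abs_def] by measurable

lemma integrable_shift:
 fixes f :: "real => real"
 assumes "integrable lborel f"
 shows "integrable lborel (%t. f (t - a))" "(LI t. f (t - a)) = (LI t. f t)"
 using lborel_integrable_real_affine[OF assms, of 1 "- a"] lborel_integral_real_affine[of 1 f "- a"]
 by auto

text \<open>Continuity is required only within S, and the kernels need not be centred at a. Both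
  matter at the end points of [0, 1], where kernels must be kept inside the interval.\<close>

lemma approximate_identity:
 fixes W :: "real => real"
 assumes K: "!!n t. 0 <= K n t" "!!n. integrable lborel (K n)" "!!n. (LI t. K n t) = 1"
  and supp: "!!n t. K n t ~= 0 ==> t : S & abs(t - a) <= de n" and de: "de ----> 0"
  and W: "continuous (at a within S) W" "W : borel_measurable borel"
 shows "(%n. LI t. K n t*W t) ----> W a"
proof (rule LIMSEQ_I)
 fix r :: real assume r: "0 < r"
 obtain d where d: "d > 0" "!!t. t : S ==> dist t a < d ==> dist (W t) (W a) < r/2"
  using W(1) r unfolding continuous_within_eps_delta by (metis half_gt_zero)
 obtain N where N: "!!n. n >= N ==> norm (de n - 0) < d" using LIMSEQ_D[OF de d(1)] by blast
 have "norm ((LI t. K n t*W t) - W a) < r" if n: "n >= N" for n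
 proof -
  have mK: "K n : borel_measurable lborel" using K(2) by (rule borel_measurable_integrable)
  have pt: "abs(K n t*W t - K n t*W a) <= K n t*(r/2)" for t
  proof (cases "K n t = 0")
   case False
   hence "t : S" "abs(t - a) < d" using supp[OF False] N[OF n] by auto
   hence "abs(W t - W a) <= r/2" using d(2)[of t] by (simp add: dist_real_def)
   hence "K n t*abs(W t - W a) <= K n t*(r/2)" by (intro mult_left_mono K(1))
   moreover have "abs(K n t*W t - K n t*W a) = K n t*abs(W t - W a)"
    using K(1)[of n t] by (simp add: abs_mult right_diff_distrib[symmetric])
   ultimately show ?thesis by simp
  qed simp
  have i1: "integrable lborel (%t. K n t*(r/2))" "integrable lborel (%t. K n t*W a)"
   using K(2) by auto
  have i2: "integrable lborel (%t. K n t*W t - K n t*W a)"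
   by (rule Bochner_Integration.integrable_bound[OF i1(1)]) (use pt W(2) mK K(1) r in auto)
  have i3: "integrable lborel (%t. K n t*W t)"
   using Bochner_Integration.integrable_add[OF i2 i1(2)] by simp
  have "(LI t. K n t*W t) - W a = (LI t. K n t*W t) - (LI t. K n t*W a)" using K(3) by simp
  also have "... = (LI t. K n t*W t - K n t*W a)" using i3 i1(2) by simp
  also have "abs(...) <= (LI t. K n t*(r/2))"
  proof -
   have "abs(LI t. K n t*W t - K n t*W a) <= (LI t. abs(K n t*W t - K n t*W a))"
    using integral_norm_bound[of lborel "%t. K n t*W t - K n t*W a"] by simp
   also have "... <= (LI t. K n t*(r/2))" by (rule integral_mono) (use i2 i1 pt in auto)
   finally show ?thesis .
  qed
  also have "... = r/2" using K(3)[of n] by simp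
  finally show ?thesis using r by simp
 qed
 thus "EX no. ALL n>=no. norm ((LI t. K n t*W t) - W a) < r" by blast
qed

text \<open>A is the difference of two translates of an antiderivative of the mollifier, so testing
  a weak equation with A yields mollified values near a and b with opposite signs.\<close>

lemma plateau:
 assumes "0 < e" "a <= b"
 obtains A where "smooth1 A" "!!t. (DERIV A t :> moll e (t - a) - moll e (t - b))"
  "!!t. 0 <= A t" "!!t. A t <= 1" "!!t. t < a - e | t > b + e ==> A t = 0"
  "!!t. a + e <= t ==> t <= b - e ==> A t = 1"
proof -
 have cont: "continuous_on S (moll e)" for S by (rule smooth1_continuous[OF smooth1_moll])
 obtain F where F: "!!t. (DERIV F t :> moll e t)"
 proof -
  have "EX F. ALL x::real. -\<infinity> < ereal x --> ereal x < \<infinity> --> (F has_vector_derivative moll e x) (at x)"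
   by (rule einterval_antiderivative)
     (use cont[of UNIV] in \<open>auto simp: continuous_on_eq_continuous_at\<close>)
  thus ?thesis using that by (auto simp: has_real_derivative_iff_has_vector_derivative)
 qed
 have mono: "F s <= F t" if "s <= t" for s t
  by (rule DERIV_nonneg_imp_nondecreasing[OF that], intro exI conjI, rule F, rule moll(1)[OF assms(1)])
 have const: "F s = F t" if st: "s < t" and out: "!!z. s < z ==> z < t ==> abs z >= e" for s t
 proof -
  obtain z where z: "s < z" "z < t" "F t - F s = (t - s)*moll e z"
   using MVT2[OF st, of F "moll e"] F by blast
  thus ?thesis using moll(2)[OF assms(1) out[OF z(1,2)]] by simp
 qed
 have left: "F t = F (- e)" if "t <= - e" for t
  using const[of t "- e"] that by (cases "t = - e") auto
 have right: "F t = F e" if "t >= e" for t using const[of e t] that by (cases "t = e") auto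
 have "(LI t. moll e t*indicator {-e..e} t) = F e - F (- e)"
  using cont[of UNIV] assms F by (intro integral_FTC_Icc_real) (auto simp: continuous_on_eq_continuous_at)
 also have "(%t. moll e t*indicator {-e..e} t) = moll e"
 proof
  fix t show "moll e t*indicator {-e..e} t = moll e t"
   using moll(2)[OF assms(1), of t] by (cases "abs t <= e") (auto simp: indicator_def abs_le_iff)
 qed
 finally have jump: "F e = F (- e) + 1" using moll(5)[OF assms(1)] by simp
 have range: "F (- e) <= F t" "F t <= F (- e) + 1" for t
  using mono[of "- e" t] mono[of t e] left[of t] right[of t] jump by linarith+
 define A where "A t = F (t - a) - F (t - b)" for t
 have dA: "DERIV A t :> moll e (t - a) - moll e (t - b)" for t
 proof -
  have "DERIV (%t. F (t - c)) t :> moll e (t - c)" for c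
  proof -
   have "DERIV (%t. t - c) t :> 1" by (auto intro!: derivative_eq_intros)
   from DERIV_chain2[OF F this] show ?thesis by simp
  qed
  thus ?thesis unfolding A_def by (intro DERIV_diff)
 qed
 show ?thesis
 proof (rule that[of A])
  show "smooth1 A"
  proof (rule smooth1.intros[OF dA])
   have "smooth1 (%t. 1*moll e (1*t + - a) + (-1)*moll e (1*t + - b))"
    by (intro smooth1_add smooth1_affine smooth1_moll)
   thus "smooth1 (%t. moll e (t - a) - moll e (t - b))" by simp
  qed
  show "DERIV A t :> moll e (t - a) - moll e (t - b)" for t by (rule dA)
  show "0 <= A t" "A t <= 1" for t
   using mono[of "t - b" "t - a"] assms(2) range[of "t - a"] range[of "t - b"] by (auto simp: A_def)
  show "A t = 0" if "t < a - e | t > b + e" for t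
   using that assms left[of "t - a"] left[of "t - b"] right[of "t - a"] right[of "t - b"]
   by (auto simp: A_def)
  show "A t = 1" if "a + e <= t" "t <= b - e" for t
   using that assms left[of "t - b"] right[of "t - a"] jump by (auto simp: A_def)
 qed
qed

text \<open>Tests with plateaus whose shoulders lie strictly between a and b, hence inside the open
  unit interval even for a = 0 or b = 1. The shoulders shrink to the end points, where continuity on
  the closed interval identifies the limits.\<close>

lemma weak_time_derivative:
 fixes W G :: "real => real"
 assumes W: "continuous_on {0..1} W" "W : borel_measurable borel"
  and G: "G : borel_measurable borel" "!!t. 0 <= t ==> t <= 1 ==> abs(G t) <= D"
  and weak: "!!A A' a b. smooth1 A ==> (!!t. (DERIV A t :> A' t)) ==> 0 < a ==> b < 1 ==>
   (!!t. t < a | t > b ==> A t = 0) ==> (LI t. A' t*W t) = (LI t. A t*G t)"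
  and ab: "0 <= a" "a < b" "b <= 1"
 shows "W a - W b = (LI t. indicator {a..b} t*G t)"
proof -
 \<comment> \<open>With 8*e <= b - a the shoulders, of total width 3*e at either end, stay
   apart.\<close>
 define e where "e n = (b - a)/(8*(real n + 1))" for n :: nat
 have e: "0 < e n" "8*e n <= b - a" for n
  using ab mult_right_mono[of a b "real n"] by (auto simp: e_def field_simps)
 have e0: "e ----> 0" unfolding e_def by real_asymp
 have "EX A. smooth1 A & (ALL t. (DERIV A t :> moll (e n) (t - (a + 2*e n)) - moll (e n) (t - (b - 2*e n))))
   & (ALL t. 0 <= A t) & (ALL t. A t <= 1) & (ALL t. t < a + e n | t > b - e n --> A t = 0)
   & (ALL t. a + 3*e n <= t --> t <= b - 3*e n --> A t = 1)" for n
 proof -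
  obtain A where A: "smooth1 A" "!!t. (DERIV A t :> moll (e n) (t - (a + 2*e n)) - moll (e n) (t - (b - 2*e n)))"
   "!!t. 0 <= A t" "!!t. A t <= 1" "!!t. t < a + 2*e n - e n | t > b - 2*e n + e n ==> A t = 0"
   "!!t. a + 2*e n + e n <= t ==> t <= b - 2*e n - e n ==> A t = 1"
   using plateau[OF e(1)[of n], of "a + 2*e n" "b - 2*e n"] e[of n] by (auto simp: algebra_simps)
  thus ?thesis by (intro exI[of _ A]) auto
 qed
 then obtain A where A: "!!n. smooth1 (A n)"
  "!!n t. (DERIV (A n) t :> moll (e n) (t - (a + 2*e n)) - moll (e n) (t - (b - 2*e n)))"
  "!!n t. 0 <= A n t" "!!n t. A n t <= 1" "!!n t. t < a + e n | t > b - e n ==> A n t = 0"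
  "!!n t. a + 3*e n <= t ==> t <= b - 3*e n ==> A n t = 1" by metis
 have mA: "A n : borel_measurable borel" for n
  by (rule borel_measurable_continuous_onI) (rule smooth1_continuous[OF A(1)])
 have supp: "abs(t - c) < e n" if "moll (e n) (t - c) ~= 0" for n t c
  using moll(2)[OF e(1)[of n], of "t - c"] that by (cases "abs(t - c) < e n") auto
 have lim1: "(%n. LI t. moll (e n) (t - (a + 2*e n))*W t) ----> W a"
 proof (rule approximate_identity[where S = "{0..1}" and de = "%n. 3*e n"])
  show "(%n. 3*e n) ----> 0" using tendsto_mult_right_zero[OF e0] by simp
  show "t : {0..1} & abs(t - a) <= 3*e n" if "moll (e n) (t - (a + 2*e n)) ~= 0" for n t
   using supp[OF that] e[of n] ab by (auto simp: abs_less_iff abs_le_iff)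
 qed (use moll e W ab integrable_shift in \<open>auto simp: continuous_on_eq_continuous_within\<close>)
 have lim2: "(%n. LI t. moll (e n) (t - (b - 2*e n))*W t) ----> W b"
 proof (rule approximate_identity[where S = "{0..1}" and de = "%n. 3*e n"])
  show "(%n. 3*e n) ----> 0" using tendsto_mult_right_zero[OF e0] by simp
  show "t : {0..1} & abs(t - b) <= 3*e n" if "moll (e n) (t - (b - 2*e n)) ~= 0" for n t
   using supp[OF that] e[of n] ab by (auto simp: abs_less_iff abs_le_iff)
 qed (use moll e W ab integrable_shift in \<open>auto simp: continuous_on_eq_continuous_within\<close>)
 obtain BW where BW: "!!t. t : {0..1} ==> abs(W t) <= BW"
 proof -
  have "bounded (W ` {0..1})" by (intro compact_imp_bounded compact_continuous_image W) simp
  then obtain D where "ALL x:W ` {0..1}. norm x <= D" unfolding bounded_iff by blast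
  hence "abs(W t) <= D" if "t : {0..1}" for t using that by fastforce
  thus ?thesis by (rule that)
 qed
 have iK: "integrable lborel (%t. moll (e n) (t - c)*W t)"
  if "!!t. moll (e n) (t - c) ~= 0 ==> t : {0..1}" for n c
 proof (rule Bochner_Integration.integrable_bound)
  show "integrable lborel (%t. moll (e n) (t - c)*BW)"
   using integrable_shift(1)[OF moll(4)[OF e(1)[of n]]] by auto
  have "abs(moll (e n) (t - c)*W t) <= abs(moll (e n) (t - c)*BW)" for t
   using BW[of t] that[of t] by (cases "moll (e n) (t - c) = 0") (auto simp: abs_mult intro!: mult_left_mono)
  thus "AE t in lborel. norm (moll (e n) (t - c)*W t) <= norm (moll (e n) (t - c)*BW)" by simp
 qed (use W(2) in measurable)
 have split: "(LI t. A n t*G t) = (LI t. moll (e n) (t - (a + 2*e n))*W t)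
   - (LI t. moll (e n) (t - (b - 2*e n))*W t)" for n
 proof -
  have "(LI t. A n t*G t) = (LI t. (moll (e n) (t - (a + 2*e n)) - moll (e n) (t - (b - 2*e n)))*W t)"
   by (rule weak[symmetric, OF A(1) A(2), of "a + e n" "b - e n"]) (use e[of n] ab A(5) in auto)
  also have "... = (LI t. moll (e n) (t - (a + 2*e n))*W t - moll (e n) (t - (b - 2*e n))*W t)"
   by (simp add: left_diff_distrib)
  also have "... = (LI t. moll (e n) (t - (a + 2*e n))*W t) - (LI t. moll (e n) (t - (b - 2*e n))*W t)"
  proof (intro Bochner_Integration.integral_diff iK)
   show "t : {0..1}" if "moll (e n) (t - (a + 2*e n)) ~= 0" for t
    using supp[OF that] e[of n] ab by (auto simp: abs_less_iff)
   show "t : {0..1}" if "moll (e n) (t - (b - 2*e n)) ~= 0" for t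
    using supp[OF that] e[of n] ab by (auto simp: abs_less_iff)
  qed
  finally show ?thesis .
 qed
 have "(%n. LI t. A n t*G t) ----> W a - W b" unfolding split by (intro tendsto_diff lim1 lim2)
 moreover have "(%n. LI t. A n t*G t) ----> (LI t. indicator {a..b} t*G t)"
 proof (rule integral_dominated_convergence[where w = "%t. indicator {0..1} t*abs D"])
  show "integrable lborel (%t::real. indicator {0..1} t*abs D)" by simp
  have "t ~= a & t ~= b --> (%n. A n t*G t) ----> indicator {a..b} t*G t" for t
  proof (intro impI tendsto_mult tendsto_const)
   assume t: "t ~= a & t ~= b"
   have e3: "(%n. 3*e n) ----> 0" using tendsto_mult_right_zero[OF e0] by simp
   show "(%n. A n t) ----> indicator {a..b} t"
   proof (cases "a < t & t < b")
    case True
    hence "\<forall>\<^sub>F n in sequentially. 3*e n < min (t - a) (b - t)"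
     using order_tendstoD(2)[OF e3, of "min (t - a) (b - t)"] by auto
    hence "\<forall>\<^sub>F n in sequentially. A n t = indicator {a..b} t"
     by eventually_elim (use True A(6) in auto)
    thus ?thesis by (rule tendsto_eventually)
   next
    case False
    hence "A n t = indicator {a..b} t" for n
     using A(5)[of t n] e[of n] t by (auto simp: indicator_def)
    thus ?thesis by simp
   qed
  qed
  moreover have "AE t in lborel. t ~= a" "AE t in lborel. t ~= b" by (auto intro: AE_lborel_singleton)
  ultimately show "AE t in lborel. (%n. A n t*G t) ----> indicator {a..b} t*G t"
   by (auto elim: AE_mp)
  have "abs(A n t*G t) <= indicator {0..1} t*abs D" for n t
  proof (cases "0 <= t & t <= 1")
   case True
   have "abs(A n t)*abs(G t) <= 1*abs D" using A(3,4) G(2)[of t] True by (intro mult_mono) auto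
   thus ?thesis using True by (simp add: abs_mult)
  next
   case False
   thus ?thesis using A(5)[of t n] e[of n] ab by auto
  qed
  thus "AE t in lborel. norm (A n t*G t) <= indicator {0..1} t*abs D" for n by simp
 qed (use mA G(1) in measurable)
 ultimately show ?thesis by (rule LIMSEQ_unique)
qed

text \<open>The measure with density 1 + u/(D + 1), which is nonnegative, agrees with Lebesgue
  measure on all boxes. It is therefore Lebesgue measure, and uniqueness of densities gives the
  claim.\<close>

lemma AE_zero_of_interval_integrals:
 fixes u :: "real => real"
 assumes u: "u : borel_measurable borel" "!!t. abs(u t) <= D" "!!t. t ~: {0..1} ==> u t = 0"
  and z: "!!a b. 0 <= a ==> a < b ==> b <= 1 ==> (LI t. indicator {a..b} t*u t) = 0"
 shows "AE t in lborel. u t = 0"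
proof -
 have D: "0 <= D" using u(2)[of 0] by linarith
 define f where "f t = ennreal (1 + u t/(D + 1))" for t
 have pos: "0 <= 1 + u t/(D + 1)" for t using u(2)[of t] D by (auto simp: field_simps abs_le_iff)
 have fm [measurable]: "f : borel_measurable borel" using u(1) by (simp add: f_def[abs_def])
 have "lborel = density lborel f"
 proof (rule lborel_eqI)
  fix l r :: real assume "!!b. b : Basis ==> l \<bullet> b <= r \<bullet> b"
  hence lr: "l <= r" by simp
  define a b where "a = max 0 l" and "b = min 1 r"
  have i: "integrable lborel (%t. indicator {l<..<r} t*u t)"
   by (rule integrableI_bounded_set[where A = "{l<..<r}" and B = D])
     (use u lr in \<open>auto simp: indicator_def\<close>)
  have eq: "AE t in lborel. indicator {l<..<r} t*u t = indicator {a..b} t*u t"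
  proof -
   have "AE t in lborel. t ~= l" "AE t in lborel. t ~= r" by (auto intro: AE_lborel_singleton)
   thus ?thesis by eventually_elim (use u(3) in \<open>auto simp: indicator_def a_def b_def\<close>)
  qed
  have "(LI t. indicator {l<..<r} t*u t) = (LI t. indicator {a..b} t*u t)"
   by (rule integral_cong_AE) (use eq u(1) in auto)
  also have "... = 0"
  proof (cases "a < b")
   case True
   thus ?thesis using z[of a b] by (simp add: a_def b_def)
  next
   case False
   have "AE t in lborel. t ~= a" by (rule AE_lborel_singleton)
   hence "AE t in lborel. indicator {a..b} t*u t = 0"
    by eventually_elim (use False in \<open>auto simp: indicator_def\<close>)
   thus ?thesis using integral_cong_AE[of "%t. indicator {a..b} t*u t" lborel "%_. 0"] u(1) by simp
  qed
  finally have z0: "(LI t. indicator {l<..<r} t*u t) = 0" .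
  have i2: "integrable lborel (%t. (1 + u t/(D + 1))*indicator {l<..<r} t)"
  proof -
   have "integrable lborel (%t. indicator {l<..<r} t + (indicator {l<..<r} t*u t)/(D + 1))"
    using i lr by (intro Bochner_Integration.integrable_add) auto
   thus ?thesis by (simp add: algebra_simps)
  qed
  have "emeasure (density lborel f) (box l r) = (\<integral>\<^sup>+t. ennreal ((1 + u t/(D + 1))*indicator {l<..<r} t) \<partial>lborel)"
   by (subst emeasure_density) (auto simp: f_def box_real intro!: nn_integral_cong split: split_indicator)
  also have "... = ennreal (LI t. (1 + u t/(D + 1))*indicator {l<..<r} t)"
   by (rule nn_integral_eq_integral[OF i2]) (use pos in auto)
  also have "(LI t. (1 + u t/(D + 1))*indicator {l<..<r} t)
    = (LI t. indicator {l<..<r} t + (indicator {l<..<r} t*u t)/(D + 1))"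
   by (simp add: algebra_simps)
  also have "... = r - l" using z0 i lr by (subst Bochner_Integration.integral_add) auto
  finally show "emeasure (density lborel f) (box l r) = ennreal (PROD b:Basis. (r - l) \<bullet> b)" by simp
 qed simp
 hence "density lborel f = density lborel (%_. 1)" by (simp add: density_1)
 hence "AE t in lborel. f t = 1" using sigma_finite_measure.density_unique_iff[OF sigma_finite_lborel, of f "%_. 1"] by simp
 thus ?thesis
 proof eventually_elim
  case (elim t)
  hence "1 + u t/(D + 1) = 1" using pos[of t] by (simp add: f_def flip: ennreal_1)
  thus ?case using D by simp
 qed
qed

section \<open>The difference of two weak solutions\<close>

definition loc_bounded :: "(real \<times> real => real) => bool" where
 "loc_bounded u \<longleftrightarrow> u : borel_measurable borel & (ALL R. EX D. ALL s z. abs z <= R --> abs(u (s, z)) <= D)"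

lemma loc_boundedI:
 assumes "u : borel_measurable borel" "!!z. abs(u z) <= D"
 shows "loc_bounded u" using assms unfolding loc_bounded_def by blast

lemma loc_bounded_continuous:
 assumes c: "continuous_on strip w" and o: "!!z. z ~: strip ==> w z = 0" and m: "w : borel_measurable borel"
 shows "loc_bounded w" unfolding loc_bounded_def
proof (intro conjI allI m)
 fix R :: real
 have "bounded (w ` ({0..1} \<times> {-R..R}))"
  by (intro compact_imp_bounded compact_continuous_image continuous_on_subset[OF c] compact_Times) auto
 then obtain D where D: "ALL x:w ` ({0..1} \<times> {-R..R}). norm x <= D" unfolding bounded_iff by blast
 have "abs(w (s, z)) <= abs D" if "abs z <= R" for s z
 proof (cases "s : {0..1}")
  case True
  hence "norm (w (s, z)) <= D" using that D by (intro bspec[OF D] imageI) (auto simp: abs_le_iff)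
  thus ?thesis by simp
 next
  case False
  thus ?thesis using o[of "(s, z)"] by auto
 qed
 thus "EX D. ALL s z. abs z <= R --> abs(w (s, z)) <= D" by blast
qed

lemma times_test_integrable:
 assumes "loc_bounded u" "test_function ph"
 shows "integrable lborel (%z. u z*ph z)"
proof (rule test_function_times_integrable[OF assms(2)])
 fix R :: real assume "R > 0"
 obtain D where "!!s z. abs z <= R ==> abs(u (s, z)) <= D" using assms(1) unfolding loc_bounded_def by blast
 hence "AE z in lborel. z : {0..1} \<times> {-R..R} --> abs(u z) <= D" by (auto simp: abs_le_iff)
 thus "EX D. AE z in lborel. z : {0..1} \<times> {-R..R} --> abs(u z) <= D" by blast
qed (use assms(1) in \<open>simp add: loc_bounded_def\<close>)

lemma loc_bounded_slice:
 assumes u: "loc_bounded u" and B: "continuous_on UNIV B" "!!z. abs z > R ==> B z = 0"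
 shows "integrable lborel (%z. u (s, z)*B z)"
  and "EX D. ALL s. abs(LI z. u (s, z)*B z) <= D"
  and "(%s. LI z. u (s, z)*B z) : borel_measurable borel"
proof -
 have um: "u : borel_measurable (borel \<Otimes>\<^sub>M borel)" using u by (simp add: loc_bounded_def borel_prod)
 have um': "(%z. u (s, z)) : borel_measurable borel" for s by (rule measurable_Pair2[OF um]) simp
 have Bm: "B : borel_measurable borel" by (rule borel_measurable_continuous_onI[OF B(1)])
 obtain D where D: "!!s z. abs z <= R ==> abs(u (s, z)) <= D" using u unfolding loc_bounded_def by blast
 have iB: "integrable lborel B" by (rule integrable_compact_support[OF B])
 have pt: "abs(u (s, z)*B z) <= abs D*abs(B z)" for s z
 proof (cases "abs z <= R")
  case True
  thus ?thesis using D[OF True, of s] by (auto simp: abs_mult intro!: mult_right_mono)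
 next
  case False
  thus ?thesis using B(2)[of z] by simp
 qed
 show int: "integrable lborel (%z. u (s, z)*B z)" for s
  by (rule Bochner_Integration.integrable_bound[where f = "%z. abs D*abs(B z)"])
    (use iB pt um' Bm in \<open>auto simp: abs_mult\<close>)
 have "abs(LI z. u (s, z)*B z) <= (LI z. abs D*abs(B z))" for s
 proof -
  have "abs(LI z. u (s, z)*B z) <= (LI z. abs(u (s, z)*B z))"
   using integral_norm_bound[of lborel "%z. u (s, z)*B z"] by simp
  also have "... <= (LI z. abs D*abs(B z))" by (rule integral_mono) (use int iB pt in auto)
  finally show ?thesis .
 qed
 thus "EX D. ALL s. abs(LI z. u (s, z)*B z) <= D" by blast
 have "(%p. u p*B (snd p)) : borel_measurable (borel \<Otimes>\<^sub>M lborel)"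
 proof -
  have "u : borel_measurable (borel \<Otimes>\<^sub>M lborel)"
   using um measurable_cong_sets[OF sets_pair_measure_cong[OF refl sets_lborel] refl] by blast
  thus ?thesis using Bm by measurable
 qed
 thus "(%s. LI z. u (s, z)*B z) : borel_measurable borel"
  using lborel.borel_measurable_lebesgue_integral[of "%s z. u (s, z)*B z" borel]
  by (simp add: case_prod_unfold)
qed

text \<open>Here w is the difference of two solutions, v that of their y-derivatives and k that of
  the quadratic terms. Factoring a difference of squares bounds k by a multiple of v, so the
  nonlinear uniqueness problem becomes a linear one with terminal value 0.\<close>

locale weak_difference =
 fixes w v k :: "real \<times> real => real" and C M :: real
 assumes w_cont: "continuous_on strip w" and w_out: "!!z. z ~: strip ==> w z = 0"
  and v_out: "!!z. z ~: strip ==> v z = 0"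
  and w_meas: "w : borel_measurable borel" and v_meas: "v : borel_measurable borel"
  and k_meas: "k : borel_measurable borel"
  and v_bound: "!!z. abs(v z) <= C" and k_bound: "!!z. abs(k z) <= M*abs(v z)" and M_nonneg: "M >= 0"
  and weak_y: "!!ph. test_function ph ==> (LI z. w z*d_y ph z) = - (LI z. v z*ph z)"
  and weak_eq: "!!ph. test_function ph ==> (LI z. - w z*d_q ph z + 1/2*w z*d_y (d_y ph) z + k z*ph z) = 0"
  and terminal: "!!y. w (1, y) = 0"
begin

lemma loc_bounded_w: "loc_bounded w" using w_cont w_out w_meas by (rule loc_bounded_continuous)

lemma k_bound': "abs(k z) <= M*C"
 using k_bound[of z] mult_left_mono[OF v_bound[of z] M_nonneg] by linarith

lemma loc_bounded_v: "loc_bounded v" by (rule loc_boundedI[OF v_meas v_bound])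
lemma loc_bounded_k: "loc_bounded k" by (rule loc_boundedI[OF k_meas k_bound'])

lemma integral_times_product:
 assumes u: "loc_bounded u" and ph: "test_function (%(s, z). A s*B z)"
 shows "(LI p. u p*(case p of (s, z) => A s*B z)) = (LI s. A s*(LI z. u (s, z)*B z))"
 using integral_plane(1)[OF times_test_integrable[OF u ph]] by (simp add: mult.left_commute)

context
 fixes B B' B'' :: "real => real" and R :: real
 assumes B: "smooth1 B" and dB: "!!z. (DERIV B z :> B' z)"
  and dB': "!!z. (DERIV B' z :> B'' z)"
  and supp: "!!z. abs z > R ==> B z = 0" "!!z. abs z > R ==> B' z = 0" "!!z. abs z > R ==> B'' z = 0"
begin

lemma smooth_B: "smooth1 B'" "smooth1 B''" "continuous_on S B" "continuous_on S B'" "continuous_on S B''"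
proof -
 show *: "smooth1 B'" by (rule smooth1_deriv_unique[OF B dB])
 show **: "smooth1 B''" by (rule smooth1_deriv_unique[OF * dB'])
 show "continuous_on S B" "continuous_on S B'" "continuous_on S B''"
  using B * ** by (auto intro: smooth1_continuous)
qed

lemma slice_continuous: "continuous_on {0..1} (%s. LI z. w (s, z)*B z)"
 unfolding continuous_on_sequentially
proof (intro allI ballI impI)
 fix x :: "nat => real" and a :: real
 assume a: "a : {0..1}" and x: "(ALL n. x n : {0..1}) & x ----> a"
 obtain D where D: "!!s z. abs z <= R ==> abs(w (s, z)) <= D" using loc_bounded_w unfolding loc_bounded_def by blast
 have iB: "integrable lborel B" by (rule integrable_compact_support[OF smooth_B(3) supp(1)])
 have "(%n. LI z. w (x n, z)*B z) ----> (LI z. w (a, z)*B z)"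
 proof (rule integral_dominated_convergence[where w = "%z. abs D*abs(B z)"])
  show "integrable lborel (%z. abs D*abs(B z))" using iB by auto
  have "(%n. w (x n, z)) ----> w (a, z)" for z
  proof -
   have "(%n. (x n, z)) ----> (a, z)" using x by (intro tendsto_intros) auto
   thus ?thesis using w_cont[unfolded continuous_on_sequentially] x a by (auto simp: comp_def)
  qed
  thus "AE z in lborel. (%n. w (x n, z)*B z) ----> w (a, z)*B z"
   by (intro AE_I2 tendsto_mult tendsto_const)
  have "abs(w (x n, z)*B z) <= abs D*abs(B z)" for n z
  proof (cases "abs z <= R")
   case True
   thus ?thesis using D[OF True, of "x n"] by (auto simp: abs_mult intro!: mult_right_mono)
  next
   case False
   thus ?thesis using supp(1)[of z] by simp
  qed
  thus "AE z in lborel. norm (w (x n, z)*B z) <= abs D*abs(B z)" for n by simp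
 qed (use loc_bounded_slice(1)[OF loc_bounded_w smooth_B(3) supp(1)] in \<open>auto dest: borel_measurable_integrable\<close>)
 thus "((%s. LI z. w (s, z)*B z) \<circ> x) ----> (LI z. w (a, z)*B z)" by (simp add: comp_def)
qed

text \<open>Tested with products A(s)*B(z), the weak identity says that the defect integrates to 0
  against every A; \<open>weak_time_derivative\<close> with W = 0 turns this into vanishing
  integrals over intervals.\<close>

lemma slice_derivative:
 "AE s in lborel. (LI z. w (s, z)*B' z) = - (LI z. v (s, z)*B z)"
proof -
 define u where "u s = (LI z. w (s, z)*B' z) + (LI z. v (s, z)*B z)" for s
 note sw = loc_bounded_slice[OF loc_bounded_w smooth_B(4) supp(2)]
 note sv = loc_bounded_slice[OF loc_bounded_v smooth_B(3) supp(1)]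
 have um: "u : borel_measurable borel" unfolding u_def by (intro borel_measurable_add sw sv)
 obtain D1 D2 where D: "!!s. abs(LI z. w (s, z)*B' z) <= D1" "!!s. abs(LI z. v (s, z)*B z) <= D2"
  using sw(2) sv(2) by blast
 have ub: "abs(u s) <= D1 + D2" for s using D[of s] unfolding u_def by linarith
 have "AE s in lborel. u s = 0"
 proof (rule AE_zero_of_interval_integrals[OF um ub])
  show "u s = 0" if "s ~: {0..1}" for s using that w_out v_out by (auto simp: u_def)
  fix a b :: real assume ab: "0 <= a" "a < b" "b <= 1"
  have "0 - 0 = (LI s. indicator {a..b} s*u s)"
  proof (rule weak_time_derivative[where W = "%_. 0" and G = u and D = "D1 + D2"])
   fix A A' :: "real => real" and a b :: real
   assume A: "smooth1 A" "!!t. (DERIV A t :> A' t)" "0 < a" "b < 1"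
    "!!t. t < a | t > b ==> A t = 0"
   have t1: "test_function (%(s, z). A s*B z)"
    by (rule test_function_product[OF A(1) B A(3,4,5) supp(1)])
   have t2: "test_function (%(s, z). A s*B' z)"
    using test_function_d(2)[OF t1] d_product(2)[OF A(2) dB] by simp
   have "(LI s. A s*(LI z. w (s, z)*B' z)) = - (LI s. A s*(LI z. v (s, z)*B z))"
    using weak_y[OF t1] integral_times_product[OF loc_bounded_w t2] integral_times_product[OF loc_bounded_v t1]
    unfolding d_product(2)[OF A(2) dB] by simp
   moreover have "(LI s. A s*u s) = (LI s. A s*(LI z. w (s, z)*B' z)) + (LI s. A s*(LI z. v (s, z)*B z))"
   proof -
    have iA: "integrable lborel A" by (rule integrable_compact_support[where R = 1])
       (use A smooth1_continuous in \<open>auto simp: abs_real_def split: if_splits\<close>)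
    have "integrable lborel (%s. A s*(LI z. w (s, z)*B' z))"
     by (rule Bochner_Integration.integrable_bound[where f = "%s. A s*D1"])
       (use iA D(1) sw(3) in \<open>auto simp: abs_mult borel_measurable_integrable intro!: mult_left_mono order.trans[OF D(1) abs_ge_self]\<close>)
    moreover have "integrable lborel (%s. A s*(LI z. v (s, z)*B z))"
     by (rule Bochner_Integration.integrable_bound[where f = "%s. A s*D2"])
       (use iA D(2) sv(3) in \<open>auto simp: abs_mult borel_measurable_integrable intro!: mult_left_mono order.trans[OF D(2) abs_ge_self]\<close>)
    ultimately show ?thesis unfolding u_def by (simp add: distrib_left)
   qed
   ultimately show "(LI s. A' s*0) = (LI s. A s*u s)" by simp
  qed (use um ub ab in auto)
  thus "(LI s. indicator {a..b} s*u s) = 0" by simp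
 qed
 thus ?thesis by eventually_elim (simp add: u_def)
qed

text \<open>The same testing in time, now with the slice of w itself as the continuous function; the
  terminal condition removes the contribution at s = 1.\<close>

lemma slice_equation:
 assumes a: "0 <= a" "a <= 1"
 shows "(LI z. w (a, z)*B z) = (LI s. indicator {a..1} s * ((LI z. w (s, z)*B'' z)/2 + (LI z. k (s, z)*B z)))"
proof (cases "a = 1")
 case True
 have "AE s in lborel. indicator {1..1::real} s*((LI z. w (s, z)*B'' z)/2 + (LI z. k (s, z)*B z)) = 0"
 proof -
  have "AE s in lborel. s ~= (1::real)" by (rule AE_lborel_singleton)
  thus ?thesis by eventually_elim auto
 qed
 hence "(LI s. indicator {1..1::real} s*((LI z. w (s, z)*B'' z)/2 + (LI z. k (s, z)*B z))) = 0"
  by (rule integral_eq_zero_AE)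
 moreover have "(LI z. w (1, z)*B z) = 0" by (simp add: terminal)
 ultimately show ?thesis by (metis True)
next
 case False
 define G where "G s = (LI z. w (s, z)*B'' z)/2 + (LI z. k (s, z)*B z)" for s
 note sw0 = loc_bounded_slice[OF loc_bounded_w smooth_B(3) supp(1)]
 note sw = loc_bounded_slice[OF loc_bounded_w smooth_B(5) supp(3)]
 note sk = loc_bounded_slice[OF loc_bounded_k smooth_B(3) supp(1)]
 obtain D0 D1 D2 where D: "!!s. abs(LI z. w (s, z)*B'' z) <= D1" "!!s. abs(LI z. k (s, z)*B z) <= D2"
   "!!s. abs(LI z. w (s, z)*B z) <= D0" using sw(2) sk(2) sw0(2) by blast
 have "(LI z. w (a, z)*B z) - (LI z. w (1, z)*B z) = (LI s. indicator {a..1} s*G s)"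
 proof (rule weak_time_derivative[where D = "D1 + D2"])
  show "continuous_on {0..1} (%s. LI z. w (s, z)*B z)" by (rule slice_continuous)
  show "(%s. LI z. w (s, z)*B z) : borel_measurable borel" by (rule sw0)
  show "G : borel_measurable borel" unfolding G_def by (intro borel_measurable_add borel_measurable_divide sw sk) auto
  show "abs(G s) <= D1 + D2" for s using D(1,2)[of s] unfolding G_def by (auto simp: abs_le_iff)
  fix A A' :: "real => real" and a b :: real
  assume A: "smooth1 A" "!!t. (DERIV A t :> A' t)" "0 < a" "b < 1"
   "!!t. t < a | t > b ==> A t = 0"
  have t1: "test_function (%(s, z). A s*B z)"
   by (rule test_function_product[OF A(1) B A(3,4,5) supp(1)])
  have t2: "test_function (%(s, z). A s*B'' z)"
   using test_function_d(2)[OF test_function_d(2)[OF t1]]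
   unfolding d_product(2)[OF A(2) dB] d_product(2)[OF A(2) dB'] .
  have t3: "test_function (%(s, z). A' s*B z)"
   using test_function_d(1)[OF t1] unfolding d_product(1)[OF A(2) dB] .
  note i1 = times_test_integrable[OF loc_bounded_k t1]
  note i2 = times_test_integrable[OF loc_bounded_w t2]
  note i3 = times_test_integrable[OF loc_bounded_w t3]
  have "0 = (LI p. - (w p*(case p of (s, z) => A' s*B z)) + (1/2*(w p*(case p of (s, z) => A s*B'' z))
    + k p*(case p of (s, z) => A s*B z)))"
   using weak_eq[OF t1] unfolding d_product(1)[OF A(2) dB] d_product(2)[OF A(2) dB] d_product(2)[OF A(2) dB']
   by (simp add: algebra_simps)
  also have "... = - (LI p. w p*(case p of (s, z) => A' s*B z))
   + (1/2*(LI p. w p*(case p of (s, z) => A s*B'' z)) + (LI p. k p*(case p of (s, z) => A s*B z)))"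
   using i1 i2 i3 by simp
  also have "... = - (LI s. A' s*(LI z. w (s, z)*B z))
    + (1/2*(LI s. A s*(LI z. w (s, z)*B'' z)) + (LI s. A s*(LI z. k (s, z)*B z)))"
   by (simp only: integral_times_product[OF loc_bounded_w t3] integral_times_product[OF loc_bounded_w t2]
    integral_times_product[OF loc_bounded_k t1])
  also have "1/2*(LI s. A s*(LI z. w (s, z)*B'' z)) + (LI s. A s*(LI z. k (s, z)*B z)) = (LI s. A s*G s)"
  proof -
   have iA: "integrable lborel A" by (rule integrable_compact_support[where R = 1])
      (use A smooth1_continuous in \<open>auto simp: abs_real_def split: if_splits\<close>)
   have "integrable lborel (%s. A s*(LI z. w (s, z)*B'' z))"
    by (rule Bochner_Integration.integrable_bound[where f = "%s. A s*D1"])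
      (use iA D(1) sw(3) in \<open>auto simp: abs_mult borel_measurable_integrable intro!: mult_left_mono order.trans[OF D(1) abs_ge_self]\<close>)
   moreover have "integrable lborel (%s. A s*(LI z. k (s, z)*B z))"
    by (rule Bochner_Integration.integrable_bound[where f = "%s. A s*D2"])
      (use iA D(2) sk(3) in \<open>auto simp: abs_mult borel_measurable_integrable intro!: mult_left_mono order.trans[OF D(2) abs_ge_self]\<close>)
   ultimately show ?thesis unfolding G_def by (simp add: distrib_left)
  qed
  finally show "(LI s. A' s*(LI z. w (s, z)*B z)) = (LI s. A s*G s)" by simp
 qed (use a False in auto)
 thus ?thesis using terminal by (simp add: G_def)
qed

end

end

section \<open>The energy estimate\<close>

text \<open>Decays like the power -6: fast enough for squares of functions of linear growth to be
  integrable, yet slowly enough that the derivative is at most 3 * weight and values at distance 1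
  are comparable.\<close>

definition weight :: "real => real"
 where "weight y = 1/(1 + y^2)^3"

lemma one_plus_square: "1 <= 1 + (y::real)^2" "1 + y^2 ~= 0" "0 < 1 + y^2"
 by (simp_all add: add_pos_nonneg less_imp_neq[THEN not_sym])

lemma weight_pos: "0 < weight y" and weight_le_1: "weight y <= 1"
 using one_plus_square(1)[of y] one_plus_square(3)[of y] by (auto simp: weight_def)

lemma weight_continuous: "continuous_on S weight"
 unfolding weight_def[abs_def] by (intro continuous_intros) (simp add: one_plus_square)

lemma weight_measurable [measurable]: "weight : borel_measurable borel"
 by (rule borel_measurable_continuous_onI[OF weight_continuous])

lemma weight_derivative: "DERIV weight y :> - 6*y/(1 + y^2)^4"
proof -
 have "((%y. 1/(1 + y^2)^3) has_real_derivative
   (0*(1 + y^2)^3 - 1*(3*(1 + y^2)^2*(2*y)))/((1 + y^2)^3*(1 + y^2)^3)) (at y)"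
  by (intro DERIV_divide) (auto intro!: derivative_eq_intros simp: one_plus_square)
 moreover have "(0*(1 + y^2)^3 - 1*(3*(1 + y^2)^2*(2*y)))/((1 + y^2)^3*(1 + y^2)^3) = - 6*y/(1 + y^2)^4"
 proof -
  have "(- 6*y*T^2)/(T^3*T^3) = - 6*y/T^4" if "T ~= 0" for T :: real
   using that by (simp add: field_simps flip: power_add)
  from this[of "1 + y^2"] show ?thesis by (simp add: one_plus_square mult_ac)
 qed
 ultimately show ?thesis by (simp add: weight_def[abs_def])
qed

lemma weight_derivative_bound: "abs(- 6*y/(1 + y^2)^4) <= 3*weight y"
proof -
 have "2*abs y <= 1 + y^2" using sum_squares_bound[of 1 "abs y"] by simp
 hence "6*abs y/(1 + y^2)^4 <= 3*(1 + y^2)/(1 + y^2)^4"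
  using one_plus_square(3)[of y] by (intro divide_right_mono) auto
 also have "... = 3*weight y"
 proof -
  have "3*T/T^4 = 3*(1/T^3)" if "T ~= 0" for T :: real
   using that by (simp add: power4_eq_xxxx power3_eq_cube)
  from this[OF one_plus_square(2)[of y]] show ?thesis by (simp only: weight_def)
 qed
 finally show ?thesis using one_plus_square(3)[of y] by (simp add: abs_mult)
qed

lemma weight_compare:
 assumes "abs(y - z) <= 1"
 shows "weight y <= 27*weight z"
proof -
 have "abs z <= abs y + 1" using assms by linarith
 hence "z^2 <= (abs y + 1)^2" by (metis abs_ge_zero abs_le_square_iff abs_of_nonneg order.trans)
 also have "... = y^2 + 2*abs y + 1" by (simp add: power2_sum)
 also have "... <= 2*y^2 + 2" using sum_squares_bound[of 1 "abs y"] by simp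
 finally have "1 + z^2 <= 3*(1 + y^2)" by (simp add: algebra_simps) (use zero_le_power2[of y] in linarith)
 hence "(1 + z^2)^3 <= (3*(1 + y^2))^3" by (intro power_mono) simp_all
 moreover have "(3*T)^3 = 27*T^3" for T :: real by (simp add: power_mult_distrib)
 ultimately have "(1 + z^2)^3 <= 27*(1 + y^2)^3" by (simp only:)
 thus ?thesis using one_plus_square(3)[of y] one_plus_square(3)[of z]
  by (simp add: weight_def divide_simps)
qed

lemma weight_growth: "(1 + abs y)^2*weight y <= 2/(1 + y^2)"
proof -
 have "(1 + abs y)^2 <= 2*(1 + y^2)" using sum_squares_bound[of 1 "abs y"] by (simp add: power2_sum)
 also have "... <= 2*(1 + y^2)^2"
 proof -
  have "T <= T^2" if "1 <= T" for T :: real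
   using mult_left_mono[of 1 T T] that by (simp add: power2_eq_square)
  thus ?thesis using one_plus_square(1)[of y] by (intro mult_left_mono) auto
 qed
 finally have "(1 + abs y)^2*weight y <= 2*(1 + y^2)^2*weight y"
  using weight_pos[of y] by (intro mult_right_mono) auto
 also have "... = 2/(1 + y^2)"
  using one_plus_square(2)[of y] by (simp add: weight_def power3_eq_cube power2_eq_square)
 finally show ?thesis .
qed

lemma integrable_inverse_one_plus_square: "integrable lborel (%y::real. 1/(1 + y^2))"
 using integrable_inverse_1_plus_square by (simp add: set_integrable_def inverse_eq_divide)

definition weight_mass :: real
 where "weight_mass = (LI y. 2/(1 + y^2))"

lemma weight_integrable:
 fixes f :: "real => real"
 assumes f: "f : borel_measurable borel" "!!y. abs(f y) <= D*(1 + abs y)^2"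
 shows "integrable lborel (%y. f y*weight y)" "abs(LI y. f y*weight y) <= D*weight_mass"
proof -
 have D: "0 <= D" using f(2)[of 0] by simp
 have pt: "abs(f y*weight y) <= D*(2/(1 + y^2))" for y
 proof -
  have "abs(f y*weight y) <= D*(1 + abs y)^2*weight y"
   using f(2)[of y] weight_pos[of y] by (simp add: abs_mult)
  also have "... <= D*(2/(1 + y^2))"
   unfolding mult.assoc by (rule mult_left_mono[OF weight_growth D])
  finally show ?thesis .
 qed
 have i: "integrable lborel (%y::real. D*(2/(1 + y^2)))"
  using integrable_mult_right[OF integrable_inverse_one_plus_square, of "D*2"] by simp
 show int: "integrable lborel (%y. f y*weight y)"
  by (rule Bochner_Integration.integrable_bound[OF i]) (use pt f(1) D one_plus_square(3) in \<open>auto intro!: order.trans[OF pt]\<close>)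
 have "abs(LI y. f y*weight y) <= (LI y. abs(f y*weight y))"
  using integral_norm_bound[of lborel "%y. f y*weight y"] by simp
 also have "... <= (LI y. D*(2/(1 + y^2)))" by (rule integral_mono) (use int i pt in auto)
 also have "... = D*weight_mass" unfolding weight_mass_def by (rule integral_mult_right_zero)
 finally show "abs(LI y. f y*weight y) <= D*weight_mass" .
qed

section \<open>Mollification in the space variable\<close>

lemma convolution_derivative:
 fixes f B :: "real => real"
 assumes f: "continuous_on UNIV f" and B: "!!t. (DERIV B t :> B' t)" "continuous_on UNIV B'"
  and supp: "!!t. abs t > R ==> B t = 0" "!!t. abs t > R ==> B' t = 0"
 shows "DERIV (%y. LI z. f z*B (y - z)) y :> (LI z. f z*B' (y - z))"
proof -
 define L where "L = abs y + 1 + abs R"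
 define U where "U = {y - 1<..<y + 1}"
 have cB: "continuous_on UNIV B" using B(1) by (auto intro!: continuous_at_imp_continuous_on DERIV_isCont)
 have HK: "(LI z. f z*H (t - z)) = integral (cbox (- L) L) (%z. f z*H (t - z))"
  if H: "continuous_on UNIV H" "!!t. abs t > R ==> H t = 0" and t: "t : U" for H t
 proof -
  have c: "continuous_on UNIV (%z. f z*H (t - z))"
   by (intro continuous_on_mult f continuous_on_compose2[OF H(1)] continuous_intros) auto
  have "(LI z. f z*H (t - z)) = (LINT z : {-L..L} | lborel. f z*H (t - z))"
   unfolding set_lebesgue_integral_def
  proof (rule Bochner_Integration.integral_cong[OF refl])
   fix z :: real
   show "f z*H (t - z) = indicator {-L..L} z *\<^sub>R (f z*H (t - z))"
   proof (cases "z : {-L..L}")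
    case False
    hence "abs(t - z) > R" using t by (auto simp: U_def L_def)
    thus ?thesis using H(2) False by simp
   qed simp
  qed
  also have "... = integral {-L..L} (%z. f z*H (t - z))" by (rule set_borel_integral_eq_integral(2))
     (use borel_integrable_compact[of "{-L..L}" "%z. f z*H (t - z)"] c in
      \<open>auto simp: set_integrable_def intro: continuous_on_subset\<close>)
  finally show ?thesis by simp
 qed
 have "((%t. integral (cbox (- L) L) (%z. f z*B (t - z))) has_real_derivative
   integral (cbox (- L) L) (%z. f z*B' (y - z))) (at y within U)"
 proof (rule leibniz_rule_field_derivative[where fx = "%t z. f z*B' (t - z)"])
  fix t z :: real
  have "DERIV (%t. t - z) t :> 1" by (auto intro!: derivative_eq_intros)
  from DERIV_chain2[OF B(1) this] have "DERIV (%t. B (t - z)) t :> B' (t - z)" by simp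
  thus "((%t. f z*B (t - z)) has_real_derivative f z*B' (t - z)) (at t within U)"
   by (rule has_field_derivative_at_within[OF DERIV_cmult])
  show "(%z. f z*B (t - z)) integrable_on cbox (- L) L"
   by (intro integrable_continuous continuous_on_mult continuous_on_subset[OF f]
     continuous_on_compose2[OF cB] continuous_intros) auto
 next
  show "continuous_on (U \<times> cbox (- L) L) (%(t, z). f z*B' (t - z))" unfolding case_prod_unfold
   by (intro continuous_on_mult continuous_on_compose2[OF f] continuous_on_compose2[OF B(2)] continuous_intros) auto
 qed (auto simp: U_def)
 hence "((%t. integral (cbox (- L) L) (%z. f z*B (t - z))) has_real_derivative
   integral (cbox (- L) L) (%z. f z*B' (y - z))) (at y)"
  using at_within_open[of y U] by (simp add: U_def)
 hence "((%t. LI z. f z*B (t - z)) has_real_derivative integral (cbox (- L) L) (%z. f z*B' (y - z))) (at y)"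
  by (rule has_field_derivative_transform_within_open[where S = U])
    (use HK[OF cB supp(1)] in \<open>auto simp: U_def\<close>)
 thus ?thesis using HK[OF B(2) supp(2), of y] by (simp add: U_def)
qed

text \<open>The square is a double integral over a square, split along the diagonal into two
  triangles of equal value. This is the chain rule for a function that is only absolutely
  continuous.\<close>

lemma square_of_primitive:
 fixes F :: "real => real"
 assumes F: "F : borel_measurable borel" "!!s. abs(F s) <= D"
 defines "u \<equiv> %q. LI s. indicator {q..1} s*F s"
 shows "(u q)^2 = 2*(LI s. indicator {q..1} s*(F s*u s))"
proof -
 have [measurable]: "F : borel_measurable borel" by fact
 define P where "P s t = indicator {q..1} s*indicator {q..1} t*(F s*F t)" for s t
 have iF: "integrable lborel (%s. indicator {q..1} s*F s)" for q
  by (rule integrableI_bounded_set[where A = "{q..1}" and B = D])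
    (use F in \<open>auto simp: indicator_def emeasure_lborel_Icc_eq\<close>)
 have D: "0 <= D" using F(2)[of 0] by linarith
 have bound: "abs(F s*F t) <= D*D" for s t unfolding abs_mult by (intro mult_mono F) (use D in auto)
 have iP: "integrable (lborel \<Otimes>\<^sub>M lborel) (%(s, t). P s t*H s t)"
  if [measurable]: "case_prod H : borel_measurable (borel \<Otimes>\<^sub>M borel)" and H: "!!s t. abs(H s t) <= 1" for H
 proof (rule integrableI_bounded_set[where A = "{q..1} \<times> {q..1}" and B = "D*D"])
  show "emeasure (lborel \<Otimes>\<^sub>M lborel) ({q..1} \<times> {q..1}) < \<infinity>"
   by (subst lborel.emeasure_pair_measure_Times) (auto simp: ennreal_mult_less_top emeasure_lborel_Icc_eq)
  have "abs(P s t*H s t) <= D*D" if "s : {q..1}" "t : {q..1}" for s t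
  proof -
   have "abs(F s*F t)*abs(H s t) <= D*D*1" by (intro mult_mono bound H) (use D in auto)
   thus ?thesis using that by (simp add: P_def abs_mult)
  qed
  thus "AE x in lborel \<Otimes>\<^sub>M lborel. x : {q..1} \<times> {q..1} --> norm (case x of (s, t) => P s t*H s t) <= D*D"
   by (auto intro!: AE_I2)
  show "(%(s, t). P s t*H s t) : borel_measurable (lborel \<Otimes>\<^sub>M lborel)" unfolding P_def by measurable
 qed (auto simp: P_def indicator_def)
 define H1 H2 :: "real => real => real" where "H1 s t = (if s <= t then 1 else 0)"
  and "H2 s t = (if t < s then 1 else 0)" for s t
 have [measurable]: "case_prod H1 : borel_measurable (borel \<Otimes>\<^sub>M borel)" "case_prod H2 : borel_measurable (borel \<Otimes>\<^sub>M borel)"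
  unfolding H1_def H2_def by measurable
 have i12: "integrable (lborel \<Otimes>\<^sub>M lborel) (%(s, t). P s t*H1 s t)" "integrable (lborel \<Otimes>\<^sub>M lborel) (%(s, t). P s t*H2 s t)"
  by (auto intro!: iP simp: H1_def H2_def)
 have inner1: "(LI t. P s t*H1 s t) = indicator {q..1} s*(F s*u s)" for s
 proof (cases "s : {q..1}")
  case True
  have "(LI t. P s t*H1 s t) = (LI t. F s*(indicator {s..1} t*F t))"
   by (rule Bochner_Integration.integral_cong) (use True in \<open>auto simp: P_def H1_def indicator_def\<close>)
  thus ?thesis using True by (simp add: u_def)
 qed (simp add: P_def)
 have inner2: "(LI s. P s t*H2 s t) = indicator {q..1} t*(F t*u t)" for t
 proof (cases "t : {q..1}")
  case True
  have "AE s in lborel. s ~= t" by (rule AE_lborel_singleton)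
  hence ae: "AE s in lborel. P s t*H2 s t = F t*(indicator {t..1} s*F s)"
   by eventually_elim (use True in \<open>auto simp: P_def H2_def indicator_def\<close>)
  have "(LI s. P s t*H2 s t) = (LI s. F t*(indicator {t..1} s*F s))"
   by (rule integral_cong_AE[OF _ _ ae]) (auto simp: P_def H2_def)
  thus ?thesis using True by (simp add: u_def)
 qed (simp add: P_def)
 have iP1: "integrable (lborel \<Otimes>\<^sub>M lborel) (%(s, t). P s t)" using iP[of "%_ _. 1"] by simp
 have "(u q)^2 = (LI s. LI t. P s t)"
 proof -
  have "P s t = (indicator {q..1} s*F s)*(indicator {q..1} t*F t)" for s t
   by (simp add: P_def mult_ac)
  hence "(LI t. P s t) = (indicator {q..1} s*F s)*u q" for s
   unfolding u_def by (simp only: integral_mult_right_zero)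
  hence "(LI s. LI t. P s t) = u q*u q" unfolding u_def by (simp only: integral_mult_left_zero)
  thus ?thesis by (simp add: power2_eq_square)
 qed
 also have "... = (LINT x|(lborel \<Otimes>\<^sub>M lborel). (case x of (s, t) => P s t))"
  using lborel_pair.integral_fst'[OF iP1] by simp
 also have "... = (LINT x|(lborel \<Otimes>\<^sub>M lborel). (case x of (s, t) => P s t*H1 s t) + (case x of (s, t) => P s t*H2 s t))"
  by (rule Bochner_Integration.integral_cong) (auto simp: H1_def H2_def)
 also have "... = (LINT x|(lborel \<Otimes>\<^sub>M lborel). (case x of (s, t) => P s t*H1 s t))
   + (LINT x|(lborel \<Otimes>\<^sub>M lborel). (case x of (s, t) => P s t*H2 s t))"
  by (rule Bochner_Integration.integral_add[OF i12])
 also have "(LINT x|(lborel \<Otimes>\<^sub>M lborel). (case x of (s, t) => P s t*H1 s t)) = (LI s. indicator {q..1} s*(F s*u s))"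
  using lborel_pair.integral_fst'[OF i12(1)] by (simp add: inner1)
 also have "(LINT x|(lborel \<Otimes>\<^sub>M lborel). (case x of (s, t) => P s t*H2 s t)) = (LI s. indicator {q..1} s*(F s*u s))"
  using lborel_pair.integral_snd[OF i12(2)] by (simp add: inner2)
 finally show ?thesis by simp
qed

lemma smooth1_deriv:
 assumes "smooth1 f"
 shows "DERIV f t :> deriv f t" "smooth1 (deriv f)"
proof -
 obtain f' where f': "!!t. (DERIV f t :> f' t)" "smooth1 f'"
  using smooth1_derivative[OF assms] by blast
 have "deriv f = f'" using f'(1) by (auto intro!: DERIV_imp_deriv)
 thus "DERIV f t :> deriv f t" "smooth1 (deriv f)" using f' by auto
qed

lemma deriv_zero_outside:
 assumes "!!t. abs t > R ==> f t = 0" "abs t > R"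
 shows "deriv f t = (0 :: real)"
proof -
 have "open {t. abs t > R}" by (intro open_Collect_less continuous_intros)
 hence "DERIV f t :> 0"
  by (rule has_field_derivative_transform_within_open[OF DERIV_const[where k = 0]])
    (use assms in auto)
 thus ?thesis by (rule DERIV_imp_deriv)
qed

definition moll1 :: "real => real => real" where "moll1 e = deriv (moll e)"
definition moll2 :: "real => real => real" where "moll2 e = deriv (moll1 e)"

lemma moll_derivatives:
 "DERIV (moll e) t :> moll1 e t" "DERIV (moll1 e) t :> moll2 e t"
 "smooth1 (moll1 e)" "smooth1 (moll2 e)"
proof -
 show s1: "smooth1 (moll1 e)" unfolding moll1_def by (intro smooth1_deriv(2) smooth1_moll)
 show "smooth1 (moll2 e)" unfolding moll2_def by (intro smooth1_deriv(2) s1)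
 show "DERIV (moll e) t :> moll1 e t" unfolding moll1_def by (intro smooth1_deriv(1) smooth1_moll)
 show "DERIV (moll1 e) t :> moll2 e t" unfolding moll2_def by (intro smooth1_deriv(1) s1)
qed

lemma moll_continuous: "continuous_on S (moll e)" "continuous_on S (moll1 e)" "continuous_on S (moll2 e)"
 by (intro smooth1_continuous smooth1_moll moll_derivatives)+

lemma moll_support:
 assumes "e > 0" "abs t > e"
 shows "moll e t = 0" "moll1 e t = 0" "moll2 e t = 0"
proof -
 have 0: "moll e t = 0" if "abs t > e" for t using moll(2)[OF assms(1), of t] that by simp
 have 1: "moll1 e t = 0" if "abs t > e" for t unfolding moll1_def by (rule deriv_zero_outside[OF 0 that])
 show "moll e t = 0" "moll1 e t = 0" by (intro 0 1 assms)+
 show "moll2 e t = 0" unfolding moll2_def by (rule deriv_zero_outside[OF 1 assms(2)])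
qed

text \<open>Mollifies in space only, so that in time the equation stays an integral identity on all
  of [0, 1], the terminal time included.\<close>

definition cv :: "(real \<times> real => real) => (real => real) => real => real => real"
 where "cv u B s y = (LI z. u (s, z)*B (y - z))"

lemma loc_bounded_pair_measurable:
 assumes "loc_bounded u"
 shows "u : borel_measurable (borel \<Otimes>\<^sub>M borel)" "(%z. u (s, z)) : borel_measurable borel"
proof -
 show um: "u : borel_measurable (borel \<Otimes>\<^sub>M borel)" using assms by (simp add: loc_bounded_def borel_prod)
 show "(%z. u (s, z)) : borel_measurable borel" by (rule measurable_Pair2[OF um]) simp
qed

lemma reflect_support:
 fixes B :: "real => real"
 assumes "!!t. abs t > R ==> B t = (0 :: real)" "abs z > abs y + R"
 shows "B (y - z) = 0" using assms(2) by (intro assms(1)) linarith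

lemma cv_integrable:
 assumes u: "loc_bounded u" and B: "continuous_on UNIV B" "!!t. abs t > R ==> B t = 0"
 shows "integrable lborel (%z. u (s, z)*B (y - z))"
proof (rule loc_bounded_slice(1)[OF u])
 show "continuous_on UNIV (%z. B (y - z))"
  by (intro continuous_on_compose2[OF B(1)] continuous_intros) auto
 show "B (y - z) = 0" if "abs z > abs y + R" for z by (rule reflect_support[OF B(2) that])
qed

lemma cv_measurable:
 assumes u: "loc_bounded u" and B: "continuous_on UNIV B"
 shows "(%p. cv u B (fst p) (snd p)) : borel_measurable (borel \<Otimes>\<^sub>M borel)"
proof -
 note [measurable] = loc_bounded_pair_measurable(1)[OF u] borel_measurable_continuous_onI[OF B]
 have "(%(p, z). u (fst p, z)*B (snd p - z)) : borel_measurable ((borel \<Otimes>\<^sub>M borel) \<Otimes>\<^sub>M lborel)"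
  by measurable
 thus ?thesis unfolding cv_def
  using lborel.borel_measurable_lebesgue_integral[of "%p z. u (fst p, z)*B (snd p - z)" "borel \<Otimes>\<^sub>M borel"] by simp
qed

lemma cv_measurable2:
 assumes "loc_bounded u" "continuous_on UNIV B"
 shows "cv u B s : borel_measurable borel" "(%s. cv u B s y) : borel_measurable borel"
proof -
 have "(%y. (s, y)) : borel \<rightarrow>\<^sub>M borel \<Otimes>\<^sub>M borel" "(%s. (s, y)) : borel \<rightarrow>\<^sub>M borel \<Otimes>\<^sub>M borel" by measurable
 from measurable_compose[OF this(1) cv_measurable[OF assms]] measurable_compose[OF this(2) cv_measurable[OF assms]]
 show "cv u B s : borel_measurable borel" "(%s. cv u B s y) : borel_measurable borel" by auto
qed

lemma cv_bound:
 assumes u: "loc_bounded u" and B: "continuous_on UNIV B" "!!t. abs t > R ==> B t = 0"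
  and b: "!!z. abs(u (s, z)) <= D*(1 + abs z)" and R: "0 <= R" "R <= 1"
 shows "abs(cv u B s y) <= 2*D*(1 + abs y)*(LI t. abs(B t))"
proof -
 have D: "0 <= D" using b[of 0] by simp
 have iB: "integrable lborel (%z. B (y - z))"
 proof (rule integrable_compact_support)
  show "continuous_on UNIV (%z. B (y - z))"
   by (intro continuous_on_compose2[OF B(1)] continuous_intros) auto
  show "B (y - z) = 0" if "abs z > abs y + R" for z by (rule reflect_support[OF B(2) that])
 qed
 have pt: "abs(u (s, z)*B (y - z)) <= 2*D*(1 + abs y)*abs(B (y - z))" for z
 proof (cases "abs(y - z) <= R")
  case True
  hence "1 + abs z <= 2*(1 + abs y)"
   using R abs_triangle_ineq2[of z y] abs_minus_commute[of z y] abs_ge_zero[of y] unfolding distrib_left by linarith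
  hence "D*(1 + abs z) <= D*(2*(1 + abs y))" by (rule mult_left_mono[OF _ D])
  hence "abs(u (s, z)) <= 2*D*(1 + abs y)" using b[of z] by (simp add: mult_ac)
  thus ?thesis by (simp add: abs_mult mult_right_mono)
 next
  case False
  thus ?thesis using B(2)[of "y - z"] by simp
 qed
 have "abs(cv u B s y) <= (LI z. abs(u (s, z)*B (y - z)))"
  unfolding cv_def using integral_norm_bound[of lborel "%z. u (s, z)*B (y - z)"] by simp
 also have "... <= (LI z. 2*D*(1 + abs y)*abs(B (y - z)))"
  by (rule integral_mono) (use cv_integrable[OF u B] iB pt in auto)
 also have "... = 2*D*(1 + abs y)*(LI z. abs(B (y - z)))" by (rule integral_mult_right_zero)
 also have "(LI z. abs(B (y - z))) = (LI t. abs(B t))"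
  using lborel_integral_real_affine[of "-1" "%t. abs(B t)" y] by simp
 finally show ?thesis .
qed

lemma moll_mass: "e > 0 ==> (LI t. abs(moll e t)) = 1" using moll(1,5)[of e] by simp

lemma cv_tendsto:
 assumes u: "(%z. u (s, z)) : borel_measurable borel" "isCont (%z. u (s, z)) y"
  and e: "!!n. e n > 0" "e ----> 0"
 shows "(%n. cv u (moll (e n)) s y) ----> u (s, y)"
proof -
 have i: "integrable lborel (%z. moll (e n) (y - z))" "(LI z. moll (e n) (y - z)) = 1" for n :: nat
  using lborel_integrable_real_affine[of "moll (e n)" "-1" y] moll(4)[OF e(1), of n]
   lborel_integral_real_affine[of "-1" "moll (e n)" y] moll(5)[OF e(1)] by auto
 have "(%n. LI z. moll (e n) (y - z)*u (s, z)) ----> u (s, y)"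
 proof (rule approximate_identity[where S = UNIV and de = e and W = "%z. u (s, z)"])
  show "t : UNIV & abs(t - y) <= e n" if "moll (e n) (y - t) ~= 0" for n t
   using moll(2)[OF e(1), of n "y - t"] that
   by (cases "e n <= abs(y - t)") (auto simp: abs_minus_commute)
 qed (use i u e moll(1)[OF e(1)] in auto)
 thus ?thesis unfolding cv_def by (simp add: mult.commute)
qed

lemma (in weak_difference) w_slice_continuous: "continuous_on UNIV (%z. w (s, z))"
proof (cases "s : {0..1}")
 case True
 thus ?thesis by (intro continuous_on_compose2[OF w_cont] continuous_intros) auto
next
 case False
 hence "w (s, z) = 0" for z using w_out[of "(s, z)"] by auto
 thus ?thesis by simp
qed

context weak_difference
begin

context
 fixes e :: real
 assumes e: "0 < e" "e <= 1"
begin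

lemma cv_w_derivative:
 "DERIV (%y. cv w (moll e) s y) y :> cv w (moll1 e) s y"
 "DERIV (%y. cv w (moll1 e) s y) y :> cv w (moll2 e) s y" unfolding cv_def
 by (rule convolution_derivative[where R = e]; intro w_slice_continuous moll_derivatives moll_continuous moll_support e; assumption)+

text \<open>These are the slice identities for B(z) = moll e (y - z); each z-derivative flips a
  sign. The third derivative of the mollifier occurs because continuity in time of the first
  derivative comes from the slice lemma applied to \<open>moll1\<close>.\<close>

lemma cv_slice:
 "AE s in lborel. cv w (moll1 e) s y = cv v (moll e) s y" (is ?A)
 "0 <= a ==> a <= 1 ==> cv w (moll e) a y = (LI s. indicator {a..1} s*(cv w (moll2 e) s y/2 + cv k (moll e) s y))"
 "continuous_on {0..1} (%s. cv w (moll1 e) s y)" (is ?C)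
proof -
 have refl: "smooth1 (%z. c*B (y - z))" if "smooth1 B" for B c
  using smooth1_affine[OF that, of c "-1" y] by simp
 have dd: "DERIV (%z. c*B (y - z)) z :> (- c)*B' (y - z)"
  if B: "!!t. (DERIV B t :> B' t)" for B B' c z
 proof -
  have "DERIV (%z. y - z) z :> -1" by (auto intro!: derivative_eq_intros)
  from DERIV_cmult[OF DERIV_chain2[OF B this], of c] show ?thesis by simp
 qed
 note ms = moll_support[OF e(1)]
 obtain B3 where B3: "!!t. (DERIV (moll2 e) t :> B3 t)"
  using smooth1_derivative[OF moll_derivatives(4)] by blast
 have B3': "B3 t = 0" if "abs t > e" for t
  using deriv_zero_outside[OF ms(3) that] DERIV_imp_deriv[OF B3, of t] by simp
 have sm: "smooth1 (%z. 1*moll e (y - z))" "smooth1 (%z. 1*moll1 e (y - z))"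
  by (intro refl smooth1_moll moll_derivatives)+
 have d0: "DERIV (%z. 1*moll e (y - z)) z :> - 1*moll1 e (y - z)"
  and d1: "DERIV (%z. - 1*moll1 e (y - z)) z :> moll2 e (y - z)"
  and d1': "DERIV (%z. 1*moll1 e (y - z)) z :> - 1*moll2 e (y - z)"
  and d2: "DERIV (%z. - 1*moll2 e (y - z)) z :> B3 (y - z)" for z
  using dd[where B = "moll e" and c = 1, OF moll_derivatives(1)] dd[where B = "moll1 e" and c = "-1", OF moll_derivatives(2)]
   dd[where B = "moll1 e" and c = 1, OF moll_derivatives(2)] dd[where B = "moll2 e" and c = "-1", OF B3] by simp_all
 have t: "1*moll e (y - z) = 0" "- 1*moll1 e (y - z) = 0" "1*moll1 e (y - z) = 0"
  "moll2 e (y - z) = 0" "- 1*moll2 e (y - z) = 0" "B3 (y - z) = 0" if "abs z > abs y + e" for z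
 proof -
  have "abs(y - z) > e" using that by linarith
  thus "1*moll e (y - z) = 0" "- 1*moll1 e (y - z) = 0" "1*moll1 e (y - z) = 0"
   "moll2 e (y - z) = 0" "- 1*moll2 e (y - z) = 0" "B3 (y - z) = 0" using ms B3' by simp_all
 qed
 have "AE s in lborel. (LI z. w (s, z)*(- 1*moll1 e (y - z))) = - (LI z. v (s, z)*(1*moll e (y - z)))"
  by (rule slice_derivative[OF sm(1) d0 d1 t(1,2,4)])
 thus ?A by eventually_elim (simp add: cv_def)
 show "cv w (moll e) a y = (LI s. indicator {a..1} s*(cv w (moll2 e) s y/2 + cv k (moll e) s y))"
  if a: "0 <= a" "a <= 1" using slice_equation[OF sm(1) d0 d1 t(1,2,4) a] by (simp add: cv_def)
 have "continuous_on {0..1} (%s. LI z. w (s, z)*(1*moll1 e (y - z)))"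
  by (rule slice_continuous[OF sm(2) d1' d2 t(3,5,6)])
 thus ?C by (simp add: cv_def)
qed

lemma cv_v_bound: "abs(cv v (moll e) s y) <= C"
proof -
 have "abs(cv v (moll e) s y) <= (LI z. abs(v (s, z)*moll e (y - z)))"
  unfolding cv_def using integral_norm_bound[of lborel "%z. v (s, z)*moll e (y - z)"] by simp
 also have "... <= (LI z. C*moll e (y - z))"
 proof (rule integral_mono)
  show "integrable lborel (%z. abs(v (s, z)*moll e (y - z)))"
   using cv_integrable[OF loc_bounded_v moll_continuous(1) moll_support(1)[OF e(1)]] by auto
  show "integrable lborel (%z. C*moll e (y - z))"
   using lborel_integrable_real_affine[of "moll e" "-1" y] moll(4)[OF e(1)] by auto
 qed (use v_bound moll(1)[OF e(1)] in \<open>auto simp: abs_mult intro!: mult_right_mono\<close>)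
 also have "... = C" using lborel_integral_real_affine[of "-1" "moll e" y] moll(5)[OF e(1)] by simp
 finally show ?thesis .
qed

text \<open>For almost every s the function is a mollification of v and so bounded by C. By
  continuity in s the set where the bound holds is closed, hence all of [0, 1].\<close>

lemma cv_w1_bound:
 assumes s: "0 <= s" "s <= 1"
 shows "abs(cv w (moll1 e) s y) <= C"
proof -
 define S where "S = {s : {0..1}. cv w (moll1 e) s y : {-C..C}}"
 have "S = {0..1} \<inter> (%s. cv w (moll1 e) s y) -` {-C..C}" by (auto simp: S_def)
 hence cl: "closed S" using continuous_closed_preimage[OF cv_slice(3)[of y]] by simp
 have "AE s in lebesgue. s : {0<..<1} --> s : S"
 proof -
  have "AE s in lborel. s : {0<..<1} --> s : S" using cv_slice(1)[of y]
  proof eventually_elim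
   case (elim s)
   thus ?case using cv_v_bound[of s y] unfolding S_def by (simp only: abs_le_iff) auto
  qed
  thus ?thesis by (rule AE_completion)
 qed
 hence "x : S" if "x : {0<..<1}" for x
  using mem_closed_if_AE_lebesgue_open[OF open_greaterThanLessThan cl _ that] by blast
 hence "{0<..<1} <= S" by blast
 hence "closure {0<..<1} <= S" using cl by (rule closure_minimal)
 hence "s : S" using s closure_greaterThanLessThan[of 0 "1::real"] by auto
 hence "- C <= cv w (moll1 e) s y" "cv w (moll1 e) s y <= C" by (simp_all add: S_def)
 thus ?thesis by linarith
qed

end

text \<open>The bound on the weak derivative holds for all mollifications and so becomes a Lipschitz
  bound in the limit. The linear growth that follows makes the weighted energy finite.\<close>

lemma w_lipschitz: "abs(w (s, y) - w (s, y')) <= C*abs(y - y')"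
proof (cases "s : {0..1}")
 case True
 define e where "e n = 1/(real n + 1)" for n
 have e: "0 < e n" "e n <= 1" "e ----> 0" for n
 proof -
  show "e ----> 0" unfolding e_def by real_asymp
 qed (auto simp: e_def)
 have lim: "(%n. cv w (moll (e n)) s y) ----> w (s, y)" for y
  by (rule cv_tendsto[OF loc_bounded_pair_measurable(2)[OF loc_bounded_w] _ e(1,3)])
    (use w_slice_continuous in \<open>auto simp: continuous_on_eq_continuous_at\<close>)
 have "abs(cv w (moll (e n)) s y - cv w (moll (e n)) s y') <= C*abs(y - y')" for n
  using field_differentiable_bound[of UNIV "cv w (moll (e n)) s" "cv w (moll1 (e n)) s" C y y'] True
   cv_w_derivative(1)[OF e(1,2)] cv_w1_bound[OF e(1,2)] by simp
 thus ?thesis by (intro LIMSEQ_le_const2[OF tendsto_rabs[OF tendsto_diff[OF lim lim]]]) auto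
next
 case False
 hence "w (s, z) = 0" for z using w_out[of "(s, z)"] by auto
 moreover have "0 <= C" using v_bound[of undefined] by linarith
 ultimately show ?thesis by simp
qed

lemma w_growth: "EX D. ALL s y. abs(w (s, y)) <= D*(1 + abs y)"
proof -
 obtain D0 where D0: "!!s z. abs z <= 0 ==> abs(w (s, z)) <= D0" using loc_bounded_w unfolding loc_bounded_def by blast
 have C: "0 <= C" using v_bound[of undefined] by linarith
 have D0': "0 <= D0" using D0[of 0 0] by linarith
 have "abs(w (s, y)) <= (D0 + C)*(1 + abs y)" for s y
 proof -
  have "abs(w (s, y)) <= D0 + C*abs y" using D0[of 0 s] w_lipschitz[of s y 0] by simp
  also have "... <= (D0 + C)*(1 + abs y)" using C D0' by (simp add: algebra_simps)
  finally show ?thesis .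
 qed
 thus ?thesis by blast
qed

end

section \<open>Weighted energy of the mollified difference\<close>

lemma integral_zero_of_decay:
 fixes F :: "real => real"
 assumes F: "!!y. (DERIV F y :> F' y)" "continuous_on UNIV F'" "integrable lborel F'"
  and b: "!!y. abs(F y) <= D/(1 + y^2)"
 shows "(LI y. F' y) = 0"
proof -
 have z: "((%y. D/(1 + y^2)) \<longlongrightarrow> 0) at_top" "((%y. D/(1 + y^2)) \<longlongrightarrow> 0) at_bot" by real_asymp+
 have l: "(F \<longlongrightarrow> 0) at_top" "(F \<longlongrightarrow> 0) at_bot"
  by (rule Lim_null_comparison[OF _ z(1)], use b in simp, rule Lim_null_comparison[OF _ z(2)], use b in simp)
 have "(LBINT y=-\<infinity>..\<infinity>. F' y) = 0 - 0"
 proof (rule interval_integral_FTC_integrable[where F = F])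
  show "(F has_vector_derivative F' y) (at y)" for y
   using F(1) by (simp add: has_real_derivative_iff_has_vector_derivative)
  show "isCont F' y" for y using F(2) by (simp add: continuous_on_eq_continuous_at)
  show "set_integrable lborel (einterval (- \<infinity>) \<infinity>) F'" using F(3) by (simp add: set_integrable_def)
  show "((F \<circ> real_of_ereal) \<longlongrightarrow> 0) (at_right (- \<infinity>))" "((F \<circ> real_of_ereal) \<longlongrightarrow> 0) (at_left \<infinity>)"
   using l by (simp_all add: ereal_tendsto_simps)
 qed simp
 thus ?thesis by (simp add: interval_lebesgue_integral_def set_lebesgue_integral_def)
qed

text \<open>As u is only bounded and measurable, Fubini moves the mollifier onto the continuous h,
  where it converges pointwise. \<open>weight_compare\<close> supplies the dominating
  function.\<close>

lemma mollified_pairing: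
 fixes u h :: "real => real"
 assumes u: "u : borel_measurable borel" "!!z. abs(u z) <= D"
  and h: "continuous_on UNIV h" "!!y. abs(h y) <= Bh*weight y"
  and e: "!!n. 0 < e n" "!!n. e n <= 1" "e ----> 0"
 shows "(%n. LI y. (LI z. u z*moll (e n) (y - z))*h y) ----> (LI z. u z*h z)"
proof -
 have D: "0 <= D" using u(2)[of 0] by linarith
 have Bh: "0 <= Bh"
 proof -
  have "0 <= Bh*weight 0" using h(2)[of 0] by linarith
  thus ?thesis using weight_pos[of 0] by (simp add: zero_le_mult_iff)
 qed
 have hm [measurable]: "h : borel_measurable borel" by (rule borel_measurable_continuous_onI[OF h(1)])
 have [measurable]: "u : borel_measurable borel" by (rule u(1))
 have iw: "integrable lborel weight"
  using weight_integrable(1)[of "%_. 1" 1] by (simp add: power2_eq_square algebra_simps)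
 have ih: "integrable lborel h"
  by (rule Bochner_Integration.integrable_bound[OF integrable_mult_right[OF iw, of Bh]])
    (use h(2) order.trans[OF h(2) abs_ge_self] in auto)
 have im: "integrable lborel (%z. moll (e n) (y - z))" "(LI z. moll (e n) (y - z)) = 1" for n y
  using lborel_integrable_real_affine[of "moll (e n)" "-1" y] moll(4)[OF e(1), of n]
   lborel_integral_real_affine[of "-1" "moll (e n)" y] moll(5)[OF e(1), of n] by auto
 have im': "integrable lborel (%y. moll (e n) (y - z))" "(LI y. moll (e n) (y - z)) = 1" for n z
  using integrable_shift[OF moll(4)[OF e(1)], of n z] moll(5)[OF e(1), of n] by auto
 have iP: "integrable (lborel \<Otimes>\<^sub>M lborel) (%(y, z). u z*moll (e n) (y - z)*h y)" for n
 proof (rule lborel_pair.Fubini_integrable)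
  show "(%(y, z). u z*moll (e n) (y - z)*h y) : borel_measurable (lborel \<Otimes>\<^sub>M lborel)" by measurable
  have i: "integrable lborel (%z. u z*moll (e n) (y - z)*h y)" for y
  proof -
   have "integrable lborel (%z. u z*moll (e n) (y - z))"
    by (rule Bochner_Integration.integrable_bound[OF integrable_mult_right[OF im(1)[of n y], of D]])
      (use u moll(1)[OF e(1)] D in \<open>auto simp: abs_mult intro!: mult_right_mono\<close>)
   thus ?thesis by (rule integrable_mult_left)
  qed
  thus "AE y in lborel. integrable lborel (%z. case (y, z) of (y, z) => u z*moll (e n) (y - z)*h y)"
   by simp
  show "integrable lborel (%y. LI z. norm (case (y, z) of (y, z) => u z*moll (e n) (y - z)*h y))"
  proof (rule Bochner_Integration.integrable_bound[OF integrable_mult_right[OF ih, of D]])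
   show "AE y in lborel. norm (LI z. norm (case (y, z) of (y, z) => u z*moll (e n) (y - z)*h y)) <= norm (D*h y)"
   proof (rule AE_I2)
    fix y
    have "(LI z. abs(u z*moll (e n) (y - z)*h y)) <= (LI z. D*abs(h y)*moll (e n) (y - z))"
    proof (rule integral_mono)
     fix z
     have "abs(u z)*(moll (e n) (y - z)*abs(h y)) <= D*(moll (e n) (y - z)*abs(h y))"
      using u(2)[of z] moll(1)[OF e(1)] by (intro mult_right_mono) auto
     thus "abs(u z*moll (e n) (y - z)*h y) <= D*abs(h y)*moll (e n) (y - z)"
      using moll(1)[OF e(1), of n "y - z"] by (simp add: abs_mult mult_ac)
    qed (use i im(1) in auto)
    also have "... = D*abs(h y)" using im(2) by simp
    finally show "norm (LI z. norm (case (y, z) of (y, z) => u z*moll (e n) (y - z)*h y)) <= norm (D*h y)"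
     using D by (simp add: abs_mult)
   qed
  qed measurable
 qed
 define p where "p n z = (LI y. moll (e n) (y - z)*h y)" for n z
 have pm: "p n : borel_measurable borel" for n unfolding p_def by measurable
 have swap: "(LI y. (LI z. u z*moll (e n) (y - z))*h y) = (LI z. u z*p n z)" for n
 proof -
  have "(LI y. (LI z. u z*moll (e n) (y - z))*h y) = (LI y. LI z. u z*moll (e n) (y - z)*h y)" by simp
  also have "... = (LI z. LI y. u z*moll (e n) (y - z)*h y)"
   using lborel_pair.Fubini_integral[of "%z y. u y*moll (e n) (z - y)*h z"] iP[of n] by simp
  also have "... = (LI z. u z*p n z)" unfolding p_def by (simp add: mult.assoc)
  finally show ?thesis .
 qed
 have pt: "p n z <= 27*Bh*weight z & - p n z <= 27*Bh*weight z" for n z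
 proof -
  have b: "abs(moll (e n) (y - z)*h y) <= 27*Bh*weight z*moll (e n) (y - z)" for y
  proof (cases "abs(y - z) <= 1")
   case True
   have "abs(h y) <= Bh*(27*weight z)"
    using h(2)[of y] mult_left_mono[OF weight_compare[OF True] Bh] by linarith
   hence "moll (e n) (y - z)*abs(h y) <= moll (e n) (y - z)*(Bh*(27*weight z))"
    by (intro mult_left_mono moll(1)[OF e(1)])
   thus ?thesis using moll(1)[OF e(1), of n "y - z"] by (simp add: abs_mult mult_ac)
  next
   case False
   thus ?thesis using moll(2)[OF e(1), of n "y - z"] e(2)[of n] by simp
  qed
  have i0: "integrable lborel (%y. 27*Bh*weight z*moll (e n) (y - z))" using im'(1) by auto
  have i1: "integrable lborel (%y. moll (e n) (y - z)*h y)"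
   by (rule Bochner_Integration.integrable_bound[OF i0]) (use b order.trans[OF b abs_ge_self] in auto)
  have "abs(p n z) <= (LI y. abs(moll (e n) (y - z)*h y))"
   unfolding p_def using integral_norm_bound[of lborel "%y. moll (e n) (y - z)*h y"] by simp
  also have "... <= (LI y. 27*Bh*weight z*moll (e n) (y - z))"
   by (rule integral_mono) (use i0 i1 b in auto)
  also have "... = 27*Bh*weight z" using im'(2) by simp
  finally show ?thesis by linarith
 qed
 have plim: "(%n. p n z) ----> h z" for z unfolding p_def
 proof (rule approximate_identity[where S = UNIV and de = e])
  show "t : UNIV & abs(t - z) <= e n" if "moll (e n) (t - z) ~= 0" for n t
   using moll(2)[OF e(1), of n "t - z"] that by (cases "e n <= abs(t - z)") auto
 qed (use im' e moll(1)[OF e(1)] h hm in \<open>auto simp: continuous_on_eq_continuous_at\<close>)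
 have "(%n. LI z. u z*p n z) ----> (LI z. u z*h z)"
 proof (rule integral_dominated_convergence[where w = "%z. (D*(27*Bh))*weight z"])
  show "integrable lborel (%z. (D*(27*Bh))*weight z)" using iw by auto
  show "AE z in lborel. (%n. u z*p n z) ----> u z*h z" by (intro AE_I2 tendsto_mult tendsto_const plim)
  have "abs(u z*p n z) <= (D*(27*Bh))*weight z" for n z
  proof -
   have "abs(u z)*abs(p n z) <= D*(27*Bh*weight z)"
    by (intro mult_mono u(2)) (use pt[of n z] D in auto)
   thus ?thesis by (simp add: abs_mult mult_ac)
  qed
  thus "AE z in lborel. norm (u z*p n z) <= (D*(27*Bh))*weight z" for n by simp
 qed (use pm in measurable)
 thus ?thesis unfolding swap .
qed

lemma strip_weight_integrable:
 fixes f :: "real \<times> real => real"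
 assumes f: "f : borel_measurable (borel \<Otimes>\<^sub>M borel)" "!!s y. abs(f (s, y)) <= D*(1 + abs y)^2"
 shows "integrable (lborel \<Otimes>\<^sub>M lborel) (%(s, y). indicator {q..1} s*(f (s, y)*weight y))"
proof (rule lborel_pair.Fubini_integrable)
 note [measurable] = f(1)
 have D: "0 <= D" using f(2)[of 0 0] by simp
 have fs: "(%y. f (s, y)) : borel_measurable borel" for s by measurable
 show "(%(s, y). indicator {q..1} s*(f (s, y)*weight y)) : borel_measurable (lborel \<Otimes>\<^sub>M lborel)"
  by measurable
 have i: "integrable lborel (%y. f (s, y)*weight y)" for s by (rule weight_integrable(1)[OF fs f(2)])
 thus "AE s in lborel. integrable lborel (%y. case (s, y) of (s, y) => indicator {q..1} s*(f (s, y)*weight y))"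
  by simp
 show "integrable lborel (%s. LI y. norm (case (s, y) of (s, y) => indicator {q..1} s*(f (s, y)*weight y)))"
 proof (rule integrableI_bounded_set[where A = "{q..1}" and B = "D*weight_mass"])
  have "abs(LI y. abs(indicator {q..1} s*(f (s, y)*weight y))) <= D*weight_mass" if "s : {q..1}" for s
  proof -
   have "abs(LI y. abs(f (s, y))*weight y) <= D*weight_mass"
    using fs[of s] f(2)[of s] by (intro weight_integrable(2)) auto
   thus ?thesis using that weight_pos by (simp add: abs_mult less_imp_le)
  qed
  thus "AE s in lborel. s : {q..1} -->
    norm (LI y. norm (case (s, y) of (s, y) => indicator {q..1} s*(f (s, y)*weight y))) <= D*weight_mass"
   by (intro AE_I2) simp
  show "(%s. LI y. norm (case (s, y) of (s, y) => indicator {q..1} s*(f (s, y)*weight y))) : borel_measurable lborel"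
   by measurable
 qed (auto simp: emeasure_lborel_Icc_eq)
qed

context weak_difference
begin

definition wgrowth :: real
 where "wgrowth = (SOME D. ALL s y. abs(w (s, y)) <= D*(1 + abs y))"

lemma wgrowth: "abs(w (s, y)) <= wgrowth*(1 + abs y)"
 using someI_ex[OF w_growth] unfolding wgrowth_def by blast

lemma wgrowth_nonneg: "0 <= wgrowth" using wgrowth[of 0 0] by simp

lemma C_nonneg: "0 <= C" using v_bound[of undefined] by linarith

lemma loc_bounded_square: "loc_bounded (%z. (v z)^2)"
 using v_meas power_mono[OF v_bound abs_ge_zero, of _ 2]
 by (intro loc_boundedI[where D = "C^2"]) auto

text \<open>The term with the derivative of the weight takes 9/2, a slack of 1/2 is added, and 2*M^2
  comes from \<open>source_estimate\<close>.\<close>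

definition energy_const :: real
 where "energy_const = 5 + 2*M^2"

context
 fixes e :: real and g :: "real \<times> real => real" and Bg :: real
 assumes e: "0 < e" "e <= 1" and g: "g : borel_measurable (borel \<Otimes>\<^sub>M borel)" "!!z. abs(g z) <= Bg"
begin

abbreviation (input) "W s y \<equiv> cv w (moll e) s y"
abbreviation (input) "W1 s y \<equiv> cv w (moll1 e) s y"
abbreviation (input) "W2 s y \<equiv> cv w (moll2 e) s y"
abbreviation (input) "V s y \<equiv> cv v (moll e) s y"
abbreviation (input) "K s y \<equiv> cv k (moll e) s y"
abbreviation (input) "Q s y \<equiv> cv (%z. (v z)^2) (moll e) s y"

lemma W_bound: "abs(W s y) <= 2*wgrowth*(1 + abs y)"
 using cv_bound[OF loc_bounded_w moll_continuous(1) moll_support(1)[OF e(1)] wgrowth _ e(2)] e moll_mass[OF e(1)] by simp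

lemma W2_bound: "EX D>=0. ALL s y. abs(W2 s y) <= D*(1 + abs y)"
proof (intro exI conjI allI)
 show "0 <= 2*wgrowth*(LI t. abs(moll2 e t))" using wgrowth_nonneg by simp
 show "abs(W2 s y) <= 2*wgrowth*(LI t. abs(moll2 e t))*(1 + abs y)" for s y
 proof -
  have "abs(W2 s y) <= 2*wgrowth*(1 + abs y)*(LI t. abs(moll2 e t))"
   by (rule cv_bound[OF loc_bounded_w moll_continuous(3) moll_support(3)[OF e(1)] wgrowth _ e(2)]) (use e in auto)
  thus ?thesis by (simp only: mult.assoc mult.commute[of "1 + abs y"])
 qed
qed

lemma average_bound:
 assumes u: "loc_bounded u" "!!z. abs(u z) <= D"
 shows "abs(cv u (moll e) s y) <= D"
proof -
 have "abs(cv u (moll e) s y) <= (LI z. abs(u (s, z)*moll e (y - z)))"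
  unfolding cv_def using integral_norm_bound[of lborel "%z. u (s, z)*moll e (y - z)"] by simp
 also have "... <= (LI z. D*moll e (y - z))"
 proof (rule integral_mono)
  show "integrable lborel (%z. abs(u (s, z)*moll e (y - z)))"
   using cv_integrable[OF u(1) moll_continuous(1) moll_support(1)[OF e(1)]] by auto
  show "integrable lborel (%z. D*moll e (y - z))"
   using lborel_integrable_real_affine[of "moll e" "-1" y] moll(4)[OF e(1)] by auto
 qed (use u(2) moll(1)[OF e(1)] in \<open>auto simp: abs_mult intro!: mult_right_mono\<close>)
 also have "... = D" using lborel_integral_real_affine[of "-1" "moll e" y] moll(5)[OF e(1)] by simp
 finally show ?thesis .
qed

lemma Q_bound: "abs(Q s y) <= C^2"
 using power_mono[OF v_bound abs_ge_zero, of _ 2] by (intro average_bound loc_bounded_square) simp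

text \<open>Young's inequality is applied before averaging, so v is squared first and mollified
  afterwards. The result Q dominates the square of V rather than being dominated by it, which is why
  the dissipation cannot absorb it directly.\<close>

lemma source_estimate: "2*W s y*K s y <= 2*M^2*(W s y)^2 + Q s y/2"
proof -
 define a where "a = W s y"
 have im: "integrable lborel (%z. moll e (y - z))" "(LI z. moll e (y - z)) = 1"
  using lborel_integrable_real_affine[of "moll e" "-1" y] moll(4)[OF e(1)]
   lborel_integral_real_affine[of "-1" "moll e" y] moll(5)[OF e(1)] by auto
 note ik = cv_integrable[OF loc_bounded_k moll_continuous(1) moll_support(1)[OF e(1)], where s = s and y = y]
 note iq = cv_integrable[OF loc_bounded_square moll_continuous(1) moll_support(1)[OF e(1)], where s = s and y = y]
 have pt: "2*a * k p <= 2*M^2*a^2 + (v p)^2/2" for p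
 proof -
  have "a * k p <= abs a*abs(k p)" using abs_ge_self[of "a * k p"] by (simp only: abs_mult)
  also have "... <= abs a*(M*abs(v p))" by (intro mult_left_mono k_bound) simp
  finally have "2*a * k p <= 2*(M*abs a)*abs(v p)" by (simp add: mult_ac)
  moreover have "0 <= (2*(M*abs a) - abs(v p))^2" by simp
  ultimately show ?thesis by (simp add: power2_diff power_mult_distrib)
 qed
 have "2*a*K s y = (LI z. 2*a*(k (s, z)*moll e (y - z)))"
  unfolding cv_def by (rule integral_mult_right_zero[symmetric])
 also have "... <= (LI z. 2*M^2*a^2*moll e (y - z) + 1/2*((v (s, z))^2*moll e (y - z)))"
 proof (rule integral_mono)
  show "integrable lborel (%z. 2*a*(k (s, z)*moll e (y - z)))" by (rule integrable_mult_right[OF ik])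
  show "integrable lborel (%z. 2*M^2*a^2*moll e (y - z) + 1/2*((v (s, z))^2*moll e (y - z)))"
   by (intro Bochner_Integration.integrable_add integrable_mult_right im iq)
  show "2*a*(k (s, z)*moll e (y - z)) <= 2*M^2*a^2*moll e (y - z) + 1/2*((v (s, z))^2*moll e (y - z))" for z
   using mult_right_mono[OF pt[of "(s, z)"] moll(1)[OF e(1), of "y - z"]] by (simp add: algebra_simps)
 qed
 also have "... = 2*M^2*a^2*(LI z. moll e (y - z)) + 1/2*Q s y" unfolding cv_def
  by (simp only: Bochner_Integration.integral_add[OF integrable_mult_right[OF im(1)] integrable_mult_right[OF iq]]
    integral_mult_right_zero)
 finally show ?thesis using im(2) by (simp add: a_def)
qed

lemma W_square:
 assumes q: "0 <= q" "q <= 1"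
 shows "(W q y)^2 = (LI s. indicator {q..1} s*(W s y*(W2 s y + 2*K s y)))"
proof -
 define F where "F s = W2 s y/2 + K s y" for s
 obtain D where D: "D >= 0" "!!s y. abs(W2 s y) <= D*(1 + abs y)" using W2_bound by blast
 have Fm: "F : borel_measurable borel" unfolding F_def
  by (intro borel_measurable_add borel_measurable_divide cv_measurable2 loc_bounded_w loc_bounded_k moll_continuous) auto
 have Fb: "abs(F s) <= D*(1 + abs y) + M*C" for s
 proof -
  have "abs(K s y) <= M*C" by (rule average_bound[OF loc_bounded_k k_bound'])
  moreover have "abs(F s) <= abs(W2 s y) + abs(K s y)" unfolding F_def by (auto simp: abs_if)
  ultimately show ?thesis using D(2)[of s y] by linarith
 qed
 have u: "W s y = (LI t. indicator {s..1} t*F t)" if "s : {q..1}" for s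
  unfolding F_def by (rule cv_slice(2)[OF e]) (use that q in auto)
 have "(W q y)^2 = 2*(LI s. indicator {q..1} s*(F s*(LI t. indicator {s..1} t*F t)))"
  using square_of_primitive[OF Fm Fb, of q] u[of q] q by simp
 also have "... = 2*(LI s. indicator {q..1} s*(F s*W s y))"
  using u by (intro arg_cong[where f = "%x. 2*x"] Bochner_Integration.integral_cong) (auto simp: indicator_def)
 also have "... = (LI s. 2*(indicator {q..1} s*(F s*W s y)))"
  by (rule integral_mult_right_zero[symmetric])
 also have "... = (LI s. indicator {q..1} s*(W s y*(W2 s y + 2*K s y)))"
  by (rule Bochner_Integration.integral_cong) (auto simp: F_def algebra_simps)
 finally show ?thesis .
qed

definition weight' :: "real => real" where "weight' y = - 6*y/(1 + y^2)^4"

lemma weight': "DERIV weight y :> weight' y" "abs(weight' y) <= 3*weight y" "continuous_on S weight'"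
proof -
 show "DERIV weight y :> weight' y" "abs(weight' y) <= 3*weight y"
  using weight_derivative weight_derivative_bound by (simp_all add: weight'_def)
 show "continuous_on S weight'" unfolding weight'_def[abs_def]
  by (intro continuous_intros) (simp add: one_plus_square)
qed

lemma W_parts:
 assumes s: "s : {0..1}"
 shows "(LI y. W s y*W2 s y*weight y) = (LI y. - ((W1 s y)^2)*weight y - W s y*W1 s y*weight' y)"
  and "integrable lborel (%y. W s y*W2 s y*weight y)"
  and "integrable lborel (%y. - ((W1 s y)^2)*weight y - W s y*W1 s y*weight' y)"
proof -
 obtain D where D: "D >= 0" "!!s y. abs(W2 s y) <= D*(1 + abs y)" using W2_bound by blast
 have cW: "continuous_on UNIV (W s)" "continuous_on UNIV (W1 s)"
  using cv_w_derivative[OF e] by (auto intro!: continuous_at_imp_continuous_on DERIV_isCont)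
 have cW2: "continuous_on UNIV (W2 s)"
 proof -
  obtain B3 where B3: "!!t. (DERIV (moll2 e) t :> B3 t)" "smooth1 B3"
   using smooth1_derivative[OF moll_derivatives(4)] by blast
  have "B3 t = 0" if "abs t > e" for t
   using deriv_zero_outside[OF moll_support(3)[OF e(1)] that] DERIV_imp_deriv[OF B3(1), of t] by simp
  hence "DERIV (W2 s) y :> cv w B3 s y" for y unfolding cv_def using moll_support[OF e(1)]
   by (intro convolution_derivative[where R = e] w_slice_continuous B3 smooth1_continuous) auto
  thus ?thesis by (auto intro!: continuous_at_imp_continuous_on DERIV_isCont)
 qed
 note meas = borel_measurable_continuous_onI[OF cW(1)] borel_measurable_continuous_onI[OF cW(2)]
  borel_measurable_continuous_onI[OF cW2]
 note [measurable] = meas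
 have g0: "1 <= (1 + abs y)" "(1 + abs y) <= (1 + abs y)^2" "1 <= (1 + abs y)^2" for y :: real
  by (simp_all add: self_le_power)
 have b1: "abs(W s y*W2 s y) <= (2*wgrowth*D)*(1 + abs y)^2" for y
 proof -
  have "abs(W s y)*abs(W2 s y) <= (2*wgrowth*(1 + abs y))*(D*(1 + abs y))"
   by (intro mult_mono W_bound D) (use wgrowth_nonneg in auto)
  thus ?thesis by (simp add: abs_mult power2_eq_square mult_ac)
 qed
 have b2: "abs((W1 s y)^2) <= C^2*(1 + abs y)^2" for y
 proof -
  have "(W1 s y)^2 <= C^2" using cv_w1_bound[OF e, of s y] s by (intro abs_le_square_iff[THEN iffD1]) auto
  also have "... <= C^2*(1 + abs y)^2" using g0(3)[of y] by (intro mult_le_cancel_left1[THEN iffD2]) auto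
  finally show ?thesis by simp
 qed
 have b3': "abs(W s y*W1 s y) <= 2*wgrowth*C*(1 + abs y)^2" for y
 proof -
  have "abs(W s y)*abs(W1 s y) <= (2*wgrowth*(1 + abs y))*C"
   by (intro mult_mono W_bound cv_w1_bound[OF e]) (use s wgrowth_nonneg in auto)
  also have "... <= 2*wgrowth*C*(1 + abs y)^2"
   using mult_left_mono[OF g0(2)[of y], of "2*wgrowth*C"] wgrowth_nonneg C_nonneg by (simp add: mult_ac)
  finally show ?thesis by (simp add: abs_mult)
 qed
 show i1: "integrable lborel (%y. W s y*W2 s y*weight y)"
  by (rule weight_integrable(1)[OF _ b1]) measurable
 have i2: "integrable lborel (%y. (W1 s y)^2*weight y)"
  by (rule weight_integrable(1)[OF _ b2]) measurable
 have i3: "integrable lborel (%y. W s y*W1 s y*weight' y)"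
 proof (rule Bochner_Integration.integrable_bound)
  show "integrable lborel (%y. 3*(W s y*W1 s y*weight y))"
   by (intro integrable_mult_right weight_integrable(1)[OF _ b3']) measurable
  have "abs(W s y*W1 s y*weight' y) <= abs(3*(W s y*W1 s y*weight y))" for y
   using mult_left_mono[OF weight'(2)[of y] abs_ge_zero[of "W s y*W1 s y"]] weight_pos[of y]
   by (simp add: abs_mult mult_ac)
  thus "AE y in lborel. norm (W s y*W1 s y*weight' y) <= norm (3*(W s y*W1 s y*weight y))" by simp
  show "(%y. W s y*W1 s y*weight' y) : borel_measurable lborel"
   using borel_measurable_continuous_onI[OF weight'(3)] by measurable
 qed
 show "integrable lborel (%y. - ((W1 s y)^2)*weight y - W s y*W1 s y*weight' y)"
  using Bochner_Integration.integrable_diff[OF integrable_minus[OF i2] i3] by simp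
 have "(LI y. W s y*W2 s y*weight y + ((W1 s y)^2*weight y + W s y*W1 s y*weight' y)) = 0"
 proof (rule integral_zero_of_decay[where F = "%y. W s y*W1 s y*weight y" and D = "2*(2*wgrowth*C)"])
  show "((%y. W s y*W1 s y*weight y) has_real_derivative
    W s y*W2 s y*weight y + ((W1 s y)^2*weight y + W s y*W1 s y*weight' y)) (at y)" for y
   by (rule derivative_eq_intros cv_w_derivative[OF e] weight' refl)+ (simp add: power2_eq_square algebra_simps)
  show "continuous_on UNIV (%y. W s y*W2 s y*weight y + ((W1 s y)^2*weight y + W s y*W1 s y*weight' y))"
   by (intro continuous_intros cW cW2 weight_continuous weight')
  show "integrable lborel (%y. W s y*W2 s y*weight y + ((W1 s y)^2*weight y + W s y*W1 s y*weight' y))"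
   by (intro Bochner_Integration.integrable_add i1 i2 i3)
  show "abs(W s y*W1 s y*weight y) <= 2*(2*wgrowth*C)/(1 + y^2)" for y
  proof -
   have "abs(W s y*W1 s y*weight y) <= 2*wgrowth*C*(1 + abs y)^2*weight y"
    using mult_right_mono[OF b3'[of y], of "weight y"] weight_pos[of y] by (simp add: abs_mult)
   also have "... <= 2*wgrowth*C*(2/(1 + y^2))" unfolding mult.assoc[of "2*wgrowth*C"]
    by (rule mult_left_mono[OF weight_growth]) (use wgrowth_nonneg C_nonneg in simp)
   finally show ?thesis by simp
  qed
 qed
 hence "(LI y. W s y*W2 s y*weight y) + ((LI y. (W1 s y)^2*weight y) + (LI y. W s y*W1 s y*weight' y)) = 0"
  using i1 i2 i3 by simp
 thus "(LI y. W s y*W2 s y*weight y) = (LI y. - ((W1 s y)^2)*weight y - W s y*W1 s y*weight' y)"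
  using i2 i3 by simp
qed

text \<open>The dissipation left after Young's inequality, minus half the square of W1, is replaced
  by its affine majorant -V*g + g^2/2, as W1 = V almost everywhere. Being linear in V it passes to
  the limit of vanishing mollification, and together with Q/2 it tends to (v - g)^2/2.\<close>

definition slice_energy :: "real => real" where
 "slice_energy s = (LI y. (- V s y*g (s, y) + (g (s, y))^2/2 + energy_const*(W s y)^2 + Q s y/2)*weight y)"

lemma slice_energy_integrable:
 "integrable lborel (%y. (- V s y*g (s, y) + (g (s, y))^2/2 + energy_const*(W s y)^2 + Q s y/2)*weight y)"
 "abs(slice_energy s) <= (C*Bg + Bg^2 + energy_const*4*wgrowth^2 + C^2)*weight_mass"
proof -
 have g1: "1 <= (1 + abs y)^2" for y :: real by (simp add: self_le_power)
 have gs: "(%y. g (s, y)) : borel_measurable borel" by (rule measurable_Pair2[OF g(1)]) simp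
 note [measurable] = gs cv_measurable2(1)[OF loc_bounded_v moll_continuous(1)]
   cv_measurable2(1)[OF loc_bounded_w moll_continuous(1)] cv_measurable2(1)[OF loc_bounded_square moll_continuous(1)]
 have Bg: "0 <= Bg" using g(2)[of undefined] by linarith
 have ec: "0 <= energy_const" by (simp add: energy_const_def)
 have b: "abs(- V s y*g (s, y) + (g (s, y))^2/2 + energy_const*(W s y)^2 + Q s y/2)
  <= (C*Bg + Bg^2 + energy_const*4*wgrowth^2 + C^2)*(1 + abs y)^2" for y
 proof -
  have 1: "abs(V s y*g (s, y)) <= C*Bg*(1 + abs y)^2"
  proof -
   have "abs(V s y)*abs(g (s, y)) <= C*Bg" by (intro mult_mono cv_v_bound[OF e] g C_nonneg) simp
   also have "... <= C*Bg*(1 + abs y)^2" using mult_left_mono[OF g1[of y], of "C*Bg"] C_nonneg Bg by simp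
   finally show ?thesis by (simp add: abs_mult)
  qed
  have 2: "(g (s, y))^2 <= Bg^2*(1 + abs y)^2"
  proof -
   have "(g (s, y))^2 <= Bg^2" using power_mono[OF g(2)[of "(s, y)"] abs_ge_zero, of 2] by simp
   also have "... <= Bg^2*(1 + abs y)^2" using mult_left_mono[OF g1[of y], of "Bg^2"] by simp
   finally show ?thesis .
  qed
  have 3: "(W s y)^2 <= 4*wgrowth^2*(1 + abs y)^2"
   using power_mono[OF W_bound[of s y] abs_ge_zero, of 2] by (simp add: power_mult_distrib)
  have 4: "abs(Q s y) <= C^2*(1 + abs y)^2"
   using Q_bound[of s y] mult_left_mono[OF g1[of y], of "C^2"] by simp
  have h3: "energy_const*(W s y)^2 <= energy_const*4*wgrowth^2*(1 + abs y)^2"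
   using mult_left_mono[OF 3 ec] by (simp add: mult_ac)
  have "abs(- V s y*g (s, y) + (g (s, y))^2/2 + energy_const*(W s y)^2 + Q s y/2)
   <= abs(V s y*g (s, y)) + (g (s, y))^2 + energy_const*(W s y)^2 + abs(Q s y)"
  proof -
   have "abs(- a + b/2 + c + d/2) <= abs a + b + c + abs d" if "0 <= b" "0 <= c" for a b c d :: real
    using that by (simp add: abs_if)
   from this[of "(g (s, y))^2" "energy_const*(W s y)^2" "V s y*g (s, y)" "Q s y"] ec show ?thesis by simp
  qed
  thus ?thesis using 1 2 h3 4 by (simp only: distrib_right)
 qed
 show "integrable lborel (%y. (- V s y*g (s, y) + (g (s, y))^2/2 + energy_const*(W s y)^2 + Q s y/2)*weight y)"
  by (rule weight_integrable(1)[OF _ b]) measurable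
 show "abs(slice_energy s) <= (C*Bg + Bg^2 + energy_const*4*wgrowth^2 + C^2)*weight_mass"
  unfolding slice_energy_def by (rule weight_integrable(2)[OF _ b]) measurable
qed

end

definition energy :: "real => real"
 where "energy s = (LI y. (w (s, y))^2*weight y)"

lemma energy_inequality:
 fixes e :: real and g :: "real \<times> real => real"
 assumes e: "0 < e" "e <= 1" and g: "g : borel_measurable (borel \<Otimes>\<^sub>M borel)" "!!z. abs(g z) <= Bg"
  and q: "0 <= q" "q <= 1"
 shows "(LI y. (cv w (moll e) q y)^2*weight y) <= (LI s. indicator {q..1} s * slice_energy e g s)"
  and "integrable lborel (%s. indicator {q..1} s * slice_energy e g s)"
proof -
 let ?W = "cv w (moll e)" and ?W1 = "cv w (moll1 e)" and ?W2 = "cv w (moll2 e)" and ?V = "cv v (moll e)"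
  and ?K = "cv k (moll e)" and ?Q = "cv (%z. (v z)^2) (moll e)"
 let ?L = "%s y. (- ?V s y*g (s, y) + (g (s, y))^2/2 + energy_const*(?W s y)^2 + ?Q s y/2)*weight y"
 define f where "f p = ?W (fst p) (snd p)*(?W2 (fst p) (snd p) + 2*?K (fst p) (snd p))" for p
 note [measurable] = cv_measurable[OF loc_bounded_w moll_continuous(1)[where e = e]]
  cv_measurable[OF loc_bounded_w moll_continuous(2)[where e = e]]
  cv_measurable[OF loc_bounded_w moll_continuous(3)[where e = e]] cv_measurable[OF loc_bounded_k moll_continuous(1)[where e = e]]
  cv_measurable[OF loc_bounded_v moll_continuous(1)[where e = e]] cv_measurable[OF loc_bounded_square moll_continuous(1)[where e = e]]
  g(1)
 have fm: "f : borel_measurable (borel \<Otimes>\<^sub>M borel)" unfolding f_def by measurable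
 obtain D where D: "D >= 0" "!!s y. abs(?W2 s y) <= D*(1 + abs y)" using W2_bound[OF e g] by blast
 have fb: "abs(f (s, y)) <= (2*wgrowth*(D + 2*(M*C)))*(1 + abs y)^2" for s y
 proof -
  have MC: "0 <= M*C" using M_nonneg C_nonneg by simp
  have "abs(?K s y) <= M*C" by (rule average_bound[OF e g loc_bounded_k k_bound'])
  hence "abs(?W2 s y + 2*?K s y) <= D*(1 + abs y) + 2*(M*C)" using D(2)[of s y] by linarith
  also have "... <= (D + 2*(M*C))*(1 + abs y)" using MC by (simp add: distrib_left distrib_right)
  finally have "abs(?W s y)*abs(?W2 s y + 2*?K s y) <= (2*wgrowth*(1 + abs y))*((D + 2*(M*C))*(1 + abs y))"
   by (intro mult_mono W_bound[OF e g]) (use wgrowth_nonneg in auto)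
  thus ?thesis unfolding f_def fst_conv snd_conv abs_mult power2_eq_square by (simp only: mult_ac)
 qed
 note i = strip_weight_integrable[OF fm fb, of q]
 have "(LI y. (?W q y)^2*weight y) = (LI y. LI s. indicator {q..1} s*(f (s, y)*weight y))"
 proof (rule Bochner_Integration.integral_cong[OF refl])
  fix y :: real
  have "(?W q y)^2*weight y = (LI s. indicator {q..1} s*f (s, y))*weight y"
   using W_square[OF e g q, of y] by (simp add: f_def)
  also have "... = (LI s. indicator {q..1} s*f (s, y)*weight y)"
   by (rule integral_mult_left_zero[symmetric])
  finally show "(?W q y)^2*weight y = (LI s. indicator {q..1} s*(f (s, y)*weight y))"
   by (simp only: mult.assoc)
 qed
 also have "... = (LI s. LI y. indicator {q..1} s*(f (s, y)*weight y))"
  using lborel_pair.Fubini_integral[of "%s y. indicator {q..1} s*(f (s, y)*weight y)"] i by simp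
 finally have eq: "(LI y. (?W q y)^2*weight y) = (LI s. LI y. indicator {q..1} s*(f (s, y)*weight y))" .
 have sm: "slice_energy e g : borel_measurable borel"
 proof -
  have "(%(s, y). ?L s y) : borel_measurable (borel \<Otimes>\<^sub>M lborel)" by measurable
  thus ?thesis unfolding slice_energy_def[OF e g]
   using lborel.borel_measurable_lebesgue_integral[of ?L borel] by simp
 qed
 show ie: "integrable lborel (%s. indicator {q..1} s * slice_energy e g s)"
 proof (rule integrableI_bounded_set[where A = "{q..1}"])
  show "AE s in lborel. s : {q..1} --> norm (indicator {q..1} s * slice_energy e g s)
   <= (C*Bg + Bg^2 + energy_const*4*wgrowth^2 + C^2)*weight_mass"
   using slice_energy_integrable(2)[OF e g] by (intro AE_I2) simp
 qed (use sm in \<open>auto simp: emeasure_lborel_Icc_eq\<close>)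
 \<comment> \<open>The identity of W1 and V is known for each y and almost every s; Fubini exchanges
   the two, since each slice is integrated in y at fixed s.\<close>
 have ae: "AE s in lborel. AE y in lborel. ?W1 s y = ?V s y"
 proof (subst lborel_pair.AE_commute)
  show "{x : space (lborel \<Otimes>\<^sub>M lborel). ?W1 (fst x) (snd x) = ?V (fst x) (snd x)} : sets (lborel \<Otimes>\<^sub>M lborel)"
   by measurable
  show "AE y in lborel. AE s in lborel. ?W1 s y = ?V s y" using cv_slice(1)[OF e] by simp
 qed
 have slice: "(LI y. f (s, y)*weight y) <= slice_energy e g s"
  if s: "s : {0..1}" and a: "AE y in lborel. ?W1 s y = ?V s y" for s
 proof -
  note [measurable] = cv_measurable2(1)[OF loc_bounded_w moll_continuous(1)[where e = e]]
   cv_measurable2(1)[OF loc_bounded_k moll_continuous(1)[where e = e]]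
  note W_parts[OF e g s]
  have fs: "(%y. f (s, y)) : borel_measurable borel" using measurable_Pair2[OF fm, of s] by simp
  have if0: "integrable lborel (%y. f (s, y)*weight y)" by (rule weight_integrable(1)[OF fs fb])
  have ifk: "integrable lborel (%y. 2*?W s y*?K s y*weight y)"
   using Bochner_Integration.integrable_diff[OF if0 W_parts(2)[OF e g s]] by (simp add: f_def algebra_simps)
  have "(LI y. f (s, y)*weight y) = (LI y. ?W s y*?W2 s y*weight y + 2*?W s y*?K s y*weight y)"
   by (simp add: f_def algebra_simps)
  also have "... = (LI y. ?W s y*?W2 s y*weight y) + (LI y. 2*?W s y*?K s y*weight y)"
   by (rule Bochner_Integration.integral_add[OF W_parts(2)[OF e g s] ifk])
  also have "... = (LI y. (- ((?W1 s y)^2)*weight y - ?W s y*?W1 s y*weight' y) + 2*?W s y*?K s y*weight y)"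
   unfolding W_parts(1)[OF e g s] by (rule Bochner_Integration.integral_add[OF W_parts(3)[OF e g s] ifk, symmetric])
  also have "... <= (LI y. ?L s y)"
  proof (rule integral_mono_AE)
   show "integrable lborel (%y. (- ((?W1 s y)^2)*weight y - ?W s y*?W1 s y*weight' y) + 2*?W s y*?K s y*weight y)"
    by (intro Bochner_Integration.integrable_add W_parts(3)[OF e g s] ifk)
   show "integrable lborel (?L s)" by (rule slice_energy_integrable(1)[OF e g])
   show "AE y in lborel. (- ((?W1 s y)^2)*weight y - ?W s y*?W1 s y*weight' y) + 2*?W s y*?K s y*weight y <= ?L s y"
    using a
   proof eventually_elim
    case (elim y)
    have p: "0 < weight y" by (rule weight_pos)
    have 1: "- (?W s y*?W1 s y*weight' y) <= ((?W1 s y)^2/2 + 9/2*(?W s y)^2)*weight y"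
    proof -
     have "- (?W s y*?W1 s y*weight' y) <= abs(?W s y)*abs(?W1 s y)*abs(weight' y)"
      using abs_ge_minus_self[of "?W s y*?W1 s y*weight' y"] by (simp only: abs_mult)
     also have "... <= abs(?W s y)*abs(?W1 s y)*(3*weight y)"
      by (intro mult_left_mono weight'(2)[OF e g]) simp
     also have "... = (3*abs(?W s y)*abs(?W1 s y))*weight y" by simp
     also have "... <= ((?W1 s y)^2/2 + 9/2*(?W s y)^2)*weight y"
     proof (rule mult_right_mono)
      have "0 <= (3*abs(?W s y) - abs(?W1 s y))^2" by simp
      thus "3*abs(?W s y)*abs(?W1 s y) <= (?W1 s y)^2/2 + 9/2*(?W s y)^2"
       by (simp add: power2_diff power_mult_distrib)
     qed (use p in simp)
     finally show ?thesis .
    qed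
    have 2: "2*?W s y*?K s y*weight y <= (2*M^2*(?W s y)^2 + ?Q s y/2)*weight y"
     using mult_right_mono[OF source_estimate[OF e g, of s y], of "weight y"] p by simp
    have 3: "- ((?W1 s y)^2)/2*weight y <= (- ?W1 s y*g (s, y) + (g (s, y))^2/2)*weight y"
    proof (rule mult_right_mono)
     have "0 <= (?W1 s y - g (s, y))^2" by simp
     thus "- ((?W1 s y)^2)/2 <= - ?W1 s y*g (s, y) + (g (s, y))^2/2"
      by (simp add: power2_diff field_simps)
    qed (use p in simp)
    have 4: "0 <= 1/2*(?W s y)^2*weight y" using p by simp
    show ?case using 1 2 3 4 unfolding elim[symmetric] energy_const_def by (simp add: algebra_simps)
   qed
  qed
  finally show ?thesis unfolding slice_energy_def[OF e g] .
 qed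
 have "(LI s. LI y. indicator {q..1} s*(f (s, y)*weight y)) <= (LI s. indicator {q..1} s * slice_energy e g s)"
 proof (rule integral_mono_AE[OF _ ie])
  show "integrable lborel (%s. LI y. indicator {q..1} s*(f (s, y)*weight y))"
   using lborel_pair.integrable_fst'[OF i] by simp
  show "AE s in lborel. (LI y. indicator {q..1} s*(f (s, y)*weight y)) <= indicator {q..1} s * slice_energy e g s"
   using ae
  proof eventually_elim
   case (elim s)
   show ?case using slice[OF _ elim] q by (auto simp: indicator_def)
  qed
 qed
 thus "(LI y. (?W q y)^2*weight y) <= (LI s. indicator {q..1} s * slice_energy e g s)"
  unfolding eq .
qed

lemma energy_slice:
 "integrable lborel (%y. (w (s, y))^2*weight y)" "0 <= energy s" "energy s <= wgrowth^2*weight_mass"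
 "energy : borel_measurable borel"
proof -
 have m: "(%y. (w (s, y))^2) : borel_measurable borel"
  using loc_bounded_pair_measurable(2)[OF loc_bounded_w, of s] by measurable
 have b: "abs((w (s, y))^2) <= wgrowth^2*(1 + abs y)^2" for y
  using power_mono[OF wgrowth[of s y] abs_ge_zero, of 2] by (simp add: power_mult_distrib)
 show "integrable lborel (%y. (w (s, y))^2*weight y)" by (rule weight_integrable(1)[OF m b])
 show "0 <= energy s" unfolding energy_def using weight_pos by (intro Bochner_Integration.integral_nonneg) (simp add: less_imp_le)
 thus "energy s <= wgrowth^2*weight_mass"
  using weight_integrable(2)[OF m b] unfolding energy_def by linarith
 note [measurable] = loc_bounded_pair_measurable(1)[OF loc_bounded_w]
 have "(%(s, y). (w (s, y))^2*weight y) : borel_measurable (borel \<Otimes>\<^sub>M lborel)" by measurable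
 thus "energy : borel_measurable borel" unfolding energy_def[abs_def]
  using lborel.borel_measurable_lebesgue_integral[of "%s y. (w (s, y))^2*weight y" borel] by simp
qed

context
 fixes e :: "nat => real"
 assumes e: "!!n. 0 < e n" "!!n. e n <= 1" "e ----> 0"
begin

lemma mollified_square_bound: "(cv w (moll (e n)) s y)^2 <= 4*wgrowth^2*(1 + abs y)^2"
proof -
 have "abs(cv w (moll (e n)) s y) <= 2*wgrowth*(1 + abs y)"
  by (rule W_bound[OF e(1,2), where g = "%_. 0" and Bg = 0]) auto
 from power_mono[OF this abs_ge_zero, of 2] show ?thesis by (simp add: power_mult_distrib)
qed

lemma mollified_energy: "(%n. LI y. (cv w (moll (e n)) s y)^2*weight y) ----> energy s"
 unfolding energy_def
proof (rule integral_dominated_convergence[where w = "%y. (4*wgrowth^2*(1 + abs y)^2)*weight y"])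
 show "integrable lborel (%y. (4*wgrowth^2*(1 + abs y)^2)*weight y)"
  by (rule weight_integrable(1)[where D = "4*wgrowth^2"]) auto
 have "(%n. cv w (moll (e n)) s y) ----> w (s, y)" for y
  by (rule cv_tendsto[OF loc_bounded_pair_measurable(2)[OF loc_bounded_w] _ e(1,3)])
    (use w_slice_continuous in \<open>auto simp: continuous_on_eq_continuous_at\<close>)
 thus "AE y in lborel. (%n. (cv w (moll (e n)) s y)^2*weight y) ----> (w (s, y))^2*weight y"
  by (intro AE_I2 tendsto_intros)
 show "AE y in lborel. norm ((cv w (moll (e n)) s y)^2*weight y) <= (4*wgrowth^2*(1 + abs y)^2)*weight y" for n
 proof (rule AE_I2)
  fix y
  have "(cv w (moll (e n)) s y)^2*weight y <= (4*wgrowth^2*(1 + abs y)^2)*weight y"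
   by (rule mult_right_mono[OF mollified_square_bound less_imp_le[OF weight_pos]])
  thus "norm ((cv w (moll (e n)) s y)^2*weight y) <= (4*wgrowth^2*(1 + abs y)^2)*weight y"
   using weight_pos[of y] by (simp add: abs_mult)
 qed
qed (use cv_measurable2(1)[OF loc_bounded_w moll_continuous(1)] loc_bounded_pair_measurable(2)[OF loc_bounded_w] in measurable)

lemma energy_limit_inequality:
 fixes g :: "real \<times> real => real"
 assumes g: "continuous_on UNIV g" "!!z. abs(g z) <= Bg" and q: "0 <= q" "q <= 1"
 shows "energy q <= (LI s. indicator {q..1} s *
   (LI y. ((v (s, y) - g (s, y))^2/2 + energy_const*(w (s, y))^2)*weight y))"
proof -
 define L where "L s = (LI y. ((v (s, y) - g (s, y))^2/2 + energy_const*(w (s, y))^2)*weight y)" for s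
 have gm: "g : borel_measurable (borel \<Otimes>\<^sub>M borel)"
  using borel_measurable_continuous_onI[OF g(1)] by (simp add: borel_prod)
 have gc: "continuous_on UNIV (%y. g (s, y))" for s
  by (intro continuous_on_compose2[OF g(1)] continuous_intros) auto
 have Bg: "0 <= Bg" using g(2)[of undefined] by linarith
 have one: "1 <= (1 + abs y)^2" for y :: real by (simp add: self_le_power)
 have bounded_integrable: "integrable lborel (%y. u y*weight y)"
  if "u : borel_measurable borel" "!!y. abs(u y) <= B" for u :: "real => real" and B
 proof (rule weight_integrable(1)[OF that(1)])
  show "abs(u y) <= abs B*(1 + abs y)^2" for y
   using that(2)[of y] mult_left_mono[OF one[of y], of "abs B"] by linarith
 qed
 have lim: "(%n. slice_energy (e n) g s) ----> L s" for s
 proof -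
  have vs: "(%y. v (s, y)) : borel_measurable borel" by (rule loc_bounded_pair_measurable(2)[OF loc_bounded_v])
  have gs: "(%y. g (s, y)) : borel_measurable borel" by (rule borel_measurable_continuous_onI[OF gc])
  have l1: "(%n. LI y. cv v (moll (e n)) s y*(g (s, y)*weight y)) ----> (LI z. v (s, z)*(g (s, z)*weight z))"
   unfolding cv_def
  proof (rule mollified_pairing[OF vs v_bound _ _ e, where Bh = Bg])
   show "continuous_on UNIV (%y. g (s, y)*weight y)" by (intro continuous_on_mult gc weight_continuous)
   show "abs(g (s, y)*weight y) <= Bg*weight y" for y
    using mult_right_mono[OF g(2), of "weight y" "(s, y)"] weight_pos[of y] by (simp add: abs_mult)
  qed
  have l2: "(%n. LI y. cv (%z. (v z)^2) (moll (e n)) s y*weight y) ----> (LI z. (v (s, z))^2*weight z)"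
   unfolding cv_def
  proof (rule mollified_pairing[OF _ _ weight_continuous _ e, where Bh = 1])
   show "(%z. (v (s, z))^2) : borel_measurable borel" using vs by measurable
   show "abs((v (s, z))^2) <= C^2" for z using power_mono[OF v_bound[of "(s, z)"] abs_ge_zero, of 2] by simp
   show "abs(weight y) <= 1*weight y" for y using weight_pos[of y] by simp
  qed
  have i1: "integrable lborel (%y. cv v (moll (e n)) s y*(g (s, y)*weight y))" for n
  proof -
   have "integrable lborel (%y. (cv v (moll (e n)) s y*g (s, y))*weight y)"
   proof (rule bounded_integrable)
    show "(%y. cv v (moll (e n)) s y*g (s, y)) : borel_measurable borel"
     by (intro borel_measurable_times gs cv_measurable2(1) loc_bounded_v moll_continuous)
    show "abs(cv v (moll (e n)) s y*g (s, y)) <= C*Bg" for y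
     unfolding abs_mult by (intro mult_mono cv_v_bound[OF e(1,2)] g C_nonneg) simp
   qed
   thus ?thesis by (simp add: mult.assoc)
  qed
  have i2: "integrable lborel (%y. (g (s, y))^2*weight y)"
  proof (rule bounded_integrable)
   show "(%y. (g (s, y))^2) : borel_measurable borel" using gs by measurable
   show "abs((g (s, y))^2) <= Bg^2" for y using power_mono[OF g(2)[of "(s, y)"] abs_ge_zero, of 2] by simp
  qed
  have i3: "integrable lborel (%y. (cv w (moll (e n)) s y)^2*weight y)" for n
  proof (rule weight_integrable(1)[where D = "4*wgrowth^2"])
   show "(%y. (cv w (moll (e n)) s y)^2) : borel_measurable borel"
    using cv_measurable2(1)[OF loc_bounded_w moll_continuous(1), of "e n" s] by measurable
   show "abs((cv w (moll (e n)) s y)^2) <= 4*wgrowth^2*(1 + abs y)^2" for y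
    using mollified_square_bound by simp
  qed
  have i4: "integrable lborel (%y. cv (%z. (v z)^2) (moll (e n)) s y*weight y)" for n
   by (rule bounded_integrable[where B = "C^2"])
     (use Q_bound[OF e(1,2) gm g(2)] cv_measurable2(1)[OF loc_bounded_square moll_continuous(1)] in auto)
  have j1: "integrable lborel (%y. v (s, y)*(g (s, y)*weight y))"
  proof -
   have "integrable lborel (%y. (v (s, y)*g (s, y))*weight y)"
   proof (rule bounded_integrable)
    show "(%y. v (s, y)*g (s, y)) : borel_measurable borel" using vs gs by measurable
    show "abs(v (s, y)*g (s, y)) <= C*Bg" for y
     unfolding abs_mult by (intro mult_mono v_bound g C_nonneg) simp
   qed
   thus ?thesis by (simp add: mult.assoc)
  qed
  have j4: "integrable lborel (%y. (v (s, y))^2*weight y)"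
  proof (rule bounded_integrable)
   show "(%y. (v (s, y))^2) : borel_measurable borel" using vs by measurable
   show "abs((v (s, y))^2) <= C^2" for y using power_mono[OF v_bound[of "(s, y)"] abs_ge_zero, of 2] by simp
  qed
  have split: "slice_energy (e n) g s = - (LI y. cv v (moll (e n)) s y*(g (s, y)*weight y))
    + 1/2*(LI y. (g (s, y))^2*weight y) + energy_const*(LI y. (cv w (moll (e n)) s y)^2*weight y)
    + 1/2*(LI y. cv (%z. (v z)^2) (moll (e n)) s y*weight y)" for n
  proof -
   have "slice_energy (e n) g s = (LI y. ((- (cv v (moll (e n)) s y*(g (s, y)*weight y))
     + 1/2*((g (s, y))^2*weight y)) + energy_const*((cv w (moll (e n)) s y)^2*weight y))
     + 1/2*(cv (%z. (v z)^2) (moll (e n)) s y*weight y))"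
    unfolding slice_energy_def[OF e(1,2) gm g(2)]
    by (rule Bochner_Integration.integral_cong) (auto simp: algebra_simps)
   thus ?thesis using i1[of n] i2 i3[of n] i4[of n] by simp
  qed
  have limit: "L s = - (LI y. v (s, y)*(g (s, y)*weight y))
    + 1/2*(LI y. (g (s, y))^2*weight y) + energy_const*energy s + 1/2*(LI y. (v (s, y))^2*weight y)"
  proof -
   have "L s = (LI y. ((- (v (s, y)*(g (s, y)*weight y))
     + 1/2*((g (s, y))^2*weight y)) + energy_const*((w (s, y))^2*weight y)) + 1/2*((v (s, y))^2*weight y))"
    unfolding L_def by (rule Bochner_Integration.integral_cong) (auto simp: power2_diff field_simps)
   thus ?thesis using j1 i2 energy_slice(1)[of s] j4 unfolding energy_def by simp
  qed
  show ?thesis unfolding split limit by (intro tendsto_intros l1 l2 mollified_energy)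
 qed
 have "(%n. LI s. indicator {q..1} s * slice_energy (e n) g s) ----> (LI s. indicator {q..1} s*L s)"
 proof (rule integral_dominated_convergence[where
    w = "%s. indicator {q..1} s*((C*Bg + Bg^2 + energy_const*4*wgrowth^2 + C^2)*weight_mass)"])
  show "AE s in lborel. (%n. indicator {q..1} s * slice_energy (e n) g s) ----> indicator {q..1} s*L s"
   by (intro AE_I2 tendsto_intros lim)
  show "AE s in lborel. norm (indicator {q..1} s * slice_energy (e n) g s)
    <= indicator {q..1} s*((C*Bg + Bg^2 + energy_const*4*wgrowth^2 + C^2)*weight_mass)" for n
   using slice_energy_integrable(2)[OF e(1,2) gm g(2)] by (intro AE_I2) (auto simp: indicator_def)
  show m: "(%s. indicator {q..1} s * slice_energy (e n) g s) : borel_measurable lborel" for n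
   using energy_inequality(2)[OF e(1,2) gm g(2) q] by (rule borel_measurable_integrable)
  show "(%s. indicator {q..1} s*L s) : borel_measurable lborel"
   by (rule borel_measurable_LIMSEQ_metric[where f = "%n s. indicator {q..1} s * slice_energy (e n) g s", OF m])
     (intro tendsto_intros lim)
 qed (simp add: integrable_indicator_iff emeasure_lborel_Icc_eq)
 from LIMSEQ_le[OF mollified_energy this, of q] energy_inequality(1)[OF e(1,2) gm g(2) q]
 show ?thesis unfolding L_def by blast
qed

end

text \<open>Measurable functions are almost everywhere limits of continuous ones, and truncation
  keeps the bound C.\<close>

lemma continuous_approximation:
 obtains g :: "nat => real \<times> real => real"
 where "!!n. continuous_on UNIV (g n)" "!!n z. abs(g n z) <= C"
  "AE z in lborel. (%n. g n z) ----> v z"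
proof -
 have "v : borel_measurable lebesgue" using v_meas by (simp add: measurable_completion)
 hence "v measurable_on UNIV" by (rule lebesgue_measurable_imp_measurable_on) simp
 then obtain N g where N: "negligible N" "!!n. continuous_on UNIV (g n :: real \<times> real => real)"
  "!!x. x ~: N ==> (%n. g n x) ----> v x" unfolding measurable_on_def by auto
 define h where "h n z = max (- C) (min C (g n z))" for n z
 have "(%n. h n x) ----> v x" if "x ~: N" for x
 proof -
  have "(%n. h n x) ----> max (- C) (min C (v x))" unfolding h_def by (intro tendsto_intros N(3) that)
  moreover have "max (- C) (min C (v x)) = v x" using v_bound[of x] by linarith
  ultimately show ?thesis by simp
 qed
 moreover obtain N' where "N' : null_sets lborel" "N <= N'"
  using N(1) unfolding negligible_iff_null_sets null_sets_completion_iff2 by blast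
 ultimately have "AE x in lborel. (%n. h n x) ----> v x" by (intro AE_I'[of N']) auto
 moreover have "continuous_on UNIV (h n)" for n unfolding h_def[abs_def] by (intro continuous_intros N(2))
 moreover have "abs(h n z) <= C" for n z using C_nonneg unfolding h_def by (auto simp: abs_le_iff)
 ultimately show ?thesis using that by blast
qed

lemma energy_integrable:
 assumes q: "0 <= q" "q <= 1"
 shows "integrable lborel (%s. indicator {q..1} s*energy s)"
proof (rule integrableI_bounded_set[where A = "{q..1}" and B = "wgrowth^2*weight_mass"])
 show "AE s in lborel. s : {q..1} --> norm (indicator {q..1} s*energy s) <= wgrowth^2*weight_mass"
  using energy_slice(2,3) by (intro AE_I2) simp
qed (use energy_slice(4) q in \<open>auto simp: emeasure_lborel_Icc_eq\<close>)

text \<open>Sends g to v after the mollification is gone: the term (v - g)^2 disappears and the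
  energy is bounded by its own time integral.\<close>

lemma energy_gronwall_inequality:
 assumes q: "0 <= q" "q <= 1"
 shows "energy q <= energy_const*(LI s. indicator {q..1} s*energy s)"
proof -
 obtain g :: "nat => real \<times> real => real"
  where g: "!!n. continuous_on UNIV (g n)" "!!n z. abs(g n z) <= C"
  "AE z in lborel. (%n. g n z) ----> v z" by (rule continuous_approximation) blast
 define e where "e n = 1/(real n + 1)" for n
 have e: "0 < e n" "e n <= 1" "e ----> 0" for n
 proof -
  show "e ----> 0" unfolding e_def by real_asymp
 qed (auto simp: e_def)
 have gm: "g n : borel_measurable (borel \<Otimes>\<^sub>M borel)" for n
  using borel_measurable_continuous_onI[OF g(1)] by (simp add: borel_prod)
 have vm: "v : borel_measurable (borel \<Otimes>\<^sub>M borel)" by (rule loc_bounded_pair_measurable(1)[OF loc_bounded_v])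
 note [measurable] = gm vm
 have one: "1 <= (1 + abs y)^2" for y :: real by (simp add: self_le_power)
 have sq: "(v z - g n z)^2/2 <= 2*C^2" for n z
 proof -
  have "abs(v z - g n z) <= 2*C" using v_bound[of z] g(2)[of n z] by linarith
  from power_mono[OF this abs_ge_zero, of 2] show ?thesis by (simp add: power_mult_distrib)
 qed
 define d where "d n p = (v p - g n p)^2/2" for n p
 have dm: "d n : borel_measurable (borel \<Otimes>\<^sub>M borel)" for n unfolding d_def by measurable
 have db: "abs(d n (s, y)) <= 2*C^2*(1 + abs y)^2" for n s y
  using sq[of "(s, y)" n] mult_left_mono[OF one[of y], of "2*C^2"] unfolding d_def by simp
 note di = strip_weight_integrable[OF dm db, of q]
 have dw: "integrable lborel (%y. d n (s, y)*weight y)" for n s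
  by (rule weight_integrable(1)[OF _ db]) (use measurable_Pair2[OF dm, of s n] in simp)
 have "(%n. LINT p|(lborel \<Otimes>\<^sub>M lborel). (case p of (s, y) => indicator {q..1} s*(d n (s, y)*weight y)))
   ----> (LINT p|((lborel :: real measure) \<Otimes>\<^sub>M (lborel :: real measure)). 0)"
 proof (rule integral_dominated_convergence[where w = "%(s, y). indicator {q..1} s*((2*C^2)*weight y)"])
  show "integrable (lborel \<Otimes>\<^sub>M lborel) (%(s, y). indicator {q..1} s*((2*C^2)*weight y))"
   using strip_weight_integrable[of "%_. 2*C^2" "2*C^2" q] mult_left_mono[OF one, of "2*C^2"] by simp
  have "AE p in lborel \<Otimes>\<^sub>M lborel. (%n. g n p) ----> v p" using g(3) unfolding lborel_plane .
  thus "AE p in lborel \<Otimes>\<^sub>M lborel. (%n. case p of (s, y) => indicator {q..1} s*(d n (s, y)*weight y)) ----> 0"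
  proof eventually_elim
   case (elim p)
   obtain s y where p: "p = (s, y)" by (cases p)
   have "(%n. d n p) ----> (v p - v p)^2/2" unfolding d_def by (intro tendsto_intros elim) simp
   hence "(%n. indicator {q..1} s*(d n (s, y)*weight y)) ----> indicator {q..1} s*(0*weight y)"
    unfolding p by (intro tendsto_intros) simp
   thus ?case by (simp add: p)
  qed
  show "AE p in lborel \<Otimes>\<^sub>M lborel. norm (case p of (s, y) => indicator {q..1} s*(d n (s, y)*weight y))
    <= (case p of (s, y) => indicator {q..1} s*((2*C^2)*weight y))" for n
  proof (rule AE_I2)
   fix p :: "real \<times> real"
   obtain s y where p: "p = (s, y)" by (cases p)
   have "abs(d n (s, y))*weight y <= 2*C^2*weight y"
    using sq[of "(s, y)" n] weight_pos[of y] unfolding d_def by (intro mult_right_mono) auto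
   thus "norm (case p of (s, y) => indicator {q..1} s*(d n (s, y)*weight y))
    <= (case p of (s, y) => indicator {q..1} s*((2*C^2)*weight y))"
    using weight_pos[of y] by (auto simp: p abs_mult indicator_def)
  qed
  show "(%p. case p of (s, y) => indicator {q..1} s*(d n (s, y)*weight y)) : borel_measurable (lborel \<Otimes>\<^sub>M lborel)" for n
   using borel_measurable_integrable[OF di[of n]] .
 qed simp
 hence lim: "(%n. LINT p|(lborel \<Otimes>\<^sub>M lborel). (case p of (s, y) => indicator {q..1} s*(d n (s, y)*weight y))) ----> 0"
  by simp
 have bound: "energy q <= (LINT p|(lborel \<Otimes>\<^sub>M lborel). (case p of (s, y) => indicator {q..1} s*(d n (s, y)*weight y)))
    + energy_const*(LI s. indicator {q..1} s*energy s)" for n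
 proof -
  have "energy q <= (LI s. indicator {q..1} s *
   (LI y. ((v (s, y) - g n (s, y))^2/2 + energy_const*(w (s, y))^2)*weight y))"
   by (rule energy_limit_inequality[OF e g(1,2) q])
  also have "... = (LI s. (LI y. indicator {q..1} s*(d n (s, y)*weight y)) + energy_const*(indicator {q..1} s*energy s))"
  proof (rule Bochner_Integration.integral_cong[OF refl])
   fix s
   have "(LI y. ((v (s, y) - g n (s, y))^2/2 + energy_const*(w (s, y))^2)*weight y)
    = (LI y. d n (s, y)*weight y + energy_const*((w (s, y))^2*weight y))"
    by (simp add: d_def algebra_simps)
   also have "... = (LI y. d n (s, y)*weight y) + energy_const*energy s"
    using dw[of n s] energy_slice(1)[of s] unfolding energy_def by simp
   finally have h1: "(LI y. ((v (s, y) - g n (s, y))^2/2 + energy_const*(w (s, y))^2)*weight y)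
    = (LI y. d n (s, y)*weight y) + energy_const*energy s" .
   have h2: "indicator {q..1} s*(LI y. d n (s, y)*weight y) = (LI y. indicator {q..1} s*(d n (s, y)*weight y))"
    by (rule integral_mult_right_zero[symmetric])
   show "indicator {q..1} s*(LI y. ((v (s, y) - g n (s, y))^2/2 + energy_const*(w (s, y))^2)*weight y)
    = (LI y. indicator {q..1} s*(d n (s, y)*weight y)) + energy_const*(indicator {q..1} s*energy s)"
    unfolding h1 distrib_left h2 by (simp only: mult.left_commute)
  qed
  also have "... = (LI s. LI y. indicator {q..1} s*(d n (s, y)*weight y))
    + energy_const*(LI s. indicator {q..1} s*energy s)"
   using lborel_pair.integrable_fst'[OF di[of n]] energy_integrable[OF q]
   by (subst Bochner_Integration.integral_add) auto
  also have "(LI s. LI y. indicator {q..1} s*(d n (s, y)*weight y))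
   = (LINT p|(lborel \<Otimes>\<^sub>M lborel). (case p of (s, y) => indicator {q..1} s*(d n (s, y)*weight y)))"
   using lborel_pair.integral_fst'[OF di[of n]] by simp
  finally show ?thesis .
 qed
 have "(%n. (LINT p|(lborel \<Otimes>\<^sub>M lborel). (case p of (s, y) => indicator {q..1} s*(d n (s, y)*weight y)))
    + energy_const*(LI s. indicator {q..1} s*energy s))
   ----> 0 + energy_const*(LI s. indicator {q..1} s*energy s)"
  by (intro tendsto_add lim tendsto_const)
 from LIMSEQ_le_const[OF this] bound show ?thesis by auto
qed

text \<open>Iterating the integral inequality n times produces the n-th term of an exponential
  series, which tends to 0.\<close>

lemma energy_power_bound:
 assumes q: "0 <= q" "q <= 1"
 shows "energy q <= wgrowth^2*weight_mass*((energy_const*(1 - q))^n/fact n)" using q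
proof (induction n arbitrary: q)
 case 0
 thus ?case using energy_slice(3) by simp
next
 case (Suc n)
 define A where "A = wgrowth^2*weight_mass*energy_const^n/fact n"
 have ec: "0 <= energy_const" by (simp add: energy_const_def)
 have i: "integrable lborel (%s. (1 - s)^n*indicator {q..1} s)"
  using borel_integrable_atLeastAtMost[of q 1 "%s. (1 - s)^n"] by (auto simp: mult.commute)
 have "energy q <= energy_const*(LI s. indicator {q..1} s*energy s)"
  by (rule energy_gronwall_inequality[OF Suc.prems])
 also have "... <= energy_const*(LI s. A*((1 - s)^n*indicator {q..1} s))"
 proof (rule mult_left_mono[OF integral_mono ec])
  show "integrable lborel (%s. indicator {q..1} s*energy s)" by (rule energy_integrable[OF Suc.prems])
  show "integrable lborel (%s. A*((1 - s)^n*indicator {q..1} s))" using i by simp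
  show "indicator {q..1} s*energy s <= A*((1 - s)^n*indicator {q..1} s)" for s
   using Suc.IH[of s] Suc.prems by (auto simp: indicator_def A_def power_mult_distrib)
 qed
 also have "(LI s. A*((1 - s)^n*indicator {q..1} s)) = A*((1 - q)^Suc n/real (Suc n))"
 proof -
  have "(LI s. (1 - s)^n*indicator {q..1} s) = - ((1 - 1)^Suc n/real (Suc n)) - - ((1 - q)^Suc n/real (Suc n))"
  proof (rule integral_FTC_Icc_real[OF Suc.prems(2)])
   show "DERIV (%s. - ((1 - s)^Suc n/real (Suc n))) s :> (1 - s)^n" for s
    by (rule derivative_eq_intros refl | simp)+
  qed auto
  thus ?thesis by simp
 qed
 also have "energy_const*(A*((1 - q)^Suc n/real (Suc n)))
   = wgrowth^2*weight_mass*((energy_const*(1 - q))^Suc n/fact (Suc n))"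
  by (simp add: A_def power_mult_distrib mult_ac)
 finally show ?case .
qed

lemma energy_zero:
 assumes q: "0 <= q" "q <= 1"
 shows "energy q = 0"
proof -
 have "(%n. wgrowth^2*weight_mass*((energy_const*(1 - q))^n/fact n)) ----> wgrowth^2*weight_mass*0"
  by (intro tendsto_mult tendsto_const)
    (use summable_LIMSEQ_zero[OF summable_exp[of "energy_const*(1 - q)"]] in \<open>simp add: divide_inverse mult.commute\<close>)
 hence "energy q <= 0" using energy_power_bound[OF q] by (intro LIMSEQ_le_const) auto
 thus ?thesis using energy_slice(2)[of q] by simp
qed

theorem w_zero: "w z = 0"
proof (cases "z : strip")
 case True
 then obtain q y where z: "z = (q, y)" "0 <= q" "q <= 1" by auto
 have "AE y in lborel. (w (q, y))^2*weight y = 0"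
  using energy_zero[OF z(2,3)] integral_nonneg_eq_0_iff_AE[OF energy_slice(1)[of q]] weight_pos
  unfolding energy_def by (simp add: less_imp_le)
 hence "AE y in lborel. y : {y. w (q, y) = 0}"
  by eventually_elim (use weight_pos in \<open>auto simp: less_imp_neq[THEN not_sym]\<close>)
 hence "AE y in lebesgue. y : {y. w (q, y) = 0}" by (rule AE_completion)
 moreover have "closed {y. w (q, y) = 0}"
  using continuous_closed_preimage_constant[OF w_slice_continuous closed_UNIV, of q 0] by simp
 ultimately show ?thesis using mem_closed_if_AE_lebesgue[of "{y. w (q, y) = 0}" y] z(1) by simp
qed (rule w_out)

end

section \<open>Uniqueness for the Parisi equation\<close>

context right_continuous_order
begin

lemma xx_fst_measurable: "(%z :: real \<times> real. xx (fst z)) : borel_measurable borel"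
 by (rule measurable_compose[OF borel_measurable_continuous_onI xx_measurable]) (intro continuous_intros)

text \<open>Replaces the essentially bounded derivative by an everywhere bounded one and extends
  both functions by 0, so that later estimates can be pointwise; test functions do not see the
  change.\<close>

lemma weak_solution_truncated:
 assumes f: "parisi_weak_solution be x f"
 obtains F G D where "!!z. z : strip ==> F z = f z" "!!z. z ~: strip ==> F z = 0" "!!z. z ~: strip ==> G z = 0"
  "F : borel_measurable borel" "G : borel_measurable borel" "!!z. abs(G z) <= D"
  "!!ph. test_function ph ==> (LI z. F z*d_y ph z) = - (LI z. G z*ph z)"
  "!!ph. test_function ph ==> (LI z. - F z*d_q ph z + 1/2*F z*d_y (d_y ph) z + 1/2*xx (fst z)*(G z)^2*ph z) = 0"
proof -
 obtain g C where g: "g : borel_measurable lborel" "AE z in lborel. z : strip --> abs(g z) <= C" "weak_d_y f g"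
  "!!ph. test_function ph ==> (LI z. - f z*d_q ph z + 1/2*f z*d_y (d_y ph) z + 1/2*x (fst z)*(g z)^2*ph z) = 0"
  and fc: "continuous_on strip f" using f unfolding parisi_weak_solution_def by blast
 define F where "F z = indicator strip z *\<^sub>R f z" for z
 define G where "G z = indicator strip z*max (- abs C) (min (abs C) (g z))" for z
 have cs: "closed strip" by (intro closed_Times) auto
 have [measurable]: "strip : sets borel" using cs by (rule borel_closed)
 have gm [measurable]: "g : borel_measurable borel" using g(1) by simp
 have Fm [measurable]: "F : borel_measurable borel"
  unfolding F_def by (rule borel_measurable_continuous_on_indicator[OF _ fc]) measurable
 have Gm [measurable]: "G : borel_measurable borel" unfolding G_def by measurable
 have zero: "ph z = 0" if "test_function ph" "z ~: strip" for ph z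
 proof -
  obtain K where "K <= {0<..<1} \<times> UNIV" "!!z. z ~: K ==> ph z = 0"
   using `test_function ph` unfolding test_function_def by blast
  thus ?thesis using that(2) by (cases z) fastforce
 qed
 have Ff: "f z*ph z = F z*ph z" if "test_function ph" for ph z
  using zero[OF that, of z] by (cases "z : strip") (auto simp: F_def)
 have Gg: "AE z in lborel. z : strip --> g z = G z"
  using g(2) by eventually_elim (auto simp: G_def abs_le_iff)
 have xxx: "x (fst z) = xx (fst z)" if "z : strip" for z using that by (cases z) (auto simp: xx_def)
 show ?thesis
 proof (rule that[of F G "abs C"])
  show "abs(G z) <= abs C" for z unfolding G_def by (auto simp: indicator_def abs_le_iff)
  fix ph :: "real \<times> real => real" assume ph: "test_function ph"
  note t = test_function_d[OF ph] test_function_d(2)[OF test_function_d(2)[OF ph]]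
  note [measurable] = test_function_measurable[OF ph] test_function_measurable[OF t(1)] test_function_measurable[OF t(2)]
   test_function_measurable[OF t(3)]
  define X where "X z = xx (fst z)" for z :: "real \<times> real"
  have [measurable]: "X : borel_measurable borel" unfolding X_def by (rule xx_fst_measurable)
  have mm: "(%z. - F z*d_q ph z + 1/2*F z*d_y (d_y ph) z + 1/2*X z*(h z)^2*ph z) : borel_measurable borel"
   if [measurable]: "h : borel_measurable borel" for h by measurable
  have "(LI z. F z*d_y ph z) = (LI z. f z*d_y ph z)" by (simp only: Ff[OF t(2)])
  also have "... = - (LI z. g z*ph z)" using g(3) ph unfolding weak_d_y_def by blast
  also have "(LI z. g z*ph z) = (LI z. G z*ph z)"
  proof (rule integral_cong_AE)
   show "AE z in lborel. g z*ph z = G z*ph z"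
    using Gg by eventually_elim (use zero[OF ph] in fastforce)
  qed measurable
  finally show "(LI z. F z*d_y ph z) = - (LI z. G z*ph z)" .
  have "0 = (LI z. - f z*d_q ph z + 1/2*f z*d_y (d_y ph) z + 1/2*x (fst z)*(g z)^2*ph z)"
   using g(4)[OF ph] by simp
  also have "... = (LI z. - F z*d_q ph z + 1/2*F z*d_y (d_y ph) z + 1/2*xx (fst z)*(g z)^2*ph z)"
  proof (rule Bochner_Integration.integral_cong[OF refl])
   fix z
   show "- f z*d_q ph z + 1/2*f z*d_y (d_y ph) z + 1/2*x (fst z)*(g z)^2*ph z
     = - F z*d_q ph z + 1/2*F z*d_y (d_y ph) z + 1/2*xx (fst z)*(g z)^2*ph z"
    using Ff[OF t(1), of z] Ff[OF t(3), of z] xxx[of z] zero[OF ph, of z] by (cases "z : strip") auto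
  qed
  also have "... = (LI z. - F z*d_q ph z + 1/2*F z*d_y (d_y ph) z + 1/2*xx (fst z)*(G z)^2*ph z)"
  proof (rule integral_cong_AE)
   show "AE z in lborel. - F z*d_q ph z + 1/2*F z*d_y (d_y ph) z + 1/2*xx (fst z)*(g z)^2*ph z
     = - F z*d_q ph z + 1/2*F z*d_y (d_y ph) z + 1/2*xx (fst z)*(G z)^2*ph z"
    using Gg by eventually_elim (use zero[OF ph] in fastforce)
  qed (use mm[OF gm] mm[OF Gm] in \<open>simp_all add: X_def\<close>)
  finally show "(LI z. - F z*d_q ph z + 1/2*F z*d_y (d_y ph) z + 1/2*xx (fst z)*(G z)^2*ph z) = 0"
   by simp
 qed (auto simp: F_def G_def Fm Gm[unfolded G_def])
qed

theorem parisi_weak_solution_unique: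
 assumes "parisi_weak_solution be x f1" "parisi_weak_solution be x f2" "z : strip"
 shows "f1 z = f2 z"
proof -
 obtain F1 G1 D1 where 1: "!!z. z : strip ==> F1 z = f1 z" "!!z. z ~: strip ==> F1 z = 0" "!!z. z ~: strip ==> G1 z = 0"
  "F1 : borel_measurable borel" "G1 : borel_measurable borel" "!!z. abs(G1 z) <= D1"
  "!!ph. test_function ph ==> (LI z. F1 z*d_y ph z) = - (LI z. G1 z*ph z)"
  "!!ph. test_function ph ==> (LI z. - F1 z*d_q ph z + 1/2*F1 z*d_y (d_y ph) z
    + 1/2*xx (fst z)*(G1 z)^2*ph z) = 0"
  using weak_solution_truncated[OF assms(1)] by blast
 obtain F2 G2 D2 where 2: "!!z. z : strip ==> F2 z = f2 z" "!!z. z ~: strip ==> F2 z = 0" "!!z. z ~: strip ==> G2 z = 0"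
  "F2 : borel_measurable borel" "G2 : borel_measurable borel" "!!z. abs(G2 z) <= D2"
  "!!ph. test_function ph ==> (LI z. F2 z*d_y ph z) = - (LI z. G2 z*ph z)"
  "!!ph. test_function ph ==> (LI z. - F2 z*d_q ph z + 1/2*F2 z*d_y (d_y ph) z
    + 1/2*xx (fst z)*(G2 z)^2*ph z) = 0"
  using weak_solution_truncated[OF assms(2)] by blast
 note [measurable] = 1(4,5) 2(4,5)
 note xm = xx_fst_measurable and tI = times_test_integrable
 have D: "0 <= D1" "0 <= D2" using 1(6)[of undefined] 2(6)[of undefined] by linarith+
 have c1: "continuous_on strip F1" and c2: "continuous_on strip F2"
  using assms(1,2) 1(1) 2(1) unfolding parisi_weak_solution_def by (auto cong: continuous_on_cong)
 have lF: "loc_bounded F1" "loc_bounded F2" by (intro loc_bounded_continuous c1 c2 1 2; assumption)+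
 have lG: "loc_bounded G1" "loc_bounded G2" by (rule loc_boundedI[OF 1(5,6)] loc_boundedI[OF 2(5,6)])+
 have lK: "loc_bounded (%z. 1/2*xx (fst z)*(G z)^2)" if G: "G : borel_measurable borel" "!!z. abs(G z) <= D" for G D
 proof (rule loc_boundedI)
  show "(%z. 1/2*xx (fst z)*(G z)^2) : borel_measurable borel" using xm G(1) by measurable
  show "abs(1/2*xx (fst z)*(G z)^2) <= 1/2*be*D^2" for z
   using power_mono[OF G(2)[of z] abs_ge_zero, of 2] xx_bounds[of "fst z"] be
   by (auto simp: abs_mult intro!: mult_mono)
 qed
 define w v k where "w z = F1 z - F2 z" and "v z = G1 z - G2 z"
  and "k z = 1/2*xx (fst z)*(G1 z)^2 - 1/2*xx (fst z)*(G2 z)^2" for z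
 interpret weak_difference w v k "D1 + D2" "be*(D1 + D2)"
 proof
  show "continuous_on strip w" unfolding w_def by (intro continuous_intros c1 c2)
  show "w z = 0" "v z = 0" if "z ~: strip" for z using that 1(2,3) 2(2,3) by (simp_all add: w_def v_def)
  show "w : borel_measurable borel" "v : borel_measurable borel" unfolding w_def v_def by measurable
  show "k : borel_measurable borel" unfolding k_def using xm by measurable
  show "abs(v z) <= D1 + D2" for z using 1(6)[of z] 2(6)[of z] unfolding v_def by linarith
  show "0 <= be*(D1 + D2)" using D be by simp
  show "abs(k z) <= be*(D1 + D2)*abs(v z)" for z
  proof -
   have "k z = 1/2*xx (fst z)*(G1 z + G2 z) * v z"
    by (simp add: k_def v_def power2_eq_square algebra_simps)
   hence "abs(k z) = abs(1/2*xx (fst z))*abs(G1 z + G2 z)*abs(v z)" by (simp only: abs_mult)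
   also have "abs(1/2*xx (fst z)) = 1/2*xx (fst z)" using xx_bounds[of "fst z"] by simp
   also have "1/2*xx (fst z)*abs(G1 z + G2 z)*abs(v z) <= be*(D1 + D2)*abs(v z)"
    using xx_bounds[of "fst z"] be 1(6)[of z] 2(6)[of z] by (intro mult_right_mono mult_mono) auto
   finally show ?thesis by simp
  qed
  show "w (1, y) = 0" for y
   using assms(1,2) 1(1)[of "(1, y)"] 2(1)[of "(1, y)"] unfolding parisi_weak_solution_def by (simp add: w_def)
  fix ph :: "real \<times> real => real" assume ph: "test_function ph"
  note t = test_function_d[OF ph] test_function_d(2)[OF test_function_d(2)[OF ph]]
  show "(LI z. w z*d_y ph z) = - (LI z. v z*ph z)"
   using 1(7)[OF ph] 2(7)[OF ph] tI[OF lF(1) t(2)] tI[OF lF(2) t(2)] tI[OF lG(1) ph] tI[OF lG(2) ph]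
   by (simp add: w_def v_def left_diff_distrib)
  define K1 K2 where "K1 z = 1/2*xx (fst z)*(G1 z)^2" and "K2 z = 1/2*xx (fst z)*(G2 z)^2" for z
  have lK12: "loc_bounded K1" "loc_bounded K2"
   unfolding K1_def K2_def by (rule lK[OF 1(5,6)] lK[OF 2(5,6)])+
  note i = tI[OF lF(1) t(1)] tI[OF lF(2) t(1)] tI[OF lF(1) t(3)] tI[OF lF(2) t(3)] tI[OF lK12(1) ph] tI[OF lK12(2) ph]
  have eq: "- (LI z. F z*d_q ph z) + 1/2*(LI z. F z*d_y (d_y ph) z) + (LI z. K z*ph z)
   = (LI z. - F z*d_q ph z + 1/2*F z*d_y (d_y ph) z + K z*ph z)"
   if "integrable lborel (%z. F z*d_q ph z)" "integrable lborel (%z. F z*d_y (d_y ph) z)" "integrable lborel (%z. K z*ph z)" for F K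
  proof -
   have "(LI z. - F z*d_q ph z + 1/2*F z*d_y (d_y ph) z + K z*ph z)
     = (LI z. (- (F z*d_q ph z) + 1/2*(F z*d_y (d_y ph) z)) + K z*ph z)" by (simp add: algebra_simps)
   thus ?thesis using that by simp
  qed
  have e1: "- (LI z. F1 z*d_q ph z) + 1/2*(LI z. F1 z*d_y (d_y ph) z) + (LI z. K1 z*ph z) = 0"
   using 1(8)[OF ph] eq[OF i(1,3,5)] unfolding K1_def by simp
  have e2: "- (LI z. F2 z*d_q ph z) + 1/2*(LI z. F2 z*d_y (d_y ph) z) + (LI z. K2 z*ph z) = 0"
   using 2(8)[OF ph] eq[OF i(2,4,6)] unfolding K2_def by simp
  have k: "k z = K1 z - K2 z" for z by (simp add: k_def K1_def K2_def)
  have "integrable lborel (%z. w z*d_q ph z)" "integrable lborel (%z. w z*d_y (d_y ph) z)" "integrable lborel (%z. k z*ph z)"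
   using i unfolding w_def k left_diff_distrib by auto
  from eq[OF this] have "(LI z. - w z*d_q ph z + 1/2*w z*d_y (d_y ph) z + k z*ph z)
   = - (LI z. w z*d_q ph z) + 1/2*(LI z. w z*d_y (d_y ph) z) + (LI z. k z*ph z)" by simp
  also have "... = 0" using e1 e2 i unfolding w_def k left_diff_distrib by (simp add: algebra_simps)
  finally show "(LI z. - w z*d_q ph z + 1/2*w z*d_y (d_y ph) z + k z*ph z) = 0" .
 qed
 show ?thesis using w_zero[of z] 1(1)[OF assms(3)] 2(1)[OF assms(3)] by (simp add: w_def)
qed

lemma parisi_solution_origin: "parisi_solution be x (0, 0) = ff (0, 0)"
 unfolding parisi_solution_def
 by (rule parisi_weak_solution_unique[OF someI[of "parisi_weak_solution be x"]])
   (use parisi_weak_solution_ff in auto)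

end

section \<open>Log-mean-exp operators\<close>

text \<open>Functions on configurations are energies; the walks and the random edges below move in
  this space.\<close>

definition vadd :: "('s => real) => ('s => real) => 's => real" (infixl "+:" 65)
 where "v +: w = (%S. v S + w S)"

definition vscale :: "real => ('s => real) => 's => real" (infixr "*:" 75)
 where "c *: w = (%S. c*w S)"

lemma vadd_assoc: "(u +: v) +: w = u +: (v +: w)"
 and vadd_commute: "v +: w = w +: v"
 and vadd_left_commute: "v +: (u +: w) = u +: (v +: w)" by (auto simp: vadd_def)

lemmas vadd_ac = vadd_assoc vadd_commute vadd_left_commute

lemma vadd_zero [simp]: "w +: (%S. 0) = w" "(%S. 0) +: w = w" by (auto simp: vadd_def)

lemma vscale_zero [simp]: "0 *: w = (%S. 0)" by (auto simp: vscale_def)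

lemma vadd_vscale: "a *: w +: b *: w = (a + b) *: w"
 by (auto simp: vadd_def vscale_def algebra_simps)

definition mean :: "('a => real) => 'a list => real"
 where "mean f vs = (SUM i<length vs. f (vs ! i))/length vs"

text \<open>A list stands for the uniform distribution on its entries, counted with multiplicity;
  \<open>conv\<close> is then the law of a sum of independent increments.\<close>

definition conv :: "('s => real) list => ('s => real) list => ('s => real) list"
 where "conv vs ws = concat (map (%v. map (%w. v +: w) ws) vs)"

lemma mean_sum_list: "mean f vs = sum_list (map f vs)/length vs"
 by (simp add: mean_def sum_list_sum_nth atLeast0LessThan)

lemma conv_eq_Nil [simp]: "conv vs ws = [] \<longleftrightarrow> vs = [] | ws = []" by (auto simp: conv_def)

lemma length_conv: "length (conv vs ws) = length vs*length ws"
 by (simp add: conv_def length_concat o_def sum_list_triv)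

lemma mean_conv: "mean f (conv vs ws) = mean (%v. mean (%w. f (v +: w)) ws) vs"
proof -
 have "sum_list (map f (conv vs ws)) = (SUM v<-vs. SUM w<-ws. f (v +: w))"
  by (induction vs) (simp_all add: conv_def o_def)
 thus ?thesis unfolding mean_sum_list length_conv divide_inverse
  by (simp add: sum_list_mult_const sum_list_const_mult mult_ac)
qed

lemma mean_mono: "(!!v. f v <= g v) ==> mean f vs <= mean g vs"
 unfolding mean_def by (intro divide_right_mono sum_mono) auto

lemma mean_add: "mean (%v. f v + g v) vs = mean f vs + mean g vs"
 by (simp add: mean_def sum.distrib add_divide_distrib)

lemma mean_cmult: "mean (%v. c*f v) vs = c*mean f vs" by (simp add: mean_def sum_distrib_left)

lemma mean_pos: "vs ~= [] ==> (!!v. f v > 0) ==> mean f vs > 0"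
 unfolding mean_def by (intro divide_pos_pos sum_pos) auto

lemma mean_two: "mean f [x, y] = (f x + f y)/2" by (simp add: mean_def lessThan_Suc numeral_2_eq_2)

definition LM :: "real => ('s => real) list => (('s => real) => real) => ('s => real) => real"
 where "LM m vs u w = ln (mean (%v. exp (m*u (w +: v))) vs)/m"

lemma exp_LM: "vs ~= [] ==> m ~= 0 ==> exp (m*LM m vs u w) = mean (%v. exp (m*u (w +: v))) vs"
 unfolding LM_def by (simp add: mean_pos)

lemma LM_conv:
 assumes "vs ~= []" "ws ~= []" "m ~= 0"
 shows "LM m (conv vs ws) u = LM m vs (LM m ws u)"
proof
 fix w
 have "exp (m*LM m (conv vs ws) u w) = exp (m*LM m vs (LM m ws u) w)"
  using assms by (simp add: exp_LM mean_conv vadd_assoc)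
 thus "LM m (conv vs ws) u w = LM m vs (LM m ws u) w" using assms by simp
qed

lemma LM_le_iff:
 assumes "vs ~= []" "m > 0"
 shows "c <= LM m vs u w \<longleftrightarrow> exp (m * c) <= mean (%v. exp (m*u (w +: v))) vs"
 using assms exp_LM[of vs m u w] by (metis exp_le_cancel_iff mult_le_cancel_left_pos less_irrefl)

lemma LM_mono:
 assumes "vs ~= []" "m > 0" "!!w. u w <= u' w"
 shows "LM m vs u w <= LM m vs u' w" using assms by (simp add: LM_le_iff exp_LM mean_mono)

text \<open>Adding B makes f nonnegative, so that numerators and denominators can be compared
  separately, each at the price of one factor E.\<close>

lemma weighted_mean_diff_le:
 fixes p q f :: "'i => real"
 assumes A: "finite A" "A ~= {}" and p: "!!i. i : A ==> p i > 0" and q: "!!i. i : A ==> q i > 0"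
  and pq: "!!i. i : A ==> p i <= E*q i" and qp: "!!i. i : A ==> q i <= E*p i"
  and B: "!!i. i : A ==> abs(f i) <= B" and E: "E >= 1"
 shows "(SUM i:A. q i*f i)/(SUM i:A. q i) - (SUM i:A. p i*f i)/(SUM i:A. p i) <= 2*B*(E^2 - 1)"
proof -
 have P: "(SUM i:A. p i) > 0" and Q: "(SUM i:A. q i) > 0" using A p q by (auto intro: sum_pos)
 have fB: "f i + B >= 0" "f i <= B" if "i : A" for i using B[OF that] by auto
 let ?c = "(SUM i:A. p i*f i)/(SUM i:A. p i)"
 have "(SUM i:A. p i*f i) <= (SUM i:A. p i*B)"
  using p fB by (intro sum_mono mult_left_mono) (auto intro: less_imp_le)
 also have "... = B*(SUM i:A. p i)" by (simp add: sum_distrib_left mult.commute)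
 finally have c: "?c <= B" using P by (simp add: divide_le_eq)
 have "(SUM i:A. q i*(f i + B)) <= (SUM i:A. E*p i*(f i + B))"
  using fB qp by (intro sum_mono mult_right_mono) auto
 also have "... = E*(SUM i:A. p i*(f i + B))" by (simp add: sum_distrib_left mult.assoc)
 finally have 1: "(SUM i:A. q i*(f i + B)) <= E*(SUM i:A. p i*(f i + B))" .
 have 2: "(SUM i:A. p i) <= E*(SUM i:A. q i)"
  unfolding sum_distrib_left using pq by (intro sum_mono)
 have 3: "(SUM i:A. p i*(f i + B)) >= 0" using p fB by (intro sum_nonneg) (auto intro: mult_nonneg_nonneg less_imp_le)
 have "(SUM i:A. q i*(f i + B))/(SUM i:A. q i) <= E*(SUM i:A. p i*(f i + B))/(SUM i:A. q i)"
  using 1 Q by (intro divide_right_mono) auto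
 also have "... <= E*(SUM i:A. p i*(f i + B))/((SUM i:A. p i)/E)"
  using 2 3 P Q E by (intro divide_left_mono mult_nonneg_nonneg mult_pos_pos) (auto simp: field_simps)
 also have "... = E^2*((SUM i:A. p i*(f i + B))/(SUM i:A. p i))" by (simp add: power2_eq_square)
 also have "(SUM i:A. p i*(f i + B))/(SUM i:A. p i) = ?c + B"
  using P by (simp add: distrib_left sum.distrib sum_distrib_right[symmetric] add_divide_distrib)
 also have "(SUM i:A. q i*(f i + B))/(SUM i:A. q i) = (SUM i:A. q i*f i)/(SUM i:A. q i) + B"
  using Q by (simp add: distrib_left sum.distrib sum_distrib_right[symmetric] add_divide_distrib)
 finally have "(SUM i:A. q i*f i)/(SUM i:A. q i) - ?c <= (E^2 - 1)*(?c + B)"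
  by (simp add: left_diff_distrib)
 also have "... <= (E^2 - 1)*(2*B)" using c E by (intro mult_left_mono) (auto simp: one_le_power)
 finally show ?thesis by (simp add: mult_ac)
qed

text \<open>For 2*x <= 1 one has (exp x)^2 - 1 <= 4*x; for larger x the trivial bound 2*B on the
  difference of two averages suffices.\<close>

lemma weighted_mean_lipschitz:
 fixes p q f :: "'i => real"
 assumes A: "finite A" "A ~= {}" and p: "!!i. i : A ==> p i > 0" and q: "!!i. i : A ==> q i > 0"
  and pq: "!!i. i : A ==> p i <= exp x*q i" and qp: "!!i. i : A ==> q i <= exp x*p i"
  and B: "!!i. i : A ==> abs(f i) <= B" and x: "x >= 0"
 shows "abs((SUM i:A. q i*f i)/(SUM i:A. q i) - (SUM i:A. p i*f i)/(SUM i:A. p i)) <= 8*B*x"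
proof -
 have B0: "B >= 0" using A B by (meson abs_ge_zero all_not_in_conv order_trans)
 have bound: "abs((SUM i:A. r i*f i)/(SUM i:A. r i)) <= B" if "!!i. i : A ==> r i > 0" for r
 proof -
  have R: "(SUM i:A. r i) > 0" using A that by (auto intro: sum_pos)
  have "abs(SUM i:A. r i*f i) <= (SUM i:A. abs(r i*f i))" by (rule sum_abs)
  also have "... <= (SUM i:A. r i*B)"
  proof (intro sum_mono)
   fix i assume "i : A"
   thus "abs(r i*f i) <= r i*B" using that[of i] B[of i] by (simp add: abs_mult)
  qed
  also have "... = B*(SUM i:A. r i)" by (simp add: sum_distrib_left mult.commute)
  finally show ?thesis using R by (simp add: abs_divide divide_le_eq)
 qed
 show ?thesis
 proof (cases "2*x <= 1")
  case True
  have "exp (2*x) <= 1 + 2*x + (2*x)^2" using True x by (intro exp_bound) auto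
  also have "(2*x)^2 <= 2*x" using mult_left_mono[OF True, of "2*x"] x by (simp add: power2_eq_square)
  finally have e: "(exp x)^2 - 1 <= 4*x" by (simp add: exp_double[symmetric])
  have "2*B*((exp x)^2 - 1) <= 2*B*(4*x)" using B0 e by (intro mult_left_mono) auto
  hence e4: "2*B*((exp x)^2 - 1) <= 8*B*x" by simp
  have "(SUM i:A. q i*f i)/(SUM i:A. q i) - (SUM i:A. p i*f i)/(SUM i:A. p i) <= 2*B*((exp x)^2 - 1)"
   by (rule weighted_mean_diff_le) (use assms in auto)
  moreover have "(SUM i:A. p i*f i)/(SUM i:A. p i) - (SUM i:A. q i*f i)/(SUM i:A. q i) <= 2*B*((exp x)^2 - 1)"
   by (rule weighted_mean_diff_le) (use assms in auto)
  ultimately show ?thesis using e4 by linarith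
 next
  case False
  have "abs((SUM i:A. q i*f i)/(SUM i:A. q i) - (SUM i:A. p i*f i)/(SUM i:A. p i)) <= 2*B"
   using bound[of p, OF p] bound[of q, OF q] by linarith
  also have "... <= 8*B*x" using False B0 mult_left_mono[of 1 "4*x" "2*B"] by auto
  finally show ?thesis .
 qed
qed

section \<open>Tilted averages\<close>

definition tav :: "real => 'i set => ('i => 'w => real) => ('i => 'w => real) => 'w => real"
 where "tav m I U f w = (SUM i:I. exp (m*U i w)*f i w)/(SUM i:I. exp (m*U i w))"

lemma exp_sum_pos: "finite I ==> I ~= {} ==> (SUM i:I. exp (f i :: real)) > 0"
 by (intro sum_pos) auto

lemma tav_const: "finite I ==> I ~= {} ==> tav m I U (%i w. c) w = c"
 using exp_sum_pos[of I "%i. m*U i w"] by (simp add: tav_def sum_distrib_right[symmetric])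

lemma tav_mono: "(!!i. i : I ==> f i w <= g i w) ==> tav m I U f w <= tav m I U g w"
 unfolding tav_def by (intro divide_right_mono sum_mono mult_left_mono sum_nonneg) auto

lemma tav_add: "tav m I U (%i w. f i w + g i w) w = tav m I U f w + tav m I U g w"
 by (simp add: tav_def distrib_left sum.distrib add_divide_distrib)

lemma tav_cmult: "tav m I U (%i w. c*f i w) w = c*tav m I U f w"
 by (simp add: tav_def sum_distrib_left mult_ac)

lemma tav_sum: "tav m I U (%i w. SUM k:A. f k i w) w = (SUM k:A. tav m I U (f k) w)"
 unfolding tav_def sum_distrib_left by (subst sum.swap) (simp add: sum_divide_distrib)

lemma tav_lipschitz:
 fixes U :: "'i => ('s => real) => real"
 assumes I: "finite I" "I ~= {}" and m: "m > 0" and a: "a >= 0"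
  and U: "!!i. i : I ==> abs(U i (w +: v) - U i w) <= a"
  and f: "!!i. i : I ==> abs(f i w) <= B" "!!i. i : I ==> abs(f i (w +: v) - f i w) <= c"
 shows "abs(tav m I U f (w +: v) - tav m I U f w) <= c + 8*B * m*a"
proof -
 let ?q = "%i. exp (m*U i (w +: v))"
 let ?h = "(SUM i:I. ?q i*f i w)/(SUM i:I. ?q i)"
 have ex: "exp (m * s) <= exp (m*a)*exp (m*t)" if "abs(s - t) <= a" for s t
 proof -
  have "m * s <= m*(a + t)" using that m by (intro mult_left_mono) auto
  thus ?thesis by (simp add: exp_add[symmetric] distrib_left)
 qed
 have Q: "(SUM i:I. ?q i) > 0" by (rule exp_sum_pos[OF I])
 have "tav m I U f (w +: v) - ?h = (SUM i:I. ?q i*(f i (w +: v) - f i w))/(SUM i:I. ?q i)"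
  by (simp add: tav_def diff_divide_distrib right_diff_distrib sum_subtractf)
 also have "abs(...) <= c"
 proof -
  have "abs(SUM i:I. ?q i*(f i (w +: v) - f i w)) <= (SUM i:I. ?q i * c)"
   using f(2) by (intro order.trans[OF sum_abs] sum_mono) (auto simp: abs_mult)
  also have "... = c*(SUM i:I. ?q i)" by (simp add: sum_distrib_left mult.commute)
  finally show ?thesis using Q by (simp add: abs_divide divide_le_eq)
 qed
 finally have 1: "abs(tav m I U f (w +: v) - ?h) <= c" .
 have 2: "abs(?h - tav m I U f w) <= 8*B*(m*a)" unfolding tav_def using m a f U
  by (intro weighted_mean_lipschitz[OF I] ex) (auto simp: abs_minus_commute)
 show ?thesis using 1 2 by (simp add: mult.assoc)
qed

lemma has_derivative_tav:
 fixes U :: "'i => ('s => real) => real"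
 assumes I: "finite I" "I ~= {}"
  and f: "!!i. i : I ==> (DERIV (%s. f i (w +: s *: ps)) 0 :> f' i w)"
  and U: "!!i. i : I ==> (DERIV (%s. U i (w +: s *: ps)) 0 :> P i w)"
 shows "((%s. tav m I U f (w +: s *: ps)) has_real_derivative
   tav m I U (%i w. f' i w + m*P i w*f i w) w - m*tav m I U P w*tav m I U f w) (at 0)"
  and "m > 0 ==> b > 0 ==> ((%s. ln ((SUM i:I. exp (m*U i (w +: s *: ps)))/b)/m) has_real_derivative
   tav m I U P w) (at 0)"
proof -
 let ?Z = "%w. SUM i:I. exp (m*U i w)"
 have Z: "?Z w > 0" by (rule exp_sum_pos[OF I])
 have e: "DERIV (%s. exp (m*U i (w +: s *: ps))) 0 :> m*(exp (m*U i w)*P i w)" if "i : I" for i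
  using U[OF that] by (auto intro!: derivative_eq_intros)
 have "((%s. exp (m*U i (w +: s *: ps))*f i (w +: s *: ps)) has_real_derivative
   exp (m*U i w)*(f' i w + m*P i w*f i w)) (at 0)" if "i : I" for i
  using DERIV_mult[OF e[OF that] f[OF that]] by (simp add: algebra_simps)
 note 1 = DERIV_sum[OF this]
 note 2 = DERIV_sum[OF e, folded sum_distrib_left]
 show "((%s. tav m I U f (w +: s *: ps)) has_real_derivative
   tav m I U (%i w. f' i w + m*P i w*f i w) w - m*tav m I U P w*tav m I U f w) (at 0)"
  unfolding tav_def by (rule DERIV_cong[OF DERIV_divide[OF 1 2]]) (use Z in \<open>auto simp: divide_simps mult_ac\<close>)
 show "DERIV (%s. ln (?Z (w +: s *: ps)/b)/m) 0 :> tav m I U P w" if "m > 0" "b > 0"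
  unfolding tav_def using Z that
  by (intro DERIV_cong[OF DERIV_cdivide[OF DERIV_ln_divide[THEN DERIV_chain2, OF _ DERIV_cdivide[OF 2]]]])
    (auto simp: divide_simps)
qed

text \<open>The derivative of \<open>LM m vs\<close> at \<open>u\<close>.\<close>

definition TE :: "real => ('s => real) list => (('s => real) => real) => (('s => real) => real)
  => ('s => real) => real"
 where "TE m vs u f = tav m {..<length vs} (%i w. u (w +: vs ! i)) (%i w. f (w +: vs ! i))"

lemma TE_mean: "TE m vs u f w = mean (%v. exp (m*u (w +: v))*f (w +: v)) vs/mean (%v. exp (m*u (w +: v))) vs"
 by (cases "vs = []") (simp_all add: TE_def tav_def mean_def)

lemma TE_const: "vs ~= [] ==> TE m vs u (%_. c) w = c" unfolding TE_def by (rule tav_const) auto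

lemma TE_mono: "(!!w. f w <= g w) ==> TE m vs u f w <= TE m vs u g w"
 unfolding TE_def by (rule tav_mono)

lemma TE_add: "TE m vs u (%w. f w + g w) w = TE m vs u f w + TE m vs u g w"
 unfolding TE_def by (rule tav_add)

lemma TE_cmult: "TE m vs u (%w. c*f w) w = c*TE m vs u f w" unfolding TE_def by (rule tav_cmult)

lemma TE_sum: "TE m vs u (%w. SUM i:A. f i w) w = (SUM i:A. TE m vs u (f i) w)"
 unfolding TE_def by (rule tav_sum)

lemma shift_swap: "w +: v +: z = w +: z +: v" by (simp add: vadd_ac)

lemma TE_lipschitz:
 assumes vs: "vs ~= []" and m: "m > 0" and a: "a >= 0"
  and u: "!!w. abs(u (w +: v) - u w) <= a"
  and f: "!!w. abs(f w) <= B" "!!w. abs(f (w +: v) - f w) <= c"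
 shows "abs(TE m vs u f (w +: v) - TE m vs u f w) <= c + 8*B * m*a"
 unfolding TE_def by (rule tav_lipschitz) (use assms shift_swap[of w v] in auto)

text \<open>Log-mean-exp is convex and lies above its tangent at u, whose slope is
  \<open>TE\<close>. With ph centred at its tilted mean this is exp x >= 1 + x.\<close>

lemma LM_ge_linear:
 assumes "vs ~= []" "m > 0"
 shows "LM m vs u w + TE m vs u ph w <= LM m vs (%w. u w + ph w) w"
proof -
 let ?t = "TE m vs u ph w"
 let ?e = "%v. exp (m*u (w +: v))"
 have M: "mean ?e vs > 0" using assms by (simp add: mean_pos)
 have "mean (%v. ?e v * (1 + m*(ph (w +: v) - ?t))) vs = mean ?e vs + m*(mean (%v. ?e v * ph (w +: v)) vs - ?t*mean ?e vs)"
 proof -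
  have "(%v. ?e v * (1 + m*(ph (w +: v) - ?t))) = (%v. ?e v + (m*(?e v * ph (w +: v)) + (- m*?t)*?e v))"
   by (auto simp: algebra_simps)
  thus ?thesis by (simp only: mean_add mean_cmult) (simp add: algebra_simps)
 qed
 also have "... = mean ?e vs" using M by (simp add: TE_mean)
 finally have 1: "mean (%v. ?e v * (1 + m*(ph (w +: v) - ?t))) vs = mean ?e vs" .
 have "mean ?e vs <= mean (%v. ?e v * exp (m*(ph (w +: v) - ?t))) vs"
  unfolding 1[symmetric] by (intro mean_mono mult_left_mono exp_ge_add_one_self) auto
 also have "... = mean (%v. exp (- m*?t)*exp (m*(u (w +: v) + ph (w +: v)))) vs"
  by (simp add: exp_add[symmetric] algebra_simps)
 also have "... = exp (- m*?t)*mean (%v. exp (m*(u (w +: v) + ph (w +: v)))) vs"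
  by (rule mean_cmult)
 finally have "exp (m*?t)*mean ?e vs <= mean (%v. exp (m*(u (w +: v) + ph (w +: v)))) vs"
  by (simp add: exp_minus field_simps)
 moreover have "exp (m*(LM m vs u w + ?t)) = exp (m*?t)*mean ?e vs"
  using assms by (simp add: distrib_left exp_add exp_LM)
 ultimately show ?thesis using assms by (simp add: LM_le_iff)
qed

section \<open>Regular functionals\<close>

locale spins =
 fixes Om :: "'s set"
 assumes finite_Om: "finite Om" and Om_nonempty: "Om ~= {}"
begin

definition avg :: "('s => real) => ('s => real) => real"
 where "avg g ps = (SUM S:Om. g S*ps S)"

definition bd :: "real => ('s => real) => bool"
 where "bd a v \<longleftrightarrow> a >= 0 & (ALL S:Om. abs(v S) <= a)"

definition prob :: "('s => real) => bool"
 where "prob g \<longleftrightarrow> (ALL S:Om. g S >= 0) & (SUM S:Om. g S) = 1"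

text \<open>Quantitative smoothness of a convex functional of the energy, with gradient
  \<open>g w\<close>, a probability vector as for a Gibbs measure, and second derivative Q.
  Directions are measured in the sup norm, so that the constants L below depend neither on the size
  of Om nor on the lengths of the walks.\<close>

definition reg :: "real => (('s => real) => real) => (('s => real) => 's => real)
  => (('s => real) => ('s => real) => real) => bool" where
 "reg L u g Q \<longleftrightarrow> (ALL w. prob (g w)) & (ALL w ps. (DERIV (%s. u (w +: s *: ps)) 0 :> avg (g w) ps)) &
   (ALL w ps. (DERIV (%s. avg (g (w +: s *: ps)) ps) 0 :> Q w ps)) & (ALL w ps. Q w ps >= 0) &
   (ALL w ps. bd 1 ps --> Q w ps <= L) &
   (ALL w ps v a. bd 1 ps --> bd a v --> abs(avg (g (w +: v)) ps - avg (g w) ps) <= L*a) &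
   (ALL w ps v a. bd 1 ps --> bd a v --> abs(Q (w +: v) ps - Q w ps) <= L*a)"

lemma regD:
 assumes "reg L u g Q"
 shows "prob (g w)"
  and "DERIV (%s. u (w +: s *: ps)) 0 :> avg (g w) ps"
  and "DERIV (%s. avg (g (w +: s *: ps)) ps) 0 :> Q w ps"
  and "Q w ps >= 0" and "bd 1 ps ==> Q w ps <= L"
  and "bd 1 ps ==> bd a v ==> abs(avg (g (w +: v)) ps - avg (g w) ps) <= L*a"
  and "bd 1 ps ==> bd a v ==> abs(Q (w +: v) ps - Q w ps) <= L*a"
 using assms unfolding reg_def by blast+

lemma abs_avg_le:
 assumes "prob g" "bd a ps"
 shows "abs(avg g ps) <= a"
proof -
 have "abs(avg g ps) <= (SUM S:Om. g S*a)" unfolding avg_def using assms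
  by (intro order.trans[OF sum_abs] sum_mono) (auto simp: abs_mult prob_def bd_def intro!: mult_left_mono)
 also have "... = a" using assms by (simp add: sum_distrib_right[symmetric] prob_def)
 finally show ?thesis .
qed

lemma has_derivative_along:
 assumes "!!w. (DERIV (%s. f (w +: s *: ps)) 0 :> f' w)"
 shows "((%s. f (w +: s *: ps)) has_real_derivative f' (w +: s *: ps)) (at s within A)"
proof -
 have "DERIV (%h. f (w +: s *: ps +: h *: ps)) 0 :> f' (w +: s *: ps)" by (rule assms)
 hence "DERIV (%h. f (w +: (s + h) *: ps)) 0 :> f' (w +: s *: ps)"
  by (simp only: vadd_assoc vadd_vscale)
 thus ?thesis using DERIV_at_within_shift[of "%s. f (w +: s *: ps)" "f' (w +: s *: ps)" s 0 UNIV]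
  by (auto intro: DERIV_subset simp: add.commute)
qed

lemma reg_contraction:
 assumes "reg L u g Q" "bd a v"
 shows "abs(u (w +: v) - u w) <= a"
proof -
 note der = has_derivative_along[of u v "%w. avg (g w) v", OF regD(2)[OF assms(1)]]
 have "abs(u (w +: 1 *: v) - u (w +: 0 *: v)) <= a*abs(1 - 0)"
  using abs_avg_le[OF regD(1)[OF assms(1)] assms(2)]
  by (intro field_differentiable_bound[where S = UNIV and f = "%s. u (w +: s *: v)", unfolded real_norm_def])
    (auto intro: der)
 thus ?thesis by (simp add: vscale_def)
qed

lemma reg_shift: "reg L u g Q ==> reg L (%w. u (w +: z)) (%w. g (w +: z)) (%w. Q (w +: z))"
 unfolding reg_def shift_swap[of _ _ z] by blast

lemma avg_tav: "avg (%S. tav m I U (%i w. g i w S) w) ps = tav m I U (%i w. avg (g i w) ps) w"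
 by (simp add: avg_def tav_sum tav_cmult[symmetric] mult.commute)

text \<open>Tilting adds to the averaged second derivative m times the variance of the gradients,
  which is nonnegative. Only averages over I occur, so the constant depends on neither I nor b, and
  the hierarchy stays uniform in the number of walk steps.\<close>

lemma reg_tav:
 assumes r: "!!i. i : I ==> reg L (U i) (g i) (Q i)" and I: "finite I" "I ~= {}"
  and m: "m > 0" and L: "L >= 1" and b: "b > 0"
 shows "reg (L + 12 * m*L + 24 * m^2) (%w. ln ((SUM i:I. exp (m*U i w))/b)/m)
   (%w S. tav m I U (%i w. g i w S) w)
   (%w ps. tav m I U (%i w. Q i w ps + m*(avg (g i w) ps)^2) w - m*(tav m I U (%i w. avg (g i w) ps) w)^2)"
  (is "reg ?C _ _ _") unfolding reg_def avg_tav
proof (intro conjI allI impI)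
 note D = regD[OF r]
 have "m*1 <= m*L" "m^2 >= 0" using m L by (auto intro: mult_left_mono)
 hence C: "L + m*1 <= ?C" "L + 8 * m <= ?C" using m by linarith+
 have diff_le_trans: "x - y <= c" if "x <= b" "b <= c" "y >= 0" for x y b c :: real using that by linarith
 fix w ps
 let ?P = "%i w. avg (g i w) ps" and ?R = "%i w. Q i w ps + m*(avg (g i w) ps)^2"
 let ?T = "tav m I U"
 show "prob (%S. ?T (%i w. g i w S) w)"
 proof -
  have "(SUM S:Om. ?T (%i w. g i w S) w) = ?T (%i w. SUM S:Om. g i w S) w"
   by (rule tav_sum[symmetric])
  also have "... = ?T (%i w. 1) w" unfolding tav_def using D(1) by (simp add: prob_def)
  finally have "(SUM S:Om. ?T (%i w. g i w S) w) = 1" by (simp only: tav_const[OF I])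
  moreover have "?T (%i w. g i w S) w >= 0" if "S : Om" for S
   using tav_mono[of I "%i w. 0" w "%i w. g i w S" m U] D(1) that by (simp add: prob_def tav_const[OF I])
  ultimately show ?thesis by (simp add: prob_def)
 qed
 show "DERIV (%s. ln ((SUM i:I. exp (m*U i (w +: s *: ps)))/b)/m) 0 :> ?T ?P w"
  by (rule has_derivative_tav(2)[where f = ?P and P = ?P and U = U and f' = "%i w. Q i w ps" and w = w and ps = ps, OF I D(3) D(2) m b])
 show "DERIV (%s. ?T ?P (w +: s *: ps)) 0 :> ?T ?R w - m*(?T ?P w)^2"
  using has_derivative_tav(1)[where f = ?P and P = ?P and U = U and f' = "%i w. Q i w ps" and w = w and ps = ps, OF I D(3) D(2)] by (simp add: power2_eq_square mult_ac)
 have le: "(?T ?P w)^2 <= ?T (%i w. (?P i w)^2) w"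
 proof -
  let ?t = "?T ?P w"
  have "2*?t*?t - ?t^2 = ?T (%i w. 2*?t*?P i w + - (?t^2)) w"
   by (simp only: tav_add tav_cmult tav_const[OF I])
  also have "... <= ?T (%i w. (?P i w)^2) w"
  proof (rule tav_mono)
   fix i show "2*?t*?P i w + - (?t^2) <= (?P i w)^2" using sum_squares_bound[of ?t "?P i w"] by simp
  qed
  finally show ?thesis by (simp add: power2_eq_square)
 qed
 have "?T (%i w. Q i w ps) w >= 0"
  using tav_mono[of I "%i w. 0" w "%i w. Q i w ps" m U] D(4) by (simp add: tav_const[OF I])
 thus "0 <= ?T ?R w - m*(?T ?P w)^2"
  unfolding tav_add tav_cmult using mult_left_mono[OF le less_imp_le[OF m]] by linarith
 have bP: "abs(?P i w) <= 1" if "bd 1 ps" "i : I" for w i using abs_avg_le[OF D(1)[OF that(2)] that(1)] .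
 have bP2: "(?P i w)^2 <= 1" if "bd 1 ps" "i : I" for w i using bP[OF that] by (simp add: abs_square_le_1)
 { assume ps: "bd 1 ps"
  have "?T ?R w <= ?T (%i w. L + m*1) w"
   using D(5)[OF _ ps] bP2[OF ps] m by (intro tav_mono add_mono mult_left_mono) auto
  thus "?T ?R w - m*(?T ?P w)^2 <= ?C"
   unfolding tav_const[OF I] using C(1) mult_nonneg_nonneg[OF less_imp_le[OF m] zero_le_power2] by (rule diff_le_trans) }
 fix v a
 assume ps: "bd 1 ps" and v: "bd a v"
 hence a: "a >= 0" by (simp add: bd_def)
 have bTP: "abs(?T ?P w) <= 1" for w
 proof -
  have "?P i w <= 1" "- 1 <= ?P i w" if "i : I" for i using bP[OF ps that, of w] by linarith+
  hence "?T ?P w <= ?T (%i w. 1) w" "?T (%i w. - 1) w <= ?T ?P w" by (auto intro: tav_mono)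
  thus ?thesis unfolding tav_const[OF I] by linarith
 qed
 note lip = tav_lipschitz[where U = U and w = w and v = v, OF I m a reg_contraction[OF r v]]
 have 1: "abs(?T ?P (w +: v) - ?T ?P w) <= L*a + 8*1 * m*a"
  by (rule lip[where f = ?P]) (auto intro: bP[OF ps] D(6)[OF _ ps v])
 also have "... = (L + 8 * m)*a" by (simp add: distrib_right)
 also have "... <= ?C*a" using a C(2) by (rule mult_right_mono[rotated])
 finally show "abs(?T ?P (w +: v) - ?T ?P w) <= ?C*a" .
 have sq: "abs(m*x^2 - m*y^2) <= m*(2 * c)" if "abs(x - y) <= c" "abs x <= 1" "abs y <= 1" for x y c :: real
 proof -
  have "m*x^2 - m*y^2 = m*((x + y)*(x - y))" by (simp add: power2_eq_square algebra_simps)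
  hence "abs(m*x^2 - m*y^2) = m*(abs(x + y)*abs(x - y))" using m by (simp add: abs_mult)
  also have "... <= m*(2 * c)" using that m by (intro mult_left_mono mult_mono) auto
  finally show ?thesis .
 qed
 have 2: "abs(?T ?R (w +: v) - ?T ?R w) <= (L*a + m*(2*(L*a))) + 8*(L + m) * m*a"
 proof (rule lip[where f = ?R])
  fix i assume i: "i : I"
  show "abs(?R i w) <= L + m"
   using D(4)[OF i, of w ps] D(5)[OF i ps, of w] mult_left_mono[OF bP2[OF ps i, of w] less_imp_le[OF m]]
    mult_nonneg_nonneg[OF less_imp_le[OF m] zero_le_power2[of "?P i w"]] by linarith
  show "abs(?R i (w +: v) - ?R i w) <= L*a + m*(2*(L*a))"
   using D(7)[OF i ps v, of w] sq[OF D(6)[OF i ps v, of w] bP[OF ps i] bP[OF ps i]] by linarith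
 qed
 have 4: "(L*a + m*(2*(L*a))) + 8*(L + m) * m*a + m*(2*(L*a + 8*1 * m*a)) = ?C*a"
  by (simp add: algebra_simps power2_eq_square)
 have "abs(A - B - (A' - B')) <= c" if "abs(A - A') <= d" "abs(B - B') <= b" "d + b = c" for A B A' B' b c d :: real
  using that by linarith
 from this[OF 2 sq[OF 1 bTP bTP] 4]
 show "abs(?T ?R (w +: v) - m*(?T ?P (w +: v))^2 - (?T ?R w - m*(?T ?P w)^2)) <= ?C*a" .
qed

lemma avg_TE: "avg (%S. TE m vs u (%w. g w S) w) ps = TE m vs u (%w. avg (g w) ps) w"
 unfolding TE_def by (rule avg_tav)

lemma reg_LM:
 assumes r: "reg L u g Q" and vs: "vs ~= []" and m: "m > 0" and L: "L >= 1"
 shows "reg (L + 12 * m*L + 24 * m^2) (LM m vs u) (%w S. TE m vs u (%w. g w S) w)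
   (%w ps. TE m vs u (%w. Q w ps + m*(avg (g w) ps)^2) w - m*(TE m vs u (%w. avg (g w) ps) w)^2)"
 using reg_tav[where I = "{..<length vs}" and b = "length vs", OF reg_shift[OF r] _ _ m L] vs
 unfolding TE_def LM_def[abs_def] mean_def by auto

lemma reg_taylor:
 assumes r: "reg L u g Q" and ps: "bd 1 ps"
 shows "abs(u (w +: h *: ps) - u w - h*avg (g w) ps - h^2/2*Q w ps) <= L*abs h^3"
proof -
 note D = regD[OF r]
 define P where "P s = avg (g (w +: s *: ps)) ps" for s
 define R where "R s = Q (w +: s *: ps) ps" for s
 have L: "L >= 0" using D(4)[of w ps] D(5)[OF ps, of w] by linarith
 have du: "((%s. u (w +: s *: ps)) has_real_derivative P s) (at s within A)" for s A
  unfolding P_def by (rule has_derivative_along[where f' = "%w. avg (g w) ps"]) (rule D(2))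
 have dP: "(P has_real_derivative R s) (at s within A)" for s A
  unfolding P_def R_def by (rule has_derivative_along[where f = "%w. avg (g w) ps" and f' = "%w. Q w ps"]) (rule D(3))
 have R: "abs(R s - R 0) <= L*abs s" for s
  unfolding R_def using ps D(7)[OF ps, of "abs s" "s *: ps" w]
  by (auto simp: bd_def vscale_def abs_mult mult_left_le)
 have bound: "abs(f s - f 0) <= B*abs s"
  if "!!t. abs t <= abs s ==> (f has_real_derivative f' t) (at t within {-abs s..abs s})" "!!t. abs t <= abs s ==> abs(f' t) <= B" for f f' s B
 proof -
  have "norm (f s - f 0) <= B*norm (s - 0)"
   using that by (intro field_differentiable_bound[where S = "{-abs s..abs s}" and f' = f']) (auto simp: abs_le_iff)
  thus ?thesis by simp
 qed
 have P: "abs(P s - P 0 - s * R 0) <= L*abs s*abs s" for s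
 proof -
  have "abs((P s - s * R 0) - (P 0 - 0 * R 0)) <= L*abs s*abs s"
  proof (rule bound[where f = "%s. P s - s * R 0" and f' = "%s. R s - R 0"])
   fix t assume t: "abs t <= abs s"
   show "((%s. P s - s * R 0) has_real_derivative R t - R 0) (at t within {-abs s..abs s})"
    by (auto intro!: derivative_eq_intros dP)
   show "abs(R t - R 0) <= L*abs s" using R[of t] mult_left_mono[OF t L] by linarith
  qed
  thus ?thesis by simp
 qed
 have "abs((u (w +: h *: ps) - h*P 0 - h^2/2 * R 0) - (u (w +: 0 *: ps) - 0*P 0 - 0^2/2 * R 0)) <= L*abs h*abs h*abs h"
 proof (rule bound[where f = "%h. u (w +: h *: ps) - h*P 0 - h^2/2 * R 0" and f' = "%s. P s - P 0 - s * R 0"])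
  fix t assume t: "abs t <= abs h"
  show "((%h. u (w +: h *: ps) - h*P 0 - h^2/2 * R 0) has_real_derivative P t - P 0 - t * R 0) (at t within {-abs h..abs h})"
   by (auto intro!: derivative_eq_intros du)
  have "L*abs t*abs t <= L*abs h*abs h" using t L by (intro mult_mono) auto
  thus "abs(P t - P 0 - t * R 0) <= L*abs h*abs h" using P[of t] by linarith
 qed
 thus ?thesis by (simp add: P_def R_def power3_eq_cube mult_ac)
qed

text \<open>The weight of \<open>S\<close> is the tilted average of its indicator, so that the regularity of the free
  energy is an instance of \<open>reg_tav\<close> for the coordinate functionals.\<close>

definition gibbs :: "real => ('s => real) => 's => real"
 where "gibbs be w S = tav be Om (%S w. w S) (%S' w. of_bool (S' = S)) w"

definition free :: "real => ('s => real) => real"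
 where "free be w = ln (SUM S:Om. exp (be*w S))/be"

lemma partition_pos: "(SUM S:Om. exp (be*w S)) > (0::real)"
 using finite_Om Om_nonempty by (rule exp_sum_pos)

lemma avg_delta: "S : Om ==> avg (%S'. of_bool (S = S')) ps = ps S"
 using finite_Om by (simp add: avg_def of_bool_def if_distrib[of "%x. x*_"] cong: if_cong)

lemma avg_gibbs: "avg (gibbs be w) ps = tav be Om (%S w. w S) (%S w. ps S) w"
 unfolding gibbs_def avg_tav by (simp add: tav_def avg_delta)

lemma reg_free:
 assumes be: "be > 0"
 shows "reg (1 + 12*be + 24*be^2) (free be) (gibbs be)
  (%w ps. be*(avg (gibbs be w) (%S. (ps S)^2) - (avg (gibbs be w) ps)^2))"
proof -
 have "reg 1 (%w. w S) (%w S'. of_bool (S = S')) (%w ps. 0)" if S: "S : Om" for S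
  unfolding reg_def avg_delta[OF S] using finite_Om S
  by (auto simp: prob_def vadd_def vscale_def bd_def intro!: derivative_eq_intros)
 from reg_tav[OF this finite_Om Om_nonempty be order_refl zero_less_one]
 have 1: "reg (1 + 12*be + 24*be^2) (free be) (gibbs be)
  (%w ps. tav be Om (%S w. w S) (%S w. be*(avg (%S'. of_bool (S = S')) ps)^2) w
    - be*(tav be Om (%S w. w S) (%S w. avg (%S'. of_bool (S = S')) ps) w)^2)"
  by (simp add: free_def[abs_def] gibbs_def[abs_def])
 have t: "tav be Om (%S w. w S) (%S w. F (avg (%S'. of_bool (S = S')) ps)) w =
   tav be Om (%S w. w S) (%S w. F (ps S)) w" for F w ps
  by (simp add: tav_def avg_delta)
 show ?thesis using 1 unfolding t[of "%x. be*x^2"] t[of "%x. x"]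
  by (simp add: avg_gibbs tav_cmult right_diff_distrib)
qed

section \<open>Walks and their second-order gain\<close>

definition two :: "real => ('s => real) => ('s => real) list"
 where "two h ps = [h *: ps, (- h) *: ps]"

lemma two_nonempty [simp]: "two h ps ~= []" by (simp add: two_def)

text \<open>The function u' under the mean need only dominate u + ph, and ph only needs small
  oscillation: it carries the gains of inner steps and levels, for which no smoothness is tracked.
  The expansion itself uses u alone.\<close>

lemma LM_two_ge:
 assumes r: "reg L u g Q" and ps: "bd 1 ps" and m: "m > 0" and h: "0 <= h" "h <= 1" and L: "L >= 0"
  and ph: "!!v. bd h v ==> ph (w +: v) >= ph w - e"
  and u': "!!w. u' w >= u w + ph w"
 shows "LM m (two h ps) u' w >= u w + ph w + h^2/2*(Q w ps + m*(avg (g w) ps)^2) - e - (L + m^3)*h^3"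
proof -
 let ?P = "avg (g w) ps"
 define c where "c = u w + ph w - e + h^2/2*Q w ps - L*h^3"
 have bd: "bd h (h *: ps)" "bd h ((- h) *: ps)"
  using ps h by (auto simp: bd_def vscale_def abs_mult mult_left_le)
 have 1: "u' (w +: h *: ps) >= c + h*?P" "u' (w +: (- h) *: ps) >= c - h*?P"
  using reg_taylor[OF r ps, of w h] reg_taylor[OF r ps, of w "- h"] ph[OF bd(1)] ph[OF bd(2)]
   u'[of "w +: h *: ps"] u'[of "w +: (- h) *: ps"] unfolding c_def abs_minus_cancel abs_of_nonneg[OF h(1)] power2_minus
  by linarith+
 have P1: "abs(?P) <= 1" by (rule abs_avg_le[OF regD(1)[OF r] ps])
 let ?x = "m*(h*?P)"
 have "m*(c + m*(h*?P)^2/2 - m^3*h^3) <= m * c + ln (cosh ?x)"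
 proof -
  have "?x^4/4 <= m*(m^3*h^3)"
  proof -
   have "h^4 <= h^3" using h by (intro power_decreasing) auto
   moreover have "abs(?P)^4 <= 1" using P1 by (intro power_le_one) auto
   ultimately have "h^4*abs(?P)^4 <= h^3*1" using h by (intro mult_mono) auto
   hence "m^4*(h^4*?P^4) <= m^4*h^3" using m by (intro mult_left_mono) auto
   moreover have "0 <= m^4*h^3" using m h by simp
   moreover have "?x^4 = m^4*(h^4*?P^4)" "m*(m^3*h^3) = m^4*h^3"
    by (simp_all add: power_mult_distrib eval_nat_numeral)
   ultimately show ?thesis by linarith
  qed
  moreover have "m*(c + m*(h*?P)^2/2 - m^3*h^3) = m * c + ?x^2/2 - m*(m^3*h^3)"
   by (simp add: power2_eq_square algebra_simps)
  ultimately show ?thesis using ln_cosh_ge[of ?x] by linarith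
 qed
 hence "exp (m*(c + m*(h*?P)^2/2 - m^3*h^3)) <= exp (m * c + ln (cosh ?x))" by simp
 also have "... = (exp (m*(c + h*?P)) + exp (m*(c - h*?P)))/2"
 proof -
  have "exp (m * c + ln (cosh ?x)) = exp (m * c)*cosh ?x" by (simp add: exp_add)
  also have "... = (exp (m * c + ?x) + exp (m * c + (- ?x)))/2"
   unfolding exp_add cosh_field_def by (simp add: algebra_simps)
  finally show ?thesis by (simp add: algebra_simps)
 qed
 also have "... <= mean (%v. exp (m*u' (w +: v))) (two h ps)"
  unfolding two_def mean_two using 1 m by (intro divide_right_mono add_mono) auto
 finally have "c + m*(h*?P)^2/2 - m^3*h^3 <= LM m (two h ps) u' w" using m by (simp add: LM_le_iff)
 moreover have "u w + ph w + h^2/2*(Q w ps + m*?P^2) - e - (L + m^3)*h^3 = c + m*(h*?P)^2/2 - m^3*h^3"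
  by (simp add: c_def algebra_simps power_mult_distrib)
 ultimately show ?thesis by simp
qed

text \<open>One step draws an independent sign for every direction in the list.\<close>

primrec stepl :: "real => ('s => real) list => ('s => real) list" where
 "stepl h [] = [%_. 0]"
| "stepl h (ps # ds) = conv (two h ps) (stepl h ds)"

primrec walk :: "real => ('s => real) list => nat => ('s => real) list" where
 "walk h ds 0 = [%_. 0]"
| "walk h ds (Suc j) = conv (walk h ds j) (stepl h ds)"

lemma stepl_nonempty [simp]: "stepl h ds ~= []" by (induction ds) auto

lemma walk_nonempty [simp]: "walk h ds j ~= []" by (induction j) auto

lemma LM_trivial: "m > 0 ==> LM m [%_. 0] u w = u w" by (simp add: LM_def mean_def)

text \<open>Up to the factor m this is the second derivative of exp (m*u) along the direction,
  divided by exp (m*u). It governs both the gain from walk steps and the cost of edges.\<close>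

definition tilt :: "real => (('s => real) => 's => real) => (('s => real) => ('s => real) => real)
  => ('s => real) => ('s => real) => real"
 where "tilt m g Q w ps = Q w ps + m*(avg (g w) ps)^2"

lemma tilt_lipschitz:
 assumes r: "reg L u g Q" and ps: "bd 1 ps" and m: "m > 0" and v: "bd a v"
 shows "abs(tilt m g Q (w +: v) ps - tilt m g Q w ps) <= (L + 2 * m*L)*a"
proof -
 let ?P = "%w. avg (g w) ps"
 have P: "abs(?P w) <= 1" for w by (rule abs_avg_le[OF regD(1)[OF r] ps])
 have "abs((?P (w +: v))^2 - (?P w)^2) = abs(?P (w +: v) + ?P w)*abs(?P (w +: v) - ?P w)"
  by (simp add: abs_mult[symmetric] power2_eq_square algebra_simps)
 also have "... <= 2*(L*a)"
  using P[of w] P[of "w +: v"] regD(6)[OF r ps v, of w] by (intro mult_mono) auto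
 finally have "m*abs((?P (w +: v))^2 - (?P w)^2) <= m*(2*(L*a))"
  using m by (intro mult_left_mono) auto
 moreover have "m*abs((?P (w +: v))^2 - (?P w)^2) = abs(m*(?P (w +: v))^2 - m*(?P w)^2)"
  using m by (simp add: abs_mult right_diff_distrib[symmetric])
 moreover have "(L + 2 * m*L)*a = L*a + m*(2*(L*a))" by (simp add: algebra_simps)
 ultimately show ?thesis using regD(7)[OF r ps v, of w] unfolding tilt_def by linarith
qed

lemma tilt_bounds:
 assumes r: "reg L u g Q" and ps: "bd 1 ps" and m: "m > 0"
 shows "0 <= tilt m g Q w ps" "tilt m g Q w ps <= L + m"
proof -
 have "(avg (g w) ps)^2 <= 1" using abs_avg_le[OF regD(1)[OF r, of w] ps] by (simp add: abs_square_le_1)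
 thus "tilt m g Q w ps <= L + m"
  using regD(5)[OF r ps, of w] mult_left_mono[of "(avg (g w) ps)^2" 1 m] m unfolding tilt_def by linarith
 show "0 <= tilt m g Q w ps" using regD(4)[OF r, of w ps] m by (simp add: tilt_def)
qed

text \<open>Directions are treated one at a time. The gains of the inner directions are put into ph;
  since \<open>tilt\<close> is Lipschitz they oscillate little and survive the outer averaging up to
  O(h^3).\<close>

lemma LM_stepl_ge:
 assumes r: "reg L u g Q" and m: "m > 0" and h: "0 <= h" "h <= 1" and L: "L >= 0" and e: "e >= 0"
  and ph: "!!w v. bd h v ==> ph (w +: v) >= ph w - e"
  and ds: "!!ps. ps : set ds ==> bd 1 ps"
 shows "LM m (stepl h ds) (%w. u w + ph w) w >= u w + ph w + h^2/2*(SUM ps<-ds. tilt m g Q w ps)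
  - real (length ds)*(e + (real (length ds)*(L + 2 * m*L) + (L + m^3))*h^3)"
 using ds
proof (induction ds arbitrary: w)
 case Nil
 thus ?case using m by (simp add: LM_trivial)
next
 case (Cons ps ds)
 let ?A = "L + 2 * m*L" and ?B = "L + m^3" and ?l = "real (length ds)"
 define E where "E = ?l*(e + (?l*?A + ?B)*h^3)"
 define ph' where "ph' w = ph w + h^2/2*(SUM ps<-ds. tilt m g Q w ps) - E" for w
 have A: "?A >= 0" "?B >= 0" "h^3 >= 0" using m L h by auto
 have sum_lip: "(SUM ps<-ds. tilt m g Q (w +: v) ps) >= (SUM ps<-ds. tilt m g Q w ps) - ?l*(?A*h)"
  if v: "bd h v" for v w
 proof -
  have "(SUM ps<-ds. tilt m g Q w ps - ?A*h) <= (SUM ps<-ds. tilt m g Q (w +: v) ps)"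
  proof (intro sum_list_mono)
   fix ps' assume "ps' : set ds"
   hence "bd 1 ps'" using Cons.prems by simp
   from tilt_lipschitz[OF r this m v, of w] show "tilt m g Q w ps' - ?A*h <= tilt m g Q (w +: v) ps'" by linarith
  qed
  thus ?thesis by (simp add: sum_list_subtractf sum_list_triv)
 qed
 have "u w + ph' w + h^2/2*tilt m g Q w ps - (e + ?l*?A*h^3) - ?B*h^3
   <= LM m (two h ps) (LM m (stepl h ds) (%w. u w + ph w)) w"
  unfolding tilt_def
 proof (rule LM_two_ge[OF r _ m h L])
  show "bd 1 ps" using Cons.prems by simp
  show "u w + ph' w <= LM m (stepl h ds) (%w. u w + ph w) w" for w
   using Cons.IH[of w] Cons.prems by (simp add: ph'_def E_def)
  show "ph' w - (e + ?l*?A*h^3) <= ph' (w +: v)" if v: "bd h v" for v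
  proof -
   have "h^2/2*((SUM ps<-ds. tilt m g Q w ps) - ?l*(?A*h)) <= h^2/2*(SUM ps<-ds. tilt m g Q (w +: v) ps)"
    using sum_lip[OF v, of w] by (intro mult_left_mono) auto
   moreover have "h^2/2*((SUM ps<-ds. tilt m g Q w ps) - ?l*(?A*h)) = h^2/2*(SUM ps<-ds. tilt m g Q w ps) - (?l*?A*h^3)/2"
    by (simp add: algebra_simps power2_eq_square power3_eq_cube)
   moreover have "0 <= ?l*?A*h^3" using A by (intro mult_nonneg_nonneg) auto
   ultimately show ?thesis using ph[OF v, of w] unfolding ph'_def by linarith
  qed
 qed
 moreover have "u w + ph w + h^2/2*(SUM ps<-ps # ds. tilt m g Q w ps)
   - real (length (ps # ds))*(e + (real (length (ps # ds))*?A + ?B)*h^3)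
   <= u w + ph' w + h^2/2*tilt m g Q w ps - (e + ?l*?A*h^3) - ?B*h^3"
 proof -
  have "(?l + 1)*(e + ((?l + 1)*?A + ?B)*h^3) - E - (e + ?l*?A*h^3) - ?B*h^3 = (?l + 1)*?A*h^3"
   unfolding E_def by (simp add: algebra_simps)
  moreover have "(?l + 1)*?A*h^3 >= 0" using A by (intro mult_nonneg_nonneg) auto
  moreover have "h^2/2*(SUM ps<-ps # ds. tilt m g Q w ps) = h^2/2*tilt m g Q w ps + h^2/2*(SUM ps<-ds. tilt m g Q w ps)"
   by (simp add: distrib_left)
  moreover have len: "real (length (ps # ds)) = ?l + 1" by simp
  ultimately show ?thesis unfolding ph'_def len by linarith
 qed
 ultimately have "u w + ph w + h^2/2*(SUM ps<-ps # ds. tilt m g Q w ps)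
   - real (length (ps # ds))*(e + (real (length (ps # ds))*?A + ?B)*h^3)
   <= LM m (two h ps) (LM m (stepl h ds) (%w. u w + ph w)) w" by linarith
 thus ?case using m by (simp add: LM_conv)
qed

end

section \<open>The hierarchical functional\<close>

text \<open>A list of levels \<open>(m, s)\<close>, outermost level first; \<open>m\<close> is the value of the order parameter
  and \<open>s\<close> the length of the interval on which it is taken.\<close>

primrec Lc :: "real => (real \<times> real) list => real" where
 "Lc be [] = 1 + 12*be + 24*be^2"
| "Lc be (p # lv) = Lc be lv + 12*fst p*Lc be lv + 24*(fst p)^2"

definition levels_ok :: "(real \<times> real) list => bool"
 where "levels_ok lv \<longleftrightarrow> (ALL p:set lv. fst p > 0 & snd p >= 0 & snd p <= 1)"

lemma levels_ok_Cons [simp]: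
 "levels_ok (p # lv) \<longleftrightarrow> fst p > 0 & snd p >= 0 & snd p <= 1 & levels_ok lv"
 by (auto simp: levels_ok_def)

lemma Lc_ge_1: "be > 0 ==> levels_ok lv ==> Lc be lv >= 1"
proof (induction lv)
 case (Cons p lv)
 hence "0 <= 12*fst p*Lc be lv" "0 <= 24*(fst p)^2" "1 <= Lc be lv" by auto
 thus ?case unfolding Lc.simps by linarith
qed auto

locale hierarchy = spins Om for Om :: "'s set" +
 fixes be :: real and dirs :: "('s => real) list"
 assumes be: "be > 0" and dirs: "ps : set dirs ==> bd 1 ps"
begin

text \<open>At every level, j steps of relative size et have been made. For et = 1/sqrt N and j = N
  each site has received increments of variance s from a level of length s; for j = 0 only the free
  energy is left.\<close>

primrec UU :: "real => nat => (real \<times> real) list => ('s => real) => real" where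
 "UU et j [] = free be"
| "UU et j (p # lv) = LM (fst p) (walk (sqrt (snd p)*et) dirs j) (UU et j lv)"

primrec GG :: "real => nat => (real \<times> real) list => ('s => real) => 's => real" where
 "GG et j [] = gibbs be"
| "GG et j (p # lv) = (%w S. TE (fst p) (walk (sqrt (snd p)*et) dirs j) (UU et j lv) (%w. GG et j lv w S) w)"

primrec QQ :: "real => nat => (real \<times> real) list => ('s => real) => ('s => real) => real" where
 "QQ et j [] = (%w ps. be*(avg (gibbs be w) (%S. (ps S)^2) - (avg (gibbs be w) ps)^2))"
| "QQ et j (p # lv) = (%w ps.
   TE (fst p) (walk (sqrt (snd p)*et) dirs j) (UU et j lv) (%w. QQ et j lv w ps + fst p*(avg (GG et j lv w) ps)^2) w
   - fst p*(TE (fst p) (walk (sqrt (snd p)*et) dirs j) (UU et j lv) (%w. avg (GG et j lv w) ps) w)^2)"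

definition XX :: "real => real => nat => (real \<times> real) list => ('s => real) => real"
 where "XX m et j lv w = (SUM ps<-dirs. tilt m (GG et j lv) (QQ et j lv) w ps)"

text \<open>Twice the second-order gain from one additional step of the walk at every level.\<close>

primrec CC :: "real => nat => (real \<times> real) list => ('s => real) => real" where
 "CC et j [] = (%w. 0)"
| "CC et j (p # lv) = TE (fst p) (walk (sqrt (snd p)*et) dirs j) (UU et j lv)
   (%w. CC et j lv w + snd p*XX (fst p) et j lv w)"

text \<open>The constant \<open>Lc\<close> follows \<open>reg_LM\<close> level by level and contains
  neither et nor j.\<close>

lemma reg_UU: "levels_ok lv ==> reg (Lc be lv) (UU et j lv) (GG et j lv) (QQ et j lv)"
proof (induction lv)
 case Nil
 show ?case using reg_free[OF be] by simp
next
 case (Cons p lv)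
 hence "reg (Lc be lv) (UU et j lv) (GG et j lv) (QQ et j lv)" by simp
 from reg_LM[OF this walk_nonempty _ Lc_ge_1] show ?case using Cons.prems be by simp
qed

lemma XX_bounds:
 assumes "levels_ok lv" "m > 0"
 shows "abs(XX m et j lv w) <= length dirs*(Lc be lv + m)"
  and "bd a v ==> abs(XX m et j lv (w +: v) - XX m et j lv w) <= length dirs*((Lc be lv + 2 * m*Lc be lv)*a)"
proof -
 note r = reg_UU[OF assms(1)]
 have sum_le: "abs(SUM ps<-ds. f ps) <= length ds * c" if "!!ps. ps : set ds ==> abs(f ps) <= c" for f and c :: real and ds :: "('s => real) list"
  using that
 proof (induction ds)
  case (Cons a ds)
  hence "abs(f a) <= c" "abs(SUM ps<-ds. f ps) <= length ds * c" by auto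
  thus ?case by (simp add: distrib_right)
 qed simp
 show "abs(XX m et j lv w) <= length dirs*(Lc be lv + m)" unfolding XX_def
 proof (rule sum_le[where f = "tilt m (GG et j lv) (QQ et j lv) w" and c = "Lc be lv + m"])
  fix ps assume "ps : set dirs"
  from tilt_bounds[OF r dirs[OF this] assms(2), of et j w]
  show "abs(tilt m (GG et j lv) (QQ et j lv) w ps) <= Lc be lv + m" by simp
 qed
 show "abs(XX m et j lv (w +: v) - XX m et j lv w) <= length dirs*((Lc be lv + 2 * m*Lc be lv)*a)" if "bd a v"
  unfolding XX_def sum_list_subtractf[symmetric]
  by (rule sum_le) (rule tilt_lipschitz[OF r dirs assms(2) that])
qed

text \<open>Its bound on increments, uniform in et and j, is what lets the gain of the inner levels
  enter an outer step as the perturbation ph.\<close>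

lemma CC_bounds:
 assumes "levels_ok lv"
 shows "EX K>=0. ALL et j w. abs(CC et j lv w) <= K & (ALL a v. bd a v --> abs(CC et j lv (w +: v) - CC et j lv w) <= K*a)"
 using assms
proof (induction lv)
 case Nil
 show ?case by (intro exI[of _ 0]) simp
next
 case (Cons p lv)
 then obtain K where K: "K >= 0" "!!et j w. abs(CC et j lv w) <= K"
  "!!et j w a v. bd a v ==> abs(CC et j lv (w +: v) - CC et j lv w) <= K*a" by auto
 obtain m s where p [simp]: "p = (m, s)" by (cases p)
 have ok: "levels_ok lv" and m: "m > 0" and s: "0 <= s" "s <= 1" using Cons.prems by auto
 let ?L = "Lc be lv" and ?n = "real (length dirs)"
 have L: "?L >= 1" by (rule Lc_ge_1[OF be ok])
 define B where "B = K + ?n*(?L + m)"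
 define D where "D = K + ?n*(?L + 2 * m*?L)"
 have BD: "B >= 0" "D >= 0" using K L m by (auto simp: B_def D_def)
 let ?f = "%et j w. CC et j lv w + s*XX m et j lv w"
 have f1: "abs(?f et j w) <= B" for et j w
 proof -
  have "abs(s*XX m et j lv w) <= 1*(?n*(?L + m))"
   unfolding abs_mult using s XX_bounds(1)[OF ok m] by (intro mult_mono) auto
  thus ?thesis using K(2)[of et j w] unfolding B_def by linarith
 qed
 have f2: "abs(?f et j (w +: v) - ?f et j w) <= D*a" if "bd a v" for et j w a v
 proof -
  have "abs(s*(XX m et j lv (w +: v) - XX m et j lv w)) <= 1*(?n*((?L + 2 * m*?L)*a))"
   unfolding abs_mult using s XX_bounds(2)[OF ok m that] by (intro mult_mono) auto
  moreover have "D*a = K*a + ?n*((?L + 2 * m*?L)*a)" by (simp add: D_def algebra_simps)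
  moreover have "?f et j (w +: v) - ?f et j w = (CC et j lv (w +: v) - CC et j lv w) + s*(XX m et j lv (w +: v) - XX m et j lv w)"
   by (simp add: algebra_simps)
  ultimately show ?thesis using K(3)[OF that, of et j w] by linarith
 qed
 show ?case
 proof (intro exI[of _ "B + D + 8*B * m"] conjI allI impI)
  show "0 <= B + D + 8*B * m" using BD m by simp
  fix et j w
  let ?T = "TE m (walk (sqrt s*et) dirs j) (UU et j lv)"
  have "?T (?f et j) w <= ?T (%_. B) w" "?T (%_. - B) w <= ?T (?f et j) w"
   using f1[of et j, unfolded abs_le_iff] by (auto intro!: TE_mono simp del: minus_add_distrib simp: minus_le_iff[of B])
  hence "abs(?T (?f et j) w) <= B" unfolding TE_const[OF walk_nonempty] by linarith
  moreover have "0 <= 8*B * m" using BD m by simp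
  ultimately show "abs(CC et j (p # lv) w) <= B + D + 8*B * m" using BD by simp
  fix a v assume v: "bd a v"
  hence a: "a >= 0" by (simp add: bd_def)
  have "abs(?T (?f et j) (w +: v) - ?T (?f et j) w) <= D*a + 8*B * m*a"
   by (rule TE_lipschitz[where u = "UU et j lv" and v = v and f = "?f et j", OF walk_nonempty m a])
     (auto intro: f1 f2 v reg_contraction[OF reg_UU[OF ok]])
  also have "... <= (B + D + 8*B * m)*a" using BD a by (simp add: algebra_simps)
  finally show "abs(CC et j (p # lv) (w +: v) - CC et j (p # lv) w) <= (B + D + 8*B * m)*a" by simp
 qed
qed

text \<open>\<open>LM_conv\<close> splits the new step off as the inner factor of the walk. The gain
  of the inner levels passes the new step as a slowly varying perturbation, the new step adds s
  times \<open>XX\<close>, and the tangent inequality carries the sum through the existing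
  walk.\<close>

lemma UU_Suc_ge:
 assumes "levels_ok lv"
 shows "EX E>=0. ALL et j w. 0 < et --> et <= 1 -->
  UU et (Suc j) lv w >= UU et j lv w + et^2/2*CC et j lv w - E*et^3"
 using assms
proof (induction lv)
 case Nil
 show ?case by (intro exI[of _ 0]) simp
next
 case (Cons p lv)
 then obtain E where E: "E >= 0" "!!et j w. 0 < et ==> et <= 1 ==>
   UU et (Suc j) lv w >= UU et j lv w + et^2/2*CC et j lv w - E*et^3" by auto
 obtain m s where p [simp]: "p = (m, s)" by (cases p)
 have ok: "levels_ok lv" and m: "m > 0" and s: "0 <= s" "s <= 1" using Cons.prems by auto
 from CC_bounds[OF ok] obtain K where K: "K >= 0"
  "!!et j w a v. bd a v ==> abs(CC et j lv (w +: v) - CC et j lv w) <= K*a" by auto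
 let ?L = "Lc be lv" and ?n = "real (length dirs)"
 have L: "?L >= 1" by (rule Lc_ge_1[OF be ok])
 define A where "A = ?n*(?L + 2 * m*?L) + (?L + m^3)"
 have A: "A >= 0" using L m by (auto simp: A_def)
 define E' where "E' = E + ?n*(K + A)"
 have E': "E' >= 0" using E K A by (auto simp: E'_def)
 show ?case
 proof (intro exI[of _ E'] conjI allI impI E')
  fix et :: real and j :: nat and w
  assume et: "0 < et" "et <= 1"
  let ?h = "sqrt s*et"
  have h: "0 <= ?h" "?h <= et" "?h <= 1" and h2: "?h^2 = s*et^2"
   using et s by (auto simp: power_mult_distrib mult_le_cancel_right1 intro!: mult_le_one mult_left_le_one_le)
  define ph where "ph w = et^2/2*CC et j lv w - E*et^3" for w
  define f where "f w = CC et j lv w + s*XX m et j lv w" for w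
  let ?U = "UU et j lv"
  have h3: "?h^3 <= et^3" using h by (intro power_mono)
  have 1: "LM m (stepl ?h dirs) (UU et (Suc j) lv) w >= ?U w + et^2/2*f w + (- E'*et^3)" for w
  proof -
   have "LM m (stepl ?h dirs) (%w. ?U w + ph w) w >= ?U w + ph w
    + ?h^2/2*(SUM ps<-dirs. tilt m (GG et j lv) (QQ et j lv) w ps)
    - ?n*(K*et^3 + (?n*(?L + 2 * m*?L) + (?L + m^3))*?h^3)"
   proof (rule LM_stepl_ge[OF reg_UU[OF ok] m h(1,3)])
    show "0 <= ?L" "0 <= K*et^3" using L K et by auto
    show "bd 1 ps" if "ps : set dirs" for ps using dirs[OF that] .
    show "ph w - K*et^3 <= ph (w +: v)" if v: "bd ?h v" for v w
    proof -
     have "CC et j lv w - K*?h <= CC et j lv (w +: v)" using K(2)[OF v, of et j w] by linarith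
     moreover have "K*?h <= K*et" using h K by (intro mult_left_mono)
     ultimately have "CC et j lv w - K*et <= CC et j lv (w +: v)" by linarith
     hence "et^2/2*(CC et j lv w - K*et) <= et^2/2*CC et j lv (w +: v)" by (intro mult_left_mono) auto
     moreover have "et^2/2*(CC et j lv w - K*et) = et^2/2*CC et j lv w - (K*et^3)/2"
      by (simp add: algebra_simps power2_eq_square power3_eq_cube)
     moreover have "0 <= K*et^3" using K et by simp
     ultimately show ?thesis unfolding ph_def by linarith
    qed
   qed
   moreover have "?n*(K*et^3 + A*?h^3) <= ?n*((K + A)*et^3)"
    using mult_left_mono[OF h3 A] by (intro mult_left_mono) (auto simp: distrib_right)
   moreover have "LM m (stepl ?h dirs) (%w. ?U w + ph w) w <= LM m (stepl ?h dirs) (UU et (Suc j) lv) w"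
    using E(2)[OF et, of j] m by (intro LM_mono) (auto simp: ph_def add_diff_eq)
   moreover have "?U w + ph w + ?h^2/2*XX m et j lv w - ?n*((K + A)*et^3) = ?U w + et^2/2*f w + (- E'*et^3)"
    unfolding h2 ph_def f_def E'_def by (simp add: algebra_simps)
   ultimately show ?thesis unfolding XX_def A_def by linarith
  qed
  have "LM m (walk ?h dirs j) ?U w + TE m (walk ?h dirs j) ?U (%w. et^2/2*f w + (- E'*et^3)) w
   <= LM m (walk ?h dirs j) (%w. ?U w + (et^2/2*f w + (- E'*et^3))) w"
   using m by (intro LM_ge_linear) auto
  also have "... <= LM m (walk ?h dirs j) (LM m (stepl ?h dirs) (UU et (Suc j) lv)) w"
   using 1 m by (intro LM_mono) (auto simp: add_diff_eq)
  also have "... = UU et (Suc j) (p # lv) w" using m by (simp add: LM_conv)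
  finally have "LM m (walk ?h dirs j) ?U w + TE m (walk ?h dirs j) ?U (%w. et^2/2*f w + (- E'*et^3)) w <= UU et (Suc j) (p # lv) w" .
  thus "UU et j (p # lv) w + et^2/2*CC et j (p # lv) w - E'*et^3 <= UU et (Suc j) (p # lv) w"
   unfolding TE_add TE_cmult TE_const[OF walk_nonempty] by (simp add: f_def)
 qed
qed

end

section \<open>Guerra's inequality\<close>

text \<open>The overlap carried by the levels above \<open>lv\<close>.\<close>

definition qrem :: "(real \<times> real) list => real"
 where "qrem lv = 1 - (SUM p<-lv. snd p)"

text \<open>Minus the integral of q * x(q) for the step function given by the levels, in Abel-summed
  form with \<open>qrem\<close> as left end of each interval. Half of it is the correction term of
  the Parisi functional.\<close>

primrec K1 :: "real => (real \<times> real) list => real" where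
 "K1 m [] = - m/2"
| "K1 m (p # lv) = K1 (fst p) lv + (fst p - m)*(qrem (p # lv))^2/2"

primrec chain :: "real => real => (real \<times> real) list => bool" where
 "chain be m [] \<longleftrightarrow> m <= be"
| "chain be m (p # lv) \<longleftrightarrow> m <= fst p & chain be (fst p) lv"

locale ising = spins Om for Om :: "'s set" +
 fixes be :: real and n :: nat and sg :: "nat => 's => real"
 assumes be_pos: "be > 0" and n_pos: "n > 0"
  and sg: "S : Om ==> i < n ==> sg i S = 1 | sg i S = -1"
begin

lemma bd_sg: "i < n ==> bd 1 (sg i)" using sg by (fastforce simp: bd_def)

sublocale hierarchy Om be "map sg [0..<n]" by unfold_locales (auto simp: be_pos bd_sg)

definition ps :: "nat => nat => 's => real"
 where "ps i k S = sg i S * sg k S"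

lemma bd_ps: "i < n ==> k < n ==> bd 1 (ps i k)"
 using bd_sg[of i] bd_sg[of k] by (auto simp: bd_def ps_def abs_mult intro!: mult_le_one)

text \<open>The second-order cost of edges at rate 1/n per unordered pair, written over ordered
  pairs; the diagonal it includes is nonnegative.\<close>

definition EE :: "real => real => nat => (real \<times> real) list => ('s => real) => real"
 where "EE m et j lv w = (SUM i<n. SUM k<n. tilt m (GG et j lv) (QQ et j lv) w (ps i k))/(2*n)"

lemma XX_sum: "XX m et j lv w = (SUM i<n. tilt m (GG et j lv) (QQ et j lv) w (sg i))"
 by (simp add: XX_def o_def interv_sum_list_conv_sum_set_nat atLeast0LessThan)

text \<open>Passing to the next inner level replaces the order parameter m by \<open>fst p\<close>.
  The price is the jump times a squared average, and these jumps carry the comparison of sites with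
  edges.\<close>

lemma tilt_Cons:
 "tilt m (GG et j (p # lv)) (QQ et j (p # lv)) w ph =
   TE (fst p) (walk (sqrt (snd p)*et) (map sg [0..<n]) j) (UU et j lv) (%w. tilt (fst p) (GG et j lv) (QQ et j lv) w ph) w
   - (fst p - m)*(avg (GG et j (p # lv) w) ph)^2"
 by (simp add: tilt_def avg_TE algebra_simps)

text \<open>For the overlap R of two replicas this says that the squared mean of R is at most the
  mean of R^2. Two sums of squares avoid the product measure: the variance of the spins projected on
  their magnetisations, and the deviations of the pair averages from products.\<close>

lemma moments_le:
 assumes "prob g"
 shows "(SUM i<n. (avg g (sg i))^2)^2 <= (SUM i<n. SUM k<n. (avg g (ps i k))^2)"
proof -
 let ?M = "%i. avg g (sg i)" and ?A = "%i k. avg g (ps i k)"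
 let ?T = "SUM i<n. (?M i)^2"
 let ?f = "%S. SUM i<n. ?M i * sg i S"
 have g: "!!S. S : Om ==> g S >= 0" "(SUM S:Om. g S) = 1" using assms by (auto simp: prob_def)
 have f: "(SUM S:Om. g S*?f S) = ?T"
 proof -
  have "(SUM S:Om. g S*?f S) = (SUM S:Om. SUM i<n. ?M i*(g S * sg i S))"
   by (simp add: sum_distrib_left mult_ac)
  also have "... = (SUM i<n. ?M i*(SUM S:Om. g S * sg i S))"
   by (subst sum.swap) (simp add: sum_distrib_left)
  also have "... = ?T" by (simp add: avg_def power2_eq_square)
  finally show ?thesis .
 qed
 have f2: "(SUM S:Om. g S*(?f S)^2) = (SUM i<n. SUM k<n. ?A i k*(?M i*?M k))"
 proof -
  have "(SUM i<n. SUM k<n. ?A i k*(?M i*?M k)) = (SUM i<n. SUM k<n. SUM S:Om. g S*(?M i * sg i S*(?M k * sg k S)))"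
   unfolding avg_def[of g "ps _ _"] ps_def sum_distrib_right by (simp add: mult_ac)
  also have "... = (SUM S:Om. SUM i<n. SUM k<n. g S*(?M i * sg i S*(?M k * sg k S)))"
   by (simp add: sum.swap[of _ Om])
  also have "... = (SUM S:Om. g S*(?f S)^2)"
   unfolding power2_eq_square sum_product by (simp add: sum_distrib_left)
  finally show ?thesis by simp
 qed
 have "0 <= (SUM S:Om. g S*(?f S - ?T)^2)" using g by (intro sum_nonneg) auto
 also have "... = (SUM S:Om. g S*(?f S)^2) - 2*?T*(SUM S:Om. g S*?f S) + ?T^2*(SUM S:Om. g S)"
 proof -
  have "g S*(x - t)^2 = g S*x^2 - (2*t)*(g S*x) + t^2*g S" for S x t
   by (simp add: power2_eq_square algebra_simps)
  thus ?thesis by (simp add: sum.distrib sum_subtractf sum_distrib_left[symmetric])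
 qed
 finally have 1: "?T^2 <= (SUM i<n. SUM k<n. ?A i k*(?M i*?M k))"
  unfolding f f2 g by (simp add: power2_eq_square)
 have "0 <= (SUM i<n. SUM k<n. (?A i k - ?M i*?M k)^2)" by (intro sum_nonneg) auto
 also have "... = (SUM i<n. SUM k<n. (?A i k)^2) - 2*(SUM i<n. SUM k<n. ?A i k*(?M i*?M k)) + (SUM i<n. SUM k<n. (?M i)^2*(?M k)^2)"
  by (simp add: power2_diff sum.distrib sum_subtractf sum_distrib_left mult_ac power_mult_distrib)
 also have "(SUM i<n. SUM k<n. (?M i)^2*(?M k)^2) = ?T^2"
  by (simp add: power2_eq_square[of ?T] sum_product)
 finally show ?thesis using 1 by linarith
qed

text \<open>Guerra's square: the mean of (R - q)^2 is nonnegative, multiplied by n/2, where R is the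
  overlap of two replicas.\<close>

lemma overlap_ineq:
 fixes q :: real
 assumes "prob g"
 shows "q*(SUM i<n. (avg g (sg i))^2) <= (SUM i<n. SUM k<n. (avg g (ps i k))^2)/(2*n) + n*q^2/2"
proof -
 let ?T = "SUM i<n. (avg g (sg i))^2"
 have "0 <= (?T - n*q)^2" by simp
 hence "q*?T*(2*n) <= ?T^2 + (n*q)^2" by (simp add: power2_diff algebra_simps)
 also have "... <= (SUM i<n. SUM k<n. (avg g (ps i k))^2) + (n*q)^2" using moments_le[OF assms] by simp
 finally have "q*?T <= ((SUM i<n. SUM k<n. (avg g (ps i k))^2) + (n*q)^2)/(2*n)"
  using n_pos by (simp add: field_simps)
 thus ?thesis using n_pos by (simp add: add_divide_distrib power2_eq_square mult_ac)
qed

lemma avg_one: "prob g ==> (!!S. S : Om ==> f S = 1) ==> avg g f = 1"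
 by (simp add: avg_def prob_def)

text \<open>Induction from the innermost level outwards. A jump of the order parameter multiplies
  half the mean squared overlap on the side of the edges and q times the mean overlap on the side of
  the sites; \<open>overlap_ineq\<close> compares them, and the remaining q^2/2 is what
  \<open>K1\<close> collects.\<close>

theorem guerra:
 assumes "levels_ok lv" "m > 0" "chain be m lv"
 shows "EE m et j lv w <= CC et j lv w + qrem lv*XX m et j lv w + n*K1 m lv" using assms
proof (induction lv arbitrary: m w)
 case Nil
 have p: "prob (gibbs be w)" using regD(1)[OF reg_free[OF be]] .
 have t: "tilt m (GG et j []) (QQ et j []) w ph = be - (be - m)*(avg (gibbs be w) ph)^2"
  if "!!S. S : Om ==> (ph S)^2 = 1" for ph
  using avg_one[OF p, of "%S. (ph S)^2"] that by (simp add: tilt_def algebra_simps)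
 have ps2: "(ps i k S)^2 = 1" if "i < n" "k < n" "S : Om" for i k S
  using sg[OF that(3,1)] sg[OF that(3,2)] by (auto simp: ps_def)
 have sg2: "(sg i S)^2 = 1" if "i < n" "S : Om" for i S using sg[OF that(2,1)] by auto
 let ?A = "SUM i<n. SUM k<n. (avg (gibbs be w) (ps i k))^2" and ?T = "SUM i<n. (avg (gibbs be w) (sg i))^2"
 have "(SUM i<n. SUM k<n. tilt m (GG et j []) (QQ et j []) w (ps i k)) = (SUM i<n. SUM k<n. be - (be - m)*(avg (gibbs be w) (ps i k))^2)"
  by (intro sum.cong refl t ps2) auto
 also have "... = n*n*be - (be - m)*?A" by (simp add: sum_subtractf sum_distrib_left[symmetric])
 finally have E: "EE m et j [] w = n*be/2 - (be - m)*(?A/(2*n))"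
  using n_pos by (simp add: EE_def field_simps)
 have "XX m et j [] w = (SUM i<n. be - (be - m)*(avg (gibbs be w) (sg i))^2)"
  unfolding XX_sum by (intro sum.cong refl t sg2) auto
 also have "... = n*be - (be - m)*?T" by (simp add: sum_subtractf sum_distrib_left[symmetric])
 finally have X: "XX m et j [] w = n*be - (be - m)*?T" .
 \<comment> \<open>No level is left here, so the overlap parameter is 1.\<close>
 have "(be - m)*?T <= (be - m)*(?A/(2*n) + n/2)"
  using overlap_ineq[OF p, of 1] Nil by (intro mult_left_mono) auto
 moreover have "(be - m)*(?A/(2*n) + n/2) = (be - m)*(?A/(2*n)) + n*be/2 + n*(- m/2)"
  by (simp add: algebra_simps diff_divide_distrib)
 ultimately show ?case unfolding E X by (simp add: qrem_def)
next
 case (Cons p lv)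
 obtain m' s where p [simp]: "p = (m', s)" by (cases p)
 have ok: "levels_ok lv" "m' > 0" "chain be m' lv" "m <= m'" using Cons.prems by auto
 let ?W = "walk (sqrt s*et) (map sg [0..<n]) j"
 let ?T = "TE m' ?W (UU et j lv)"
 let ?g = "GG et j (p # lv) w"
 have g: "prob ?g" by (rule regD(1)[OF reg_UU]) (rule Cons.prems)
 let ?A = "SUM i<n. SUM k<n. (avg ?g (ps i k))^2" and ?M = "SUM i<n. (avg ?g (sg i))^2"
 let ?q = "qrem (p # lv)"
 have q: "qrem lv = ?q + s" by (simp add: qrem_def)
 have "EE m et j (p # lv) w = (SUM i<n. SUM k<n. ?T (%w. tilt m' (GG et j lv) (QQ et j lv) w (ps i k)) w)/(2*n) - (m' - m)*(?A/(2*n))"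
  unfolding EE_def tilt_Cons fst_conv snd_conv p
  by (simp add: sum_subtractf sum_distrib_left[symmetric] diff_divide_distrib)
 also have "(SUM i<n. SUM k<n. ?T (%w. tilt m' (GG et j lv) (QQ et j lv) w (ps i k)) w)/(2*n) = ?T (EE m' et j lv) w"
  unfolding EE_def divide_inverse mult.commute[of _ "inverse (real (2*n))"] TE_cmult TE_sum ..
 finally have E: "EE m et j (p # lv) w = ?T (EE m' et j lv) w - (m' - m)*(?A/(2*n))" .
 have X: "XX m et j (p # lv) w = ?T (XX m' et j lv) w - (m' - m)*?M"
  unfolding XX_sum tilt_Cons fst_conv snd_conv p
  by (simp add: TE_sum sum_subtractf sum_distrib_left[symmetric])
 have C: "CC et j (p # lv) w = ?T (CC et j lv) w + s*?T (XX m' et j lv) w"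
  by (simp add: TE_add TE_cmult)
 have "?T (EE m' et j lv) w <= ?T (%w. CC et j lv w + qrem lv*XX m' et j lv w + n*K1 m' lv) w"
  using Cons.IH[OF ok(1-3)] by (intro TE_mono) auto
 also have "... = ?T (CC et j lv) w + qrem lv*?T (XX m' et j lv) w + n*K1 m' lv"
  by (simp only: TE_add TE_cmult TE_const[OF walk_nonempty])
 finally have 1: "?T (EE m' et j lv) w <= ?T (CC et j lv) w + qrem lv*?T (XX m' et j lv) w + n*K1 m' lv" .
 have 2: "(m' - m)*(?q*?M) <= (m' - m)*(?A/(2*n) + n*?q^2/2)"
  using overlap_ineq[OF g, of ?q] ok(4) by (intro mult_left_mono) auto
 have "CC et j (p # lv) w + ?q*XX m et j (p # lv) w + n*K1 m (p # lv)
   = ?T (CC et j lv) w + qrem lv*?T (XX m' et j lv) w + n*K1 m' lv - (m' - m)*(?q*?M) + (m' - m)*(n*?q^2/2)"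
  unfolding X C q K1.simps by (simp add: algebra_simps)
 thus ?case unfolding E using 1 2 by (simp only: distrib_left)
qed

end

section \<open>Adding edges\<close>

text \<open>The effect of one random edge: averaging over an increment that is v with probability p
  and 0 otherwise.\<close>

definition Bop :: "('s => real) => real => (('s => real) => real) => ('s => real) => real"
 where "Bop v p U w = (1 - p)*U w + p*U (w +: v)"

primrec Bs :: "('s => real) list => real => (('s => real) => real) => ('s => real) => real" where
 "Bs [] p U = U"
| "Bs (v # vs) p U = Bop v p (Bs vs p U)"

text \<open>Convexity along w, w + v, w + 2*v only. This is what comparing one Bernoulli edge with
  two independent ones uses, and it is stable under further edges.\<close>

definition midconvex :: "(('s => real) => real) => bool"
 where "midconvex U \<longleftrightarrow> (ALL w v. 2*U (w +: v) <= U w + U (w +: v +: v))"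

lemma Bop_mono: "0 <= p ==> p <= 1 ==> (!!w. U w <= U' w) ==> Bop v p U w <= Bop v p U' w"
 unfolding Bop_def by (intro add_mono mult_left_mono) auto

lemma Bs_mono: "0 <= p ==> p <= 1 ==> (!!w. U w <= U' w) ==> Bs vs p U w <= Bs vs p U' w"
 by (induction vs arbitrary: w) (auto intro: Bop_mono)

lemma Bs_cmult: "Bs vs p (%w. c*U w) w = c*Bs vs p U w"
 by (induction vs arbitrary: w) (auto simp: Bop_def algebra_simps)

lemma midconvex_Bop:
 assumes "0 <= p" "p <= 1" "midconvex U"
 shows "midconvex (Bop v p U)" unfolding midconvex_def Bop_def
proof (intro allI)
 fix w a
 have 1: "2*U (w +: a) <= U w + U (w +: a +: a)" using assms(3) by (auto simp: midconvex_def)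
 have 2: "2*U (w +: a +: v) <= U (w +: v) + U (w +: a +: a +: v)"
  using assms(3)[unfolded midconvex_def, rule_format, of "w +: v" a] by (simp add: vadd_ac)
 show "2*((1 - p)*U (w +: a) + p*U (w +: a +: v))
    <= (1 - p)*U w + p*U (w +: v) + ((1 - p)*U (w +: a +: a) + p*U (w +: a +: a +: v))"
  using mult_left_mono[OF 1, of "1 - p"] mult_left_mono[OF 2 assms(1)] assms(2) by (simp add: algebra_simps)
qed

lemma midconvex_Bs: "0 <= p ==> p <= 1 ==> midconvex U ==> midconvex (Bs vs p U)"
 by (induction vs) (auto intro: midconvex_Bop)

lemma Bop_commute: "Bop v p (Bop a q U) = Bop a q (Bop v p U)"
 unfolding Bop_def by (intro ext) (simp add: vadd_ac algebra_simps)

lemma Bop_Bs_commute: "Bop v p (Bs vs q U) = Bs vs q (Bop v p U)"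
 by (induction vs) (auto simp: Bop_commute[of v])

text \<open>A Bernoulli variable is dominated in convex order by a sum of two independent ones with the
  same total mean.\<close>

lemma Bop_split:
 assumes "0 <= p" "0 <= q" "midconvex U"
 shows "Bop v (p + q) U w <= Bop v p (Bop v q U) w"
proof -
 have "0 <= p*q*(U w + U (w +: v +: v) - 2*U (w +: v))"
  using assms by (intro mult_nonneg_nonneg) (auto simp: midconvex_def)
 thus ?thesis by (simp add: Bop_def algebra_simps)
qed

lemma Bs_split:
 assumes "0 <= p" "0 <= q" "p + q <= 1" "midconvex U"
 shows "Bs vs (p + q) U w <= Bs vs p (Bs vs q U) w"
proof (induction vs arbitrary: w)
 case (Cons v vs)
 have "Bs (v # vs) (p + q) U w <= Bop v (p + q) (Bs vs p (Bs vs q U)) w"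
  using Cons assms by (auto intro: Bop_mono)
 also have "... <= Bop v p (Bop v q (Bs vs p (Bs vs q U))) w"
  using assms by (intro Bop_split midconvex_Bs) auto
 also have "... = Bs (v # vs) p (Bs (v # vs) q U) w" by (simp add: Bop_Bs_commute)
 finally show ?case .
qed simp

text \<open>The constant in the quadratic error term of the expansion of \<open>Bs vs p\<close> at \<open>p = 0\<close>.\<close>

primrec Bc :: "real => nat => real" where
 "Bc R 0 = 0"
| "Bc R (Suc l) = Bc R l*(1 + R) + l*(1 + R^2)"

lemma Bc_nonneg: "R >= 0 ==> Bc R l >= 0" by (induction l) auto

text \<open>Everything is measured relative to U w by means of the bounded ratio R. The term of
  first order in p is exact; p will be proportional to et^2, so the rest is negligible.\<close>

lemma Bs_le:
 assumes p: "0 <= p" "p <= 1" and U: "!!w. U w > 0" and R: "R >= 0"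
  and vs: "!!v w. v : set vs ==> U (w +: v) <= R*U w"
 shows "Bs vs p U w <= U w*(1 + p*(SUM v<-vs. U (w +: v)/U w - 1) + Bc R (length vs)*p^2)" using vs
proof (induction vs arbitrary: w)
 case (Cons v vs)
 let ?l = "real (length vs)" and ?C = "Bc R (length vs)"
 let ?s = "%w. SUM v<-vs. U (w +: v)/U w - 1"
 have C: "?C >= 0" using R by (rule Bc_nonneg)
 define r where "r = U (w +: v)/U w"
 have r: "0 <= r" "r <= R" "U (w +: v) = r*U w"
  using Cons.prems[of v w] U[of w] U[of "w +: v"] by (auto simp: r_def divide_le_eq intro: less_imp_le)
 have s: "- ?l <= ?s w'" "?s w' <= ?l * R" for w'
 proof -
  have "(SUM v<-vs. -1) <= ?s w'"
   using U by (intro sum_list_mono) (auto intro: divide_nonneg_nonneg less_imp_le)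
  thus "- ?l <= ?s w'" by (simp add: sum_list_triv)
  have "?s w' <= (SUM v<-vs. R)"
  proof (intro sum_list_mono)
   fix a assume "a : set vs"
   hence "U (w' +: a)/U w' <= R" using Cons.prems[of a w'] U[of w'] by (simp add: divide_le_eq)
   thus "U (w' +: a)/U w' - 1 <= R" by simp
  qed
  thus "?s w' <= ?l * R" by (simp add: sum_list_triv)
 qed
 have IH: "Bs vs p U w' <= U w'*(1 + p*?s w' + ?C*p^2)" for w' using Cons by simp
 have "Bs (v # vs) p U w <= (1 - p)*(U w*(1 + p*?s w + ?C*p^2)) + p*(U (w +: v)*(1 + p*?s (w +: v) + ?C*p^2))"
  unfolding Bs.simps Bop_def using p IH by (intro add_mono mult_left_mono) auto
 also have "... = U w*((1 - p)*(1 + p*?s w + ?C*p^2) + p*r*(1 + p*?s (w +: v) + ?C*p^2))"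
  unfolding r(3) by (simp add: algebra_simps)
 also have "... <= U w*(1 + p*(?s w + r - 1) + Bc R (Suc (length vs))*p^2)"
 proof (intro mult_left_mono)
  have a: "p^2*(- ?s w) <= p^2*?l" using s(1)[of w] by (intro mult_left_mono) auto
  have "r*?s (w +: v) <= r*(?l * R)" using s(2)[of "w +: v"] r by (intro mult_left_mono)
  also have "... <= R*(?l * R)" using r R by (intro mult_right_mono) auto
  finally have b: "p^2*(r*?s (w +: v)) <= p^2*(R*(?l * R))" by (intro mult_left_mono) auto
  have "p*r*?C <= 1 * R*?C" using p r C R by (intro mult_mono mult_nonneg_nonneg) auto
  hence c: "p^2*(p*r*?C) <= p^2*(R*?C)" by (intro mult_left_mono) auto
  have d: "0 <= p^3*?C" using p C by simp
  have "(1 - p)*(1 + p*?s w + ?C*p^2) + p*r*(1 + p*?s (w +: v) + ?C*p^2)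
   = 1 + p*(?s w + r - 1) + p^2*?C + p^2*(- ?s w) + p^2*(r*?s (w +: v)) + p^2*(p*r*?C) - p^3*?C"
   by (simp add: algebra_simps power2_eq_square power3_eq_cube)
  also have "... <= 1 + p*(?s w + r - 1) + p^2*?C + p^2*?l + p^2*(R*(?l * R)) + p^2*(R*?C)"
   using a b c d by linarith
  also have "... = 1 + p*(?s w + r - 1) + Bc R (Suc (length vs))*p^2"
   by (simp add: algebra_simps power2_eq_square)
  finally show "(1 - p)*(1 + p*?s w + ?C*p^2) + p*r*(1 + p*?s (w +: v) + ?C*p^2)
   <= 1 + p*(?s w + r - 1) + Bc R (Suc (length vs))*p^2" .
 qed (use U in \<open>auto intro: less_imp_le\<close>)
 finally show ?case by (simp add: r_def algebra_simps)
qed simp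

definition upper_pairs :: "nat => (nat \<times> nat) set"
 where "upper_pairs n = {(i, k). i < k & k < n}"

lemma finite_upper_pairs [simp]: "finite (upper_pairs n)"
 by (rule finite_subset[of _ "{..<n} \<times> {..<n}"]) (auto simp: upper_pairs_def)

lemma sum_upper_pairs:
 fixes f :: "nat => nat => real"
 assumes "!!i k. f i k = f k i"
 shows "2*(SUM (i, k):upper_pairs n. f i k) = (SUM i<n. SUM k<n. f i k) - (SUM i<n. f i i)"
proof -
 let ?P = "upper_pairs n" and ?Q = "{(i, k). k < i & i < n}" and ?D = "(%i. (i, i)) ` {..<n}"
 have u: "{..<n} \<times> {..<n} = ?P \<union> (?Q \<union> ?D)" by (auto simp: upper_pairs_def)
 have fQ: "finite ?Q" by (rule finite_subset[of _ "{..<n} \<times> {..<n}"]) auto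
 have "(SUM i<n. SUM k<n. f i k) = (SUM (i, k):{..<n} \<times> {..<n}. f i k)"
  by (rule sum.cartesian_product)
 also have "... = (SUM (i, k):?P. f i k) + ((SUM (i, k):?Q. f i k) + (SUM (i, k):?D. f i k))"
 proof -
  have "?P \<inter> (?Q \<union> ?D) = {}" "?Q \<inter> ?D = {}" by (auto simp: upper_pairs_def)
  thus ?thesis unfolding u using fQ by (simp add: sum.union_disjoint)
 qed
 also have "(SUM (i, k):?Q. f i k) = (SUM (i, k):?P. f i k)"
  by (rule sum.reindex_bij_witness[of _ "%(i, k). (k, i)" "%(i, k). (k, i)"]) (auto simp: upper_pairs_def assms)
 also have "(SUM (i, k):?D. f i k) = (SUM i<n. f i i)"
  by (subst sum.reindex) (auto simp: inj_on_def)
 finally show ?thesis by simp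
qed

lemma exp_le_cubic:
 fixes x :: real
 assumes "abs x <= c"
 shows "exp x <= 1 + x + x^2/2 + exp c*abs x^3"
proof -
 obtain t where t: "abs t <= abs x" "exp x = (SUM m<3. x^m/fact m) + exp t/fact 3*x^3"
  using Maclaurin_exp_le[of x 3] by blast
 have "exp t/fact 3*x^3 <= abs(exp t/fact 3*x^3)" by (rule abs_ge_self)
 also have "... = exp t/6*abs x^3" by (simp add: abs_mult power_abs fact_numeral)
 also have "... <= exp c*abs x^3" using t(1) assms
  by (intro mult_right_mono order.trans[of "exp t/6" "exp t" "exp c"]) auto
 finally show ?thesis using t(2) by (simp add: eval_nat_numeral lessThan_Suc)
qed

section \<open>Trading edges for walk steps on balanced spins\<close>

locale balanced_ising = ising +
 assumes balanced: "S : Om ==> (SUM i<n. sg i S) = 0"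
begin

lemma ps_sym: "ps i k = ps k i" by (auto simp: ps_def mult.commute)

text \<open>The sum of balanced spins vanishes, so the off-diagonal products add up to minus the
  diagonal. This disposes of the first-order effect of the edges, whose indicators are not
  centred.\<close>

lemma sum_avg_ps:
 assumes "prob g"
 shows "(SUM (i, k):upper_pairs n. avg g (ps i k)) <= 0"
proof -
 have "(SUM i<n. SUM k<n. avg g (ps i k)) = avg g (%S. SUM i<n. SUM k<n. ps i k S)"
  unfolding avg_def sum_distrib_left by (simp add: sum.swap[of _ Om])
 also have "... = avg g (%S. (SUM i<n. sg i S)^2)"
  by (simp add: power2_eq_square sum_product ps_def)
 also have "... = 0" using balanced by (simp add: avg_def)
 finally have 1: "(SUM i<n. SUM k<n. avg g (ps i k)) = 0" .
 have "avg g (ps i i) = 1" if "i < n" for i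
  using sg that by (intro avg_one assms) (fastforce simp: ps_def)
 thus ?thesis using sum_upper_pairs[of "%i k. avg g (ps i k)" n] 1 by (simp add: ps_sym)
qed

lemma sum_tilt_ps:
 assumes "levels_ok lv" "m > 0"
 shows "(SUM (i, k):upper_pairs n. tilt m (GG et j lv) (QQ et j lv) w (ps i k)) <= n*EE m et j lv w"
proof -
 let ?t = "%i k. tilt m (GG et j lv) (QQ et j lv) w (ps i k)"
 have "0 <= (SUM i<n. ?t i i)"
  using tilt_bounds(1)[OF reg_UU[OF assms(1)] bd_ps assms(2)] by (intro sum_nonneg) auto
 moreover have "2*(SUM (i, k):upper_pairs n. ?t i k) = (SUM i<n. SUM k<n. ?t i k) - (SUM i<n. ?t i i)"
  by (rule sum_upper_pairs) (simp add: ps_sym)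
 ultimately show ?thesis using n_pos by (simp add: EE_def)
qed

text \<open>u is convex along lines because Q is nonnegative; the exponential follows by the
  inequality of arithmetic and geometric means.\<close>

lemma midconvex_exp_reg:
 assumes r: "reg L u g Q" and m: "m > 0"
 shows "midconvex (%w. exp (m*u w))" unfolding midconvex_def
proof (intro allI)
 fix w v
 let ?f = "%s. u (w +: s *: v)"
 have "convex_on UNIV ?f"
 proof (rule f''_ge0_imp_convex[where f' = "%s. avg (g (w +: s *: v)) v" and f'' = "%s. Q (w +: s *: v) v"])
  show "DERIV ?f s :> avg (g (w +: s *: v)) v" for s
   by (rule has_derivative_along[where f' = "%w. avg (g w) v"]) (rule regD(2)[OF r])
  show "DERIV (%s. avg (g (w +: s *: v)) v) s :> Q (w +: s *: v) v" for s
   by (rule has_derivative_along[where f = "%w. avg (g w) v" and f' = "%w. Q w v"]) (rule regD(3)[OF r])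
 qed (use regD(4)[OF r] in auto)
 hence "?f ((1 - 1/2) *\<^sub>R 0 + (1/2) *\<^sub>R 2) <= (1 - 1/2)*?f 0 + (1/2)*?f 2"
  by (intro convex_onD) auto
 have c: "2*u (w +: v) <= u w + u (w +: v +: v)"
 proof -
  have "w +: 2 *: v = w +: v +: v" "w +: 1 *: v = w +: v" by (auto simp: vadd_def vscale_def)
  thus ?thesis using \<open>?f ((1 - 1/2) *\<^sub>R 0 + (1/2) *\<^sub>R 2) <= (1 - 1/2) * ?f 0 + (1/2) * ?f 2\<close> by simp
 qed
 have "2*exp (m*u (w +: v)) <= 2*exp ((m*u w + m*u (w +: v +: v))/2)"
  using mult_left_mono[OF c, of m] m by (simp add: algebra_simps)
 also have "... = 2*(exp (m*u w/2)*exp (m*u (w +: v +: v)/2))"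
  by (simp add: exp_add[symmetric] add_divide_distrib)
 also have "... <= (exp (m*u w/2))^2 + (exp (m*u (w +: v +: v)/2))^2"
  using sum_squares_bound[of "exp (m*u w/2)" "exp (m*u (w +: v +: v)/2)"] by simp
 also have "... = exp (m*u w) + exp (m*u (w +: v +: v))" by (simp add: exp_double[symmetric])
 finally show "2*exp (m*u (w +: v)) <= exp (m*u w) + exp (m*u (w +: v +: v))" .
qed

lemma exp_increment_le:
 assumes r: "reg L u g Q" and m: "m > 0" and ph: "bd 1 ph" and k: "0 < k" "k <= 1"
 shows "exp (m*u (w +: k *: ph))/exp (m*u w) - 1
  <= m*(k*avg (g w) ph + k^2/2*tilt m g Q w ph + (L + 2 * m*L + m^2*exp m) * k^3)"
proof -
 define d where "d = u (w +: k *: ph) - u w"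
 define P where "P = avg (g w) ph"
 have L: "L >= 0" using regD(4)[OF r, of w ph] regD(5)[OF r ph, of w] by linarith
 have bdk: "bd k (k *: ph)" using ph k by (auto simp: bd_def vscale_def abs_mult mult_left_le)
 have d: "abs d <= k" unfolding d_def by (rule reg_contraction[OF r bdk])
 have P: "abs P <= 1" unfolding P_def by (rule abs_avg_le[OF regD(1)[OF r] ph])
 have t: "abs(d - k*P - k^2/2*Q w ph) <= L * k^3"
  using reg_taylor[OF r ph, of w k] k unfolding d_def P_def by simp
 have "abs(d - k*P) <= 3/2*L * k^2"
 proof -
  have "k^2/2*Q w ph <= k^2/2*L" using regD(5)[OF r ph, of w] by (intro mult_left_mono) auto
  moreover have "0 <= k^2/2*Q w ph" using regD(4)[OF r, of w ph] by simp
  moreover have "L * k^3 <= L * k^2" using k L by (intro mult_left_mono power_decreasing) auto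
  moreover have "k^2/2*L = L * k^2/2" "3/2*L * k^2 = L * k^2 + L * k^2/2" by (simp_all add: algebra_simps)
  ultimately show ?thesis using t by linarith
 qed
 have d2: "d^2 <= (k*P)^2 + 3*L * k^3"
 proof -
  have "d^2 - (k*P)^2 = (d + k*P)*(d - k*P)" by (simp add: power2_eq_square algebra_simps)
  also have "... <= abs(d + k*P)*abs(d - k*P)" by (simp add: abs_mult[symmetric])
  also have "... <= (2 * k)*(3/2*L * k^2)"
  proof (intro mult_mono)
   have "abs(k*P) <= k" using P k by (simp add: abs_mult mult_left_le)
   thus "abs(d + k*P) <= 2 * k" using d by linarith
  qed (use k \<open>\<bar>d - k * P\<bar> <= 3 / 2 * L * k\<^sup>2\<close> in auto)
  finally show ?thesis by (simp add: power2_eq_square power3_eq_cube)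
 qed
 have "exp (m*u (w +: k *: ph))/exp (m*u w) = exp (m*d)"
  by (simp add: d_def right_diff_distrib exp_diff)
 also have "... <= 1 + m*d + (m*d)^2/2 + exp m*abs(m*d)^3"
 proof (rule exp_le_cubic)
  have "abs(m*d) <= m * k" using d m by (simp add: abs_mult)
  also have "... <= m" using k m by simp
  finally show "abs(m*d) <= m" .
 qed
 also have "... <= 1 + m*(k*P + k^2/2*Q w ph + L * k^3) + m^2*((k*P)^2 + 3*L * k^3)/2 + exp m*(m * k)^3"
 proof (intro add_mono)
  show "m*d <= m*(k*P + k^2/2*Q w ph + L * k^3)" using t m by (intro mult_left_mono) auto
  show "(m*d)^2/2 <= m^2*((k*P)^2 + 3*L * k^3)/2"
   using d2 unfolding power_mult_distrib by (intro divide_right_mono mult_left_mono) auto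
  have "abs(m*d)^3 <= (m * k)^3" using d m by (intro power_mono) (auto simp: abs_mult)
  thus "exp m*abs(m*d)^3 <= exp m*(m * k)^3" by simp
 qed auto
 also have "... <= 1 + m*(k*P + k^2/2*(Q w ph + m*P^2) + (L + 2 * m*L + m^2*exp m) * k^3)"
 proof -
  have "0 <= m^2*L * k^3" using m L k by simp
  thus ?thesis by (simp add: algebra_simps power2_eq_square power3_eq_cube)
 qed
 finally show ?thesis by (simp add: tilt_def P_def)
qed

definition edges :: "(nat \<times> nat) list => bool"
 where "edges es \<longleftrightarrow> distinct es & set es = upper_pairs n"

definition ev :: "real => (nat \<times> nat) list => ('a => real) list"
 where "ev ka es = map (%(i, k). ka *: ps i k) es"

lemma sum_edges: "edges es ==> (SUM p<-es. f p) = (SUM p:upper_pairs n. f p)"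
 by (simp add: edges_def sum_list_distinct_conv_sum_set)

text \<open>The cubic constant of \<open>exp_increment_le\<close> at the outermost m. It involves
  neither n nor the step size, so that the cubic error per site is of order 1/sqrt ga
  uniformly.\<close>

definition C3 :: "(real \<times> real) list => real"
 where "C3 lv = Lc be lv + 2*fst (hd lv)*Lc be lv + (fst (hd lv))^2*exp (fst (hd lv))"

text \<open>Edges of probability ga/n*et^2 and weight ka with ga*ka^2 = 1 have a second-order effect
  of at most m*et^2/2 times \<open>EE\<close>. By \<open>guerra\<close> with
  \<open>qrem lv = 0\<close> this is at most m*et^2/2 times CC + n*K1, and CC is what one further
  walk step gives back. C may depend on n: it multiplies et^3 and will vanish with et.\<close>

lemma edge_step:
 fixes m s ga :: real
 assumes lv: "levels_ok lv" "lv = (m, s) # lv'" "chain be m lv" "qrem lv = 0"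
  and es: "edges es" and ga: "ga >= 1" "ga <= n"
 shows "EX C>=0. ALL et j w. 0 < et --> et <= 1 -->
  Bs (ev (1/sqrt ga) es) (ga/n*et^2) (%w. exp (m*UU et j lv w)) w
  <= exp (m*n*et^2*(K1 m lv/2 + C3 lv/(2 * sqrt ga)) + C*et^3)*exp (m*UU et (Suc j) lv w)"
proof -
 define ka where "ka = 1/sqrt ga"
 have ka: "0 < ka" "ka <= 1" "ga * ka^2 = 1" using ga by (auto simp: ka_def power_divide)
 have m: "m > 0" using lv by auto
 obtain E where E: "E >= 0" "!!et j w. 0 < et ==> et <= 1 ==>
   UU et (Suc j) lv w >= UU et j lv w + et^2/2*CC et j lv w - E*et^3"
  using UU_Suc_ge[OF lv(1)] by auto
 define R where "R = exp (m*1)"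
 define C where "C = Bc R (length es) + m*E"
 have Bc0: "Bc R (length es) >= 0" by (rule Bc_nonneg) (simp add: R_def)
 show ?thesis
 proof (intro exI[of _ C] conjI allI impI)
  show "0 <= C" using Bc0 m E by (simp add: C_def)
  fix et :: real and j :: nat and w :: "'a => real"
  assume et: "0 < et" "et <= 1"
  let ?U = "UU et j lv" and ?g = "GG et j lv" and ?Q = "QQ et j lv"
  note r = reg_UU[OF lv(1), of et j]
  let ?A = "%w. exp (m*?U w)"
  define pe where "pe = ga/n*et^2"
  have et2: "et^2 <= 1" using et by (simp add: power_le_one)
  have gn: "ga/n <= 1" "0 <= ga/n" using ga n_pos by auto
  have pe: "0 <= pe" "pe <= 1" "pe <= et^2"
  proof -
   show "0 <= pe" using gn(2) unfolding pe_def by (intro mult_nonneg_nonneg) auto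
   show "pe <= et^2" using mult_right_mono[OF gn(1), of "et^2"] unfolding pe_def by simp
   with et2 show "pe <= 1" by linarith
  qed
  have bound: "?A (w +: v) <= R*?A w" if v: "v : set (ev ka es)" for v w
  proof -
   obtain i k where ik: "(i, k) : set es" "v = ka *: ps i k" using v by (auto simp: ev_def)
   moreover from ik(1) es have "i < n" "k < n" by (auto simp: edges_def upper_pairs_def)
   ultimately have "v = ka *: ps i k" "i < n" "k < n" by blast+
   hence "bd 1 v"
    using bd_ps[of i k] ka by (auto simp: bd_def vscale_def abs_mult intro!: mult_le_one)
   from reg_contraction[OF r this, of w] have "m*?U (w +: v) <= m*(1 + ?U w)"
    using m by (intro mult_left_mono) auto
   thus ?thesis unfolding R_def exp_add[symmetric] by (simp add: distrib_left)
  qed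
  let ?s = "SUM v<-ev ka es. ?A (w +: v)/?A w - 1"
  have 1: "Bs (ev ka es) pe ?A w <= ?A w*(1 + pe*?s + Bc R (length es)*pe^2)"
  proof -
   have len: "length es = length (ev ka es)" by (simp add: ev_def)
   show ?thesis unfolding len
    by (rule Bs_le[where U = ?A, OF pe(1,2)]) (simp, simp add: R_def, rule bound)
  qed
  let ?P = "upper_pairs n"
  have c3: "C3 lv >= 0" "C3 lv = Lc be lv + 2 * m*Lc be lv + m^2*exp m"
   using Lc_ge_1[OF be lv(1)] m lv by (auto simp: C3_def)
  have "?s = (SUM (i, k):?P. ?A (w +: ka *: ps i k)/?A w - 1)"
   using sum_edges[OF es] by (simp add: ev_def o_def case_prod_beta)
  also have "... <= (SUM (i, k):?P. m*(ka*avg (?g w) (ps i k) + ka^2/2*tilt m ?g ?Q w (ps i k) + C3 lv * ka^3))"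
  proof (intro sum_mono, clarify)
   fix i k assume "(i, k) : ?P"
   hence "bd 1 (ps i k)" by (intro bd_ps) (auto simp: upper_pairs_def)
   from exp_increment_le[OF r m this ka(1,2), of w]
   show "?A (w +: ka *: ps i k)/?A w - 1 <=
     m*(ka*avg (?g w) (ps i k) + ka^2/2*tilt m ?g ?Q w (ps i k) + C3 lv * ka^3)"
    unfolding c3(2) .
  qed
  also have "... = m*(ka*(SUM (i, k):?P. avg (?g w) (ps i k)) + ka^2/2*(SUM (i, k):?P. tilt m ?g ?Q w (ps i k)) + card ?P*(C3 lv * ka^3))"
  proof -
   have gen: "(SUM x:?P. m*(a*f x + c*h x + d)) = m*(a * sum f ?P + c * sum h ?P + card ?P*d)" for a c d :: real and f h
    by (simp add: sum_distrib_left sum.distrib distrib_left mult_ac)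
   show ?thesis unfolding case_prod_beta by (rule gen)
  qed
  also have "... <= m*(ka*0 + ka^2/2*(n*EE m et j lv w) + n^2/2*(C3 lv * ka^3))"
  proof -
   have "real (card ?P) <= n^2/2"
    using sum_upper_pairs[of "%_ _. 1" n] by (simp add: power2_eq_square case_prod_beta)
   thus ?thesis using m ka c3(1) sum_avg_ps[OF regD(1)[OF r]] sum_tilt_ps[OF lv(1) m]
    by (intro mult_left_mono add_mono mult_right_mono) auto
  qed
  finally have s: "?s <= m*(ka^2/2*(n*EE m et j lv w) + n^2/2*(C3 lv * ka^3))" by simp
  have EE: "EE m et j lv w <= CC et j lv w + n*K1 m lv"
   using guerra[OF lv(1) m lv(3), of et j w] lv(4) by simp
  have "pe*?s <= pe*(m*(ka^2/2*(n*EE m et j lv w) + n^2/2*(C3 lv * ka^3)))"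
   using s pe(1) by (rule mult_left_mono)
  also have "... = m*et^2*(ga * ka^2)*(EE m et j lv w/2 + n*C3 lv * ka/2)"
   using n_pos by (simp add: pe_def field_simps power2_eq_square power3_eq_cube)
  also have "... <= m*et^2*(ga * ka^2)*((CC et j lv w + n*K1 m lv)/2 + n*C3 lv * ka/2)"
  proof (rule mult_left_mono)
   show "EE m et j lv w/2 + n*C3 lv * ka/2 <= (CC et j lv w + n*K1 m lv)/2 + n*C3 lv * ka/2"
    by (intro add_right_mono divide_right_mono EE) simp
  qed (use m ka(3) in auto)
  finally have 2: "pe*?s <= m*et^2*((CC et j lv w + n*K1 m lv)/2 + n*C3 lv * ka/2)"
   unfolding ka(3) by simp
  have "pe^2 <= (et^2)^2" using pe by (intro power_mono) auto
  also have "... = et^4" by simp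
  also have "... <= et^3" using et by (intro power_decreasing) auto
  finally have 3: "Bc R (length es)*pe^2 <= Bc R (length es)*et^3" using Bc0 by (rule mult_left_mono)
  let ?x = "m*et^2*((CC et j lv w + n*K1 m lv)/2 + n*C3 lv * ka/2) + Bc R (length es)*et^3"
  have "1 + pe*?s + Bc R (length es)*pe^2 <= 1 + ?x" using 2 3 by linarith
  also have "... <= exp ?x" by (rule exp_ge_add_one_self)
  finally have "Bs (ev ka es) pe ?A w <= ?A w*exp ?x"
   using 1 by (meson exp_ge_zero mult_left_mono order.trans)
  also have "... = exp (m*?U w + ?x)" by (simp add: exp_add)
  also have "... <= exp (m*n*et^2*(K1 m lv/2 + C3 lv/(2 * sqrt ga)) + C*et^3 + m*UU et (Suc j) lv w)"
  proof -
   have "m*(?U w + et^2/2*CC et j lv w - E*et^3) <= m*UU et (Suc j) lv w"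
    using E(2)[OF et, of j w] m by (intro mult_left_mono) auto
   moreover have "m*?U w + ?x = m*n*et^2*(K1 m lv/2 + C3 lv/(2 * sqrt ga)) + C*et^3
     + m*(?U w + et^2/2*CC et j lv w - E*et^3)"
    by (simp add: C_def ka_def algebra_simps add_divide_distrib)
   ultimately show ?thesis by simp
  qed
  finally show "Bs (ev (1/sqrt ga) es) (ga/n*et^2) ?A w
   <= exp (m*n*et^2*(K1 m lv/2 + C3 lv/(2 * sqrt ga)) + C*et^3)*exp (m*UU et (Suc j) lv w)"
   unfolding ka_def pe_def exp_add .
 qed
qed

lemma UU_0: "levels_ok lv ==> UU et 0 lv = free be" by (induction lv) (auto simp: LM_trivial)

text \<open>Each edge of probability ga/n is split into N independent ones, and each of the N layers
  is exchanged for one step of the walks. The N errors C*et^3 add up to C/sqrt N.\<close>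

theorem Bs_free_le:
 fixes m s ga :: real
 assumes lv: "levels_ok lv" "lv = (m, s) # lv'" "chain be m lv" "qrem lv = 0"
  and es: "edges es" and ga: "ga >= 1" "ga <= n"
 shows "EX C. ALL N>0. Bs (ev (1/sqrt ga) es) (ga/n) (%w. exp (m*free be w)) w
  <= exp (m*n*(K1 m lv/2 + C3 lv/(2 * sqrt ga)) + C/sqrt N + m*UU (1/sqrt N) N lv w)"
proof -
 obtain C where C: "!!et j w. 0 < et ==> et <= 1 ==>
  Bs (ev (1/sqrt ga) es) (ga/n*et^2) (%w. exp (m*UU et j lv w)) w
  <= exp (m*n*et^2*(K1 m lv/2 + C3 lv/(2 * sqrt ga)) + C*et^3)*exp (m*UU et (Suc j) lv w)"
  using edge_step[OF lv es ga] by blast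
 show ?thesis
 proof (intro exI[of _ C] allI impI)
  fix N :: nat assume N: "N > 0"
  define et where "et = 1/sqrt N"
  have et: "0 < et" "et <= 1" "N*et^2 = 1" using N by (auto simp: et_def power_divide)
  define x where "x = m*n*et^2*(K1 m lv/2 + C3 lv/(2 * sqrt ga)) + C*et^3"
  define pe where "pe = ga/n*et^2"
  have pe: "0 <= pe" using ga by (simp add: pe_def)
  have Npe: "N*pe = ga/n" using et(3) by (simp add: pe_def mult.left_commute)
  have gn: "ga/n <= 1" using ga n_pos by auto
  let ?v = "ev (1/sqrt ga) es"
  have m: "m > 0" using lv by auto
  have mc: "midconvex (%w. exp (m*UU et j lv w))" for j
   by (rule midconvex_exp_reg[OF reg_UU[OF lv(1)] m])
  have le: "t*pe <= 1" if "t <= N" for t :: nat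
  proof -
   have "t*pe <= N*pe" using that pe by (intro mult_right_mono) auto
   thus ?thesis using Npe gn by linarith
  qed
  have "Bs ?v (t*pe) (%w. exp (m*UU et j lv w)) w <= exp (t*x)*exp (m*UU et (j + t) lv w)" if "t <= N" for t j w
   using that
  proof (induction t arbitrary: j w)
   case 0
   have "Bs vs 0 U = U" for vs and U :: "('a => real) => real" by (induction vs) (auto simp: Bop_def)
   thus ?case by simp
  next
   case (Suc t)
   have t1: "t*pe + pe <= 1" using le[OF Suc.prems] by (simp add: algebra_simps)
   have "Bs ?v (Suc t*pe) (%w. exp (m*UU et j lv w)) w = Bs ?v (t*pe + pe) (%w. exp (m*UU et j lv w)) w"
    by (simp add: algebra_simps)
   also have "... <= Bs ?v (t*pe) (Bs ?v pe (%w. exp (m*UU et j lv w))) w"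
    using pe t1 by (intro Bs_split mc) auto
   also have "... <= Bs ?v (t*pe) (%w. exp x*exp (m*UU et (Suc j) lv w)) w"
   proof (rule Bs_mono)
    show "0 <= t*pe" using pe by simp
    show "t*pe <= 1" using pe t1 by linarith
    show "Bs ?v pe (%w. exp (m*UU et j lv w)) w <= exp x*exp (m*UU et (Suc j) lv w)" for w
     unfolding x_def pe_def by (rule C[OF et(1,2)])
   qed
   also have "... = exp x*Bs ?v (t*pe) (%w. exp (m*UU et (Suc j) lv w)) w" by (rule Bs_cmult)
   also have "... <= exp x*(exp (t*x)*exp (m*UU et (Suc j + t) lv w))"
    using Suc.IH[of "Suc j"] Suc.prems by (intro mult_left_mono) auto
   also have "... = exp (Suc t*x)*exp (m*UU et (j + Suc t) lv w)"
    by (simp add: distrib_right exp_add)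
   finally show ?case .
  qed
  from this[of N 0 w] have "Bs ?v (ga/n) (%w. exp (m*free be w)) w <= exp (N*x + m*UU et N lv w)"
   by (simp add: Npe UU_0[OF lv(1)] exp_add)
  also have "N*x = m*n*(N*et^2)*(K1 m lv/2 + C3 lv/(2 * sqrt ga)) + C*(N*et^2)*et"
   by (simp add: x_def algebra_simps power2_eq_square power3_eq_cube)
  finally show "Bs ?v (ga/n) (%w. exp (m*free be w)) w
   <= exp (m*n*(K1 m lv/2 + C3 lv/(2 * sqrt ga)) + C/sqrt N + m*UU (1/sqrt N) N lv w)"
   unfolding et(3) by (simp add: et_def)
 qed
qed

end

section \<open>Decoupling of the sites\<close>

context ising
begin

definition field :: "(nat => real) => 's => real"
 where "field y S = (SUM i<n. y i * sg i S)"

lemma field_zero: "field (%_. 0) = (%S. 0)" by (simp add: field_def fun_eq_iff)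

lemma field_shift:
 assumes "a < n"
 shows "field y +: c *: sg a = field (y(a := y a + c))"
proof
 fix S
 have "field (y(a := y a + c)) S = (SUM i<n. y i * sg i S + (if i = a then c * sg a S else 0))"
  unfolding field_def by (rule sum.cong) (auto simp: algebra_simps)
 also have "... = field y S + c * sg a S" using assms by (simp add: sum.distrib field_def)
 finally show "(field y +: c *: sg a) S = field (y(a := y a + c)) S" by (simp add: vadd_def vscale_def)
qed

text \<open>A bound that is a sum over sites stays one: the step moves only the coordinate of site
  a, and the other sites factor out of the mean of exponentials.\<close>

lemma LM_two_le:
 assumes m: "m > 0" and a: "a < n" and u: "!!y. u (field y) <= (SUM i<n. ph i (y i))"
 shows "LM m (two h (sg a)) u (field y) <= (SUM i<n. (if i = a then pstep m h (ph a) else ph i) (y i))"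
proof -
 define R where "R = (SUM i:{..<n} - {a}. ph i (y i))"
 have split: "(SUM i<n. ph i ((y(a := t)) i)) = ph a t + R" for t
  using a by (subst sum.remove[of _ a]) (auto simp: R_def intro!: sum.cong)
 have "exp (m*LM m (two h (sg a)) u (field y)) = mean (%v. exp (m*u (field y +: v))) (two h (sg a))"
  using m by (intro exp_LM) auto
 also have "... = (exp (m*u (field (y(a := y a + h)))) + exp (m*u (field (y(a := y a - h)))))/2"
  using field_shift[OF a, of y h] field_shift[OF a, of y "- h"] by (simp add: two_def mean_two)
 also have "... <= (exp (m*(ph a (y a + h) + R)) + exp (m*(ph a (y a - h) + R)))/2"
  using u[of "y(a := y a + h)"] u[of "y(a := y a - h)"] m unfolding split
  by (intro divide_right_mono add_mono) auto
 also have "... = exp (m*pstep m h (ph a) (y a))*exp (m * R)"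
  unfolding exp_pstep[OF m] by (simp add: exp_add distrib_left add_divide_distrib distrib_right)
 also have "... = exp (m*(pstep m h (ph a) (y a) + R))" by (simp add: exp_add distrib_left)
 finally have "LM m (two h (sg a)) u (field y) <= pstep m h (ph a) (y a) + R" using m by simp
 also have "... = (SUM i<n. (if i = a then pstep m h (ph a) else ph i) (y i))"
  using a by (subst sum.remove[of _ a]) (auto simp: R_def intro!: sum.cong)
 finally show ?thesis .
qed

lemma LM_stepl_le:
 assumes m: "m > 0" and u: "!!y. u (field y) <= (SUM i<n. ph (y i))"
  and js: "distinct js" "set js <= {..<n}"
 shows "LM m (stepl h (map sg js)) u (field y) <= (SUM i<n. (if i : set js then pstep m h ph else ph) (y i))"
 using js
proof (induction js arbitrary: y)
 case Nil
 thus ?case using u m by (simp add: LM_trivial)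
next
 case (Cons a js)
 have "LM m (stepl h (map sg (a # js))) u = LM m (two h (sg a)) (LM m (stepl h (map sg js)) u)"
  using m by (simp add: LM_conv)
 moreover have "LM m (two h (sg a)) (LM m (stepl h (map sg js)) u) (field y)
   <= (SUM i<n. (if i = a then pstep m h (if a : set js then pstep m h ph else ph) else (if i : set js then pstep m h ph else ph)) (y i))"
  by (rule LM_two_le[OF m, where ph = "%i. if i : set js then pstep m h ph else ph"]) (use Cons in auto)
 moreover have "... = (SUM i<n. (if i : set (a # js) then pstep m h ph else ph) (y i))"
  using Cons.prems by (intro sum.cong) auto
 ultimately show ?case by simp
qed

lemma LM_walk_le:
 assumes m: "m > 0" and u: "!!y. u (field y) <= (SUM i<n. ph (y i))"
 shows "LM m (walk h (map sg [0..<n]) j) u (field y) <= (SUM i<n. (pstep m h ^^ j) ph (y i))"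
 using u
proof (induction j arbitrary: u ph y)
 case 0
 thus ?case using m by (simp add: LM_trivial)
next
 case (Suc j)
 have "LM m (stepl h (map sg [0..<n])) u (field y) <= (SUM i<n. pstep m h ph (y i))" for y
  using LM_stepl_le[where u = u and ph = ph and js = "[0..<n]" and h = h and y = y, OF m] Suc.prems by (simp add: atLeast0LessThan)
 from Suc.IH[where ph = "pstep m h ph" and y = y and u = "LM m (stepl h (map sg [0..<n])) u", OF this] show ?case
  using m by (simp add: LM_conv funpow_Suc_right del: funpow.simps)
qed

text \<open>The single-site counterpart of \<open>UU\<close>, driven by the same step sizes.\<close>

primrec VV :: "real => nat => (real \<times> real) list => real => real" where
 "VV et j [] = pterm be"
| "VV et j (p # lv) = (pstep (fst p) (sqrt (snd p)*et) ^^ j) (VV et j lv)"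

text \<open>Dropping the balance constraint enlarges the sum to all sign vectors, where it factors
  over sites; injectivity prevents a sign vector from being counted twice.\<close>

lemma free_field_le:
 assumes inj: "inj_on (%S. restrict (%i. sg i S) {..<n}) Om"
 shows "free be (field y) <= (SUM i<n. pterm be (y i))"
proof -
 define T where "T S = restrict (%i. sg i S) {..<n}" for S
 define g where "g f = (PROD i<n. exp (be*(y i*f i)))" for f :: "nat => real"
 have "(SUM S:Om. exp (be*field y S)) = (SUM S:Om. g (T S))"
  by (rule sum.cong) (auto simp: g_def T_def field_def sum_distrib_left exp_sum)
 also have "... = sum g (T ` Om)" using inj by (simp add: sum.reindex T_def[abs_def])
 also have "... <= sum g (PiE {..<n} (%_. {1, -1}))"
 proof (rule sum_mono2)
  have "T S : PiE {..<n} (%_. {1, -1})" if "S : Om" for S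
   using sg[OF that] by (intro PiE_I) (auto simp: T_def)
  thus "T ` Om <= PiE {..<n} (%_. {1, -1})" by blast
  show "0 <= g f" for f unfolding g_def by (intro prod_nonneg) auto
 qed (auto intro: finite_PiE)
 also have "... = (PROD i<n. SUM s:{1, -1}. exp (be*(y i * s)))"
  unfolding g_def by (rule prod_sum_PiE[symmetric]) auto
 also have "... = (PROD i<n. 2*cosh (be*y i))" by (rule prod.cong) (auto simp: cosh_field_def)
 finally have le: "(SUM S:Om. exp (be*field y S)) <= (PROD i<n. 2*cosh (be*y i))" .
 have "ln (SUM S:Om. exp (be*field y S)) <= ln (PROD i<n. 2*cosh (be*y i))"
  using le partition_pos[of be "field y"] by (subst ln_le_cancel_iff) linarith+
 also have "... = (SUM i<n. ln (2*cosh (be*y i)))" by (rule ln_prod) (auto intro: cosh_real_pos)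
 finally have "free be (field y) <= (SUM i<n. ln (2*cosh (be*y i)))/be"
  unfolding free_def using be_pos by (intro divide_right_mono) auto
 thus ?thesis by (simp add: pterm_def sum_divide_distrib)
qed

lemma UU_le_VV:
 assumes inj: "inj_on (%S. restrict (%i. sg i S) {..<n}) Om" and lv: "levels_ok lv"
 shows "UU et j lv (field y) <= (SUM i<n. VV et j lv (y i))" using lv
proof (induction lv arbitrary: y)
 case Nil
 thus ?case using free_field_le[OF inj] by simp
next
 case (Cons p lv)
 thus ?case by (auto intro!: LM_walk_le)
qed

end

section \<open>From lists of levels to the order parameter\<close>

lemma sch_block:
 assumes "!!i. a <= i ==> i < a + N ==> mm i = m"
 shows "(pstep m h ^^ N) (sch be h mm a) = sch be h mm (a + N)" using assms by (induction N) auto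

definition levels :: "(nat => real) => nat => (real \<times> real) list"
 where "levels mu K = map (%l. (mu l, 1/real K)) [0..<K]"

text \<open>K levels of N steps each form one scheme of K*N steps. The scheme counts down from q = 1
  while levels are listed upwards from q = 0, whence the index K - 1 - i div N.\<close>

lemma (in ising) VV_levels:
 assumes "K > 0" "N > 0"
 shows "VV (1/sqrt N) N (levels mu K) = sch be (1/sqrt (K*N)) (%i. mu (K - 1 - i div N)) (K*N)"
proof -
 define mm where "mm i = mu (K - 1 - i div N)" for i
 define s where "s = 1/real K"
 have h: "sqrt s*(1/sqrt N) = 1/sqrt (K*N)" by (simp add: s_def real_sqrt_divide real_sqrt_mult)
 have "VV (1/sqrt N) N (map (%l. (mu l, s)) [K - j..<K]) = sch be (1/sqrt (K*N)) mm (j*N)" if "j <= K" for j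
  using that
 proof (induction j)
  case (Suc j)
  hence eq: "[K - Suc j..<K] = (K - Suc j) # [K - j..<K]"
   by (simp add: upt_rec[of "K - Suc j" K] Suc_diff_Suc)
  have b: "(pstep (mu (K - Suc j)) h' ^^ N) (sch be h' mm (j*N)) = sch be h' mm (j*N + N)" for h'
  proof (rule sch_block)
   fix i assume "j*N <= i" "i < j*N + N"
   hence "i div N = j" using assms(2) by (intro div_nat_eqI) (auto simp: mult.commute)
   thus "mm i = mu (K - Suc j)" by (simp add: mm_def)
  qed
  have "VV (1/sqrt N) N (map (%l. (mu l, s)) [K - Suc j..<K])
    = (pstep (mu (K - Suc j)) (1/sqrt (K*N)) ^^ N) (VV (1/sqrt N) N (map (%l. (mu l, s)) [K - j..<K]))"
   unfolding eq list.map VV.simps fst_conv snd_conv h ..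
  also have "... = (pstep (mu (K - Suc j)) (1/sqrt (K*N)) ^^ N) (sch be (1/sqrt (K*N)) mm (j*N))"
   using Suc by simp
  finally show ?case using b by (simp add: add.commute)
 qed simp
 from this[of K] show ?thesis by (simp add: levels_def s_def mm_def[abs_def])
qed

lemma qrem_levels:
 assumes "K > 0" "l <= K"
 shows "qrem (map (%l. (mu l, 1/real K)) [l..<K]) = real l/real K"
 using assms by (simp add: qrem_def comp_def sum_list_triv of_nat_diff field_simps)

lemma K1_levels:
 assumes K: "K > 0"
 shows "K1 (mu 0) (levels mu K) = - (SUM l<K. mu l*(2*real l + 1))/(2*(real K)^2)"
proof -
 define L where "L l = map (%l. (mu l, 1/real K)) [l..<K]" for l
 have "K1 m (L l) = - m/2*(1 - (1 - (real l/real K)^2)) - (SUM i=l..<K. mu i*(2*real i + 1))/(2*(real K)^2)"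
  if "l <= K" for l m using that
 proof (induction "K - l" arbitrary: l m)
  case 0
  thus ?case using K by (simp add: L_def)
 next
  case (Suc j)
  hence l: "l < K" by simp
  hence L: "L l = (mu l, 1/real K) # L (Suc l)" by (simp add: L_def upt_rec[of l K])
  have q: "qrem ((mu l, 1/real K) # L (Suc l)) = real l/real K"
  proof -
   have "qrem (L l) = real l/real K" using qrem_levels[OF K Suc.prems] by (simp add: L_def)
   thus ?thesis unfolding L .
  qed
  have IH: "K1 (mu l) (L (Suc l)) = - mu l/2*(1 - (1 - (real (Suc l)/real K)^2))
    - (SUM i=Suc l..<K. mu i*(2*real i + 1))/(2*(real K)^2)"
   by (rule Suc.hyps(1)) (use Suc.hyps(2) l in auto)
  have s: "(SUM i=l..<K. mu i*(2*real i + 1)) = mu l*(2*real l + 1) + (SUM i=Suc l..<K. mu i*(2*real i + 1))"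
   using l by (rule sum.atLeast_Suc_lessThan)
  show ?case unfolding L s K1.simps q fst_conv IH using K
   by (simp add: field_simps power2_eq_square)
 qed
 from this[of 0 "mu 0"] show ?thesis by (simp add: L_def levels_def atLeast0LessThan)
qed

lemma chain_levels:
 assumes mono: "!!i j. i <= j ==> j < K ==> mu i <= mu j" and b: "!!i. i < K ==> mu i <= be" and K: "K > 0"
 shows "chain be (mu 0) (levels mu K)"
proof -
 have "chain be m (map (%l. (mu l, s)) [l..<K])" if "l <= K" "m <= be" "l < K ==> m <= mu l" for l m s
  using that
 proof (induction "K - l" arbitrary: l m)
  case (Suc j)
  hence l: "l < K" by simp
  have "chain be (mu l) (map (%l. (mu l, s)) [Suc l..<K])"
   by (rule Suc.hyps(1)) (use Suc.hyps(2) l b mono in auto)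
  thus ?case using l Suc.prems by (simp add: upt_rec[of l K])
 qed simp
 from this[of 0 "mu 0"] show ?thesis using K b by (simp add: levels_def)
qed

context order_parameter
begin

lemma mult_mono_on: "mono_on {0..1} (%q. q*x q)"
 by (rule mono_onI) (use x_range x_mono in \<open>auto intro!: mult_mono\<close>)

lemma q_x_integrable: "0 <= a ==> b <= 1 ==> (%q. q*x q) integrable_on {a..b}"
 by (rule integrable_on_mono_on[OF mono_on_subset[OF mult_mono_on]]) auto

lemma integral_q_x_upper:
 assumes K: "K > 0"
 shows "integral {0..1} (%q. q*x q) <= (SUM l<K. x (real (Suc l)/real K)*(2*real l + 1))/(2*(real K)^2)"
proof -
 have "integral {0..real j/real K} (%q. q*x q) <= (SUM l<j. x (real (Suc l)/real K)*(2*real l + 1))/(2*(real K)^2)"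
  if "j <= K" for j using that
 proof (induction j)
  case (Suc j)
  define a b where "a = real j/real K" and "b = real (Suc j)/real K"
  have ab: "0 <= a" "a <= b" "b <= 1" using Suc.prems K by (auto simp: a_def b_def divide_simps)
  have "integral {0..b} (%q. q*x q) = integral {0..a} (%q. q*x q) + integral {a..b} (%q. q*x q)"
   using ab by (intro Henstock_Kurzweil_Integration.integral_combine[symmetric] q_x_integrable) auto
  moreover have "integral {a..b} (%q. q*x q) <= integral {a..b} (%q. q*x b)"
   by (rule Henstock_Kurzweil_Integration.integral_le)
     (use ab x_mono q_x_integrable in \<open>auto intro!: integrable_continuous_real continuous_intros mult_left_mono\<close>)
  moreover have "integral {a..b} (%q. q*x b) = x b*(2*real j + 1)/(2*(real K)^2)"
  proof -
   have "((%q. q*x b) has_integral (b^2/2*x b - a^2/2*x b)) {a..b}"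
    using ab(2) by (rule fundamental_theorem_of_calculus)
     (auto intro!: derivative_eq_intros simp flip: has_real_derivative_iff_has_vector_derivative)
   hence "integral {a..b} (%q. q*x b) = (b^2 - a^2)/2*x b"
    by (subst integral_unique) (auto simp: field_simps)
   also have "b^2 - a^2 = (2*real j + 1)/(real K)^2"
    using K by (simp add: a_def b_def field_simps power2_eq_square)
   finally show ?thesis by (simp add: mult_ac)
  qed
  moreover have "integral {0..a} (%q. q*x q) <= (SUM l<j. x (real (Suc l)/real K)*(2*real l + 1))/(2*(real K)^2)"
   using Suc by (simp add: a_def)
  ultimately show ?case unfolding sum.lessThan_Suc add_divide_distrib b_def[symmetric] by linarith
 qed simp
 from this[of K] K show ?thesis by simp
qed

text \<open>The order parameter is sampled at the left ends of K cells: then the scheme of the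
  levels lies below the true one by monotonicity, while the integral term loses at most be/K.
  Raising the samples to ep > 0 makes the outermost m positive at a cost controlled by ep. K is a
  power of 2 so that K*N can run through the dyadic schemes.\<close>

lemma levels_choice:
 assumes de: "de > 0"
 obtains mu :: "nat => real" and a :: nat
 where "mu 0 > 0" "levels_ok (levels mu (2^a))" "chain be (mu 0) (levels mu (2^a))"
  "K1 (mu 0) (levels mu (2^a))/2 <= - (1/2)*integral {0..1} (%q. q*x q) + de"
  "!!N. N > 0 ==> sch be (1/sqrt (real (2^a)*real N)) (%i. mu (2^a - 1 - i div N)) (2^a*N) y
    <= U (2^a*N) (2^a*N) y + de"
proof -
 obtain a :: nat where a: "be/de < 2^a" using real_arch_pow[of 2 "be/de"] by auto
 define K :: nat where "K = 2^a"
 have K: "K > 0" "be/real K <= de" using a de by (auto simp: K_def field_simps)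
 define ep where "ep = min be de"
 have ep: "0 < ep" "ep <= be" "ep <= de" using be de by (auto simp: ep_def)
 define mu where "mu l = max ep (x (real l/real K))" for l
 have xl: "0 <= x (real l/real K)" "x (real l/real K) <= be" if "l <= K" for l
  using x_range[of "real l/real K"] that K by auto
 have mono: "mu i <= mu j" if "i <= j" "j < K" for i j
  unfolding mu_def using x_mono[of "real i/real K" "real j/real K"] that K
  by (auto simp: divide_right_mono intro: max.mono)
 have b: "mu i <= be" if "i < K" for i using xl[of i] that ep by (auto simp: mu_def)
 show ?thesis
 proof (rule that[of mu a], unfold K_def[symmetric])
  show "mu 0 > 0" using ep by (simp add: mu_def less_max_iff_disj)
  show "levels_ok (levels mu K)" using ep K by (auto simp: levels_ok_def levels_def mu_def less_max_iff_disj)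
  show "chain be (mu 0) (levels mu K)" by (rule chain_levels[OF mono b K(1)])
  show "K1 (mu 0) (levels mu K)/2 <= - (1/2)*integral {0..1} (%q. q*x q) + de"
  proof -
   define X where "X l = x (real l/real K)" for l
   have "(SUM l<K. X (Suc l)*(2*real l + 1)) <= (SUM l<K. mu l*(2*real l + 1) + (X (Suc l) - X l)*(2*real K))"
   proof (rule sum_mono)
    fix l assume l: "l : {..<K}"
    have "X l <= X (Suc l)" unfolding X_def using l K by (intro x_mono) (auto simp: divide_right_mono)
    hence "(X (Suc l) - X l)*(2*real l + 1) <= (X (Suc l) - X l)*(2*real K)"
     using l by (intro mult_left_mono) auto
    moreover have "X l*(2*real l + 1) <= mu l*(2*real l + 1)"
     by (intro mult_right_mono) (auto simp: mu_def X_def)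
    ultimately show "X (Suc l)*(2*real l + 1) <= mu l*(2*real l + 1) + (X (Suc l) - X l)*(2*real K)"
     by (simp add: algebra_simps)
   qed
   also have "... = (SUM l<K. mu l*(2*real l + 1)) + (X K - X 0)*(2*real K)"
    by (simp add: sum.distrib sum_lessThan_telescope flip: sum_distrib_right)
   also have "... <= (SUM l<K. mu l*(2*real l + 1)) + be*(2*real K)"
    using xl[of K] xl[of 0] K by (intro add_left_mono mult_right_mono) (auto simp: X_def)
   finally have s: "(SUM l<K. X (Suc l)*(2*real l + 1)) <= (SUM l<K. mu l*(2*real l + 1)) + be*(2*real K)" .
   have "integral {0..1} (%q. q*x q) <= (SUM l<K. X (Suc l)*(2*real l + 1))/(2*(real K)^2)"
    using integral_q_x_upper[OF K(1)] by (simp add: X_def)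
   also have "... <= ((SUM l<K. mu l*(2*real l + 1)) + be*(2*real K))/(2*(real K)^2)"
    by (intro divide_right_mono s) auto
   also have "... = (SUM l<K. mu l*(2*real l + 1))/(2*(real K)^2) + be/real K"
    using K(1) by (simp add: add_divide_distrib power2_eq_square)
   finally have "integral {0..1} (%q. q*x q) <= - K1 (mu 0) (levels mu K) + de"
    using K1_levels[OF K(1), of mu] K(2) by simp
   thus ?thesis using de by linarith
  qed
  fix N :: nat assume N: "N > 0"
  define T where "T = K*N"
  define h where "h = 1/sqrt (real T)"
  define gm where "gm i = max ep (grid T i)" for i
  have T: "T > 0" using K N by (simp add: T_def)
  have "sch be h (%i. mu (K - 1 - i div N)) T y <= sch be h gm T y"
  proof (rule sch_param(1)[OF be])
   fix i assume i: "i < T"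
   define l where "l = K - 1 - i div N"
   have q: "i div N < K" using i N by (simp add: T_def less_mult_imp_div_less)
   have "i < (i div N + 1)*N" using N by (simp add: dividend_less_div_times)
   have "real l/real K <= (real T - real i)/real T"
   proof -
    have "l + (i div N + 1) = K" using q by (simp add: l_def)
    hence "l*N + (i div N + 1)*N = T" unfolding T_def by (metis add_mult_distrib)
    hence "l*N + i <= T" using \<open>i < (i div N + 1) * N\<close> by linarith
    hence "real l*real N + real i <= real T" unfolding of_nat_mult[symmetric] of_nat_add[symmetric] of_nat_le_iff .
    hence "real l*real N/real T <= (real T - real i)/real T" by (intro divide_right_mono) auto
    thus ?thesis using K N by (simp add: T_def)
   qed
   moreover have "(real T - real i)/real T <= 1" using T by simp
   ultimately have "x (real l/real K) <= grid T i" unfolding grid_def by (intro x_mono) auto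
   thus "mu (K - 1 - i div N) <= gm i" unfolding mu_def gm_def l_def[symmetric] by (intro max.mono) auto
  qed
  also have "... <= sch be h (grid T) T y + (SUM i<T. gm i - grid T i)*h^2/2"
   by (rule sch_param(2)[OF be]) (simp add: gm_def)
  also have "(SUM i<T. gm i - grid T i)*h^2/2 <= de"
  proof -
   have "(SUM i<T. gm i - grid T i) <= (SUM i<T. ep)"
   proof (rule sum_mono)
    fix i assume "i : {..<T}"
    hence "0 <= grid T i" using grid_bounds[OF _ T, of i] by simp
    thus "gm i - grid T i <= ep" using ep unfolding gm_def by linarith
   qed
   hence "(SUM i<T. gm i - grid T i)*h^2 <= real T*ep*h^2" by (intro mult_right_mono) auto
   also have "... = ep" using T by (simp add: h_def power_divide)
   finally show ?thesis using ep by linarith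
  qed
  finally show "sch be (1/sqrt (real K*real N)) (%i. mu (K - 1 - i div N)) (K*N) y <= U (K*N) (K*N) y + de"
   by (simp add: T_def h_def U_def)
 qed
qed

text \<open>m and c are chosen before n, ga and the spins, so the error c/sqrt ga is uniform in n.
  With all else fixed the walk length runs through powers of 2, which turns the scheme into
  \<open>ff\<close> and removes the term C/sqrt N.\<close>

theorem guerra_parisi:
 assumes de: "de > 0"
 shows "EX m c. m > 0 & (ALL (Om :: nat set set) n sg (ga :: real) es. balanced_ising Om be n sg -->
  inj_on (%S. restrict (%i. sg i S) {..<n}) Om --> distinct es & set es = upper_pairs n --> 1 <= ga --> ga <= n -->
  Bs (map (%(i, k). (1/sqrt ga) *: (%S. sg i S * sg k S)) es) (ga/n) (%w. exp (m * spins.free Om be w)) (%S. 0)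
  <= exp (m*n*(ff (0, 0) - 1/2*integral {0..1} (%q. q*x q) + de + c/sqrt ga)))"
proof -
 obtain mu :: "nat => real" and a :: nat
 where l: "mu 0 > 0" "levels_ok (levels mu (2^a))" "chain be (mu 0) (levels mu (2^a))"
  "K1 (mu 0) (levels mu (2^a))/2 <= - (1/2)*integral {0..1} (%q. q*x q) + de/2"
  and V: "!!N. N > 0 ==> sch be (1/sqrt (real (2^a)*real N)) (%i. mu (2^a - 1 - i div N)) (2^a*N) 0
    <= U (2^a*N) (2^a*N) 0 + de/2"
  using levels_choice[of "de/2" 0] de by auto
 define K :: nat where "K = 2^a"
 have K: "K > 0" by (simp add: K_def)
 define lv where "lv = levels mu K"
 define c where "c = balanced_ising.C3 be lv/2"
 have Cons: "lv = (mu 0, 1/real K) # map (%l. (mu l, 1/real K)) [Suc 0..<K]"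
  using K by (simp add: lv_def levels_def upt_rec[of 0 K])
 have q0: "qrem lv = 0" using qrem_levels[OF K, of 0 mu] by (simp add: lv_def levels_def)
 show ?thesis
 proof (rule exI[of _ "mu 0"], rule exI[of _ c], intro conjI allI impI)
  show "mu 0 > 0" by (rule l)
  fix Om :: "nat set set" and n sg ga es
  assume bi: "balanced_ising Om be n sg" and inj: "inj_on (%S. restrict (%i. sg i S) {..<n}) Om"
   and es: "distinct es & set es = upper_pairs n" and ga: "1 <= ga" "ga <= real n"
  interpret B: balanced_ising Om be n sg by (rule bi)
  let ?B = "Bs (map (%(i, k). (1/sqrt ga) *: (%S. sg i S * sg k S)) es) (ga/n) (%w. exp (mu 0*B.free be w)) (%S. 0)"
  have "B.ev (1/sqrt ga) es = map (%(i, k). (1/sqrt ga) *: (%S. sg i S * sg k S)) es"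
   by (simp add: B.ev_def B.ps_def[abs_def])
  then obtain C where C: "!!N. N > 0 ==> ?B <= exp (mu 0*n*(K1 (mu 0) lv/2 + B.C3 lv/(2 * sqrt ga)) + C/sqrt N + mu 0*B.UU (1/sqrt N) N lv (%S. 0))"
   using B.Bs_free_le[OF _ Cons _ q0 _ ga, of es "%S. 0"] l es unfolding B.edges_def lv_def[symmetric] K_def[symmetric] by auto
  have UUb: "B.UU (1/sqrt N) N lv (%S. 0) <= n*(U (K*N) (K*N) 0 + de/2)" if "N > 0" for N :: nat
  proof -
   have "B.UU (1/sqrt N) N lv (%S. 0) <= (SUM i<n. B.VV (1/sqrt N) N lv 0)"
    using B.UU_le_VV[OF inj, of lv "1/sqrt N" N "%_. 0"] l(2) by (simp add: B.field_zero lv_def K_def)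
   also have "... = n*B.VV (1/sqrt N) N lv 0" by simp
   also have "B.VV (1/sqrt N) N lv 0 <= U (K*N) (K*N) 0 + de/2"
    using V[OF that] unfolding lv_def B.VV_levels[OF K that] K_def[symmetric] by simp
   finally show ?thesis by (simp add: mult_left_mono)
  qed
  have bound: "?B <= exp (mu 0*n*(- (1/2)*integral {0..1} (%q. q*x q) + de/2 + c/sqrt ga) + C/sqrt (real (2^b))
    + mu 0*(n*(U (2^(a + b)) (2^(a + b)) 0 + de/2)))" for b :: nat
  proof -
   have "?B <= exp (mu 0*n*(K1 (mu 0) lv/2 + B.C3 lv/(2 * sqrt ga)) + C/sqrt (real (2^b)) + mu 0*B.UU (1/sqrt (real (2^b))) (2^b) lv (%S. 0))"
    by (rule C) simp
   also have "... <= exp (mu 0*n*(- (1/2)*integral {0..1} (%q. q*x q) + de/2 + c/sqrt ga) + C/sqrt (real (2^b))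
     + mu 0*(n*(U (2^(a + b)) (2^(a + b)) 0 + de/2)))"
    unfolding exp_le_cancel_iff
   proof (intro add_mono mult_left_mono order.refl)
    show "K1 (mu 0) lv/2 <= - (1/2)*integral {0..1} (%q. q*x q) + de/2" using l(4) by (simp add: lv_def K_def)
    show "B.C3 lv/(2 * sqrt ga) <= c/sqrt ga" by (simp add: c_def)
    show "B.UU (1/sqrt (real (2^b))) (2^b) lv (%S. 0) <= n*(U (2^(a + b)) (2^(a + b)) 0 + de/2)"
     using UUb[of "2^b"] by (simp add: K_def power_add)
   qed (use l in auto)
   finally show ?thesis .
  qed
  have "(%b. exp (mu 0*n*(- (1/2)*integral {0..1} (%q. q*x q) + de/2 + c/sqrt ga) + C/sqrt (real (2^b))
    + mu 0*(n*(U (2^(a + b)) (2^(a + b)) 0 + de/2))))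
   ----> exp (mu 0*n*(- (1/2)*integral {0..1} (%q. q*x q) + de/2 + c/sqrt ga) + 0
    + mu 0*(n*(ff (0, 0) + de/2)))"
  proof (intro tendsto_intros)
   have "(%b::nat. C/sqrt (2^b)) ----> 0" by real_asymp
   thus "(%b::nat. C/sqrt (real (2^b))) ----> 0" by simp
   show "(%b. U (2^(a + b)) (2^(a + b)) 0) ----> ff (0, 0)"
    using LIMSEQ_ignore_initial_segment[OF U_tendsto_ff[of 0], of a] by (simp add: add.commute)
  qed
  from LIMSEQ_le_const[OF this] bound
  have "?B <= exp (mu 0*n*(- (1/2)*integral {0..1} (%q. q*x q) + de/2 + c/sqrt ga) + 0
    + mu 0*(n*(ff (0, 0) + de/2)))" by blast
  also have "mu 0*n*(- (1/2)*integral {0..1} (%q. q*x q) + de/2 + c/sqrt ga) + 0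
    + mu 0*(n*(ff (0, 0) + de/2)) = mu 0*n*(ff (0, 0) - 1/2*integral {0..1} (%q. q*x q) + de + c/sqrt ga)"
   by (simp add: field_simps)
  finally show "?B <= exp (mu 0*n*(ff (0, 0) - 1/2*integral {0..1} (%q. q*x q) + de + c/sqrt ga))" .
 qed
qed

end

section \<open>The sparse random graph\<close>

text \<open>Sites are numbered from 0 and vertices from 1, hence the \<open>Suc\<close>.\<close>

definition sgn_of :: "nat => nat set => real"
 where "sgn_of i S = (if Suc i : S then 1 else -1)"

definition edge_sgn :: "nat set => nat set => real"
 where "edge_sgn e S = (if e <= S | e \<inter> S = {} then 1 else -1)"

definition pair_edge :: "nat \<times> nat => nat set"
 where "pair_edge p = {Suc (fst p), Suc (snd p)}"

definition cut :: "nat => nat set set => nat set => nat"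
 where "cut n G S = card {e:G. EX i:S. EX j:{1..n} - S. e = {i, j}}"

lemma mcut_cut: "mcut n G = (MIN S\<in>halves n. cut n G S)" by (simp add: mcut_def cut_def)

lemma edge_sgn_pair_edge: "edge_sgn (pair_edge (i, k)) S = sgn_of i S * sgn_of k S"
 by (auto simp: edge_sgn_def pair_edge_def sgn_of_def)

lemma pair_edge_bij: "bij_betw pair_edge (upper_pairs n) (pairs n)"
proof (rule bij_betwI')
 fix p q assume "p : upper_pairs n" "q : upper_pairs n"
 thus "(pair_edge p = pair_edge q) = (p = q)"
  by (cases p; cases q) (auto simp: upper_pairs_def pair_edge_def doubleton_eq_iff)
next
 fix p assume "p : upper_pairs n"
 thus "pair_edge p : pairs n" by (cases p) (auto simp: upper_pairs_def pair_edge_def pairs_def)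
next
 fix e assume "e : pairs n"
 then obtain a b where e: "e = {a, b}" "a ~= b" "e <= {1..n}" unfolding pairs_def by (auto simp: card_2_iff)
 define i k where "i = min a b - 1" and "k = max a b - 1"
 have ab: "1 <= a" "a <= n" "1 <= b" "b <= n" using e by auto
 hence "(i, k) : upper_pairs n" using e(2) by (auto simp: i_def k_def upper_pairs_def min_def max_def)
 moreover have "e = pair_edge (i, k)" using ab e(1) by (auto simp: i_def k_def pair_edge_def min_def max_def)
 ultimately show "EX p:upper_pairs n. e = pair_edge p" by blast
qed

lemma finite_pairs [simp]: "finite (pairs n)"
 using pair_edge_bij[of n] bij_betw_finite finite_upper_pairs by blast

lemma finite_halves [simp]: "finite (halves n)"
 unfolding halves_def by (rule finite_subset[of _ "Pow {1..n}"]) auto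

lemma halves_nonempty:
 assumes "even n"
 shows "halves n ~= {}"
proof -
 obtain S where "S <= {1..n}" "card S = n div 2" using obtain_subset_with_card_n[of "n div 2" "{1..n}"] by auto
 hence "S : halves n" using assms by (auto simp: halves_def)
 thus ?thesis by blast
qed

lemma balanced_ising_halves:
 assumes "even n" "n > 0" "be > 0"
 shows "balanced_ising (halves n) be n sgn_of"
proof
 show "finite (halves n)" "halves n ~= {}" using halves_nonempty assms by auto
 show "sgn_of i S = 1 | sgn_of i S = - 1" for i S by (simp add: sgn_of_def)
 fix S assume S: "S : halves n"
 hence Ssub: "S <= {1..n}" and c: "2*card S = n" by (auto simp: halves_def)
 have fin: "finite S" using Ssub finite_subset by blast
 have "(SUM i<n. sgn_of i S) = (SUM j:{1..n}. if j : S then 1 else - 1 :: real)"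
  unfolding sgn_of_def by (rule sum.reindex_bij_witness[of _ "%j. j - 1" Suc]) auto
 also have "... = (SUM j:{1..n}. 2*(if j : S then 1 else 0) - 1)" by (rule sum.cong) auto
 also have "... = 2*real (card ({1..n} \<inter> S)) - real n"
  by (simp add: sum_subtractf sum_distrib_left[symmetric] sum.If_cases)
 also have "{1..n} \<inter> S = S" using Ssub by blast
 also have "2*real (card S) - real n = 0" using c by (metis diff_self of_nat_mult of_nat_numeral)
 finally show "(SUM i<n. sgn_of i S) = 0" .
qed (use assms in auto)

lemma inj_sgn_of: "inj_on (%S. restrict (%i. sgn_of i S) {..<n}) (halves n)"
proof (rule inj_onI)
 fix S T assume S: "S : halves n" "T : halves n"
  and eq: "restrict (%i. sgn_of i S) {..<n} = restrict (%i. sgn_of i T) {..<n}"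
 have "Suc i : S \<longleftrightarrow> Suc i : T" if "i < n" for i
  using fun_cong[OF eq, of i] that by (auto simp: sgn_of_def split: if_splits)
 moreover have "S <= {1..n}" "T <= {1..n}" using S by (auto simp: halves_def)
 ultimately have "j : S \<longleftrightarrow> j : T" for j by (cases j) (auto simp: Suc_le_eq dest: subsetD)
 thus "S = T" by blast
qed

lemma finite_set_Pi_pmf_bool:
 "finite A ==> finite (set_pmf (Pi_pmf A False (%e. bernoulli_pmf (p e))))"
 by (subst set_Pi_pmf) (auto intro!: finite_PiE_dflt)

text \<open>Links the operator \<open>Bs\<close> to probability, by conditioning on one edge at a
  time.\<close>

lemma expectation_edges:
 fixes U :: "('s => real) => real"
 assumes p: "0 <= p" "p <= 1" and d: "distinct es"
 shows "measure_pmf.expectation (Pi_pmf (set es) False (%_. bernoulli_pmf p))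
   (%om. U (w +: (%S. SUM e:{e:set es. om e}. v e S))) = Bs (map v es) p U w"
 using d
proof (induction es arbitrary: w)
 case Nil
 thus ?case by simp
next
 case (Cons e es)
 let ?P = "Pi_pmf (set es) False (%_. bernoulli_pmf p)"
 define F where "F w om = U (w +: (%S. SUM e:{e:set es. om e}. v e S))" for w om
 define H where "H om = U (w +: (%S. SUM e':{e':set (e # es). om e'}. v e' S))" for om
 have HT: "H (f(e := True)) = F (w +: v e) f" for f
 proof -
  have "{e':set (e # es). (f(e := True)) e'} = insert e {e':set es. f e'}" using Cons.prems by auto
  hence "(SUM e':{e':set (e # es). (f(e := True)) e'}. v e' S) = v e S + (SUM e:{e:set es. f e}. v e S)" for S
   using Cons.prems by simp
  thus ?thesis by (simp add: H_def F_def vadd_def add.assoc)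
 qed
 have HF: "H (f(e := False)) = F w f" for f
 proof -
  have "{e':set (e # es). (f(e := False)) e'} = {e':set es. f e'}" using Cons.prems by auto
  thus ?thesis by (simp only: H_def F_def)
 qed
 have "measure_pmf.expectation (Pi_pmf (set (e # es)) False (%_. bernoulli_pmf p)) H
  = measure_pmf.expectation (bernoulli_pmf p \<bind> (%y. map_pmf (%f. f(e := y)) ?P)) H"
  using Cons.prems by (simp add: Pi_pmf_insert' map_pmf_def)
 also have "... = (SUM y:UNIV. pmf (bernoulli_pmf p) y *\<^sub>R measure_pmf.expectation (map_pmf (%f. f(e := y)) ?P) H)"
  by (rule pmf_expectation_bind) (auto intro: finite_set_Pi_pmf_bool)
 also have "... = (1 - p)*measure_pmf.expectation ?P (F w) + p*measure_pmf.expectation ?P (F (w +: v e))"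
  using p by (simp add: UNIV_bool HT HF)
 also have "... = Bs (map v (e # es)) p U w" using Cons unfolding F_def by (simp add: Bop_def)
 finally show ?case unfolding H_def[abs_def] .
qed

lemma sum_edge_sgn:
 assumes G: "G <= pairs n" and S: "S <= {1..n}"
 shows "(SUM e:G. edge_sgn e S) = real (card G) - 2*real (cut n G S)"
proof -
 have fin: "finite G" by (rule finite_subset[OF G finite_pairs])
 have "(EX i:S. EX j:{1..n} - S. e = {i, j}) \<longleftrightarrow> ~ (e <= S | e \<inter> S = {})" if "e : G" for e
 proof -
  have "card e = 2" "e <= {1..n}" using that G by (auto simp: pairs_def)
  then obtain a b where "e = {a, b}" "a ~= b" "a : {1..n}" "b : {1..n}" by (auto simp: card_2_iff)
  note e = this
  show ?thesis
  proof
   assume "EX i:S. EX j:{1..n} - S. e = {i, j}"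
   thus "~ (e <= S | e \<inter> S = {})" by blast
  next
   assume "~ (e <= S | e \<inter> S = {})"
   then obtain i j where ij: "i : e" "i : S" "j : e" "j ~: S" by blast
   hence "i ~= j" "i = a | i = b" "j = a | j = b" using e(1) by auto
   hence "e = {i, j}" using e(1) by auto
   moreover have "j : {1..n}" using `j = a | j = b` e(3,4) by auto
   ultimately show "EX i:S. EX j:{1..n} - S. e = {i, j}" using ij(2,4) by blast
  qed
 qed
 hence eq: "{e:G. EX i:S. EX j:{1..n} - S. e = {i, j}} = {e:G. ~ (e <= S | e \<inter> S = {})}" by auto
 have "(SUM e:G. edge_sgn e S) = (SUM e:G. 1 - 2*(if ~ (e <= S | e \<inter> S = {}) then 1 else 0))"
  unfolding edge_sgn_def by (rule sum.cong) auto
 also have "... = real (card G) - 2*real (card {e:G. ~ (e <= S | e \<inter> S = {})})"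
  using fin by (simp add: sum_subtractf sum_distrib_left[symmetric] sum.If_cases Int_def conj_commute)
 finally show ?thesis unfolding cut_def eq .
qed

lemma mcut_attained:
 assumes "even n"
 obtains S where "S : halves n" "mcut n G = cut n G S"
proof -
 have "mcut n G : cut n G ` halves n" unfolding mcut_cut
  using halves_nonempty[OF assms] by (intro Min_in) auto
 thus ?thesis using that by blast
qed

lemma (in spins) le_free:
 assumes "be > 0" "S : Om"
 shows "w S <= free be w"
proof -
 have "exp (be*w S) <= (SUM S:Om. exp (be*w S))"
  using assms(2) finite_Om by (intro member_le_sum) auto
 hence "be*w S <= ln (SUM S:Om. exp (be*w S))" using partition_pos[of be w] by (simp add: ln_ge_iff)
 thus ?thesis using assms(1) by (simp add: free_def field_simps)
qed

section \<open>Exponential tail bound for the null model\<close>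

context order_parameter
begin

text \<open>Markov's inequality for exp (m * free energy), since the free energy dominates the
  energy of every bisection. An optimal bisection has card G - 2 * mcut as its difference of uncut
  and cut edges.\<close>

lemma erdos_renyi_moment:
 fixes ga :: real
 assumes n: "even n" "n > 0" and ga: "0 < ga" "ga <= n" and es: "distinct es" "set es = upper_pairs n" and m: "m > 0"
 shows "measure_pmf.prob (erdos_renyi n (ga/n)) {G. real n * sqrt ga*t <= real (card G) - 2*real (mcut n G)}
  <= Bs (map (%(i, k). (1/sqrt ga) *: (%S. sgn_of i S * sgn_of k S)) es) (ga/n)
    (%w. exp (m * spins.free (halves n) be w)) (%S. 0)/exp (m*(n*t))"
proof -
 interpret B: balanced_ising "halves n" be n sgn_of by (rule balanced_ising_halves[OF n be])
 define P where "P = Pi_pmf (pairs n) False (%_. bernoulli_pmf (ga/n))"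
 define X where "X om = exp (m*B.free be (%S. SUM e:{e:pairs n. om e}. 1/sqrt ga*edge_sgn e S))" for om
 have se: "set (map pair_edge es) = pairs n" using pair_edge_bij[of n] es(2) by (simp add: bij_betw_def)
 have de: "distinct (map pair_edge es)" using pair_edge_bij[of n] es by (simp add: bij_betw_def distinct_map)
 define V where "V e = (1/sqrt ga) *: edge_sgn e" for e
 have Veq: "map V (map pair_edge es) = map (%(i, k). (1/sqrt ga) *: (%S. sgn_of i S * sgn_of k S)) es"
  by (auto simp: V_def vscale_def fun_eq_iff edge_sgn_pair_edge)
 have "measure_pmf.expectation P (%om. exp (m*B.free be ((%S. 0) +: (%S. SUM e:{e:pairs n. om e}. V e S))))
   = Bs (map V (map pair_edge es)) (ga/n) (%w. exp (m*B.free be w)) (%S. 0)"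
  unfolding P_def se[symmetric] by (rule expectation_edges[OF _ _ de]) (use ga in auto)
 hence EX: "measure_pmf.expectation P X = Bs (map (%(i, k). (1/sqrt ga) *: (%S. sgn_of i S * sgn_of k S)) es) (ga/n)
    (%w. exp (m*B.free be w)) (%S. 0)"
  unfolding Veq by (simp add: X_def[abs_def] V_def vscale_def)
 have fin: "finite (set_pmf P)" unfolding P_def by (rule finite_set_Pi_pmf_bool) simp
 have "measure_pmf.prob (erdos_renyi n (ga/n)) {G. real n * sqrt ga*t <= real (card G) - 2*real (mcut n G)}
  = measure_pmf.prob P {om. real n * sqrt ga*t <= real (card {e:pairs n. om e}) - 2*real (mcut n {e:pairs n. om e})}"
  unfolding erdos_renyi_def edge_indep_graph_def P_def[symmetric] by (simp add: vimage_def)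
 also have "... <= measure_pmf.prob P {om : space (measure_pmf P). exp (m*(n*t)) <= X om}"
 proof (rule measure_pmf.finite_measure_mono)
  show "{om. real n * sqrt ga*t <= real (card {e:pairs n. om e}) - 2*real (mcut n {e:pairs n. om e})}
   <= {om : space (measure_pmf P). exp (m*(n*t)) <= X om}"
  proof (intro subsetI CollectI conjI)
   fix om assume "om : {om. real n * sqrt ga*t <= real (card {e:pairs n. om e}) - 2*real (mcut n {e:pairs n. om e})}"
   hence h: "real n * sqrt ga*t <= real (card {e:pairs n. om e}) - 2*real (mcut n {e:pairs n. om e})" by simp
   define G where "G = {e:pairs n. om e}"
   obtain S where S: "S : halves n" "mcut n G = cut n G S" by (rule mcut_attained[OF n(1)])
   have "real n*t = 1/sqrt ga*(real n * sqrt ga*t)" using ga by simp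
   also have "... <= 1/sqrt ga*(real (card G) - 2*real (cut n G S))"
    using h S(2) ga unfolding G_def by (intro mult_left_mono) auto
   also have "... = (SUM e:G. 1/sqrt ga*edge_sgn e S)"
   proof -
    have "G <= pairs n" "S <= {1..n}" using S(1) by (auto simp: G_def halves_def)
    from sum_edge_sgn[OF this] show ?thesis by (simp only: sum_distrib_left[symmetric])
   qed
   also have "... <= B.free be (%S. SUM e:G. 1/sqrt ga*edge_sgn e S)"
    by (rule B.le_free[OF be S(1)])
   finally show "exp (m*(n*t)) <= X om" using m by (simp add: X_def G_def mult_left_mono)
  qed simp
 qed simp
 also have "... <= measure_pmf.expectation P X/exp (m*(n*t))"
  by (rule integral_Markov_inequality_measure[where A = "{}"])
    (use fin in \<open>auto simp: X_def intro!: integrable_measure_pmf_finite\<close>)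
 finally show ?thesis unfolding EX .
qed

theorem erdos_renyi_bisection:
 assumes t: "ff (0, 0) - 1/2*integral {0..1} (%q. q*x q) < t"
 shows "EX ga0>=1. EX r>0. ALL (ga::real) n. ga0 <= ga --> ga <= n --> even n -->
  measure_pmf.prob (erdos_renyi n (ga/n)) {G. real n * sqrt ga*t <= real (card G) - 2*real (mcut n G)} <= exp (- r*n)"
proof -
 define L where "L = ff (0, 0) - 1/2*integral {0..1} (%q. q*x q)"
 \<comment> \<open>One third of the gap pays for the approximation in \<open>guerra_parisi\<close>,
   one for c/sqrt ga, and one remains as the exponential rate.\<close>
 define de where "de = (t - L)/3"
 have de: "de > 0" using t by (simp add: de_def L_def)
 obtain m c where m: "m > 0" and c: "!!(Om :: nat set set) n sg (ga :: real) es. balanced_ising Om be n sg ==>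
  inj_on (%S. restrict (%i. sg i S) {..<n}) Om ==> distinct es & set es = upper_pairs n ==> 1 <= ga ==> ga <= n ==>
  Bs (map (%(i, k). (1/sqrt ga) *: (%S. sg i S * sg k S)) es) (ga/n) (%w. exp (m * spins.free Om be w)) (%S. 0)
  <= exp (m*n*(L + de + c/sqrt ga))"
  using guerra_parisi[OF de] unfolding L_def by blast
 define ga0 where "ga0 = max 1 ((abs c/de)^2)"
 have "measure_pmf.prob (erdos_renyi n (ga/n)) {G. real n * sqrt ga*t <= real (card G) - 2*real (mcut n G)}
   <= exp (- (m*de)*n)"
  if ga: "ga0 <= ga" "ga <= real n" and n: "even n" for ga :: real and n :: nat
 proof -
  have ga1: "1 <= ga" using ga(1) by (simp add: ga0_def)
  hence n0: "n > 0" using ga(2) by (cases n) auto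
  have "abs c/de <= sqrt ga" using ga(1) by (intro real_le_rsqrt) (simp add: ga0_def)
  hence "abs c <= de * sqrt ga" using de by (simp add: field_simps)
  hence cs: "c/sqrt ga <= de" using ga1 by (simp add: field_simps abs_le_iff)
  obtain es where es: "set es = upper_pairs n" "distinct es" using finite_distinct_list[OF finite_upper_pairs] by blast
  have "measure_pmf.prob (erdos_renyi n (ga/n)) {G. real n * sqrt ga*t <= real (card G) - 2*real (mcut n G)}
   <= Bs (map (%(i, k). (1/sqrt ga) *: (%S. sgn_of i S * sgn_of k S)) es) (ga/n)
    (%w. exp (m * spins.free (halves n) be w)) (%S. 0)/exp (m*(n*t))"
   by (rule erdos_renyi_moment[OF n n0 _ ga(2) es(2,1) m]) (use ga1 in simp)
  also have "... <= exp (m*n*(L + de + c/sqrt ga))/exp (m*(n*t))"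
   by (intro divide_right_mono c[OF balanced_ising_halves[OF n n0 be] inj_sgn_of]) (use es ga1 ga in auto)
  also have "... = exp (m*n*(L + de + c/sqrt ga - t))"
   by (simp add: exp_diff[symmetric] algebra_simps)
  also have "... <= exp (- (m*de)*n)"
  proof -
   have "L + de + c/sqrt ga - t <= - de"
   proof -
    have "3*de = t - L" by (simp add: de_def)
    thus ?thesis using cs by linarith
   qed
   hence "m*n*(L + de + c/sqrt ga - t) <= m*n*(- de)" using m by (intro mult_left_mono) auto
   thus ?thesis by (simp add: mult_ac)
  qed
  finally show ?thesis .
 qed
 moreover have "1 <= ga0" "0 < m*de" using m de by (auto simp: ga0_def)
 ultimately show ?thesis by blast
qed

end

section \<open>Second moments for independent edges\<close>

text \<open>The offset y absorbs the shift caused by conditioning on the next edge, so the induction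
  closes on an exact identity without covariances.\<close>

lemma centered_second_moment:
 assumes p: "!!e. e : A ==> 0 <= p e & p e <= (1 :: real)" and A: "finite A"
 shows "measure_pmf.expectation (Pi_pmf A False (%e. bernoulli_pmf (p e)))
   (%om. (y + (SUM e:{e:A. om e}. c e) - (SUM e:A. p e * c e))^2) = y^2 + (SUM e:A. p e*(1 - p e)*(c e)^2)"
 using A p
proof (induction A arbitrary: y rule: finite_induct)
 case empty
 thus ?case by simp
next
 case (insert a A)
 let ?P = "Pi_pmf A False (%e. bernoulli_pmf (p e))"
 define F where "F y om = (y + (SUM e:{e:A. om e}. c e) - (SUM e:A. p e * c e))^2" for y om
 define H where "H om = (y + (SUM e:{e:insert a A. om e}. c e) - (SUM e:insert a A. p e * c e))^2" for om
 have HT: "H (f(a := True)) = F (y + c a - p a * c a) f" for f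
 proof -
  have "{e:insert a A. (f(a := True)) e} = insert a {e:A. f e}" using insert.hyps by auto
  thus ?thesis using insert.hyps by (simp add: H_def F_def algebra_simps)
 qed
 have HF: "H (f(a := False)) = F (y - p a * c a) f" for f
 proof -
  have "{e:insert a A. (f(a := False)) e} = {e:A. f e}" using insert.hyps by auto
  thus ?thesis using insert.hyps by (simp add: H_def F_def algebra_simps)
 qed
 have IH: "measure_pmf.expectation ?P (F y) = y^2 + (SUM e:A. p e*(1 - p e)*(c e)^2)" for y
  unfolding F_def by (rule insert.IH) (use insert.prems in auto)
 have "measure_pmf.expectation (Pi_pmf (insert a A) False (%e. bernoulli_pmf (p e))) H
  = measure_pmf.expectation (bernoulli_pmf (p a) \<bind> (%y. map_pmf (%f. f(a := y)) ?P)) H"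
  using insert.hyps by (simp add: Pi_pmf_insert' map_pmf_def)
 also have "... = (SUM y:UNIV. pmf (bernoulli_pmf (p a)) y *\<^sub>R measure_pmf.expectation (map_pmf (%f. f(a := y)) ?P) H)"
  by (rule pmf_expectation_bind) (auto intro: finite_set_Pi_pmf_bool insert.hyps)
 also have "... = (1 - p a)*measure_pmf.expectation ?P (F (y - p a * c a)) + p a*measure_pmf.expectation ?P (F (y + c a - p a * c a))"
  using insert.prems by (simp add: UNIV_bool HT HF)
 also have "... = y^2 + (SUM e:insert a A. p e*(1 - p e)*(c e)^2)"
  unfolding IH using insert.hyps by (simp add: power2_eq_square algebra_simps)
 finally show ?case unfolding H_def[abs_def] .
qed

lemma edge_graph_deviation:
 assumes p: "!!e. e : pairs n ==> 0 <= p e & p e <= 1" and a: "a > 0"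
 shows "measure_pmf.prob (edge_indep_graph n p) {G. a <= abs((SUM e:G. c e) - (SUM e:pairs n. p e * c e))}
  <= (SUM e:pairs n. p e*(c e)^2)/a^2"
proof -
 define P where "P = Pi_pmf (pairs n) False (%e. bernoulli_pmf (p e))"
 define X where "X om = (0 + (SUM e:{e:pairs n. om e}. c e) - (SUM e:pairs n. p e * c e))^2" for om
 have fin: "finite (set_pmf P)" unfolding P_def by (rule finite_set_Pi_pmf_bool) simp
 have "measure_pmf.prob (edge_indep_graph n p) {G. a <= abs((SUM e:G. c e) - (SUM e:pairs n. p e * c e))}
   = measure_pmf.prob P {om. a <= abs((SUM e:{e:pairs n. om e}. c e) - (SUM e:pairs n. p e * c e))}"
  unfolding edge_indep_graph_def P_def[symmetric] by (simp add: vimage_def)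
 also have "... <= measure_pmf.prob P {om : space (measure_pmf P). a^2 <= X om}"
 proof (rule measure_pmf.finite_measure_mono)
  show "{om. a <= abs((SUM e:{e:pairs n. om e}. c e) - (SUM e:pairs n. p e * c e))} <= {om : space (measure_pmf P). a^2 <= X om}"
   using a by (auto simp: X_def intro!: abs_le_square_iff[THEN iffD1])
 qed simp
 also have "... <= measure_pmf.expectation P X/a^2"
  by (rule integral_Markov_inequality_measure[where A = "{}"])
    (use fin a in \<open>auto simp: X_def intro!: integrable_measure_pmf_finite\<close>)
 also have "measure_pmf.expectation P X = (SUM e:pairs n. p e*(1 - p e)*(c e)^2)"
  unfolding P_def X_def using centered_second_moment[of "pairs n" p 0 c] p by simp
 also have "(SUM e:pairs n. p e*(1 - p e)*(c e)^2)/a^2 <= (SUM e:pairs n. p e*(c e)^2)/a^2"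
  using p by (intro divide_right_mono sum_mono mult_right_mono) (auto intro: mult_left_le)
 finally show ?thesis .
qed

lemma card_pairs: "2*real (card (pairs n)) = real n*real n - real n"
proof -
 have "2*(SUM (i, k):upper_pairs n. 1 :: real) = (SUM i<n. SUM k<n. 1) - (SUM i<n. 1)"
  by (rule sum_upper_pairs) simp
 moreover have "card (pairs n) = card (upper_pairs n)" using bij_betw_same_card[OF pair_edge_bij[of n]] by simp
 ultimately show ?thesis by (simp add: case_prod_unfold)
qed

lemma sum_edge_sgn_pairs:
 assumes n: "even n" "n > 0" and S: "S : halves n"
 shows "(SUM e:pairs n. edge_sgn e S) = - real n/2"
proof -
 interpret balanced_ising "halves n" 1 n sgn_of by (rule balanced_ising_halves[OF n]) simp
 have "(SUM e:pairs n. edge_sgn e S) = (SUM p:upper_pairs n. edge_sgn (pair_edge p) S)"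
  by (rule sum.reindex_bij_betw[OF pair_edge_bij, symmetric])
 also have "... = (SUM (i, k):upper_pairs n. sgn_of i S * sgn_of k S)"
  by (rule sum.cong) (auto simp: edge_sgn_pair_edge)
 finally have eq: "(SUM e:pairs n. edge_sgn e S) = (SUM (i, k):upper_pairs n. sgn_of i S * sgn_of k S)" .
 have "2*(SUM (i, k):upper_pairs n. sgn_of i S * sgn_of k S)
   = (SUM i<n. SUM k<n. sgn_of i S * sgn_of k S) - (SUM i<n. sgn_of i S * sgn_of i S)"
  by (rule sum_upper_pairs) (simp add: mult.commute)
 also have "(SUM i<n. SUM k<n. sgn_of i S * sgn_of k S) = 0"
  using balanced[OF S] by (simp add: sum_distrib_left[symmetric])
 also have "(SUM i<n. sgn_of i S * sgn_of i S) = (SUM i<n. 1)"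
  by (rule sum.cong) (auto simp: sgn_of_def)
 finally show ?thesis using eq by simp
qed

lemma finite_cut_le: "even n ==> S : halves n ==> mcut n G <= cut n G S"
 unfolding mcut_cut by (intro Min_le) auto

lemma AE_edge_graph: "G : set_pmf (edge_indep_graph n p) ==> G <= pairs n"
 by (auto simp: edge_indep_graph_def)

section \<open>Limits along even numbers\<close>

lemma filterlim_even_at_topD:
 "filterlim f F at_top ==> filterlim f F even_at_top"
 unfolding even_at_top_def by (rule filterlim_mono[OF _ order.refl inf_le1])

lemma eventually_even: "eventually even even_at_top"
 unfolding even_at_top_def by (simp add: eventually_inf_principal)

lemma eventually_even_at_top: "eventually P at_top ==> eventually P even_at_top"
 unfolding even_at_top_def eventually_inf_principal by (erule eventually_mono) simp

lemma even_at_top_nontrivial [simp]: "even_at_top ~= bot"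
proof
 assume "even_at_top = bot"
 hence "eventually (%_. False) even_at_top" by (simp only: eventually_bot)
 hence "eventually (%n. even n --> False) (at_top :: nat filter)"
  unfolding even_at_top_def eventually_inf_principal by simp
 then obtain N :: nat where "ALL n>=N. odd n" by (auto simp: eventually_at_top_linorder)
 hence "odd (2*N)" by (auto dest: spec[of _ "2*N"])
 thus False by simp
qed

lemma tendsto_even_upper:
 fixes f :: "nat => real"
 assumes "\<forall>\<^sub>F n in even_at_top. 0 <= f n & f n <= g n" "(g \<longlongrightarrow> 0) even_at_top"
 shows "(f \<longlongrightarrow> 0) even_at_top"
 by (rule Lim_null_comparison[OF _ assms(2)]) (use assms(1) in \<open>auto elim: eventually_mono\<close>)

section \<open>The Parisi constant\<close>

lemma right_continuous_order_domain:
 assumes "be > 0" "x : parisi_domain be"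
 shows "right_continuous_order be x"
proof
 show "be > 0" by fact
 have r: "x ` {0..1} <= {0..be}" and m: "mono_on {0..1} x" and c: "!!q. q : {0..<1} ==> continuous (at_right q) x"
  using assms(2) by (auto simp: parisi_domain_def)
 show "0 <= x q & x q <= be" if "0 <= q" "q <= 1" for q using r that by (force simp: image_subset_iff)
 show "x p <= x q" if "0 <= p" "p <= q" "q <= 1" for p q using mono_onD[OF m, of p q] that by auto
 show "continuous (at_right q) x" if "0 <= q" "q < 1" for q using c that by auto
qed

lemma order_parameter_domain:
 "be > 0 ==> x : parisi_domain be ==> order_parameter be x"
 using right_continuous_order_domain right_continuous_order.axioms(1) by blast

lemma parisi_functional_eq:
 assumes "be > 0" "x : parisi_domain be"
 shows "parisi_functional be x = order_parameter.ff be x (0, 0) - 1/2*integral {0..1} (%q. q*x q)"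
 using right_continuous_order.parisi_solution_origin[OF right_continuous_order_domain[OF assms]]
 by (simp add: parisi_functional_def)

text \<open>A negative value would keep card G - 2 * mcut below a negative multiple of n with high
  probability. But for any fixed bisection the difference of uncut and cut edges has mean -ga/2 and
  variance O(n). Nonnegativity is what makes the infimum in \<open>P_star_beta\<close>
  meaningful.\<close>

lemma parisi_functional_nonneg:
 assumes "be > 0" "x : parisi_domain be"
 shows "0 <= parisi_functional be x"
proof (rule ccontr)
 interpret order_parameter be x by (rule order_parameter_domain[OF assms])
 assume neg: "~ 0 <= parisi_functional be x"
 define t where "t = parisi_functional be x/2"
 have t: "t < 0" "parisi_functional be x < t" using neg by (auto simp: t_def)
 obtain ga r where ga: "ga >= 1" "r > 0" and b: "!!n. ga <= real n ==> even n ==>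
  measure_pmf.prob (erdos_renyi n (ga/n)) {G. real n * sqrt ga*t <= real (card G) - 2*real (mcut n G)} <= exp (- r*n)"
  using erdos_renyi_bisection[of t] t(2) unfolding parisi_functional_eq[OF assms] by blast
 \<comment> \<open>The distance from the mean -ga/2 down to the level n * sqrt ga * t; it is of
   order n because t < 0.\<close>
 define a where "a n = - (real n * sqrt ga*t) - ga/2" for n
 have "1 <= exp (- r*n) + (ga*n/2)/(a n)^2" if n: "ga <= real n" "even n" "a n > 0" for n
 proof -
  have n0: "n > 0" using n ga by (cases n) auto
  obtain S where S: "S : halves n" using halves_nonempty[OF n(2)] by blast
  have mean: "(SUM e:pairs n. ga/n*edge_sgn e S) = - ga/2"
   unfolding sum_distrib_left[symmetric] sum_edge_sgn_pairs[OF n(2) n0 S] using n0 by simp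
  have var: "(SUM e:pairs n. ga/n*(edge_sgn e S)^2) <= ga*n/2"
  proof -
   have "(SUM e:pairs n. ga/n*(edge_sgn e S)^2) = (SUM e:pairs n. ga/n)"
    by (rule sum.cong) (auto simp: edge_sgn_def)
   also have "... = ga/n*(2*real (card (pairs n)))/2" by simp
   also have "... <= ga/n*(real n*real n)/2"
    unfolding card_pairs using ga by (intro divide_right_mono mult_left_mono) auto
   finally show ?thesis using n0 by simp
  qed
  have dev: "measure_pmf.prob (erdos_renyi n (ga/n)) {G. a n <= abs((SUM e:G. edge_sgn e S) - (- ga/2))} <= (ga*n/2)/(a n)^2"
  proof -
   have "measure_pmf.prob (erdos_renyi n (ga/n)) {G. a n <= abs((SUM e:G. edge_sgn e S) - (- ga/2))}
    <= (SUM e:pairs n. ga/n*(edge_sgn e S)^2)/(a n)^2"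
    unfolding erdos_renyi_def mean[symmetric]
    by (rule edge_graph_deviation) (use n ga in \<open>auto simp: field_simps\<close>)
   also have "... <= (ga*n/2)/(a n)^2" by (intro divide_right_mono var) auto
   finally show ?thesis .
  qed
  have "1 = measure_pmf.prob (erdos_renyi n (ga/n)) UNIV" by simp
  also have "... <= measure_pmf.prob (erdos_renyi n (ga/n))
    ({G. real n * sqrt ga*t <= real (card G) - 2*real (mcut n G)} \<union> {G. a n <= abs((SUM e:G. edge_sgn e S) - (- ga/2))})"
  proof (rule measure_pmf.finite_measure_mono_AE)
   show "AE G in measure_pmf (erdos_renyi n (ga/n)). G : UNIV -->
    G : {G. real n * sqrt ga*t <= real (card G) - 2*real (mcut n G)} \<union> {G. a n <= abs((SUM e:G. edge_sgn e S) - (- ga/2))}"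
   proof (rule AE_pmfI, intro impI)
    fix G assume "G : set_pmf (erdos_renyi n (ga/n))"
    hence G: "G <= pairs n" by (simp add: erdos_renyi_def AE_edge_graph)
    have "(SUM e:G. edge_sgn e S) <= real (card G) - 2*real (mcut n G)"
     using sum_edge_sgn[OF G] S finite_cut_le[OF n(2) S, of G] by (simp add: halves_def)
    thus "G : {G. real n * sqrt ga*t <= real (card G) - 2*real (mcut n G)} \<union> {G. a n <= abs((SUM e:G. edge_sgn e S) - (- ga/2))}"
     unfolding a_def by auto
   qed
  qed simp
  also have "... <= measure_pmf.prob (erdos_renyi n (ga/n)) {G. real n * sqrt ga*t <= real (card G) - 2*real (mcut n G)}
    + measure_pmf.prob (erdos_renyi n (ga/n)) {G. a n <= abs((SUM e:G. edge_sgn e S) - (- ga/2))}"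
   by (rule measure_Un_le) auto
  also have "... <= exp (- r*n) + (ga*n/2)/(a n)^2" using b[OF n(1,2)] dev by (intro add_mono)
  finally show ?thesis .
 qed
 hence step: "ga <= real n ==> even n ==> a n > 0 ==> 1 <= exp (- r*n) + (ga*n/2)/(a n)^2" for n
  by blast
 have evs: "\<forall>\<^sub>F n in even_at_top. ga <= real n" "\<forall>\<^sub>F n in even_at_top. a n > 0"
 proof -
  show "\<forall>\<^sub>F n in even_at_top. ga <= real n" by (intro eventually_even_at_top) real_asymp
  define u where "u = sqrt ga*(- t)"
  have "u > 0" unfolding u_def using ga t by (intro mult_pos_pos) auto
  hence "\<forall>\<^sub>F n::nat in at_top. real n*u - ga/2 > 0" by real_asymp
  thus "\<forall>\<^sub>F n in even_at_top. a n > 0" unfolding a_def by (intro eventually_even_at_top) (simp add: u_def mult_ac)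
 qed
 have ev: "\<forall>\<^sub>F n in even_at_top. 1 <= exp (- r*real n) + (ga*real n/2)/(a n)^2"
  using evs eventually_even by eventually_elim (rule step)
 have "((%n. exp (- r*real n) + (ga*real n/2)/(a n)^2) \<longlongrightarrow> 0) even_at_top"
 proof (rule filterlim_even_at_topD)
  define u where "u = sqrt ga*(- t)"
  have "u > 0" unfolding u_def using ga t by (intro mult_pos_pos) auto
  hence "((%n::nat. exp (- r*real n) + (ga*real n/2)/(real n*u - ga/2)^2) \<longlongrightarrow> 0) at_top"
   using ga by real_asymp
  thus "((%n::nat. exp (- r*real n) + (ga*real n/2)/(a n)^2) \<longlongrightarrow> 0) at_top"
   by (simp add: a_def u_def mult_ac)
 qed
 from tendsto_lowerbound[OF this ev] show False by simp
qed

lemma const_parisi_domain: "be > 0 ==> (%_. 0) : parisi_domain be"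
 by (auto simp: parisi_domain_def intro: mono_onI)

lemma parisi_domain_mono: "be <= be' ==> parisi_domain be <= parisi_domain be'"
 by (auto simp: parisi_domain_def)

text \<open>The terminal value decreases in be and the steps are monotone, with the same order
  parameter on both sides.\<close>

lemma parisi_functional_antimono:
 assumes "0 < be" "be <= be'" "x : parisi_domain be"
 shows "parisi_functional be' x <= parisi_functional be x"
proof -
 have x': "x : parisi_domain be'" using parisi_domain_mono[OF assms(2)] assms(3) by blast
 have b': "be' > 0" using assms(1,2) by linarith
 interpret A: order_parameter be x by (rule order_parameter_domain[OF assms(1,3)])
 interpret B: order_parameter be' x by (rule order_parameter_domain[OF b' x'])
 have "B.ff (0, 0) <= A.ff (0, 0)"
 proof (rule LIMSEQ_le[OF B.U_tendsto_ff A.U_tendsto_ff], intro exI allI impI)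
  show "B.U (2^j) (2^j) 0 <= A.U (2^j) (2^j) 0" for j
   unfolding A.U_def B.U_def A.grid_def[abs_def] B.grid_def[abs_def] by (rule sch_antimono[OF assms(1,2)])
 qed
 thus ?thesis unfolding parisi_functional_eq[OF assms(1,3)] parisi_functional_eq[OF b' x'] by simp
qed

lemma parisi_functional_bdd_below: "be > 0 ==> bdd_below (parisi_functional be ` parisi_domain be)"
 using parisi_functional_nonneg by (intro bdd_belowI2[where m = 0]) auto

lemma P_star_beta_nonneg: "be > 0 ==> 0 <= P_star_beta be"
 unfolding P_star_beta_def using const_parisi_domain parisi_functional_nonneg by (intro cINF_greatest) auto

lemma P_star_beta_antimono:
 assumes "0 < be" "be <= be'"
 shows "P_star_beta be' <= P_star_beta be" unfolding P_star_beta_def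
proof (rule cINF_mono)
 show "parisi_domain be ~= {}" using const_parisi_domain[OF assms(1)] by blast
 show "bdd_below (parisi_functional be' ` parisi_domain be')" using assms by (intro parisi_functional_bdd_below) simp
 show "EX y:parisi_domain be'. parisi_functional be' y <= parisi_functional be x" if "x : parisi_domain be" for x
  using parisi_functional_antimono[OF assms that] parisi_domain_mono[OF assms(2)] that by blast
qed

text \<open>By monotonicity in be the limit is an infimum, so some finite be and a single order
  parameter come within de of it.\<close>

lemma P_star:
 "0 <= P_star" "de > 0 ==> EX be>0. EX x:parisi_domain be. parisi_functional be x < P_star + de"
proof -
 define L where "L = Inf (P_star_beta ` {0<..})"
 have bd: "bdd_below (P_star_beta ` {0<..})"
  using P_star_beta_nonneg by (intro bdd_belowI2[where m = 0]) auto
 have ne: "P_star_beta ` {0<..} ~= {}" by (simp add: greaterThan_non_empty)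
 have "(P_star_beta \<longlongrightarrow> L) at_top"
 proof (rule decreasing_tendsto)
  show "\<forall>\<^sub>F be in at_top. L <= P_star_beta be"
   using eventually_gt_at_top[of 0] by eventually_elim (use bd in \<open>auto simp: L_def intro: cInf_lower\<close>)
  fix a assume "L < a"
  then obtain be where be: "be > 0" "P_star_beta be < a"
   unfolding L_def using cInf_lessD[OF ne] by auto
  show "\<forall>\<^sub>F be in at_top. P_star_beta be < a" using eventually_ge_at_top[of be]
  proof eventually_elim
   case (elim be')
   thus ?case using P_star_beta_antimono[OF be(1) elim] be(2) by linarith
  qed
 qed
 hence L: "P_star = L" unfolding P_star_def by (intro tendsto_Lim) auto
 show "0 <= P_star" unfolding L L_def using ne P_star_beta_nonneg by (intro cInf_greatest) auto
 assume "de > 0"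
 hence "L < P_star + de" by (simp add: L)
 then obtain be where be: "be > 0" "P_star_beta be < P_star + de"
  unfolding L_def using cInf_lessD[OF ne] by auto
 then obtain x where "x : parisi_domain be" "parisi_functional be x < P_star + de"
  unfolding P_star_beta_def using cInf_lessD[of "parisi_functional be ` parisi_domain be"] const_parisi_domain[OF be(1)] by auto
 thus "EX be>0. EX x:parisi_domain be. parisi_functional be x < P_star + de" using be(1) by blast
qed

section \<open>The two models\<close>

text \<open>At a fixed degree the Parisi bound holds only up to an error; \<open>de\<close> is an
  error with which it holds with high probability.\<close>

definition admissible :: "real => real => bool" where
 "admissible ga de \<longleftrightarrow> de > 0 & ((%n. measure_pmf.prob (erdos_renyi n (ga/n))
    {G. real n * sqrt ga*(P_star + de) <= real (card G) - 2*real (mcut n G)}) \<longlongrightarrow> 0) even_at_top"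

lemma eventually_admissible:
 assumes "de > 0"
 shows "\<forall>\<^sub>F ga in at_top. admissible ga de"
proof -
 obtain be x where x: "be > 0" "x : parisi_domain be" "parisi_functional be x < P_star + de"
  using P_star(2)[OF assms] by blast
 interpret order_parameter be x by (rule order_parameter_domain[OF x(1,2)])
 obtain ga0 r where ga0: "ga0 >= 1" "r > 0" and b: "!!(ga::real) n. ga0 <= ga ==> ga <= n ==> even n ==>
  measure_pmf.prob (erdos_renyi n (ga/n)) {G. real n * sqrt ga*(P_star + de) <= real (card G) - 2*real (mcut n G)} <= exp (- r*n)"
  using erdos_renyi_bisection[of "P_star + de"] x(3) unfolding parisi_functional_eq[OF x(1,2)] by blast
 show ?thesis using eventually_ge_at_top[of ga0]
 proof eventually_elim
  case (elim ga)
  have l: "((%n. exp (- r*real n)) \<longlongrightarrow> 0) even_at_top"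
   by (rule filterlim_even_at_topD) (use ga0 in real_asymp)
  have "\<forall>\<^sub>F n in even_at_top. ga <= real n" by (intro eventually_even_at_top) real_asymp
  hence "\<forall>\<^sub>F n in even_at_top. 0 <= measure_pmf.prob (erdos_renyi n (ga/n))
    {G. real n * sqrt ga*(P_star + de) <= real (card G) - 2*real (mcut n G)} &
    measure_pmf.prob (erdos_renyi n (ga/n))
    {G. real n * sqrt ga*(P_star + de) <= real (card G) - 2*real (mcut n G)} <= exp (- r*real n)"
   using eventually_even by eventually_elim (use b[OF elim] in auto)
  from tendsto_even_upper[OF this l] show ?case unfolding admissible_def using assms by simp
 qed
qed

lemma admissible_mono:
 assumes "admissible ga de" "de <= de'" "ga >= 0"
 shows "admissible ga de'" unfolding admissible_def
proof
 show "de' > 0" using assms by (auto simp: admissible_def)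
 show "((%n. measure_pmf.prob (erdos_renyi n (ga/n))
    {G. real n * sqrt ga*(P_star + de') <= real (card G) - 2*real (mcut n G)}) \<longlongrightarrow> 0) even_at_top"
 proof (rule tendsto_even_upper)
  show "((%n. measure_pmf.prob (erdos_renyi n (ga/n))
    {G. real n * sqrt ga*(P_star + de) <= real (card G) - 2*real (mcut n G)}) \<longlongrightarrow> 0) even_at_top"
   using assms(1) by (simp add: admissible_def)
  have le: "real n * sqrt ga*(P_star + de) <= real n * sqrt ga*(P_star + de')" for n
   using assms by (intro mult_left_mono) auto
  show "\<forall>\<^sub>F n in even_at_top. 0 <= measure_pmf.prob (erdos_renyi n (ga/n))
    {G. real n * sqrt ga*(P_star + de') <= real (card G) - 2*real (mcut n G)} &
   measure_pmf.prob (erdos_renyi n (ga/n))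
    {G. real n * sqrt ga*(P_star + de') <= real (card G) - 2*real (mcut n G)} <=
   measure_pmf.prob (erdos_renyi n (ga/n))
    {G. real n * sqrt ga*(P_star + de) <= real (card G) - 2*real (mcut n G)}"
   by (intro always_eventually allI conjI measure_pmf.finite_measure_mono subsetI)
     (use order.trans[OF le] in auto)
 qed
qed

lemma prob_tendsto_1:
 fixes P :: "nat => nat set set pmf"
 assumes "((%n. measure_pmf.prob (P n) {G. ~ Q n G}) \<longlongrightarrow> 0) even_at_top"
 shows "((%n. measure_pmf.prob (P n) {G. Q n G}) \<longlongrightarrow> 1) even_at_top"
proof -
 have "measure_pmf.prob (P n) {G. Q n G} = 1 - measure_pmf.prob (P n) {G. ~ Q n G}" for n
  using measure_pmf.prob_compl[of "{G. ~ Q n G}" "P n"] by (simp add: Compl_eq_Diff_UNIV[symmetric] Collect_neg_eq[symmetric])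
 thus ?thesis using tendsto_diff[OF tendsto_const[of 1] assms] by simp
qed

lemma null_model:
 fixes a b :: real
 assumes ab: "a > b" "b > 0" and adm: "admissible ((a + b)/2) de"
  and gap: "(a - b)^2 > 8*(P_star + de)^2*(a + b)" and ep: "(ep \<longlongrightarrow> 0) even_at_top"
 shows "((%n. measure_pmf.prob (erdos_renyi n ((a + b)/(2*real n)))
         {G. real (mcut n G) > real n*(b/4 + ep n)}) \<longlongrightarrow> 1) even_at_top"
proof (rule prob_tendsto_1)
 define ga where "ga = (a + b)/2"
 define t where "t = P_star + de"
 have ga: "ga > 0" using ab by (simp add: ga_def)
 have t: "t > 0" using adm P_star(1) by (simp add: t_def admissible_def)
 \<comment> \<open>Positive by the gap condition, as 16*ga = 8*(a + b). Up to errors the minimum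
   bisection exceeds n*(b/4 + s); half of s is reserved for ep, the rest for the edge count and the
   constant ga/2.\<close>
 define s where "s = ((a - b) - 4 * sqrt ga*t)/8"
 have s: "s > 0"
 proof -
  have "(4 * sqrt ga*t)^2 = 8*t^2*(a + b)" using ga by (simp add: power_mult_distrib ga_def)
  hence "4 * sqrt ga*t < a - b" using gap ab by (intro power2_less_imp_less[of _ "a - b"]) (auto simp: t_def)
  thus ?thesis by (simp add: s_def)
 qed
 let ?p = "%n. measure_pmf.prob (erdos_renyi n (ga/n))" and ?p' = "%n. measure_pmf.prob (erdos_renyi n ((a + b)/(2*real n)))"
  and ?F = "%n. {G. ~ real (mcut n G) > real n*(b/4 + ep n)}" and ?A = "%n. {G. real n * sqrt ga*t <= real (card G) - 2*real (mcut n G)}"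
  and ?D = "%n. {G. s*n/2 <= abs(real (card G) - (real n - 1)*ga/2)}" and ?v = "%n. (real n*ga/2)/(s*n/2)^2"
 have dev: "?p n (?D n) <= ?v n" if n: "ga <= real n" for n
 proof -
  have n0: "n > 0" using n ga by (cases n) auto
  have mean: "(SUM e:pairs n. ga/n*1) = (real n - 1)*ga/2"
  proof -
   have "(SUM e:pairs n. ga/n*1) = ga/n*(2*real (card (pairs n)))/2" by simp
   thus ?thesis unfolding card_pairs using n0 by (simp add: field_simps)
  qed
  have "?p n {G. s*n/2 <= abs((SUM e:G. 1) - (SUM e:pairs n. ga/n*1))} <= (SUM e:pairs n. ga/n*1^2)/(s*n/2)^2"
   unfolding erdos_renyi_def
   by (rule edge_graph_deviation) (use n n0 ga s in \<open>auto simp: field_simps\<close>)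
  also have "(SUM e:pairs n. ga/n*1^2) = (real n - 1)*ga/2" using mean by simp
  also have "(real n - 1)*ga/2/(s*n/2)^2 <= ?v n"
   using ga by (intro divide_right_mono mult_right_mono) auto
  finally show ?thesis unfolding mean by simp
 qed
 have sub: "?p' n (?F n) <= ?p n (?A n) + ?v n"
  if n: "ga <= real n" "ep n < s/2" "ga/2 <= s*n/2" for n
 proof -
  have n0: "n > 0" using n ga by (cases n) auto
  have "?p' n (?F n) <= ?p n (?A n \<union> ?D n)"
  proof -
   have "?F n <= ?A n \<union> ?D n"
   proof
    fix G assume "G : ?F n"
    hence m: "real (mcut n G) <= real n*(b/4 + ep n)" by simp
    have e: "real n*ep n <= real n*(s/2)" using n(2) by (intro mult_left_mono) auto
    show "G : ?A n \<union> ?D n"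
    proof (cases "s*n/2 <= abs(real (card G) - (real n - 1)*ga/2)")
     case False
     hence c: "real (card G) >= (real n - 1)*ga/2 - s*n/2" by linarith
     have "real n * sqrt ga*t = real n*(ga/2 - b/2 - 2 * s)"
     proof -
      have "sqrt ga*t = ga/2 - b/2 - 2 * s" by (simp add: s_def ga_def field_simps)
      thus ?thesis by (simp only: mult.assoc)
     qed
     also have "... <= real (card G) - 2*real (mcut n G)"
      using c m e n(3) by (simp add: algebra_simps)
     finally show ?thesis by simp
    qed simp
   qed
   thus ?thesis unfolding ga_def by (simp add: field_simps measure_pmf.finite_measure_mono)
  qed
  also have "... <= ?p n (?A n) + ?p n (?D n)" by (rule measure_Un_le) auto
  finally show ?thesis using dev[OF n(1)] by linarith
 qed
 show "((%n. ?p' n (?F n)) \<longlongrightarrow> 0) even_at_top"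
 proof (rule tendsto_even_upper)
  have 1: "\<forall>\<^sub>F n in even_at_top. ga <= real n" by (intro eventually_even_at_top) real_asymp
  have 2: "\<forall>\<^sub>F n in even_at_top. ep n < s/2" using order_tendstoD(2)[OF ep, of "s/2"] s by simp
  have 3: "\<forall>\<^sub>F n in even_at_top. ga/2 <= s*real n/2" by (intro eventually_even_at_top) (use s in real_asymp)
  show "\<forall>\<^sub>F n in even_at_top. 0 <= ?p' n (?F n) & ?p' n (?F n) <= ?p n (?A n) + ?v n"
   using 1 2 3 by eventually_elim (use sub in auto)
  have l1: "((%n. ?p n (?A n)) \<longlongrightarrow> 0) even_at_top"
   using adm by (simp add: admissible_def ga_def[symmetric] t_def)
  have l2: "((%n::nat. ?v n) \<longlongrightarrow> 0) even_at_top"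
   by (rule filterlim_even_at_topD) (use s ga in real_asymp)
  show "((%n. ?p n (?A n) + ?v n) \<longlongrightarrow> 0) even_at_top" using tendsto_add[OF l1 l2] by simp
 qed
qed

text \<open>Given the planted side, the cut has n^2/4 possible edges of probability b/n, so mean
  n*b/4 and no larger variance. Chebyshev at distance n*ep gives b/4 over the square of ep * sqrt n,
  uniformly in the planted side and hence after averaging over it.\<close>

lemma planted_model:
 fixes a b :: real
 assumes ab: "a > b" "b > 0" and ep: "filterlim (%n. ep n * sqrt (real n)) at_top even_at_top"
 shows "((%n. measure_pmf.prob (planted_partition n (a/real n) (b/real n))
         {G. real (mcut n G) <= real n*(b/4 + ep n)}) \<longlongrightarrow> 1) even_at_top"
proof (rule prob_tendsto_1)
 let ?F = "%n. {G. ~ real (mcut n G) <= real n*(b/4 + ep n)}" and ?p = "%n. measure_pmf.prob (planted_partition n (a/real n) (b/real n))"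
  and ?v = "%n. b/4/(ep n * sqrt n)^2" and ?E = "%n V. edge_indep_graph n (%e. if e <= V | e \<inter> V = {} then a/n else b/n)"
 have one: "measure_pmf.prob (?E n V) (?F n) <= ?v n"
  if n: "a <= real n" "even n" "ep n * sqrt (real n) > 0" and V: "V : halves n" for n V
 proof -
  have n0: "n > 0" using n ab by (cases n) auto
  define p where "p e = (if e <= V | e \<inter> V = {} then a/n else b/n)" for e
  define c where "c e = (1 - edge_sgn e V)/2" for e
  have ep0: "ep n > 0" using n(3) n0 by (simp add: zero_less_mult_iff)
  have pc: "p e * c e = b/n * c e" "(c e)^2 = c e" for e by (auto simp: p_def c_def edge_sgn_def)
  have sc: "(SUM e:G. c e) = real (cut n G V)" if "G <= pairs n" for G
   using sum_edge_sgn[OF that, of V] V by (simp add: c_def halves_def sum_divide_distrib[symmetric] sum_subtractf)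
  have "(SUM e:pairs n. c e) = (real (card (pairs n)) + real n/2)/2"
   using sum_edge_sgn_pairs[OF n(2) n0 V] by (simp add: c_def sum_divide_distrib[symmetric] sum_subtractf)
  also have "... = (2*real (card (pairs n)) + real n)/4" by (simp add: field_simps)
  also have "... = real n*real n/4" unfolding card_pairs by simp
  finally have cc: "(SUM e:pairs n. c e) = real n*real n/4" .
  have mean: "(SUM e:pairs n. p e * c e) = n*b/4"
   unfolding pc(1) sum_distrib_left[symmetric] cc using n0 by simp
  have var: "(SUM e:pairs n. p e*(c e)^2) = n*b/4" using mean by (simp add: pc(2))
  have "measure_pmf.prob (edge_indep_graph n p) (?F n)
    <= measure_pmf.prob (edge_indep_graph n p) {G. n*ep n <= abs((SUM e:G. c e) - (SUM e:pairs n. p e * c e))}"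
  proof (rule measure_pmf.finite_measure_mono_AE)
   show "AE G in measure_pmf (edge_indep_graph n p). G : (?F n) -->
    G : {G. n*ep n <= abs((SUM e:G. c e) - (SUM e:pairs n. p e * c e))}"
   proof (rule AE_pmfI, intro impI)
    fix G assume G: "G : set_pmf (edge_indep_graph n p)" and "G : (?F n)"
    hence "real n*(b/4 + ep n) < real (mcut n G)" by simp
    also have "... <= real (cut n G V)" using finite_cut_le[OF n(2) V] by simp
    also have "... = (SUM e:G. c e)" by (rule sc[symmetric, OF AE_edge_graph[OF G]])
    finally have "n*ep n <= (SUM e:G. c e) - (SUM e:pairs n. p e * c e)" unfolding mean by (simp add: algebra_simps)
    thus "G : {G. n*ep n <= abs((SUM e:G. c e) - (SUM e:pairs n. p e * c e))}" by simp
   qed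
  qed simp
  also have "... <= (SUM e:pairs n. p e*(c e)^2)/(n*ep n)^2"
   by (rule edge_graph_deviation) (use n n0 ab ep0 in \<open>auto simp: p_def field_simps\<close>)
  also have "... = ?v n"
   unfolding var using n0 ep0 by (simp add: power_mult_distrib field_simps power2_eq_square)
  finally show ?thesis unfolding p_def .
 qed
 have all: "?p n (?F n) <= ?v n" if n: "a <= real n" "even n" "ep n * sqrt (real n) > 0" for n
 proof -
  have ne: "halves n ~= {}" by (rule halves_nonempty[OF n(2)])
  have "?p n (?F n) = measure_pmf.expectation (pmf_of_set (halves n) \<bind> ?E n) (indicator (?F n))"
   by (simp add: planted_partition_def)
  also have "... = (SUM V:halves n. measure_pmf.expectation (?E n V) (indicator (?F n)) /\<^sub>R real (card (halves n)))"
   by (rule pmf_expectation_bind_pmf_of_set[OF ne])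
     (simp_all add: edge_indep_graph_def finite_set_Pi_pmf_bool[where p = "%e. if e <= _ | e \<inter> _ = {} then _ else _"])
  also have "... <= (SUM V:halves n. ?v n /\<^sub>R real (card (halves n)))"
  proof (rule sum_mono)
   fix V assume "V : halves n"
   hence "measure_pmf.expectation (?E n V) (indicator (?F n)) <= ?v n" using one[OF n] by simp
   thus "measure_pmf.expectation (?E n V) (indicator (?F n)) /\<^sub>R real (card (halves n)) <= ?v n /\<^sub>R real (card (halves n))"
    by (intro scaleR_left_mono) auto
  qed
  also have "... = ?v n" using ne by simp
  finally show ?thesis .
 qed
 show "((%n. ?p n (?F n)) \<longlongrightarrow> 0) even_at_top"
 proof (rule tendsto_even_upper)
  have 1: "\<forall>\<^sub>F n in even_at_top. a <= real n" by (intro eventually_even_at_top) real_asymp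
  have 2: "\<forall>\<^sub>F n in even_at_top. ep n * sqrt (real n) > 0" using ep by (simp add: filterlim_at_top_dense)
  show "\<forall>\<^sub>F n in even_at_top. 0 <= ?p n (?F n) & ?p n (?F n) <= ?v n"
   using 1 2 eventually_even by eventually_elim (use all in auto)
  have "((%x::real. b/4/x^2) \<longlongrightarrow> 0) at_top" by real_asymp
  from filterlim_compose[OF this ep] show "((%n. ?v n) \<longlongrightarrow> 0) even_at_top" .
 qed
qed

text \<open>Under the null model the minimum bisection is itself of order n, so a threshold n*(b/4 +
  \<epsilon> n) with \<epsilon> bounded away from 0 can exceed it; hence the premise that \<epsilon>
  tends to 0 on the null half.\<close>

theorem corollary1p7:
  shows "\<exists>h :: real \<Rightarrow> real.
    (\<forall>s>0. h s > 0) \<and> ((\<lambda>s. h s / s) \<longlongrightarrow> 0) at_top \<and>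
    (\<forall>(a::real) (b::real) (\<epsilon> :: nat \<Rightarrow> real).
       a > b \<and> b > 0 \<and>
       (a - b)\<^sup>2 \<ge> 8 * P_star\<^sup>2 * (a + b) + h (a + b) \<and>
       filterlim (\<lambda>n. \<epsilon> n * sqrt (real n)) at_top even_at_top \<longrightarrow>
         ((\<epsilon> \<longlongrightarrow> 0) even_at_top \<longrightarrow>
          ((\<lambda>n. measure_pmf.prob (erdos_renyi n ((a + b) / (2 * real n)))
                  {G. real (mcut n G) > real n * (b / 4 + \<epsilon> n)}) \<longlongrightarrow> 1) even_at_top) \<and>
         ((\<lambda>n. measure_pmf.prob (planted_partition n (a / real n) (b / real n))
                 {G. real (mcut n G) \<le> real n * (b / 4 + \<epsilon> n)}) \<longlongrightarrow> 1) even_at_top)"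
proof -
 define D where "D s = {de. admissible (s/2) de}" for s
 \<comment> \<open>The infimum itself may fail to be admissible. Adding 1/s goes strictly above it,
   which suffices by monotonicity and still tends to 0.\<close>
 define d where "d s = Inf (D s) + 1/s" for s
 \<comment> \<open>At s = a + b the hypothesis becomes (a - b)^2 > 8*(P_star + d s)^2*s, strict
   because of the added 1. If no error is admissible, s^2 + 1 makes the hypothesis unsatisfiable, as
   (a - b)^2 <= s^2; this happens only for bounded s and does not affect the limit of h s /
   s.\<close>
 define h where "h s = (if D s = {} then s^2 + 1 else 8 * s*((P_star + d s)^2 - P_star^2) + 1)" for s
 have Dpos: "de > 0" if "de : D s" for de s using that by (simp add: D_def admissible_def)
 have bd: "bdd_below (D s)" for s using Dpos by (intro bdd_belowI[of _ 0]) (auto intro: less_imp_le)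
 have d0: "0 < d s" if "s > 0" "D s ~= {}" for s
 proof -
  have "0 <= Inf (D s)" using that(2) Dpos by (intro cInf_greatest) (auto intro: less_imp_le)
  thus ?thesis using that(1) by (simp add: d_def add_nonneg_pos)
 qed
 have dD: "admissible (s/2) (d s)" if s: "s > 0" and ne: "D s ~= {}" for s
 proof -
  have "Inf (D s) < d s" using s by (simp add: d_def)
  then obtain de where "de : D s" "de < d s" using cInf_lessD[OF ne] by blast
  thus ?thesis using admissible_mono[of "s/2" de "d s"] s by (simp add: D_def)
 qed
 have hpos: "h s > 0" if "s > 0" for s
 proof (cases "D s = {}")
  case False
  have "P_star^2 <= (P_star + d s)^2" using P_star(1) d0[OF that False] by (intro power_mono) auto
  hence "0 <= 8 * s*((P_star + d s)^2 - P_star^2)" using that by simp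
  thus ?thesis using False by (simp add: h_def)
 qed (simp add: h_def add_nonneg_pos)
 have evD: "\<forall>\<^sub>F s in at_top. et : D s" if "et > 0" for et
 proof -
  have "filterlim (%s::real. s/2) at_top at_top" by real_asymp
  from eventually_compose_filterlim[OF eventually_admissible[OF that] this] show ?thesis by (simp add: D_def)
 qed
 have dlim: "(d \<longlongrightarrow> 0) at_top"
 proof (rule tendstoI)
  fix et :: real assume et: "et > 0"
  have "((%s::real. 1/s) \<longlongrightarrow> 0) at_top" by real_asymp
  hence "\<forall>\<^sub>F s::real in at_top. 1/s < et/2" using et by (intro order_tendstoD(2)) auto
  thus "\<forall>\<^sub>F s in at_top. dist (d s) 0 < et"
   using evD[OF half_gt_zero[OF et]] eventually_gt_at_top[of 0]
  proof eventually_elim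
   case (elim s)
   have "Inf (D s) <= et/2" using bd by (intro cInf_lower elim)
   moreover have "0 < d s" using elim by (intro d0) auto
   ultimately show ?case using elim unfolding d_def dist_real_def by linarith
  qed
 qed
 have hlim: "((%s. h s/s) \<longlongrightarrow> 0) at_top"
 proof (rule Lim_transform_eventually)
  have "((%s. 8*((P_star + d s)^2 - P_star^2) + 1/s) \<longlongrightarrow> 8*((P_star + 0)^2 - P_star^2) + 0) at_top"
   by (intro tendsto_intros dlim) real_asymp
  thus "((%s. 8*((P_star + d s)^2 - P_star^2) + 1/s) \<longlongrightarrow> 0) at_top" by simp
  show "\<forall>\<^sub>F s in at_top. 8*((P_star + d s)^2 - P_star^2) + 1/s = h s/s"
   using evD[OF zero_less_one] eventually_gt_at_top[of 0]
  proof eventually_elim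
   case (elim s)
   thus ?case by (auto simp: h_def add_divide_distrib)
  qed
 qed
 have main: "((ep \<longlongrightarrow> 0) even_at_top --> ((%n. measure_pmf.prob (erdos_renyi n ((a + b)/(2*real n)))
         {G. real (mcut n G) > real n*(b/4 + ep n)}) \<longlongrightarrow> 1) even_at_top)"
  if ab: "a > b" "b > 0" and gap: "(a - b)^2 >= 8*P_star^2*(a + b) + h (a + b)" for a b :: real and ep
 proof
  assume ep: "(ep \<longlongrightarrow> 0) even_at_top"
  have ne: "D (a + b) ~= {}"
  proof
   assume "D (a + b) = {}"
   hence "8*P_star^2*(a + b) + ((a + b)^2 + 1) <= (a - b)^2" using gap by (simp add: h_def)
   moreover have "0 <= 8*P_star^2*(a + b)" using ab by simp
   moreover have "(a - b)^2 <= (a + b)^2" using ab by (intro power_mono) auto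
   ultimately show False by linarith
  qed
  have s: "a + b > 0" using ab by simp
  have "(a - b)^2 > 8*(P_star + d (a + b))^2*(a + b)"
   using gap ne by (simp add: h_def algebra_simps)
  thus "((%n. measure_pmf.prob (erdos_renyi n ((a + b)/(2*real n)))
         {G. real (mcut n G) > real n*(b/4 + ep n)}) \<longlongrightarrow> 1) even_at_top"
   by (intro null_model[OF ab dD[OF s ne] _ ep])
 qed
 show ?thesis
 proof (intro exI[of _ h] conjI allI impI)
  show "h s > 0" if "s > 0" for s by (rule hpos[OF that])
  show "((%s. h s/s) \<longlongrightarrow> 0) at_top" by (rule hlim)
 next
  fix a b :: real and ep :: "nat => real"
  assume A: "a > b & b > 0 & (a - b)^2 >= 8*P_star^2*(a + b) + h (a + b) &
    filterlim (%n. ep n * sqrt (real n)) at_top even_at_top"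
  show "((%n. measure_pmf.prob (planted_partition n (a/real n) (b/real n))
         {G. real (mcut n G) <= real n*(b/4 + ep n)}) \<longlongrightarrow> 1) even_at_top"
   using A by (intro planted_model) auto
  assume "(ep \<longlongrightarrow> 0) even_at_top"
  thus "((%n. measure_pmf.prob (erdos_renyi n ((a + b)/(2*real n)))
         {G. real (mcut n G) > real n*(b/4 + ep n)}) \<longlongrightarrow> 1) even_at_top"
   using main[of b a ep] A by blast
 qed
qed

end
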